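(* The root lattices $\mathsf{A}_d$ for $d\ge 2$, $\mathsf{D}_d$ for $d\ge 3$, and $\mathsf{E}_d$ for $d=6,7,8$, as well as the Leech lattice, are periodic extreme.
   Context: **Lattices.** $\mathsf{A}_d=\{\vec{x}\in\mathbb{Z}^{d+1}:\sum_i x_i=0\}$, viewed as a full rank lattice in the $d$-dimensional Euclidean space it spans; $\mathsf{D}_d=\{\vec{x}\in\mathbb{Z}^d:\sum_i x_i\equiv 0 \bmod 2\}$; $\mathsf{E}_8=\mathsf{D}_8\cup(\mathsf{D}_8+(\tfrac12,\dots,\tfrac12))$; $\mathsf{E}_7$ and $\mathsf{E}_6$ are the usual root lattices (the sublattices of $\mathsf{E}_8$ orthogonal to a sublattice of $\mathsf{E}_8$ isometric to $\mathsf{A}_1$, resp. $\mathsf{A}_2$, each viewed as a full rank lattice in its span). The Leech lattice is the unique (up to isometry) even unimodular lattice in $\mathbb{R}^{24}$ without vectors of squared length $2$. **Periodic forms.** $\mathcal{S}^d_{>0}$ is the set of real symmetric positive definite $d\times d$ matrices; $Q[\vec{x}]=\vec{x}^tQ\vec{x}$. For $m\ge1$ let $\mathcal{S}^{d,m}_{>0}=\mathcal{S}^d_{>0}\times\mathbb{R}^{d\times(m-1)}$, with its usual Euclidean topology. Its elements $X=(Q,\vec{t})$, $\vec{t}=(\vec{t}_1,\dots,\vec{t}_{m-1})$, are called periodic forms; by convention $\vec{t}_m=\vec{0}$. The generalized arithmetical minimum is $$\lambda(X)=\min\{Q[\vec{t}_i-\vec{t}_j-\vec{v}] : 1\le i,j\le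 m,\ \vec{v}\in\mathbb{Z}^d,\ \vec{v}\ne\vec{0}\text{ if } i=j\}.$$ With $\det X=\det Q$ and $B^d$ the unit ball in $\mathbb{R}^d$, the sphere packing density function is $$\delta(X)=\left(\frac{\lambda(X)}{(\det X)^{1/d}}\right)^{d/2}\frac{m\,\mathrm{vol}\,B^d}{2^d}.$$ $X\in\mathcal{S}^{d,m}_{>0}$ is *$m$-extreme* if $\delta$, as a function on $\mathcal{S}^{d,m}_{>0}$, has a local maximum at $X$ (not necessarily strict). **Representations.** A periodic set is a finite union of translates of a lattice in $\mathbb{R}^d$; in particular every lattice is a periodic set. A periodic form $X=(Q,\vec{t})\in\mathcal{S}^{d,m}_{>0}$ is a *representation* of a periodic set $\Lambda$ if, for $A\in\mathrm{GL}_d(\mathbb{R})$ with $Q=A^tA$, the set $A\bigl(\bigcup_{i=1}^m(\vec{t}_i+\mathbb{Z}^d)\bigr)$ equals $\Lambda$ up to an isometry of $\mathbb{R}^d$, where the $m$ translates $\vec{t}_i+\mathbb{Z}^d$ are pairwise disjoint (equivalently $\lambda(X)>0$). The number $m$ may vary among representations of the same set. A periodic set is *periodic extreme* if for all $m$ all of its representations $X\in\mathcal{S}^{d,m}_{>0}$ are $m$-extreme. *)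

theory Defs
  imports "HOL-Analysis.Analysis"
begin

section \<open>Lattices and periodic sets\<close>

definition int_vecs :: "(real^'n) set" where
  "int_vecs = {v. \<forall>i. v $ i \<in> \<int>}"

definition full_rank_lattice :: "(real^'n) set \<Rightarrow> bool" where
  "full_rank_lattice L \<longleftrightarrow> (\<exists>A :: real^'n^'n. invertible A \<and> L = (\<lambda>z. A *v z) ` int_vecs)"

definition periodic_set :: "(real^'n) set \<Rightarrow> bool" where
  "periodic_set \<Lambda> \<longleftrightarrow>
     (\<exists>L T. full_rank_lattice L \<and> finite T \<and> T \<noteq> {} \<and> \<Lambda> = (\<Union>t\<in>T. (\<lambda>v. t + v) ` L))"

text \<open>
  Isometry of lattices that may live in different ambient spaces and need not have full rank
  there: a linear isometry from the span of the first onto the span of the second. (A linear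
  map on the span always extends to a linear map on the ambient space.)
\<close>

definition lattice_isometric ::
    "'a::euclidean_space set \<Rightarrow> 'b::euclidean_space set \<Rightarrow> bool" where
  "lattice_isometric L M \<longleftrightarrow>
     (\<exists>f. linear f \<and> (\<forall>x\<in>span L. norm (f x) = norm x) \<and> f ` L = M)"


section \<open>Root lattices and the Leech lattice\<close>

text \<open>
  With coordinates indexed by a type of cardinality \<open>d + 1\<close>, this is $A_d$ inside
  $\mathbb{R}^{d+1}$; it spans a hyperplane.
\<close>

definition root_A :: "(real^'k) set" where
  "root_A = {x \<in> int_vecs. (\<Sum>i\<in>UNIV. x $ i) = 0}"

definition root_D :: "(real^'n) set" where
  "root_D = {x \<in> int_vecs. \<exists>k::int. (\<Sum>i\<in>UNIV. x $ i) = 2 * of_int k}"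

definition root_E8 :: "(real^8) set" where
  "root_E8 = root_D \<union> (\<lambda>x. x + (\<chi> i. 1/2)) ` root_D"

definition orth_in_E8 :: "(real^8) set \<Rightarrow> (real^8) set" where
  "orth_in_E8 S = {x \<in> root_E8. \<forall>y\<in>S. orthogonal x y}"

text \<open>
  The predicates below hold of the full rank realisations of the lattice in question.
  $A_1$ and $A_2$ are taken in $\mathbb{R}^2$ and $\mathbb{R}^3$. That \<open>S\<close> is a subgroup
  is implied by its being the linear image of one.
\<close>

definition is_root_A :: "(real^'n) set \<Rightarrow> bool" where
  "is_root_A \<Lambda> \<longleftrightarrow> lattice_isometric \<Lambda> (root_A :: (real^('n option)) set)"

definition is_root_E7 :: "(real^7) set \<Rightarrow> bool" where
  "is_root_E7 \<Lambda> \<longleftrightarrow>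
     (\<exists>S \<subseteq> root_E8. lattice_isometric S (root_A :: (real^2) set) \<and>
        lattice_isometric \<Lambda> (orth_in_E8 S))"

definition is_root_E6 :: "(real^6) set \<Rightarrow> bool" where
  "is_root_E6 \<Lambda> \<longleftrightarrow>
     (\<exists>S \<subseteq> root_E8. lattice_isometric S (root_A :: (real^3) set) \<and>
        lattice_isometric \<Lambda> (orth_in_E8 S))"

definition unimodular_lattice :: "(real^'n) set \<Rightarrow> bool" where
  "unimodular_lattice L \<longleftrightarrow>
     (\<exists>A :: real^'n^'n. \<bar>det A\<bar> = 1 \<and> L = (\<lambda>z. A *v z) ` int_vecs) \<and>
     (\<forall>x\<in>L. \<forall>y\<in>L. x \<bullet> y \<in> \<int>)"

definition is_Leech :: "(real^24) set \<Rightarrow> bool" where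
  "is_Leech \<Lambda> \<longleftrightarrow>
     unimodular_lattice \<Lambda> \<and>
     (\<forall>x\<in>\<Lambda>. \<exists>k::int. x \<bullet> x = 2 * of_int k) \<and>
     (\<forall>x\<in>\<Lambda>. x \<bullet> x \<noteq> 2)"


section \<open>Periodic forms\<close>

definition quad_form :: "real^'n^'n \<Rightarrow> real^'n \<Rightarrow> real" where
  "quad_form Q x = x \<bullet> (Q *v x)"

definition pos_def :: "real^'n^'n \<Rightarrow> bool" where
  "pos_def Q \<longleftrightarrow> transpose Q = Q \<and> (\<forall>x. x \<noteq> 0 \<longrightarrow> quad_form Q x > 0)"

text \<open>
  The tuple $(t_1,\dots,t_{m-1})$ is a function on \<open>nat\<close> vanishing outside \<open>{1..<m}\<close>; in
  particular $t_m = 0$. The topology that the type carries (the product topology on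
  \<open>nat \<Rightarrow> real^'n\<close>) induces on this set the Euclidean topology of
  $\mathcal{S}^d_{>0}\times\mathbb{R}^{d\times(m-1)}$.
\<close>

type_synonym 'n periodic_form = "(real^'n^'n) \<times> (nat \<Rightarrow> real^'n)"

definition periodic_forms :: "nat \<Rightarrow> 'n::finite periodic_form set" where
  "periodic_forms m = {(Q, t). pos_def Q \<and> (\<forall>i. i \<notin> {1..<m} \<longrightarrow> t i = 0)}"

text \<open>For positive definite \<open>Q\<close> the infimum is attained.\<close>

definition gen_min :: "nat \<Rightarrow> 'n::finite periodic_form \<Rightarrow> real" where
  "gen_min m X = (case X of (Q, t) \<Rightarrow>
     Inf {quad_form Q (t i - t j - v) | i j v.
            i \<in> {1..m} \<and> j \<in> {1..m} \<and> v \<in> int_vecs \<and> (i = j \<longrightarrow> v \<noteq> 0)})"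

definition packing_density :: "nat \<Rightarrow> 'n::finite periodic_form \<Rightarrow> real" where
  "packing_density m X =
     (gen_min m X / det (fst X) powr (1 / real CARD('n))) powr (real CARD('n) / 2)
       * (real m * measure lborel (cball (0 :: real^'n) 1) / 2 ^ CARD('n))"

definition m_extreme :: "nat \<Rightarrow> 'n::finite periodic_form \<Rightarrow> bool" where
  "m_extreme m X \<longleftrightarrow> X \<in> periodic_forms m \<and>
     (\<forall>\<^sub>F Y in at X within periodic_forms m. packing_density m Y \<le> packing_density m X)"

text \<open>
  The factor \<open>A\<close> with \<open>Q = A\<^sup>t A\<close> is unique up to an orthogonal map on the left, so requiring
  the condition for some \<open>A\<close> or for all \<open>A\<close> is the same.
\<close>

definition represents ::
    "nat \<Rightarrow> 'n::finite periodic_form \<Rightarrow> (real^'n) set \<Rightarrow> bool" where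
  "represents m X \<Lambda> \<longleftrightarrow> X \<in> periodic_forms m \<and>
     disjoint_family_on (\<lambda>i. (\<lambda>v. snd X i + v) ` int_vecs) {1..m} \<and>
     (\<exists>A :: real^'n^'n. invertible A \<and> fst X = transpose A ** A \<and>
       (\<exists>f :: real^'n \<Rightarrow> real^'n. (\<forall>x y. dist (f x) (f y) = dist x y) \<and>
          f ` ((\<lambda>x. A *v x) ` (\<Union>i\<in>{1..m}. (\<lambda>v. snd X i + v) ` int_vecs)) = \<Lambda>))"

definition periodic_extreme :: "(real^'n) set \<Rightarrow> bool" where
  "periodic_extreme \<Lambda> \<longleftrightarrow> periodic_set \<Lambda> \<and>
     (\<forall>m\<ge>1. \<forall>X. represents m X \<Lambda> \<longrightarrow> m_extreme m X)"

end

theory Submission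
  imports Defs "HOL-Probability.Characteristic_Functions" "HOL-Complex_Analysis.Complex_Analysis"
begin

unbundle no Formal_Power_Series.fps_syntax

text \<open>
  Let \<open>M\<close> be the set of minimal vectors, of squared length \<open>\<lambda>\<close>, of a lattice \<open>L\<close>.
  Suppose that \<open>M\<close> is strongly eutactic, i.e. \<open>\<Sum>x\<in>M. (x \<bullet> a)\<^sup>2\<close> is proportional to \<open>a \<bullet> a\<close>, and that
  every \<open>x \<in> M\<close> together with the \<open>y \<in> M\<close> with \<open>\<bar>x \<bullet> y\<bar> = \<lambda> / 2\<close> spans the space. Then \<open>L\<close> is periodic
  extreme. A periodic form near a representation of \<open>L\<close> amounts to a matrix \<open>G = 1 + H\<close> near the
  identity and a small periodic displacement \<open>s\<close> of the points of \<open>L\<close>. If the minimum has not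
  decreased, then \<open>H[x] + 2 x \<bullet> (s (y + x) - s y)\<close> is nonnegative up to second order terms for all
  \<open>y \<in> L\<close> and \<open>x \<in> M\<close>. The displacements cancel in the average over \<open>y\<close>, and eutaxy turns the
  sum over \<open>x\<close> into a multiple of the trace of \<open>H\<close>, so that \<open>det G < 1\<close> forces all these expressions
  to be of second order. By the spanning condition they control \<open>H\<close> and the differences of \<open>s\<close>, hence
  both are of the order of their own squares and vanish.

  For \<open>A\<^sub>d\<close> and \<open>D\<^sub>d\<close> the spanning condition is read off the coordinates. For \<open>E\<^sub>8\<close> and
  the Leech lattice, theta series with the harmonic coefficients \<open>(x \<bullet> a + \<i> (x \<bullet> b)) ^ d\<close>, where
  \<open>a\<close> and \<open>b\<close> are orthogonal of equal length, are cusp forms of high order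
  and vanish for \<open>d = 2, 4, 6\<close>; so \<open>M\<close> has the moments of the sphere up to degree 6. If \<open>v\<close> is
  orthogonal to \<open>x\<close> and to all its neighbours, then \<open>\<Sum>y\<in>M. (y \<bullet> v)\<^sup>2 * p (y \<bullet> x)\<close> vanishes for a suitable
  polynomial \<open>p\<close>, while the moments make it a positive multiple of \<open>v \<bullet> v\<close>. A further weight
  supported on the roots orthogonal to \<open>A\<^sub>1\<close> or \<open>A\<^sub>2\<close> treats \<open>E\<^sub>7\<close> and \<open>E\<^sub>6\<close> in the same way.
\<close>

section \<open>Strongly eutactic lattices with spanning stars\<close>

text \<open>For deformations of the lattice alone, perfection and eutaxy would do. A displacement
  \<open>s\<close> adds terms linear in its differences, which sum to zero over a period along every
  line in direction \<open>x\<close>; positivity then bounds each of them from both sides, but only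
  in the direction \<open>x\<close>. The spanning condition turns this into control of all
  directions, so perfection is strengthened to stars. For root lattices strong eutaxy comes from the
  reflections: they make every root an eigenvector of the second moment operator, and a spanning
  star makes the eigenvalue common. Theta series serve the stars of the exceptional lattices and the
  Leech lattice. The inversion law with harmonic weights is obtained from ordinary Poisson summation
  at real shifts \<open>\<alpha> a + \<beta> b\<close>, continued to
  \<open>\<beta> = \<i> \<alpha>\<close>, where the shift is isotropic; Taylor coefficients in
  \<alpha> give every power of \<open>x \<bullet> a + \<i> (x \<bullet> b)\<close> at once. The
  moments are then linear algebra over an orthonormal basis.\<close>

lemma norm_matrix_vector_mult_le:
  fixes H :: "real^'n^'m"
  shows "norm (H *v v) \<le> norm H * norm v"
proof -
  have "(norm (H *v v))\<^sup>2 = (\<Sum>i\<in>UNIV. (H $ i \<bullet> v)\<^sup>2)"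
    by (simp only: power2_norm_eq_inner inner_vec_def[of "H *v v"])
       (simp add: matrix_vector_mult_def inner_vec_def power2_eq_square)
  also have "\<dots> \<le> (\<Sum>i\<in>UNIV. (norm (H $ i))\<^sup>2 * (norm v)\<^sup>2)"
    using Cauchy_Schwarz_ineq by (intro sum_mono) (simp add: power2_norm_eq_inner)
  also have "\<dots> = (norm H * norm v)\<^sup>2"
    by (simp add: power_mult_distrib sum_distrib_right[symmetric] power2_norm_eq_inner inner_vec_def)
  finally show ?thesis by (rule power2_le_imp_le) simp
qed

lemma abs_bilinear_le:
  fixes H :: "real^'n^'n"
  shows "\<bar>u \<bullet> (H *v v)\<bar> \<le> norm H * norm u * norm v"
proof -
  have "\<bar>u \<bullet> (H *v v)\<bar> \<le> norm u * norm (H *v v)" by (rule Cauchy_Schwarz_ineq2)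
  also have "\<dots> \<le> norm u * (norm H * norm v)" by (intro mult_left_mono norm_matrix_vector_mult_le) simp
  finally show ?thesis by (simp add: mult_ac)
qed

lemma matrix_entry_le_norm: "\<bar>(H :: real^'n^'m) $ i $ j\<bar> \<le> norm H"
  by (metis Finite_Cartesian_Product.norm_nth_le order_trans real_norm_def)

text \<open>This treats the diagonal term of the determinant of \<open>1 + H\<close>. Adjoining one
  factor multiplies the old error by at most 2 and adds the cross term
  \<open>a x * (\<Sum>i\<in>S. a i)\<close>, so the constant depends only on
  \<open>S\<close>.\<close>

lemma prod_one_plus_expansion:
  assumes "finite S"
  shows "\<exists>C\<ge>0. \<forall>a h. 0 \<le> h \<and> h \<le> 1 \<and> (\<forall>i\<in>S. \<bar>a i\<bar> \<le> (h::real)) \<longrightarrow>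
     \<bar>(\<Prod>i\<in>S. 1 + a i) - 1 - (\<Sum>i\<in>S. a i)\<bar> \<le> C * h\<^sup>2"
  using assms
proof (induction S)
  case empty
  then show ?case by (auto intro: exI[of _ 0])
next
  case (insert x S)
  then obtain C where C: "C \<ge> 0" "\<forall>a h. 0 \<le> h \<and> h \<le> 1 \<and> (\<forall>i\<in>S. \<bar>a i\<bar> \<le> (h::real)) \<longrightarrow>
     \<bar>(\<Prod>i\<in>S. 1 + a i) - 1 - (\<Sum>i\<in>S. a i)\<bar> \<le> C * h\<^sup>2" by (elim exE conjE)
  have "\<bar>(\<Prod>i\<in>insert x S. 1 + a i) - 1 - (\<Sum>i\<in>insert x S. a i)\<bar> \<le> (2 * C + real (card S)) * h\<^sup>2"
    if h: "0 \<le> h" "h \<le> 1" and a: "\<forall>i\<in>insert x S. \<bar>a i\<bar> \<le> h" for a and h :: real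
  proof -
    define e where "e = (\<Prod>i\<in>S. 1 + a i) - 1 - (\<Sum>i\<in>S. a i)"
    have e: "\<bar>e\<bar> \<le> C * h\<^sup>2" unfolding e_def using a h by (intro C(2)[rule_format]) auto
    have s: "\<bar>\<Sum>i\<in>S. a i\<bar> \<le> real (card S) * h"
      using a by (intro order_trans[OF sum_abs] order_trans[OF sum_bounded_above]) auto
    have ax: "\<bar>a x\<bar> \<le> h" using a by auto
    have "(\<Prod>i\<in>insert x S. 1 + a i) - 1 - (\<Sum>i\<in>insert x S. a i) = (1 + a x) * e + a x * (\<Sum>i\<in>S. a i)"
      using insert.hyps by (simp add: e_def algebra_simps)
    also have "\<bar>\<dots>\<bar> \<le> \<bar>1 + a x\<bar> * \<bar>e\<bar> + \<bar>a x\<bar> * \<bar>\<Sum>i\<in>S. a i\<bar>"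
      by (metis abs_mult abs_triangle_ineq)
    also have "\<dots> \<le> 2 * (C * h\<^sup>2) + h * (real (card S) * h)"
      using ax h s e by (intro add_mono mult_mono) auto
    finally show ?thesis by (simp add: algebra_simps power2_eq_square)
  qed
  then show ?case using C(1) by (intro exI[of _ "2 * C + real (card S)"]) auto
qed

text \<open>A permutation other than the identity moves some \<open>a\<close> and then also
  \<open>p a\<close>. Its term contains two off-diagonal factors, each at most
  \<open>norm H\<close>, while the remaining factors are at most 2. So only the identity contributes
  to first order.\<close>

lemma det_near_identity:
  "\<exists>C\<ge>0. \<forall>H :: real^'n^'n. norm H \<le> 1 \<longrightarrow> \<bar>det (mat 1 + H) - 1 - (\<Sum>i\<in>UNIV. H $ i $ i)\<bar> \<le> C * (norm H)\<^sup>2"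
proof -
  obtain C where C: "C \<ge> 0" "\<forall>a h. 0 \<le> h \<and> h \<le> 1 \<and> (\<forall>i\<in>(UNIV::'n set). \<bar>a i\<bar> \<le> (h::real)) \<longrightarrow>
     \<bar>(\<Prod>i\<in>UNIV. 1 + a i) - 1 - (\<Sum>i\<in>UNIV. a i)\<bar> \<le> C * h\<^sup>2"
    using prod_one_plus_expansion[OF finite[of "UNIV::'n set"]] by (elim exE conjE)
  let ?P = "{p. p permutes (UNIV :: 'n set)}"
  define K where "K = real (card (?P - {id})) * 2 ^ CARD('n)"
  have "\<bar>det (mat 1 + H) - 1 - (\<Sum>i\<in>UNIV. H $ i $ i)\<bar> \<le> (C + K) * (norm H)\<^sup>2"
    if h: "norm H \<le> 1" for H :: "real^'n^'n"
  proof -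
    let ?t = "\<lambda>p. of_int (sign p) * (\<Prod>i\<in>UNIV. (mat 1 + H) $ i $ p i)"
    have fin: "finite ?P" by (simp add: finite_permutations)
    have "det (mat 1 + H) = ?t id + (\<Sum>p\<in>?P - {id}. ?t p)"
      unfolding det_def using fin permutes_id by (subst sum.remove[of _ id]) auto
    moreover have "\<bar>?t id - 1 - (\<Sum>i\<in>UNIV. H $ i $ i)\<bar> \<le> C * (norm H)\<^sup>2"
      using C(2)[rule_format, of "norm H" "\<lambda>i. H $ i $ i"] h by (simp add: mat_def matrix_entry_le_norm)
    moreover have "\<bar>\<Sum>p\<in>?P - {id}. ?t p\<bar> \<le> K * (norm H)\<^sup>2"
    proof -
      have "\<bar>?t p\<bar> \<le> 2 ^ CARD('n) * (norm H)\<^sup>2" if p: "p \<in> ?P - {id}" for p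
      proof -
        from p obtain a where a: "p a \<noteq> a" by (metis DiffE eq_id_iff insertCI)
        have inj: "inj p" using p by (auto simp: permutes_inj)
        have b: "p (p a) \<noteq> p a" using a inj by (auto dest: injD)
        have le2: "\<bar>(mat 1 + H) $ i $ j\<bar> \<le> 2" for i j
          using matrix_entry_le_norm[of H i j] h by (auto simp: mat_def)
        have off: "\<bar>(mat 1 + H) $ i $ p i\<bar> \<le> norm H" if "p i \<noteq> i" for i
          using matrix_entry_le_norm[of H i "p i"] that by (auto simp: mat_def)
        have "\<bar>?t p\<bar> = (\<Prod>i\<in>UNIV. \<bar>(mat 1 + H) $ i $ p i\<bar>)"
          by (simp add: abs_mult abs_prod sign_def)
        also have "\<dots> = \<bar>(mat 1 + H) $ a $ p a\<bar> * (\<bar>(mat 1 + H) $ p a $ p (p a)\<bar> * (\<Prod>i\<in>UNIV - {a} - {p a}. \<bar>(mat 1 + H) $ i $ p i\<bar>))"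
          using a by (subst prod.remove[of _ a], simp, simp, subst prod.remove[of _ "p a"]) auto
        also have "\<dots> \<le> norm H * (norm H * 2 ^ CARD('n))"
        proof (intro mult_mono off a b)
          have "(\<Prod>i\<in>UNIV - {a} - {p a}. \<bar>(mat 1 + H) $ i $ p i\<bar>) \<le> (\<Prod>i\<in>UNIV - {a} - {p a}. 2)"
            using le2 by (intro prod_mono) auto
          also have "\<dots> \<le> 2 ^ CARD('n)" by (simp add: power_increasing card_mono)
          finally show "(\<Prod>i\<in>UNIV - {a} - {p a}. \<bar>(mat 1 + H) $ i $ p i\<bar>) \<le> 2 ^ CARD('n)" .
        qed (auto intro!: mult_nonneg_nonneg prod_nonneg)
        finally show ?thesis by (simp add: power2_eq_square algebra_simps)
      qed
      then have "\<bar>\<Sum>p\<in>?P - {id}. ?t p\<bar> \<le> (\<Sum>p\<in>?P - {id}. 2 ^ CARD('n) * (norm H)\<^sup>2)"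
        by (intro order_trans[OF sum_abs] sum_mono) auto
      then show ?thesis by (simp add: K_def mult_ac)
    qed
    ultimately show ?thesis by (simp add: algebra_simps abs_le_iff)
  qed
  moreover have "C + K \<ge> 0" using C(1) by (simp add: K_def)
  ultimately show ?thesis by blast
qed

text \<open>Writing each unit vector as a combination of \<open>S\<close> gives a constant
  independent of \<open>v\<close> and \<open>b\<close>. This turns spanning into the linear
  estimates on which the second order argument rests.\<close>

lemma spanning_bound:
  fixes S :: "(real^'n) set"
  assumes "finite S" "span S = UNIV"
  shows "\<exists>C\<ge>0. \<forall>v b. (\<forall>x\<in>S. \<bar>x \<bullet> v\<bar> \<le> b) \<longrightarrow> norm v \<le> C * b"
proof -
  have "\<exists>u. axis i 1 = (\<Sum>x\<in>S. u x *\<^sub>R x)" for i :: 'n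
    using assms span_finite[OF assms(1)] by (metis (no_types, lifting) UNIV_I imageE)
  then obtain u where u: "\<And>i::'n. axis i 1 = (\<Sum>x\<in>S. u i x *\<^sub>R x)" by metis
  let ?C = "\<Sum>i\<in>UNIV. \<Sum>x\<in>S. \<bar>u i x\<bar>"
  have "norm v \<le> ?C * b" if b: "\<forall>x\<in>S. \<bar>x \<bullet> v\<bar> \<le> b" for v b
  proof -
    have "\<bar>v $ i\<bar> \<le> (\<Sum>x\<in>S. \<bar>u i x\<bar> * b)" for i
    proof -
      have "v $ i = axis i 1 \<bullet> v" by (simp add: inner_axis')
      also have "\<dots> = (\<Sum>x\<in>S. u i x * (x \<bullet> v))" by (simp add: u inner_sum_left)
      also have "\<bar>\<dots>\<bar> \<le> (\<Sum>x\<in>S. \<bar>u i x\<bar> * b)"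
        using b by (intro order_trans[OF sum_abs] sum_mono) (auto simp: abs_mult intro!: mult_left_mono)
      finally show ?thesis .
    qed
    then have "(\<Sum>i\<in>UNIV. \<bar>v $ i\<bar>) \<le> (\<Sum>i\<in>UNIV. \<Sum>x\<in>S. \<bar>u i x\<bar> * b)" by (intro sum_mono)
    then show ?thesis using norm_le_l1_cart[of v] by (simp add: sum_distrib_right)
  qed
  then show ?thesis by (intro exI[of _ ?C]) (auto intro!: sum_nonneg)
qed

text \<open>Polarising strong eutaxy shows that the second moment tensor of \<open>M\<close> is
  \<open>c\<close> times the identity; contracting it with \<open>H\<close> leaves the
  trace.\<close>

lemma sum_inner_square_matrix:
  fixes M :: "(real^'n) set" and H :: "real^'n^'n"
  assumes "finite M" and E: "\<And>a. (\<Sum>x\<in>M. (x \<bullet> a)\<^sup>2) = c * (a \<bullet> a)"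
  shows "(\<Sum>x\<in>M. x \<bullet> (H *v x)) = c * (\<Sum>i\<in>UNIV. H $ i $ i)"
proof -
  have bil: "(\<Sum>x\<in>M. (x \<bullet> a) * (x \<bullet> b)) = c * (a \<bullet> b)" for a b
  proof -
    have "(\<Sum>x\<in>M. (x \<bullet> (a + b))\<^sup>2) = (\<Sum>x\<in>M. (x \<bullet> a)\<^sup>2) + 2 * (\<Sum>x\<in>M. (x \<bullet> a) * (x \<bullet> b)) + (\<Sum>x\<in>M. (x \<bullet> b)\<^sup>2)"
      by (simp add: power2_eq_square algebra_simps sum.distrib sum_distrib_left)
    then show ?thesis unfolding E by (simp add: algebra_simps inner_commute)
  qed
  have "(\<Sum>x\<in>M. x $ i * x $ j) = c * (if i = j then 1 else 0)" for i j
  proof -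
    have "axis i (1::real) $ j = (if i = j then 1 else 0)" by (simp add: axis_def)
    then show ?thesis using bil[of "axis i 1" "axis j 1"] by (simp add: inner_axis)
  qed
  then have ij: "(\<Sum>x\<in>M. H $ i $ j * (x $ i * x $ j)) = (if i = j then c * H $ i $ i else 0)" for i j
    by (simp add: sum_distrib_left[symmetric])
  have "(\<Sum>x\<in>M. x \<bullet> (H *v x)) = (\<Sum>x\<in>M. \<Sum>i\<in>UNIV. \<Sum>j\<in>UNIV. H $ i $ j * (x $ i * x $ j))"
    by (simp add: inner_vec_def matrix_vector_mult_def sum_distrib_left mult.left_commute)
  also have "\<dots> = (\<Sum>i\<in>UNIV. \<Sum>j\<in>UNIV. \<Sum>x\<in>M. H $ i $ j * (x $ i * x $ j))"
    by (subst sum.swap) (intro sum.cong refl sum.swap)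
  also have "\<dots> = c * (\<Sum>i\<in>UNIV. H $ i $ i)" by (simp add: ij sum_distrib_left)
  finally show ?thesis .
qed

text \<open>The mean of \<open>Q\<close> over \<open>{..<N}\<close> is zero and no value there is
  further than \<open>N * b\<close> from \<open>Q 0\<close>, so \<open>Q 0\<close> is itself that
  small.\<close>

lemma small_cyclic_differences:
  fixes Q :: "nat \<Rightarrow> real"
  assumes "N \<ge> 1" and "\<And>k. \<bar>Q (Suc k) - Q k\<bar> \<le> b" and "(\<Sum>k<N. Q k) = 0"
  shows "\<bar>Q 0\<bar> \<le> real N * b"
proof -
  have b: "b \<ge> 0" using assms(2)[of 0] by linarith
  have k: "\<bar>Q k - Q 0\<bar> \<le> real k * b" for k
  proof (induction k)
    case (Suc k)
    then show ?case using assms(2)[of k] by (simp add: algebra_simps abs_le_iff)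
  qed simp
  have "real N * Q 0 = - (\<Sum>k<N. Q k - Q 0)" using assms(3) by (simp add: sum_subtractf)
  then have "real N * \<bar>Q 0\<bar> \<le> (\<Sum>k<N. \<bar>Q k - Q 0\<bar>)" by (metis abs_minus_cancel abs_mult abs_of_nat sum_abs)
  also have "\<dots> \<le> (\<Sum>k<N. real N * b)"
    using k b by (intro sum_mono order_trans[OF k] mult_right_mono) auto
  finally show ?thesis using assms(1) by simp
qed

section \<open>Perfection and rigidity of lattices with spanning stars\<close>

locale star_lattice =
  fixes L :: "(real^'n) set" and lam c :: real and M :: "(real^'n) set"
  defines "M \<equiv> {x \<in> L. x \<bullet> x = lam}"
  assumes zero_mem: "0 \<in> L" and diff_mem: "\<And>x y. x \<in> L \<Longrightarrow> y \<in> L \<Longrightarrow> x - y \<in> L"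
    and lam_pos: "lam > 0" and lam_min: "\<And>x. x \<in> L \<Longrightarrow> x \<noteq> 0 \<Longrightarrow> lam \<le> x \<bullet> x"
    and fin: "finite M" and c_pos: "c > 0"
    and eutactic: "\<And>a. (\<Sum>x\<in>M. (x \<bullet> a)\<^sup>2) = c * (a \<bullet> a)"
    and star: "\<And>x. x \<in> M \<Longrightarrow> span (insert x {y \<in> M. \<bar>x \<bullet> y\<bar> = lam / 2}) = UNIV"
begin

lemma uminus_mem: "x \<in> L \<Longrightarrow> - x \<in> L"
  using diff_mem[OF zero_mem] by simp

lemma add_mem: "x \<in> L \<Longrightarrow> y \<in> L \<Longrightarrow> x + y \<in> L"
  using diff_mem[OF _ uminus_mem] by (metis diff_minus_eq_add)

lemma scale_mem: "x \<in> L \<Longrightarrow> real k *\<^sub>R x \<in> L"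
  by (induction k) (auto simp: zero_mem scaleR_left.add add_mem algebra_simps)

lemma M_subset: "x \<in> M \<Longrightarrow> x \<in> L" and M_inner: "x \<in> M \<Longrightarrow> x \<bullet> x = lam"
  by (auto simp: M_def)

lemma M_norm: "x \<in> M \<Longrightarrow> norm x = sqrt lam"
  by (simp add: M_inner norm_eq_sqrt_inner)

lemma M_nonempty: "M \<noteq> {}"
proof
  assume "M = {}"
  with eutactic[of "axis undefined 1"] c_pos show False by (simp add: inner_axis_axis)
qed

text \<open>Two minimal vectors at 120 degrees close up to a triangle of minimal vectors. These
  triangles are how the star condition is exploited, for the matrix \<open>H\<close> as well as for
  the displacements.\<close>

lemma neighbour_add: "x \<in> M \<Longrightarrow> y \<in> M \<Longrightarrow> x \<bullet> y = - lam / 2 \<Longrightarrow> x + y \<in> M"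
  by (auto simp: M_def add_mem inner_left_distrib inner_right_distrib inner_commute)

lemma uminus_M: "x \<in> M \<Longrightarrow> - x \<in> M"
  by (auto simp: M_def uminus_mem)

definition nbh :: "real^'n \<Rightarrow> (real^'n) set" where
  "nbh x = insert x {y \<in> M. \<bar>x \<bullet> y\<bar> = lam / 2}"

lemma nbh_cases:
  assumes "y \<in> nbh x"
  obtains "y = x" | "y \<in> M" "x \<bullet> y = - lam / 2" | "y \<in> M" "x \<bullet> (- y) = - lam / 2"
  using assms by (auto simp: nbh_def abs_if split: if_splits)

text \<open>As \<open>M\<close> is finite, the sum of the constants for the single stars serves all
  of them.\<close>

lemma star_bound:
  "\<exists>C\<ge>0. \<forall>x\<in>M. \<forall>v. \<forall>b\<ge>0. (\<forall>y\<in>nbh x. \<bar>y \<bullet> v\<bar> \<le> b) \<longrightarrow> norm v \<le> C * b"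
proof -
  let ?P = "\<lambda>x C. C \<ge> 0 \<and> (\<forall>v b. (\<forall>y\<in>nbh x. \<bar>y \<bullet> v\<bar> \<le> b) \<longrightarrow> norm v \<le> C * b)"
  have "\<forall>x\<in>M. \<exists>C. ?P x C"
    using fin star by (intro ballI spanning_bound) (auto simp: nbh_def)
  then obtain K where K: "\<forall>x\<in>M. ?P x (K x)" using bchoice[of M ?P] by blast
  have KK: "K x \<le> (\<Sum>x\<in>M. K x)" if "x \<in> M" for x
    using that fin K by (intro member_le_sum) auto
  have "norm v \<le> (\<Sum>x\<in>M. K x) * b"
    if "x \<in> M" "b \<ge> 0" "\<forall>y\<in>nbh x. \<bar>y \<bullet> v\<bar> \<le> b" for x v b
  proof -
    have "norm v \<le> K x * b" using K that by blast
    also have "\<dots> \<le> (\<Sum>x\<in>M. K x) * b" using KK that by (intro mult_right_mono) auto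
    finally show ?thesis .
  qed
  moreover have "(\<Sum>x\<in>M. K x) \<ge> 0" using K by (intro sum_nonneg) blast
  ultimately show ?thesis by blast
qed

text \<open>On a triangle \<open>x\<close>, \<open>y\<close>, \<open>x + y\<close> (or
  \<open>x - y\<close>) of minimal vectors, polarisation recovers
  \<open>y \<bullet> (H *v x)\<close> from the values of the form. The star of \<open>x\<close> then
  bounds \<open>H *v x\<close>, and as \<open>M\<close> spans, every row of \<open>H\<close>. With
  \<open>b = 0\<close> this is perfection of \<open>L\<close>.\<close>

lemma perfect_bound:
  "\<exists>C\<ge>0. \<forall>H b. transpose H = H \<longrightarrow> (\<forall>x\<in>M. \<bar>x \<bullet> (H *v x)\<bar> \<le> b) \<longrightarrow> norm H \<le> C * b"
proof -
  obtain KK where KK0: "KK \<ge> 0" and KK: "\<And>x v b. x \<in> M \<Longrightarrow> b \<ge> 0 \<Longrightarrow> \<forall>y\<in>nbh x. \<bar>y \<bullet> v\<bar> \<le> b \<Longrightarrow> norm v \<le> KK * b"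
    using star_bound by blast
  have spanM: "span M = UNIV"
  proof -
    obtain x where x: "x \<in> M" using M_nonempty by blast
    have "span (nbh x) \<subseteq> span M" using x by (intro span_mono) (auto simp: nbh_def)
    then show ?thesis using star[OF x] by (auto simp: nbh_def)
  qed
  obtain C1 where C1: "C1 \<ge> 0" "\<And>v b. (\<forall>y\<in>M. \<bar>y \<bullet> v\<bar> \<le> b) \<Longrightarrow> norm v \<le> C1 * b"
    using spanning_bound[OF fin spanM] by blast
  have "norm H \<le> (real CARD('n) * (C1 * (KK * 2))) * b"
    if sym: "transpose H = H" and b: "\<forall>x\<in>M. \<bar>x \<bullet> (H *v x)\<bar> \<le> b" for H :: "real^'n^'n" and b
  proof -
    have b0: "b \<ge> 0" using M_nonempty b by fastforce
    have swap: "u \<bullet> (H *v v) = v \<bullet> (H *v u)" for u v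
      by (metis dot_lmul_matrix inner_commute sym vector_transpose_matrix)
    have Hx: "norm (H *v x) \<le> KK * (2 * b)" if x: "x \<in> M" for x
    proof -
      have "\<bar>y \<bullet> (H *v x)\<bar> \<le> 2 * b" if y: "y \<in> nbh x" for y
      proof -
        from y show ?thesis
        proof (cases rule: nbh_cases)
          case 1
          have "\<bar>x \<bullet> (H *v x)\<bar> \<le> b" using b x by blast
          then show ?thesis using 1 b0 by simp
        next
          case 2
          have "(x + y) \<bullet> (H *v (x + y)) = x \<bullet> (H *v x) + y \<bullet> (H *v y) + 2 * (y \<bullet> (H *v x))"
            using swap[of x y] by (simp add: matrix_vector_right_distrib inner_left_distrib inner_right_distrib)
          moreover have "\<bar>(x + y) \<bullet> (H *v (x + y))\<bar> \<le> b" "\<bar>x \<bullet> (H *v x)\<bar> \<le> b" "\<bar>y \<bullet> (H *v y)\<bar> \<le> b"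
            using b x 2 neighbour_add by blast+
          ultimately show ?thesis using b0 by linarith
        next
          case 3
          have "(x + (-y)) \<bullet> (H *v (x + (-y))) = x \<bullet> (H *v x) + y \<bullet> (H *v y) - 2 * (y \<bullet> (H *v x))"
            using swap[of x y] by (simp add: matrix_vector_right_distrib matrix_vector_mult_diff_distrib inner_diff_left inner_diff_right)
          moreover have "\<bar>(x + (-y)) \<bullet> (H *v (x + (-y)))\<bar> \<le> b" "\<bar>x \<bullet> (H *v x)\<bar> \<le> b" "\<bar>y \<bullet> (H *v y)\<bar> \<le> b"
            using b x 3 neighbour_add uminus_M by blast+
          ultimately show ?thesis using b0 by linarith
        qed
      qed
      then show ?thesis using b0 by (intro KK[OF x]) auto
    qed
    have row: "norm (H $ i) \<le> C1 * (KK * (2 * b))" for i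
    proof (rule C1(2), rule ballI)
      fix y assume y: "y \<in> M"
      have "y \<bullet> H $ i = (H *v y) $ i" by (simp add: matrix_vector_mult_def inner_vec_def mult_ac)
      also have "\<bar>\<dots>\<bar> \<le> norm (H *v y)" by (rule component_le_norm_cart)
      finally show "\<bar>y \<bullet> H $ i\<bar> \<le> KK * (2 * b)" using Hx[OF y] by linarith
    qed
    have "norm H \<le> (\<Sum>i\<in>UNIV. norm (H $ i))" by (simp add: norm_vec_def L2_set_le_sum)
    also have "\<dots> \<le> (\<Sum>i\<in>(UNIV::'n set). C1 * (KK * (2 * b)))" by (intro sum_mono row)
    finally show ?thesis by (simp add: mult_ac)
  qed
  moreover have "(real CARD('n) * (C1 * (KK * 2))) \<ge> 0" using C1 KK0 by simp
  ultimately show ?thesis by blast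
qed

text \<open>
  Periodicity of the displacement \<open>s\<close> along \<open>x\<close> turns smallness of its second
  differences into smallness of its first differences; the triangles formed by two minimal vectors
  and their sum provide the second differences.
\<close>

lemma flex_bound:
  assumes N: "N \<ge> (1::nat)"
  shows "\<exists>C\<ge>0. \<forall>s b. (\<forall>y\<in>L. \<forall>x\<in>M. s (y + real N *\<^sub>R x) = s y) \<longrightarrow>
     (\<forall>y\<in>L. \<forall>x\<in>M. \<bar>x \<bullet> (s (y + x) - s y)\<bar> \<le> b) \<longrightarrow>
     (\<forall>y\<in>L. \<forall>x\<in>M. norm (s (y + x) - s y) \<le> C * b)"
proof -
  obtain KK where KK0: "KK \<ge> 0" and KK: "\<And>x v b. x \<in> M \<Longrightarrow> b \<ge> 0 \<Longrightarrow> \<forall>y\<in>nbh x. \<bar>y \<bullet> v\<bar> \<le> b \<Longrightarrow> norm v \<le> KK * b"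
    using star_bound by blast
  have "norm (s (y + x) - s y) \<le> (KK * (8 * real N)) * b"
    if per: "\<forall>y\<in>L. \<forall>x\<in>M. s (y + real N *\<^sub>R x) = s y"
      and b: "\<forall>y\<in>L. \<forall>x\<in>M. \<bar>x \<bullet> (s (y + x) - s y)\<bar> \<le> b"
      and y: "y \<in> L" and x: "x \<in> M" for s :: "real^'n \<Rightarrow> real^'n" and b y x
  proof -
    have b0: "b \<ge> 0" using b y x by force
    have main: "\<bar>t \<bullet> (s (y + x) - s y)\<bar> \<le> real N * (8 * b)" if t: "t \<in> M" and tx: "x \<bullet> t = - lam / 2" for t
    proof -
      \<comment> \<open>\<open>P\<close> and \<open>Q\<close> pair the difference along one side of
        the triangle with the other side. Their sum is small because all three sides are.
        \<open>P\<close> changes little along \<open>x\<close>, since its change is a difference of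
        two values of \<open>x \<bullet> (s (z + x) - s z)\<close>. Hence \<open>Q\<close> varies
        slowly along \<open>x\<close>, and over one period it sums to zero.\<close>
      define P where "P z = x \<bullet> (s (z + t) - s z)" for z
      define Q where "Q z = t \<bullet> (s (z + x) - s z)" for z
      have PQ: "\<bar>P z + Q z\<bar> \<le> 3 * b" if z: "z \<in> L" for z
      proof -
        have "\<bar>(x + t) \<bullet> (s (z + (x + t)) - s z)\<bar> \<le> b" "\<bar>x \<bullet> (s ((z + t) + x) - s (z + t))\<bar> \<le> b"
          "\<bar>t \<bullet> (s ((z + x) + t) - s (z + x))\<bar> \<le> b"
          using b z x t neighbour_add[OF x t tx] add_mem M_subset by blast+
        moreover have "P z + Q z = (x + t) \<bullet> (s (z + (x + t)) - s z) - x \<bullet> (s ((z + t) + x) - s (z + t))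
           - t \<bullet> (s ((z + x) + t) - s (z + x))"
          by (simp add: P_def Q_def inner_diff_right inner_left_distrib add_ac)
        ultimately show ?thesis by linarith
      qed
      have PP: "\<bar>P (z + x) - P z\<bar> \<le> 2 * b" if z: "z \<in> L" for z
      proof -
        have "\<bar>x \<bullet> (s ((z + t) + x) - s (z + t))\<bar> \<le> b" "\<bar>x \<bullet> (s (z + x) - s z)\<bar> \<le> b"
          using b z x t add_mem M_subset by blast+
        moreover have "P (z + x) - P z = x \<bullet> (s ((z + t) + x) - s (z + t)) - x \<bullet> (s (z + x) - s z)"
          by (simp add: P_def inner_diff_right add_ac)
        ultimately show ?thesis by linarith
      qed
      have L: "y + real k *\<^sub>R x \<in> L" for k using y x M_subset add_mem scale_mem by blast
      have step: "y + real (Suc k) *\<^sub>R x = (y + real k *\<^sub>R x) + x" for k by (simp add: algebra_simps)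
      have "\<bar>Q (y + real 0 *\<^sub>R x)\<bar> \<le> real N * (8 * b)"
      proof (rule small_cyclic_differences[OF N])
        \<comment> \<open>\<open>PQ\<close> at both ends and \<open>PP\<close> between them add up
          to \<open>3 * b + 3 * b + 2 * b\<close>.\<close>
        show "\<bar>Q (y + real (Suc k) *\<^sub>R x) - Q (y + real k *\<^sub>R x)\<bar> \<le> 8 * b" for k
          using PQ[OF L[of "Suc k"]] PQ[OF L[of k]] PP[OF L[of k]] unfolding step by linarith
        have "(\<Sum>k<N. Q (y + real k *\<^sub>R x)) = (\<Sum>k<N. t \<bullet> s (y + real (Suc k) *\<^sub>R x) - t \<bullet> s (y + real k *\<^sub>R x))"
          unfolding step by (simp add: Q_def inner_diff_right)
        also have "\<dots> = t \<bullet> s (y + real N *\<^sub>R x) - t \<bullet> s y"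
          by (subst sum_lessThan_telescope) simp
        finally show "(\<Sum>k<N. Q (y + real k *\<^sub>R x)) = 0" using per y x by simp
      qed
      then show ?thesis by (simp add: Q_def)
    qed
    have "\<forall>t\<in>nbh x. \<bar>t \<bullet> (s (y + x) - s y)\<bar> \<le> real N * (8 * b)"
    proof
      fix t assume "t \<in> nbh x"
      then show "\<bar>t \<bullet> (s (y + x) - s y)\<bar> \<le> real N * (8 * b)"
      proof (cases rule: nbh_cases)
        case 1
        have "b * 1 \<le> b * (8 * real N)" using N b0 by (intro mult_left_mono) auto
        moreover have "\<bar>t \<bullet> (s (y + x) - s y)\<bar> \<le> b" using 1 b y x by blast
        ultimately show ?thesis by (simp add: mult_ac)
      next
        case 2 then show ?thesis by (rule main)
      next
        case 3 then show ?thesis using main[of "- t"] uminus_M by auto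
      qed
    qed
    then have "norm (s (y + x) - s y) \<le> KK * (real N * (8 * b))" using b0 by (intro KK[OF x]) auto
    then show ?thesis by (simp add: mult_ac)
  qed
  moreover have "KK * (8 * real N) \<ge> 0" using KK0 by simp
  ultimately show ?thesis by blast
qed

end

lemma quad_form_scaleR: "quad_form (r *\<^sub>R G) x = r * quad_form G x"
  by (simp add: quad_form_def scaleR_matrix_vector_assoc[symmetric])

lemma inner_matrix_vector: "((A::real^'n^'m) *v x) \<bullet> y = x \<bullet> (transpose A *v y)"
  by (metis dot_lmul_matrix inner_commute vector_transpose_matrix)

lemma quad_form_congruence:
  fixes P Q :: "real^'n^'n"
  shows "quad_form (transpose P ** Q ** P) x = quad_form Q (P *v x)"
  by (simp add: quad_form_def inner_matrix_vector matrix_vector_mul_assoc[symmetric])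

lemma det_scaleR: "det (r *\<^sub>R (G :: real^'n^'n)) = r ^ CARD('n) * det G"
  by (simp add: det_def prod.distrib sum_distrib_left mult_ac)

lemma tendsto_matrix_mult:
  fixes f :: "'a \<Rightarrow> real^'n^'m" and g :: "'a \<Rightarrow> real^'k^'n"
  assumes "(f \<longlongrightarrow> A) F" "(g \<longlongrightarrow> B) F"
  shows "((\<lambda>x. f x ** g x) \<longlongrightarrow> A ** B) F"
  unfolding matrix_matrix_mult_def by (intro tendsto_intros assms)

lemma tendsto_matrix_vector_mult:
  fixes f :: "'a \<Rightarrow> real^'n^'m"
  assumes "(f \<longlongrightarrow> A) F" "(g \<longlongrightarrow> v) F"
  shows "((\<lambda>x. f x *v g x) \<longlongrightarrow> A *v v) F"
  unfolding matrix_vector_mult_def by (intro tendsto_intros assms)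

lemma tendsto_det:
  fixes f :: "'a \<Rightarrow> real^'n^'n"
  assumes "(f \<longlongrightarrow> A) F"
  shows "((\<lambda>x. det (f x)) \<longlongrightarrow> det A) F"
  unfolding det_def by (intro tendsto_intros assms)

section \<open>Local optimality in the coordinates of the lattice\<close>

context star_lattice
begin

text \<open>\<open>G\<close> is the form in the coordinates of \<open>L\<close> and \<open>s\<close>
  moves the points; the last hypothesis says that no contact has become shorter than
  \<open>lam\<close>. If \<open>det G < 1\<close>, the size \<open>rho = h + D\<close> of the
  perturbation is bounded by a multiple of \<open>rho\<^sup>2\<close>, so it vanishes and
  \<open>G\<close> is the identity after all.\<close>

lemma local_extreme:
  assumes N: "N \<ge> (1::nat)"
  shows "\<exists>\<epsilon>>0. \<forall>G s. transpose G = G \<longrightarrow> norm (G - mat 1) < \<epsilon> \<longrightarrow> (\<forall>y\<in>L. norm (s y) < \<epsilon>) \<longrightarrow>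
     (\<forall>y\<in>L. \<forall>x\<in>M. s (y + real N *\<^sub>R x) = s y) \<longrightarrow>
     (\<forall>y\<in>L. \<forall>x\<in>M. lam \<le> quad_form G (x + (s (y + x) - s y))) \<longrightarrow> 1 \<le> det G"
proof -
  obtain C0 where C0: "C0 \<ge> 0" "\<And>H :: real^'n^'n. norm H \<le> 1 \<Longrightarrow> \<bar>det (mat 1 + H) - 1 - (\<Sum>i\<in>UNIV. H $ i $ i)\<bar> \<le> C0 * (norm H)\<^sup>2"
    using det_near_identity by blast
  obtain C1 where C1: "C1 \<ge> 0" "\<forall>H b. transpose H = H \<longrightarrow> (\<forall>x\<in>M. \<bar>x \<bullet> (H *v x)\<bar> \<le> b) \<longrightarrow> norm H \<le> C1 * b"
    using perfect_bound by (elim exE conjE)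
  obtain C2 where C2: "C2 \<ge> 0" "\<forall>s b. (\<forall>y\<in>L. \<forall>x\<in>M. s (y + real N *\<^sub>R x) = s y) \<longrightarrow>
     (\<forall>y\<in>L. \<forall>x\<in>M. \<bar>x \<bullet> (s (y + x) - s y)\<bar> \<le> b) \<longrightarrow>
     (\<forall>y\<in>L. \<forall>x\<in>M. norm (s (y + x) - s y) \<le> C2 * b)"
    using flex_bound[OF N] by (elim exE conjE)
  \<comment> \<open>Total coefficient of \<open>rho\<^sup>2\<close> in the terms beyond first order:
    \<open>d \<bullet> d\<close> and \<open>d \<bullet> (H *v d)\<close> contribute 1 each, the
    mixed term \<open>2 * (d \<bullet> (H *v x))\<close> contributes
    \<open>2 * sqrt lam\<close>.\<close>
  define E where "E = 2 * sqrt lam + 2"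
  have E0: "E \<ge> 0" using lam_pos by (simp add: E_def)
  define K1 where "K1 = c * C0 + real (card M) * E"
  define K2 where "K2 = real (N + 1) * (K1 + E)"
  define K where "K = C1 * K1 + C2 * K2"
  have cM: "real (card M) \<ge> 1" using fin M_nonempty by (metis One_nat_def Suc_leI card_gt_0_iff of_nat_1 of_nat_mono)
  have K1E: "K1 \<ge> E"
  proof -
    have "1 * E \<le> real (card M) * E" using cM E0 by (intro mult_right_mono) auto
    moreover have "0 \<le> c * C0" using c_pos C0(1) by simp
    ultimately show ?thesis by (simp add: K1_def)
  qed
  have K10: "K1 \<ge> 0" using K1E E0 by linarith
  have K20: "K2 \<ge> 0" using K10 E0 by (simp add: K2_def)
  have K0: "K \<ge> 0" using K10 K20 C1(1) C2(1) by (simp add: K_def)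
  \<comment> \<open>From \<open>h < eps\<close> and \<open>D \<le> 2 * eps\<close> follows
    \<open>rho < 3 * eps = 1 / (K + 1)\<close>, hence \<open>K * rho < 1\<close>.\<close>
  define eps where "eps = 1 / (3 * (K + 1))"
  have eps: "eps > 0" using K0 by (simp add: eps_def)
  have "1 \<le> det G"
    if sym: "transpose G = G" and near: "norm (G - mat 1) < eps" and small: "\<forall>y\<in>L. norm (s y) < eps"
      and per: "\<forall>y\<in>L. \<forall>x\<in>M. s (y + real N *\<^sub>R x) = s y"
      and ge: "\<forall>y\<in>L. \<forall>x\<in>M. lam \<le> quad_form G (x + (s (y + x) - s y))"
    for G :: "real^'n^'n" and s :: "real^'n \<Rightarrow> real^'n"
  proof (rule ccontr)
    assume "\<not> 1 \<le> det G"
    then have det1: "det G < 1" by simp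
    define H where "H = G - mat 1"
    have G: "G = mat 1 + H" by (simp add: H_def)
    have symH: "transpose H = H" using sym by (simp add: H_def transpose_def mat_def vec_eq_iff)
    define h where "h = norm H"
    \<comment> \<open>The displacement is measured by its differences, since a common translation of
      all points changes nothing.\<close>
    define S where "S = (\<lambda>(y, x). norm (s (y + x) - s y)) ` (L \<times> M)"
    define D where "D = Sup S"
    have S_le: "z \<le> 2 * eps" if "z \<in> S" for z
    proof -
      from that obtain y x where yx: "y \<in> L" "x \<in> M" "z = norm (s (y + x) - s y)" by (auto simp: S_def)
      then have "norm (s (y + x)) < eps" "norm (s y) < eps" using small add_mem M_subset by blast+
      then show ?thesis using norm_triangle_ineq4[of "s (y + x)" "s y"] yx by linarith
    qed
    obtain x0 where x0: "x0 \<in> M" using M_nonempty by blast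
    have S_ne: "S \<noteq> {}" using x0 zero_mem by (auto simp: S_def)
    have D_ge: "norm (s (y + x) - s y) \<le> D" if "y \<in> L" "x \<in> M" for y x
      unfolding D_def using that S_le by (intro cSup_upper bdd_aboveI) (auto simp: S_def)
    have D_le: "D \<le> 2 * eps" unfolding D_def using S_ne S_le by (intro cSup_least)
    have D0: "D \<ge> 0" using D_ge[OF zero_mem x0] norm_ge_zero order_trans by blast
    define rho where "rho = h + D"
    have h0: "h \<ge> 0" by (simp add: h_def)
    have rho0: "rho \<ge> 0" using h0 D0 by (simp add: rho_def)
    have rho_lt: "rho < 1 / (K + 1)"
    proof -
      have "rho < 3 * eps" using near D_le by (simp add: rho_def h_def H_def)
      moreover have "3 * eps = 1 / (K + 1)" using K0 unfolding eps_def by (simp only: divide_simps) simp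
      ultimately show ?thesis by simp
    qed
    also have "\<dots> \<le> 1" using K0 by simp
    finally have rho1: "rho < 1" .
    have h1: "h \<le> 1" using rho1 D0 by (simp add: rho_def)
    have hr: "h\<^sup>2 \<le> rho\<^sup>2" "D\<^sup>2 \<le> rho\<^sup>2" "h * D \<le> rho\<^sup>2"
      using h0 D0 by (auto simp: rho_def power2_eq_square algebra_simps)
    define eta where "eta = E * rho\<^sup>2"
    have eta0: "eta \<ge> 0" using E0 by (simp add: eta_def)
    \<comment> \<open>The first order part of \<open>quad_form G (x + d) - lam\<close>, where
      \<open>d = s (y + x) - s y\<close>.\<close>
    define el where "el y x = x \<bullet> (H *v x) + 2 * (x \<bullet> (s (y + x) - s y))" for y x
    have el_ge: "- eta \<le> el y x" if y: "y \<in> L" and x: "x \<in> M" for y x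
    proof -
      define d where "d = s (y + x) - s y"
      have nd: "norm d \<le> D" using D_ge[OF y x] by (simp add: d_def)
      have swap: "x \<bullet> (H *v d) = d \<bullet> (H *v x)"
        by (metis dot_lmul_matrix inner_commute symH vector_transpose_matrix)
      have "quad_form G (x + d) = lam + el y x + d \<bullet> d + 2 * (d \<bullet> (H *v x)) + d \<bullet> (H *v d)"
        using M_inner[OF x] swap
        unfolding el_def d_def[symmetric]
        by (simp add: quad_form_def G matrix_vector_mult_add_rdistrib matrix_vector_right_distrib inner_left_distrib inner_right_distrib inner_commute[of d x])
      moreover have "lam \<le> quad_form G (x + d)" using ge y x by (simp add: d_def)
      moreover have "d \<bullet> d \<le> rho\<^sup>2"
      proof -
        have "d \<bullet> d = (norm d)\<^sup>2" by (simp add: power2_norm_eq_inner)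
        also have "\<dots> \<le> D\<^sup>2" using nd by (intro power_mono) auto
        finally show ?thesis using hr by linarith
      qed
      moreover have "\<bar>d \<bullet> (H *v x)\<bar> \<le> sqrt lam * rho\<^sup>2"
      proof -
        have "\<bar>d \<bullet> (H *v x)\<bar> \<le> h * norm d * norm x" unfolding h_def by (rule abs_bilinear_le)
        also have "\<dots> \<le> h * D * sqrt lam"
          using nd h0 D0 M_norm[OF x] lam_pos by (intro mult_mono) auto
        also have "\<dots> \<le> rho\<^sup>2 * sqrt lam" using hr lam_pos by (intro mult_right_mono) auto
        finally show ?thesis by (simp add: mult_ac)
      qed
      moreover have "\<bar>d \<bullet> (H *v d)\<bar> \<le> rho\<^sup>2"
      proof -
        have "\<bar>d \<bullet> (H *v d)\<bar> \<le> h * norm d * norm d" unfolding h_def by (rule abs_bilinear_le)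
        also have "\<dots> \<le> 1 * D * D"
          using nd h0 h1 D0 by (intro mult_mono) auto
        finally show ?thesis using hr by (simp add: power2_eq_square)
      qed
      ultimately have "0 \<le> el y x + rho\<^sup>2 + 2 * (sqrt lam * rho\<^sup>2) + rho\<^sup>2" by linarith
      then show ?thesis by (simp add: eta_def E_def algebra_simps)
    qed
    \<comment> \<open>The displacement terms telescope over a period along \<open>x\<close>; only
      \<open>H\<close> survives.\<close>
    have line: "(\<Sum>k<N. el (y + real k *\<^sub>R x) x) = real N * (x \<bullet> (H *v x))" if y: "y \<in> L" and x: "x \<in> M" for y x
    proof -
      have step: "(y + real k *\<^sub>R x) + x = y + real (Suc k) *\<^sub>R x" for k by (simp add: algebra_simps)
      have "(\<Sum>k<N. el (y + real k *\<^sub>R x) x) = real N * (x \<bullet> (H *v x)) + 2 * (\<Sum>k<N. x \<bullet> s (y + real (Suc k) *\<^sub>R x) - x \<bullet> s (y + real k *\<^sub>R x))"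
        by (simp only: el_def step sum.distrib sum_distrib_left[symmetric] inner_diff_right) simp
      also have "(\<Sum>k<N. x \<bullet> s (y + real (Suc k) *\<^sub>R x) - x \<bullet> s (y + real k *\<^sub>R x)) = x \<bullet> s (y + real N *\<^sub>R x) - x \<bullet> s y"
        by (subst sum_lessThan_telescope) simp
      finally show ?thesis using per y x by simp
    qed
    have memk: "y + real k *\<^sub>R x \<in> L" if "y \<in> L" "x \<in> M" for y x k
      using that add_mem scale_mem M_subset by blast
    have lowH: "- eta \<le> x \<bullet> (H *v x)" if x: "x \<in> M" for x
    proof -
      have "(\<Sum>k<N. - eta) \<le> (\<Sum>k<N. el (0 + real k *\<^sub>R x) x)"
        by (intro sum_mono el_ge memk zero_mem x)
      then have "real N * (- eta) \<le> real N * (x \<bullet> (H *v x))" using line[OF zero_mem x] by simp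
      then show ?thesis using N by (subst (asm) mult_le_cancel_left_pos) auto
    qed
    have tr: "(\<Sum>i\<in>UNIV. H $ i $ i) \<le> C0 * rho\<^sup>2"
    proof -
      have "\<bar>det G - 1 - (\<Sum>i\<in>UNIV. H $ i $ i)\<bar> \<le> C0 * h\<^sup>2"
        unfolding G h_def using h1 by (intro C0) (simp add: h_def)
      moreover have "C0 * h\<^sup>2 \<le> C0 * rho\<^sup>2" using hr C0 by (intro mult_left_mono) auto
      ultimately show ?thesis using det1 by linarith
    qed
    have upH: "x \<bullet> (H *v x) \<le> K1 * rho\<^sup>2" if x: "x \<in> M" for x
    proof -
      \<comment> \<open>Every summand is at least \<open>- eta\<close>, and their total is
        \<open>c\<close> times the trace, which \<open>det G < 1\<close> keeps below a second order
        term. So no single summand can be large.\<close>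
      have "c * (\<Sum>i\<in>UNIV. H $ i $ i) = (\<Sum>x\<in>M. x \<bullet> (H *v x))"
        using sum_inner_square_matrix[OF fin eutactic] by simp
      also have "\<dots> = x \<bullet> (H *v x) + (\<Sum>z\<in>M - {x}. z \<bullet> (H *v z))"
        using fin x by (simp add: sum.remove)
      finally have "x \<bullet> (H *v x) = c * (\<Sum>i\<in>UNIV. H $ i $ i) - (\<Sum>z\<in>M - {x}. z \<bullet> (H *v z))" by simp
      moreover have "c * (\<Sum>i\<in>UNIV. H $ i $ i) \<le> c * (C0 * rho\<^sup>2)" using tr c_pos by (intro mult_left_mono) auto
      moreover have "(\<Sum>z\<in>M - {x}. - eta) \<le> (\<Sum>z\<in>M - {x}. z \<bullet> (H *v z))"
        using lowH by (intro sum_mono) auto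
      moreover have "(\<Sum>z\<in>M - {x}. eta) \<le> real (card M) * eta"
        using eta0 fin by (simp add: card_Diff_subset x mult_right_mono)
      ultimately show ?thesis by (simp add: K1_def eta_def sum_negf algebra_simps)
    qed
    have eta_le: "eta \<le> K1 * rho\<^sup>2" unfolding eta_def using K1E by (intro mult_right_mono) auto
    have absH: "\<forall>x\<in>M. \<bar>x \<bullet> (H *v x)\<bar> \<le> K1 * rho\<^sup>2"
    proof
      fix x assume x: "x \<in> M"
      show "\<bar>x \<bullet> (H *v x)\<bar> \<le> K1 * rho\<^sup>2" using lowH[OF x] upH[OF x] eta_le by linarith
    qed
    have hle: "h \<le> C1 * (K1 * rho\<^sup>2)"
      unfolding h_def using C1(2) symH absH by blast
    have absd: "\<forall>y\<in>L. \<forall>x\<in>M. \<bar>x \<bullet> (s (y + x) - s y)\<bar> \<le> K2 * rho\<^sup>2"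
    proof (intro ballI)
      fix y x assume y: "y \<in> L" and x: "x \<in> M"
      \<comment> \<open>The same argument along the line: the total is known and all other terms are
        at least \<open>- eta\<close>.\<close>
      have "el y x = (\<Sum>k<N. el (y + real k *\<^sub>R x) x) - (\<Sum>k\<in>{..<N} - {0}. el (y + real k *\<^sub>R x) x)"
        using N by (subst sum.remove[of "{..<N}" 0]) auto
      also have "\<dots> \<le> real N * (K1 * rho\<^sup>2) + real N * eta"
      proof -
        have "(\<Sum>k<N. el (y + real k *\<^sub>R x) x) \<le> real N * (K1 * rho\<^sup>2)"
          unfolding line[OF y x] using upH[OF x] by (intro mult_left_mono) auto
        moreover have "(\<Sum>k\<in>{..<N} - {0}. - eta) \<le> (\<Sum>k\<in>{..<N} - {0}. el (y + real k *\<^sub>R x) x)"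
          by (intro sum_mono el_ge memk y x)
        moreover have "(\<Sum>k\<in>{..<N} - {0}. eta) \<le> real N * eta"
          using eta0 N by (simp add: card_Diff_subset mult_right_mono)
        ultimately show ?thesis by (simp add: sum_negf)
      qed
      finally have up: "el y x \<le> real N * (K1 * rho\<^sup>2 + eta)" by (simp add: algebra_simps)
      have "K2 * rho\<^sup>2 = real N * (K1 * rho\<^sup>2 + eta) + K1 * rho\<^sup>2 + eta"
        by (simp add: K2_def eta_def algebra_simps)
      moreover have "real N * (K1 * rho\<^sup>2 + eta) \<ge> 0" using K10 eta0 by simp
      moreover have "- (K1 * rho\<^sup>2) \<le> x \<bullet> (H *v x)" "x \<bullet> (H *v x) \<le> K1 * rho\<^sup>2" using absH x by (auto simp: abs_le_iff)
      moreover have "- eta \<le> el y x" using el_ge[OF y x] .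
      ultimately show "\<bar>x \<bullet> (s (y + x) - s y)\<bar> \<le> K2 * rho\<^sup>2"
        using up eta0 unfolding el_def by - (rule abs_leI; linarith)
    qed
    have "\<forall>y\<in>L. \<forall>x\<in>M. norm (s (y + x) - s y) \<le> C2 * (K2 * rho\<^sup>2)"
      using C2(2) per absd by blast
    then have "D \<le> C2 * (K2 * rho\<^sup>2)"
      unfolding D_def using S_ne by (intro cSup_least) (auto simp: S_def)
    with hle have rho_le: "rho \<le> K * rho\<^sup>2" by (simp add: rho_def K_def algebra_simps)
    have Kr: "K * rho < 1" if "rho > 0"
    proof -
      have "(K + 1) * rho < 1" using rho_lt K0 by (simp add: field_simps)
      then show ?thesis using that by (simp add: algebra_simps)
    qed
    have "rho = 0"
    proof -
      have "rho * (1 - K * rho) \<le> 0" using rho_le by (simp add: power2_eq_square algebra_simps)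
      moreover have "rho * (1 - K * rho) > 0" if "rho > 0" using that Kr by simp
      ultimately show ?thesis using rho0 by force
    qed
    then have "h = 0" using h0 D0 by (simp add: rho_def)
    then have "H = 0" by (simp add: h_def)
    then show False using det1 by (simp add: G)
  qed
  then show ?thesis using eps by blast
qed

end

section \<open>Periodic forms near a representation\<close>

lemma zero_in_int_vecs: "0 \<in> int_vecs"
  by (simp add: int_vecs_def)

lemma diff_in_int_vecs: "u \<in> int_vecs \<Longrightarrow> v \<in> int_vecs \<Longrightarrow> u - v \<in> int_vecs"
  by (simp add: int_vecs_def)

lemma add_in_int_vecs: "u \<in> int_vecs \<Longrightarrow> v \<in> int_vecs \<Longrightarrow> u + v \<in> int_vecs"
  by (simp add: int_vecs_def)

lemma scale_in_int_vecs: "v \<in> int_vecs \<Longrightarrow> real k *\<^sub>R v \<in> int_vecs"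
  by (simp add: int_vecs_def)

lemma quad_form_transpose_mult:
  "quad_form (transpose (B :: real^'n^'n) ** B) x = (B *v x) \<bullet> (B *v x)"
  by (simp add: quad_form_def inner_matrix_vector matrix_vector_mul_assoc)

lemma pos_def_quad_form_nonneg: "pos_def Q \<Longrightarrow> 0 \<le> quad_form Q x"
  by (cases "x = 0") (auto simp: pos_def_def quad_form_def intro: less_imp_le)

text \<open>The infimum enters the proof through this upper bound and the lower bound
  \<open>le_gen_min\<close> below.\<close>

lemma gen_min_le:
  assumes "(Q, t) \<in> periodic_forms m" "i \<in> {1..m}" "j \<in> {1..m}" "v \<in> int_vecs" "i = j \<Longrightarrow> v \<noteq> 0"
  shows "gen_min m (Q, t) \<le> quad_form Q (t i - t j - v)"
  unfolding gen_min_def prod.case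
proof (rule cInf_lower)
  show "bdd_below {quad_form Q (t i - t j - v) | i j v. i \<in> {1..m} \<and> j \<in> {1..m} \<and> v \<in> int_vecs \<and> (i = j \<longrightarrow> v \<noteq> 0)}"
    using assms(1) by (intro bdd_belowI[of _ 0]) (auto simp: periodic_forms_def intro: pos_def_quad_form_nonneg)
qed (use assms in blast)

lemma le_gen_min:
  assumes "m \<ge> 1"
    and "\<And>i j v. i \<in> {1..m} \<Longrightarrow> j \<in> {1..m} \<Longrightarrow> v \<in> int_vecs \<Longrightarrow> (i = j \<Longrightarrow> v \<noteq> 0) \<Longrightarrow> a \<le> quad_form Q (t i - t j - v)"
  shows "a \<le> gen_min m (Q, t :: nat \<Rightarrow> real^'n)"
  unfolding gen_min_def prod.case
proof (rule cInf_greatest)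
  have "(\<chi> i. 1) \<in> (int_vecs :: (real^'n) set)" "(\<chi> i. 1) \<noteq> (0 :: real^'n)"
    by (auto simp: int_vecs_def vec_eq_iff)
  then show "{quad_form Q (t i - t j - v) | i j v. i \<in> {1..m} \<and> j \<in> {1..m} \<and> v \<in> int_vecs \<and> (i = j \<longrightarrow> v \<noteq> 0)} \<noteq> {}"
    using assms(1) by fastforce
qed (use assms(2) in auto)

text \<open>An isometry is an orthogonal map followed by the translation by \<open>f 0\<close>. As
  \<open>t m = 0\<close>, the origin is a represented point, so \<open>f 0\<close> lies in
  \<Lambda>, and a set closed under differences is invariant under translation by it. The orthogonal
  part is absorbed into \<open>B\<close> without changing \<open>transpose B ** B\<close>.\<close>

lemma representsE:
  fixes \<Lambda> :: "(real^'n) set"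
  assumes rep: "represents m X \<Lambda>" and m: "m \<ge> 1"
    and diff: "\<And>x y. x \<in> \<Lambda> \<Longrightarrow> y \<in> \<Lambda> \<Longrightarrow> x - y \<in> \<Lambda>"
  obtains B :: "real^'n^'n" where "invertible B" "fst X = transpose B ** B"
    "(\<lambda>x. B *v x) ` (\<Union>i\<in>{1..m}. (\<lambda>v. snd X i + v) ` int_vecs) = \<Lambda>"
proof -
  let ?U = "\<Union>i\<in>{1..m}. (\<lambda>v. snd X i + v) ` int_vecs"
  obtain A :: "real^'n^'n" and f where A: "invertible A" "fst X = transpose A ** A"
    and f: "\<forall>x y. dist (f x) (f y) = dist x y" and im: "f ` ((\<lambda>x. A *v x) ` ?U) = \<Lambda>"
    using rep unfolding represents_def by blast
  have tm: "snd X m = 0" using rep by (cases X) (auto simp: represents_def periodic_forms_def)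
  define g where "g x = f x - f 0" for x
  have "orthogonal_transformation g"
    unfolding orthogonal_transformation_isometry using f by (simp add: g_def dist_norm)
  then have lin: "linear g" and om: "orthogonal_matrix (matrix g)"
    by (auto simp: orthogonal_transformation_matrix)
  have g: "g x = matrix g *v x" for x using lin by (simp add: matrix_works)
  have "0 \<in> ?U" using m tm zero_in_int_vecs by force
  then have "f 0 \<in> \<Lambda>" unfolding im[symmetric] by (metis image_eqI matrix_vector_mult_0_right)
  then have sub: "(\<lambda>x. x - f 0) ` \<Lambda> = \<Lambda>"
  proof (intro antisym subsetI)
    fix x assume x: "x \<in> \<Lambda>"
    have "x - (f 0 - f 0 - f 0) \<in> \<Lambda>" using \<open>f 0 \<in> \<Lambda>\<close> x diff by blast
    then show "x \<in> (\<lambda>x. x - f 0) ` \<Lambda>" by (intro image_eqI[of _ _ "x + f 0"]) auto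
  qed (use diff in auto)
  show thesis
  proof (rule that[of "matrix g ** A"])
    have "invertible (matrix g)" using om by (auto simp: orthogonal_matrix_def invertible_def)
    then show "invertible (matrix g ** A)" using A(1) by (rule invertible_mult)
    show "fst X = transpose (matrix g ** A) ** (matrix g ** A)"
    proof -
      have "transpose (matrix g ** A) ** (matrix g ** A) = transpose A ** (transpose (matrix g) ** matrix g) ** A"
        by (simp add: matrix_transpose_mul matrix_mul_assoc)
      then show ?thesis using om A(2) by (simp add: orthogonal_matrix_def)
    qed
    have "(\<lambda>x. (matrix g ** A) *v x) ` ?U = (\<lambda>x. x - f 0) ` (f ` ((\<lambda>x. A *v x) ` ?U))"
      by (simp add: image_image matrix_vector_mul_assoc[symmetric] g[symmetric]) (simp add: g_def)
    then show "(\<lambda>x. (matrix g ** A) *v x) ` ?U = \<Lambda>" by (simp only: im sub)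
  qed
qed

text \<open>Among the \<open>m + 1\<close> multiples \<open>0\<close>, \<open>x\<close>, up to
  \<open>m x\<close>, two lie in the same class. So some \<open>(k - j) x\<close> with
  \<open>0 < k - j \<le> m\<close> is in \<open>S\<close>, and \<open>k - j\<close> divides
  \<open>fact m\<close>. One exponent thus serves all of \<open>L\<close>.\<close>

lemma exponent_of_sublattice:
  fixes idx :: "real^'n \<Rightarrow> nat"
  assumes L0: "0 \<in> L" and add: "\<And>x y. x \<in> L \<Longrightarrow> y \<in> L \<Longrightarrow> x + y \<in> L"
    and idx: "\<And>y. y \<in> L \<Longrightarrow> idx y \<in> {1..m}"
    and same: "\<And>y z. y \<in> L \<Longrightarrow> z \<in> L \<Longrightarrow> idx y = idx z \<Longrightarrow> z - y \<in> S"
    and S: "\<And>k z. z \<in> S \<Longrightarrow> real k *\<^sub>R z \<in> S" and x: "x \<in> L"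
  shows "real (fact m) *\<^sub>R x \<in> S"
proof -
  have mem: "real k *\<^sub>R x \<in> L" for k
    by (induction k) (auto simp: L0 scaleR_left.add add x algebra_simps)
  have "\<not> inj_on (\<lambda>k. idx (real k *\<^sub>R x)) {0..m}"
  proof
    assume "inj_on (\<lambda>k. idx (real k *\<^sub>R x)) {0..m}"
    then have "card {0..m} \<le> card {1..m}" using idx mem by (intro card_inj_on_le) auto
    then show False by simp
  qed
  then obtain j k where jk: "j < k" "k \<le> m" "idx (real j *\<^sub>R x) = idx (real k *\<^sub>R x)"
    unfolding inj_on_def by (metis atLeastAtMost_iff linorder_neqE_nat)
  have "real k *\<^sub>R x - real j *\<^sub>R x \<in> S" using jk mem same by blast
  then have d: "real (k - j) *\<^sub>R x \<in> S" using jk by (simp add: scaleR_left_diff_distrib of_nat_diff)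
  have "(k - j) dvd fact m" using jk by (intro dvd_fact) auto
  then obtain q where q: "fact m = q * (k - j)" by (auto simp: dvd_def mult.commute)
  then have "real (fact m) *\<^sub>R x = real q *\<^sub>R (real (k - j) *\<^sub>R x)" by (metis of_nat_mult scaleR_scaleR)
  then show ?thesis using S[OF d] by metis
qed

context star_lattice
begin

text \<open>Suppose that some \<open>Y\<close> near \<open>X\<close> were denser. Transported to the
  coordinates of \<open>L\<close> and rescaled by \<open>r\<close> so that its minimum becomes
  \<open>lam\<close>, it would be a perturbation as in \<open>local_extreme\<close> with determinant
  below 1. The point is that \<open>r\<close> stays near 1: from above because \<open>Y\<close> is
  denser, from below because the minimum of \<open>Y\<close> is at most its value on one fixed
  minimal vector.\<close>

theorem periodic_extreme_star:
  assumes lattice: "full_rank_lattice L"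
  shows "periodic_extreme L"
  unfolding periodic_extreme_def
proof (intro conjI allI impI)
  show "periodic_set L"
    unfolding periodic_set_def using lattice by (intro exI[of _ L] exI[of _ "{0}"]) auto
next
  fix m :: nat and X :: "'n periodic_form"
  assume m: "1 \<le> m" and rep: "represents m X L"
  obtain Q0 t0 where X: "X = (Q0, t0)" by (cases X)
  obtain B :: "real^'n^'n" where B: "invertible B" and Q0: "Q0 = transpose B ** B"
    and im: "(\<lambda>x. B *v x) ` (\<Union>i\<in>{1..m}. (\<lambda>v. t0 i + v) ` int_vecs) = L"
    by (rule representsE[OF rep m diff_mem, unfolded X fst_conv snd_conv])
  obtain Bi where Bi: "B ** Bi = mat 1" "Bi ** B = mat 1" using B by (auto simp: invertible_def)
  have BiB: "Bi *v (B *v u) = u" and BBi: "B *v (Bi *v u) = u" for u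
    by (simp_all add: matrix_vector_mul_assoc Bi)
  have B_inj: "B *v u = B *v v \<Longrightarrow> u = v" for u v by (metis BiB)
  have Xpf: "X \<in> periodic_forms m" and disj: "disjoint_family_on (\<lambda>i. (\<lambda>v. t0 i + v) ` int_vecs) {1..m}"
    using rep by (auto simp: represents_def X)
  have uniq: "i = j" if "i \<in> {1..m}" "j \<in> {1..m}" "v \<in> int_vecs" "w \<in> int_vecs" "t0 i + v = t0 j + w" for i j v w
  proof (rule ccontr)
    assume "i \<noteq> j"
    then have "(\<lambda>v. t0 i + v) ` int_vecs \<inter> (\<lambda>v. t0 j + v) ` int_vecs = {}" by (rule disjoint_family_onD[OF disj that(1,2)])
    moreover have "t0 i + v \<in> (\<lambda>v. t0 i + v) ` int_vecs" "t0 i + v \<in> (\<lambda>v. t0 j + v) ` int_vecs"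
      using that by (metis imageI)+
    ultimately show False by blast
  qed
  have memB: "B *v (t0 i + v) \<in> L" if "i \<in> {1..m}" "v \<in> int_vecs" for i v
    unfolding im[symmetric] using that by (intro imageI UN_I[of i])
  have "\<exists>i v. i \<in> {1..m} \<and> v \<in> int_vecs \<and> y = B *v (t0 i + v)" if "y \<in> L" for y
    using that unfolding im[symmetric] by auto
  then obtain idx cv where idx: "\<And>y. y \<in> L \<Longrightarrow> idx y \<in> {1..m}" and cv: "\<And>y. y \<in> L \<Longrightarrow> cv y \<in> int_vecs"
    and eq: "\<And>y. y \<in> L \<Longrightarrow> y = B *v (t0 (idx y) + cv y)" by metis
  have idx_shift: "idx (y + B *v v) = idx y" if y: "y \<in> L" and yv: "y + B *v v \<in> L" and v: "v \<in> int_vecs" for y v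
  proof -
    have "B *v (t0 (idx (y + B *v v)) + cv (y + B *v v)) = y + B *v v" by (rule eq[OF yv, symmetric])
    also have "\<dots> = B *v (t0 (idx y) + cv y) + B *v v" by (rule arg_cong[OF eq[OF y], of "\<lambda>z. z + B *v v"])
    also have "\<dots> = B *v (t0 (idx y) + (cv y + v))" by (simp add: matrix_vector_right_distrib add.assoc)
    finally have "t0 (idx (y + B *v v)) + cv (y + B *v v) = t0 (idx y) + (cv y + v)" by (rule B_inj)
    then show ?thesis by (rule uniq[OF idx[OF yv] idx[OF y] cv[OF yv] add_in_int_vecs[OF cv[OF y] v]])
  qed
  \<comment> \<open>A common period: \<open>fact m\<close> times a point of \<open>L\<close> lies in
    the translation lattice of the representation, so displacements that depend only on the class
    repeat after \<open>N\<close> steps.\<close>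
  define N where "N = (fact m :: nat)"
  have N1: "N \<ge> 1" by (simp add: N_def)
  have Nx: "real N *\<^sub>R x \<in> (\<lambda>v. B *v v) ` int_vecs" if x: "x \<in> L" for x
    unfolding N_def
  proof (rule exponent_of_sublattice[OF zero_mem add_mem _ _ _ x])
    fix y z assume y: "y \<in> L" and z: "z \<in> L" and same: "idx y = idx z"
    have "z - y = B *v (cv z - cv y)"
      using eq[OF y] eq[OF z] same by (metis add_diff_cancel_left matrix_vector_mult_diff_distrib)
    then show "z - y \<in> (\<lambda>v. B *v v) ` int_vecs" using cv y z diff_in_int_vecs by blast
  next
    fix k z assume "z \<in> (\<lambda>v. B *v v) ` int_vecs"
    then obtain v where "v \<in> int_vecs" "z = B *v v" by blast
    then show "real k *\<^sub>R z \<in> (\<lambda>v. B *v v) ` int_vecs"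
      by (intro image_eqI[of _ _ "real k *\<^sub>R v"]) (auto simp: matrix_vector_mult_scaleR scale_in_int_vecs)
  qed (use idx in auto)
  obtain \<epsilon> where \<epsilon>: "\<epsilon> > 0" and loc: "\<forall>G s. transpose G = G \<longrightarrow> norm (G - mat 1) < \<epsilon> \<longrightarrow> (\<forall>y\<in>L. norm (s y) < \<epsilon>) \<longrightarrow>
     (\<forall>y\<in>L. \<forall>x\<in>M. s (y + real N *\<^sub>R x) = s y) \<longrightarrow>
     (\<forall>y\<in>L. \<forall>x\<in>M. lam \<le> quad_form G (x + (s (y + x) - s y))) \<longrightarrow> 1 \<le> det G"
    using local_extreme[OF N1] by (elim exE conjE)
  define n where "n = real CARD('n)"
  have n0: "n > 0" by (simp add: n_def)
  define d0 where "d0 = det Q0"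
  have d0: "d0 = (det B)\<^sup>2" by (simp add: d0_def Q0 det_mul det_transpose power2_eq_square)
  have d0_pos: "d0 > 0" using B by (simp add: d0 invertible_det_nz)
  have lam_le: "lam \<le> gen_min m X"
    unfolding X
  proof (rule le_gen_min[OF m])
    fix i j :: nat and v :: "real^'n" assume ij: "i \<in> {1..m}" "j \<in> {1..m}" "v \<in> int_vecs" "i = j \<Longrightarrow> v \<noteq> 0"
    let ?z = "B *v (t0 i - t0 j - v)"
    have "?z = B *v (t0 i + 0) - B *v (t0 j + v)"
      by (simp add: matrix_vector_mult_diff_distrib[symmetric] algebra_simps)
    then have "?z \<in> L" using memB ij zero_in_int_vecs diff_mem by metis
    moreover have "?z \<noteq> 0"
    proof
      assume "?z = 0"
      then have "t0 i - t0 j - v = 0" using B_inj[of "t0 i - t0 j - v" 0] by simp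
      then have "t0 i + 0 = t0 j + v" by (simp add: algebra_simps)
      then show False using uniq[OF ij(1,2) zero_in_int_vecs ij(3)] ij(4) by auto
    qed
    ultimately show "lam \<le> quad_form Q0 (t0 i - t0 j - v)"
      unfolding Q0 quad_form_transpose_mult by (rule lam_min)
  qed
  let ?F = "at X within periodic_forms m"
  have toQ: "(fst \<longlongrightarrow> Q0) ?F"
    using tendsto_fst[OF tendsto_ident_at[of X "periodic_forms m"]] by (simp add: X)
  have tot: "((\<lambda>Y. snd Y i) \<longlongrightarrow> t0 i) ?F" for i
  proof -
    have "isCont (\<lambda>t :: nat \<Rightarrow> real^'n. t i) t0"
      using continuous_on_product_coordinates[of i] continuous_on_eq_continuous_at[OF open_UNIV] by blast
    moreover have "(snd \<longlongrightarrow> t0) ?F" using tendsto_snd[OF tendsto_ident_at[of X "periodic_forms m"]] by (simp add: X)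
    ultimately show ?thesis by (rule isCont_tendsto_compose)
  qed
  \<comment> \<open>The form \<open>Q\<close> read in the coordinates \<open>B *v u\<close>; the
    reference \<open>Q0\<close> becomes the identity.\<close>
  define Gm where "Gm Q = transpose Bi ** Q ** Bi" for Q
  have quadGm: "quad_form (Gm Q) (B *v u) = quad_form Q u" for Q u
    by (simp add: Gm_def quad_form_congruence BiB)
  have GmQ0: "Gm Q0 = mat 1"
  proof -
    have "Gm Q0 = transpose (B ** Bi) ** (B ** Bi)"
      by (simp add: Gm_def Q0 matrix_transpose_mul matrix_mul_assoc)
    then show ?thesis by (simp add: Bi)
  qed
  have detGm: "det (Gm Q) = det Q / d0" for Q
  proof -
    have "det Bi * det B = 1" using Bi(2) by (metis det_I det_mul)
    then have "det Bi = 1 / det B" by (metis eq_divide_eq mult_zero_right zero_neq_one)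
    then show ?thesis by (simp add: Gm_def det_mul det_transpose d0 power2_eq_square)
  qed
  obtain x0 where x0: "x0 \<in> M" using M_nonempty by blast
  \<comment> \<open>One minimal vector as a difference of two represented points. Its value
    \<open>q Y\<close> depends continuously on \<open>Y\<close> and bounds the minimum of
    \<open>Y\<close> from above.\<close>
  define i0 j0 v0 where "i0 = idx x0" and "j0 = idx 0" and "v0 = cv 0 - cv x0"
  have x0L: "x0 \<in> L" using x0 by (rule M_subset)
  have x0eq: "x0 = B *v (t0 i0 - t0 j0 - v0)"
  proof -
    have "x0 = x0 - 0" by simp
    also have "\<dots> = B *v (t0 i0 + cv x0) - B *v (t0 j0 + cv 0)"
      by (simp only: i0_def j0_def eq[OF x0L, symmetric] eq[OF zero_mem, symmetric])
    also have "\<dots> = B *v (t0 i0 - t0 j0 - v0)"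
      by (simp add: matrix_vector_mult_diff_distrib[symmetric] v0_def algebra_simps)
    finally show ?thesis .
  qed
  have v0_ne: "v0 \<noteq> 0" if "i0 = j0"
  proof
    assume "v0 = 0"
    then have "x0 = 0" using x0eq that by simp
    then show False using M_inner[OF x0] lam_pos by simp
  qed
  have quad0: "quad_form Q0 (t0 i0 - t0 j0 - v0) = lam"
    using M_inner[OF x0] by (simp add: Q0 quad_form_transpose_mult x0eq[symmetric])
  define q where "q Y = quad_form (fst Y) (snd Y i0 - snd Y j0 - v0)" for Y
  have toq: "((\<lambda>Y. lam / q Y) \<longlongrightarrow> 1) ?F"
  proof -
    have "(q \<longlongrightarrow> quad_form Q0 (t0 i0 - t0 j0 - v0)) ?F"
      unfolding q_def quad_form_def by (intro tendsto_intros tendsto_matrix_vector_mult toQ tot)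
    then have "((\<lambda>Y. lam / q Y) \<longlongrightarrow> lam / lam) ?F" unfolding quad0 using lam_pos by (intro tendsto_intros) auto
    then show ?thesis using lam_pos by simp
  qed
  have todet: "((\<lambda>Y. det (fst Y)) \<longlongrightarrow> d0) ?F" unfolding d0_def by (intro tendsto_det toQ)
  have tob: "((\<lambda>Y. (d0 / det (fst Y)) powr (1 / n)) \<longlongrightarrow> 1) ?F"
  proof -
    have "((\<lambda>Y. (d0 / det (fst Y)) powr (1 / n)) \<longlongrightarrow> (d0 / d0) powr (1 / n)) ?F"
      using d0_pos by (intro tendsto_intros todet) auto
    then show ?thesis using d0_pos by simp
  qed
  have toG: "((\<lambda>Y. Gm (fst Y)) \<longlongrightarrow> mat 1) ?F"
    unfolding Gm_def GmQ0[symmetric] by (intro tendsto_matrix_mult tendsto_const toQ)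
  \<comment> \<open>Half of \<epsilon> is reserved for the scale: as \<open>norm (Gm Q)\<close> is
    at most \<open>norm (mat 1) + 1\<close>, an error of \<open>\<delta>\<close> in \<open>r\<close>
    costs at most \<open>\<epsilon> / 2\<close>.\<close>
  define \<delta> where "\<delta> = \<epsilon> / (2 * (norm (mat 1 :: real^'n^'n) + 1))"
  have \<delta>: "\<delta> > 0" using \<epsilon> by (simp add: \<delta>_def add_nonneg_pos)
  have e1: "\<forall>\<^sub>F Y in ?F. dist (lam / q Y) 1 < \<delta>" using tendstoD[OF toq \<delta>] .
  have e2: "\<forall>\<^sub>F Y in ?F. dist ((d0 / det (fst Y)) powr (1 / n)) 1 < \<delta>" using tendstoD[OF tob \<delta>] .
  have e3: "\<forall>\<^sub>F Y in ?F. dist (Gm (fst Y)) (mat 1) < min 1 (\<epsilon> / 2)" using \<epsilon> by (intro tendstoD[OF toG]) auto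
  have e4: "\<forall>\<^sub>F Y in ?F. \<forall>i\<in>{1..m}. dist (B *v (snd Y i - t0 i)) 0 < \<epsilon>"
  proof (rule eventually_ball_finite[OF finite_atLeastAtMost], rule ballI)
    fix i
    have "((\<lambda>Y. B *v (snd Y i - t0 i)) \<longlongrightarrow> B *v (t0 i - t0 i)) ?F"
      by (intro tendsto_matrix_vector_mult tendsto_intros tot)
    then have "((\<lambda>Y. B *v (snd Y i - t0 i)) \<longlongrightarrow> 0) ?F" by simp
    then show "\<forall>\<^sub>F Y in ?F. dist (B *v (snd Y i - t0 i)) 0 < \<epsilon>" by (rule tendstoD[OF _ \<epsilon>])
  qed
  have e5: "\<forall>\<^sub>F Y in ?F. det (fst Y) > 0" using order_tendstoD(1)[OF todet d0_pos] .
  have e6: "\<forall>\<^sub>F Y in ?F. Y \<in> periodic_forms m" by (simp add: eventually_at_filter)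
  have key: "\<forall>\<^sub>F Y in ?F. gen_min m Y / det (fst Y) powr (1 / n) \<le> lam / d0 powr (1 / n)"
    using e1 e2 e3 e4 e5 e6
  proof eventually_elim
    case (elim Y)
    obtain Q t where Y: "Y = (Q, t)" by (cases Y)
    define \<mu> where "\<mu> = gen_min m Y"
    have detQ: "det Q > 0" using elim by (simp add: Y)
    have Qsym: "transpose Q = Q" and Ypf: "(Q, t) \<in> periodic_forms m"
      using elim by (auto simp: Y periodic_forms_def pos_def_def)
    show ?case
    proof (rule ccontr)
      assume "\<not> ?case"
      then have gt: "lam / d0 powr (1 / n) < \<mu> / det Q powr (1 / n)" by (simp add: Y \<mu>_def)
      moreover have "lam / d0 powr (1 / n) > 0" using lam_pos d0_pos by simp
      ultimately have "\<mu> / det Q powr (1 / n) > 0" by linarith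
      then have \<mu>0: "\<mu> > 0" using detQ by (simp add: zero_less_divide_iff)
      define r where "r = lam / \<mu>"
      have r0: "r > 0" using \<mu>0 lam_pos by (simp add: r_def)
      have r_lt: "r < (d0 / det Q) powr (1 / n)"
        using gt \<mu>0 d0_pos detQ by (simp add: r_def powr_divide field_simps)
      have "\<mu> \<le> q Y"
        unfolding \<mu>_def q_def Y fst_conv snd_conv
      proof (rule gen_min_le[OF Ypf])
        show "i0 \<in> {1..m}" "j0 \<in> {1..m}" using idx x0L zero_mem by (auto simp: i0_def j0_def)
        show "v0 \<in> int_vecs" unfolding v0_def by (intro diff_in_int_vecs cv x0L zero_mem)
      qed (use v0_ne in auto)
      then have r_ge: "lam / q Y \<le> r" unfolding r_def using \<mu>0 lam_pos by (intro divide_left_mono) auto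
      have r1: "\<bar>r - 1\<bar> < \<delta>"
        using r_lt r_ge elim(1,2) by (auto simp: dist_real_def Y)
      define G where "G = r *\<^sub>R Gm Q"
      have nearG: "norm (G - mat 1) < \<epsilon>"
      proof -
        have near: "norm (Gm Q - mat 1) < 1" "norm (Gm Q - mat 1) < \<epsilon> / 2"
          using elim(3) by (auto simp: Y dist_norm)
        have nG: "norm (Gm Q) \<le> norm (mat 1 :: real^'n^'n) + 1"
          using near(1) norm_triangle_ineq2[of "Gm Q" "mat 1"] by linarith
        have "G - mat 1 = (r - 1) *\<^sub>R Gm Q + (Gm Q - mat 1)" by (simp add: G_def algebra_simps)
        then have "norm (G - mat 1) \<le> \<bar>r - 1\<bar> * norm (Gm Q) + norm (Gm Q - mat 1)"
          by (metis norm_scaleR norm_triangle_ineq)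
        also have "\<dots> < \<delta> * (norm (mat 1 :: real^'n^'n) + 1) + \<epsilon> / 2"
        proof (intro add_le_less_mono near mult_mono nG)
          show "\<bar>r - 1\<bar> \<le> \<delta>" using r1 by simp
        qed (use \<delta> in auto)
        also have "\<delta> * (norm (mat 1 :: real^'n^'n) + 1) = \<epsilon> / 2"
        proof -
          have "norm (mat 1 :: real^'n^'n) + 1 > 0" by (simp add: add_nonneg_pos)
          then show ?thesis unfolding \<delta>_def by (simp add: field_simps)
        qed
        finally show ?thesis by simp
      qed
      have symG: "transpose G = G"
      proof -
        have "transpose (Gm Q) = Gm Q" by (simp add: Gm_def matrix_transpose_mul Qsym matrix_mul_assoc)
        then show ?thesis by (simp add: G_def transpose_def vec_eq_iff) 
      qed
      define s where "s y = B *v (t (idx y) - t0 (idx y))" for y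
      have smallS: "\<forall>y\<in>L. norm (s y) < \<epsilon>" using elim(4) idx by (auto simp: s_def Y)
      have perS: "\<forall>y\<in>L. \<forall>x\<in>M. s (y + real N *\<^sub>R x) = s y"
      proof (intro ballI)
        fix y x assume y: "y \<in> L" and x: "x \<in> M"
        obtain v where v: "v \<in> int_vecs" "real N *\<^sub>R x = B *v v" using Nx[OF M_subset[OF x]] by blast
        have "y + B *v v \<in> L" using v(2) y x add_mem scale_mem M_subset by metis
        then show "s (y + real N *\<^sub>R x) = s y" using idx_shift[OF y _ v(1)] by (simp add: s_def v(2))
      qed
      have geS: "\<forall>y\<in>L. \<forall>x\<in>M. lam \<le> quad_form G (x + (s (y + x) - s y))"
      proof (intro ballI)
        fix y x assume y: "y \<in> L" and x: "x \<in> M"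
        have yx: "y + x \<in> L" using y x add_mem M_subset by blast
        define i j v where "i = idx (y + x)" and "j = idx y" and "v = cv y - cv (y + x)"
        have xeq: "x = B *v (t0 i - t0 j - v)"
        proof -
          have "x = (y + x) - y" by simp
          also have "\<dots> = B *v (t0 i + cv (y + x)) - B *v (t0 j + cv y)"
            by (simp only: i_def j_def eq[OF yx, symmetric] eq[OF y, symmetric])
          also have "\<dots> = B *v (t0 i - t0 j - v)"
            by (simp add: matrix_vector_mult_diff_distrib[symmetric] v_def algebra_simps)
          finally show ?thesis .
        qed
        have "x + (s (y + x) - s y) = B *v (t i - t j - v)"
        proof -
          have "x + (s (y + x) - s y) = B *v (t0 i - t0 j - v) + (B *v (t i - t0 i) - B *v (t j - t0 j))"
            by (subst xeq) (simp add: s_def i_def j_def)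
          also have "\<dots> = B *v ((t0 i - t0 j - v) + ((t i - t0 i) - (t j - t0 j)))"
            by (simp only: matrix_vector_right_distrib matrix_vector_mult_diff_distrib)
          also have "(t0 i - t0 j - v) + ((t i - t0 i) - (t j - t0 j)) = t i - t j - v" by simp
          finally show ?thesis .
        qed
        then have "quad_form G (x + (s (y + x) - s y)) = r * quad_form Q (t i - t j - v)"
          by (simp add: G_def quad_form_scaleR quadGm)
        moreover have "\<mu> \<le> quad_form Q (t i - t j - v)"
          unfolding \<mu>_def Y
        proof (rule gen_min_le[OF Ypf])
          show "i \<in> {1..m}" "j \<in> {1..m}" using idx yx y by (auto simp: i_def j_def)
          show "v \<in> int_vecs" unfolding v_def by (intro diff_in_int_vecs cv yx y)
          show "v \<noteq> 0" if "i = j"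
          proof
            assume "v = 0"
            then have "x = 0" using xeq that by simp
            then show False using M_inner[OF x] lam_pos by simp
          qed
        qed
        then have "r * \<mu> \<le> r * quad_form Q (t i - t j - v)" using r0 by (intro mult_left_mono) auto
        moreover have "r * \<mu> = lam" using \<mu>0 by (simp add: r_def)
        ultimately show "lam \<le> quad_form G (x + (s (y + x) - s y))" by linarith
      qed
      have "1 \<le> det G"
        using loc[THEN spec, THEN spec, THEN mp, OF symG, THEN mp, OF nearG, THEN mp, OF smallS, THEN mp, OF perS, THEN mp, OF geS] .
      moreover have "det G = r ^ CARD('n) * (det Q / d0)" by (simp add: G_def det_scaleR detGm)
      moreover have "r ^ CARD('n) < d0 / det Q"
      proof -
        have "r ^ CARD('n) < ((d0 / det Q) powr (1 / n)) ^ CARD('n)"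
          using r_lt r0 by (intro power_strict_mono) auto
        also have "\<dots> = d0 / det Q"
        proof -
          have "((d0 / det Q) powr (1 / n)) ^ CARD('n) = ((d0 / det Q) powr (1 / n)) powr n"
            using d0_pos detQ unfolding n_def by (subst powr_realpow) auto
          also have "\<dots> = d0 / det Q" using n0 d0_pos detQ by (simp add: powr_powr)
          finally show ?thesis .
        qed
        finally show ?thesis .
      qed
      then have "r ^ CARD('n) * (det Q / d0) < d0 / det Q * (det Q / d0)"
        using detQ d0_pos by (intro mult_strict_right_mono) auto
      ultimately show False using detQ d0_pos by simp
    qed
  qed
  have "\<forall>\<^sub>F Y in ?F. packing_density m Y \<le> packing_density m X"
    using key e5 e6
  proof eventually_elim
    case (elim Y)
    have "0 \<le> gen_min m Y"
    proof -
      obtain Q t where Y: "Y = (Q, t)" by (cases Y)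
      have "pos_def Q" using elim(3) by (auto simp: Y periodic_forms_def)
      then show ?thesis unfolding Y by (intro le_gen_min[OF m] pos_def_quad_form_nonneg)
    qed
    then have "0 \<le> gen_min m Y / det (fst Y) powr (1 / n)" by simp
    moreover have "lam / d0 powr (1 / n) \<le> gen_min m X / d0 powr (1 / n)"
      using lam_le by (intro divide_right_mono) auto
    ultimately have "(gen_min m Y / det (fst Y) powr (1 / n)) powr (n / 2) \<le> (gen_min m X / d0 powr (1 / n)) powr (n / 2)"
      using elim(1) n0 by (intro powr_mono2) auto
    then show ?case
      unfolding packing_density_def n_def[symmetric] by (intro mult_right_mono) (auto simp: X d0_def)
  qed
  then show "m_extreme m X" unfolding m_extreme_def using Xpf by blast
qed

end

section \<open>Root lattices\<close>

lemma Ints_det: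
  assumes "\<And>i j. (A :: real^'n^'n) $ i $ j \<in> \<int>"
  shows "det A \<in> \<int>"
  unfolding det_def using assms by (intro Ints_sum Ints_mult Ints_prod) auto

lemma subgroup_scale_int:
  fixes L :: "'a::real_vector set"
  assumes "0 \<in> L" "\<And>x y. x \<in> L \<Longrightarrow> y \<in> L \<Longrightarrow> x - y \<in> L" "x \<in> L" "r \<in> \<int>"
  shows "r *\<^sub>R x \<in> L"
proof -
  have neg: "- y \<in> L" if "y \<in> L" for y using assms(1,2) that by (metis diff_0)
  have add: "y + z \<in> L" if "y \<in> L" "z \<in> L" for y z
    using assms(2) neg that by (metis diff_minus_eq_add)
  have nat: "real k *\<^sub>R x \<in> L" for k
    by (induction k) (auto simp: assms(1,3) add scaleR_left.add algebra_simps)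
  obtain k :: int where k: "r = of_int k" using assms(4) by (auto elim: Ints_cases)
  show ?thesis
  proof (cases "k \<ge> 0")
    case True then show ?thesis using nat[of "nat k"] by (simp add: k)
  next
    case False then show ?thesis using neg[OF nat[of "nat (- k)"]] by (simp add: k)
  qed
qed

lemma subgroup_sum:
  fixes L :: "'a::real_vector set"
  assumes "0 \<in> L" "\<And>x y. x \<in> L \<Longrightarrow> y \<in> L \<Longrightarrow> x - y \<in> L" "\<And>i. i \<in> I \<Longrightarrow> f i \<in> L"
  shows "sum f I \<in> L"
proof -
  have neg: "- y \<in> L" if "y \<in> L" for y using assms(1,2) that by (metis diff_0)
  have add: "y + z \<in> L" if "y \<in> L" "z \<in> L" for y z
    using assms(2) neg that by (metis diff_minus_eq_add)
  show ?thesis using assms(1,3) add by (induction I rule: infinite_finite_induct) auto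
qed

lemma subgroup_matrix_image:
  fixes L :: "(real^'n) set"
  assumes "0 \<in> L" "\<And>x y. x \<in> L \<Longrightarrow> y \<in> L \<Longrightarrow> x - y \<in> L"
    and "\<And>j. column j B \<in> L" "z \<in> int_vecs"
  shows "(B :: real^'n^'n) *v z \<in> L"
  unfolding matrix_mult_sum scalar_mult_eq_scaleR using assms
  by (intro subgroup_sum subgroup_scale_int) (auto simp: int_vecs_def)

text \<open>
  Linearly independent lattice vectors of least nonzero determinant form a basis: a lattice vector
  with a non-integral coordinate could be reduced so as to lower the determinant.
\<close>

lemma integral_subgroup_full_rank:
  fixes L :: "(real^'n) set"
  assumes L0: "0 \<in> L" and Ld: "\<And>x y. x \<in> L \<Longrightarrow> y \<in> L \<Longrightarrow> x - y \<in> L"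
    and int: "\<And>x y. x \<in> L \<Longrightarrow> y \<in> L \<Longrightarrow> x \<bullet> y \<in> \<int>" and sp: "span L = UNIV"
  shows "full_rank_lattice L"
proof -
  define P where "P B \<longleftrightarrow> (\<forall>j. column j B \<in> L) \<and> det B \<noteq> 0" for B :: "real^'n^'n"
  \<comment> \<open>For columns in \<open>L\<close>, \<open>(det B)\<^sup>2\<close> is the
    determinant of an integral Gram matrix, so nothing is lost by the floor (see
    \<open>det2\<close>) and a minimum exists.\<close>
  define w where "w B = nat \<lfloor>(det B)\<^sup>2\<rfloor>" for B :: "real^'n^'n"
  have det2: "(det B)\<^sup>2 = real (w B)" if "\<forall>j. column j B \<in> L" for B
  proof -
    have "(transpose B ** B) $ i $ j = column i B \<bullet> column j B" for i j
      by (simp add: matrix_matrix_mult_def transpose_def column_def inner_vec_def)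
    then have "det (transpose B ** B) \<in> \<int>" using int that by (intro Ints_det) auto
    then have "(det B)\<^sup>2 \<in> \<int>" by (simp add: det_mul det_transpose power2_eq_square)
    then show ?thesis unfolding w_def by (auto simp: Ints_def)
  qed
  obtain S where S: "S \<subseteq> L" "independent S" "L \<subseteq> span S" "card S = dim L"
    using basis_exists by blast
  have spS: "span S = UNIV" using S sp by (metis span_eq subset_antisym span_mono span_span top_greatest subset_UNIV)
  have cardS: "card S = CARD('n)" using S(4) sp by (metis dim_span dim_UNIV DIM_cart DIM_real mult.right_neutral)
  have "finite S" using S(2) by (rule independent_imp_finite)
  then obtain g where g: "bij_betw g (UNIV :: 'n set) S" using cardS by (metis finite finite_same_card_bij)
  define B0 where "B0 = (\<chi> i j. g j $ i)"
  have col: "column j B0 = g j" for j by (simp add: B0_def column_def vec_eq_iff)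
  have "columns B0 = S" using g by (auto simp: columns_def col bij_betw_def)
  then have "\<exists>B. B0 ** B = mat 1" using spS matrix_right_invertible_span_columns[of B0] by (simp add: span_vec_eq)
  then have "det B0 \<noteq> 0" using invertible_right_inverse invertible_det_nz by blast
  then have "P B0" using g S(1) by (auto simp: P_def col bij_betw_def)
  then obtain B where PB: "P B" and least: "\<And>B'. P B' \<Longrightarrow> w B \<le> w B'"
    using ex_has_least_nat[of P B0 w] by blast
  have colB: "column j B \<in> L" for j using PB by (simp add: P_def)
  have invB: "invertible B" using PB by (simp add: P_def invertible_det_nz)
  then obtain Bi where Bi: "B ** Bi = mat 1" by (auto simp: invertible_def)
  have "x \<in> (\<lambda>z. B *v z) ` int_vecs" if x: "x \<in> L" for x
  proof -
    define u where "u = Bi *v x"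
    have Bu: "B *v u = x" by (simp add: u_def matrix_vector_mul_assoc Bi)
    have "u $ k \<in> \<int>" for k
    proof (rule ccontr)
      assume nk: "u $ k \<notin> \<int>"
      define z where "z = (\<chi> i. real_of_int \<lfloor>u $ i\<rfloor>)"
      have "z \<in> int_vecs" by (simp add: z_def int_vecs_def)
      then have x': "x - B *v z \<in> L" using subgroup_matrix_image[OF L0 Ld colB] x Ld by blast
      define y where "y = u - z"
      have By: "B *v y = x - B *v z" by (simp add: y_def matrix_vector_mult_diff_distrib Bu)
      \<comment> \<open>Column \<open>k\<close> is replaced by the reduced vector. By Cramer's rule
        this multiplies the determinant by \<open>y $ k\<close>, which lies strictly between 0 and
        1.\<close>
      define B' where "B' = (\<chi> i j. if j = k then (B *v y) $ i else B $ i $ j)"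
      have dB': "det B' = y $ k * det B" unfolding B'_def by (rule cramer_lemma)
      have yk: "0 < y $ k" "y $ k < 1"
        using nk by (auto simp: y_def z_def frac_def[symmetric] frac_lt_1 frac_gt_0_iff)
      have "column j B' \<in> L" for j
      proof (cases "j = k")
        case True
        then have "column j B' = B *v y" by (simp add: B'_def column_def vec_eq_iff)
        then show ?thesis using x' By by simp
      next
        case False
        then have "column j B' = column j B" by (simp add: B'_def column_def vec_eq_iff)
        then show ?thesis using colB by simp
      qed
      then have PB': "P B'" using dB' yk PB by (auto simp: P_def)
      have "real (w B') = (y $ k)\<^sup>2 * real (w B)"
        using det2[of B'] det2[of B] PB PB' by (simp add: P_def dB' power_mult_distrib)
      also have "\<dots> < 1 * real (w B)"
      proof (intro mult_strict_right_mono)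
        show "(y $ k)\<^sup>2 < 1" using yk by (simp add: power_less_one_iff)
        show "0 < real (w B)" using det2[of B] PB unfolding P_def by (metis zero_less_power2)
      qed
      finally show False using least[OF PB'] by simp
    qed
    then show ?thesis using Bu by (auto simp: int_vecs_def)
  qed
  moreover have "(\<lambda>z. B *v z) ` int_vecs \<subseteq> L" using subgroup_matrix_image[OF L0 Ld colB] by blast
  ultimately show ?thesis unfolding full_rank_lattice_def using invB by blast
qed

lemma finite_bounded_int_vecs: "finite {v \<in> (int_vecs :: (real^'n) set). norm v \<le> r}"
proof (rule finite_subset)
  let ?N = "\<lceil>r\<rceil>"
  show "finite ((\<lambda>f. \<chi> i. real_of_int (f i)) ` (PiE (UNIV :: 'n set) (\<lambda>_. {- ?N..?N})))"
    by (intro finite_imageI finite_PiE) auto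
  show "{v \<in> (int_vecs :: (real^'n) set). norm v \<le> r} \<subseteq> (\<lambda>f. \<chi> i. real_of_int (f i)) ` (PiE UNIV (\<lambda>_. {- ?N..?N}))"
  proof
    fix v :: "real^'n" assume "v \<in> {v \<in> int_vecs. norm v \<le> r}"
    then have v: "\<And>i. v $ i \<in> \<int>" "norm v \<le> r" by (auto simp: int_vecs_def)
    have fl: "real_of_int \<lfloor>v $ i\<rfloor> = v $ i" for i using v(1) by (metis Ints_cases floor_of_int)
    have "\<lfloor>v $ i\<rfloor> \<in> {- ?N..?N}" for i
    proof -
      have "\<bar>v $ i\<bar> \<le> r" using component_le_norm_cart[of v i] v(2) by linarith
      then have "\<bar>real_of_int \<lfloor>v $ i\<rfloor>\<bar> \<le> of_int ?N" unfolding fl by linarith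
      then show ?thesis by (simp add: abs_le_iff)
    qed
    then show "v \<in> (\<lambda>f. \<chi> i. real_of_int (f i)) ` (PiE UNIV (\<lambda>_. {- ?N..?N}))"
      by (intro image_eqI[of _ _ "\<lambda>i. \<lfloor>v $ i\<rfloor>"]) (auto simp: fl vec_eq_iff)
  qed
qed

lemma finite_bounded_lattice:
  fixes L :: "(real^'n) set"
  assumes "full_rank_lattice L"
  shows "finite {x \<in> L. norm x \<le> r}"
proof -
  obtain A :: "real^'n^'n" where A: "invertible A" "L = (\<lambda>z. A *v z) ` int_vecs"
    using assms by (auto simp: full_rank_lattice_def)
  then obtain Ai where Ai: "Ai ** A = mat 1" by (auto simp: invertible_def)
  have "{x \<in> L. norm x \<le> r} \<subseteq> (\<lambda>z. A *v z) ` {v \<in> int_vecs. norm v \<le> norm Ai * r}"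
  proof
    fix x assume "x \<in> {x \<in> L. norm x \<le> r}"
    then obtain z where z: "z \<in> int_vecs" "x = A *v z" "norm x \<le> r" using A by auto
    have "z = Ai *v x" by (simp add: z matrix_vector_mul_assoc Ai)
    then have "norm z \<le> norm Ai * norm x" by (simp add: norm_matrix_vector_mult_le)
    also have "\<dots> \<le> norm Ai * r" using z by (intro mult_left_mono) auto
    finally show "x \<in> (\<lambda>z. A *v z) ` {v \<in> int_vecs. norm v \<le> norm Ai * r}" using z by auto
  qed
  then show ?thesis by (rule finite_subset) (intro finite_imageI finite_bounded_int_vecs)
qed

section \<open>Root systems with spanning stars\<close>

lemma span_eq_UNIV_iff_orthogonal:
  fixes S :: "'a::euclidean_space set"
  shows "span S = UNIV \<longleftrightarrow> (\<forall>v. (\<forall>y\<in>S. v \<bullet> y = 0) \<longrightarrow> v = 0)"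
proof
  assume sp: "span S = UNIV"
  show "\<forall>v. (\<forall>y\<in>S. v \<bullet> y = 0) \<longrightarrow> v = 0"
  proof (intro allI impI)
    fix v assume "\<forall>y\<in>S. v \<bullet> y = 0"
    then have "v \<in> {v. orthogonal v v}"
      using orthogonal_to_span[of v S v] sp by (auto simp: orthogonal_def)
    then show "v = 0" by (simp add: orthogonal_def)
  qed
next
  assume R: "\<forall>v. (\<forall>y\<in>S. v \<bullet> y = 0) \<longrightarrow> v = 0"
  show "span S = UNIV"
  proof (rule ccontr)
    assume "span S \<noteq> UNIV"
    then obtain a where "a \<noteq> 0" "span S \<subseteq> {x. a \<bullet> x = 0}" using span_not_UNIV_orthogonal by blast
    then show False using R span_base by blast
  qed
qed

text \<open>Strong eutaxy is the condition to be produced. The operator \<open>T\<close> is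
  invariant under the reflections in the roots, which permute \<open>M\<close>; this makes every
  root an eigenvector. As \<open>T\<close> is symmetric, two roots that are not orthogonal share
  their eigenvalue, and since the star of one root \<open>r\<close> spans, \<open>T\<close> is a
  multiple of the identity.\<close>

lemma star_lattice_of_roots:
  fixes L :: "(real^'n) set"
  assumes L0: "0 \<in> L" and Ld: "\<And>x y. x \<in> L \<Longrightarrow> y \<in> L \<Longrightarrow> x - y \<in> L"
    and int: "\<And>x y. x \<in> L \<Longrightarrow> y \<in> L \<Longrightarrow> x \<bullet> y \<in> \<int>"
    and even: "\<And>x. x \<in> L \<Longrightarrow> \<exists>k::int. x \<bullet> x = 2 * of_int k"
    and ne: "\<exists>x\<in>L. x \<bullet> x = 2"
    and star: "\<And>x. x \<in> L \<Longrightarrow> x \<bullet> x = 2 \<Longrightarrow> span (insert x {y \<in> L. y \<bullet> y = 2 \<and> \<bar>x \<bullet> y\<bar> = 1}) = UNIV"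
  shows "full_rank_lattice L" and "\<exists>c. star_lattice L 2 c"
proof -
  define M where "M = {x \<in> L. x \<bullet> x = 2}"
  obtain r where r: "r \<in> M" using ne by (auto simp: M_def)
  have "span (insert r {y \<in> L. y \<bullet> y = 2 \<and> \<bar>r \<bullet> y\<bar> = 1}) \<subseteq> span L"
    using r by (intro span_mono) (auto simp: M_def)
  then have sp: "span L = UNIV" using star[of r] r by (auto simp: M_def)
  show frl: "full_rank_lattice L" by (rule integral_subgroup_full_rank[OF L0 Ld int sp])
  have "M \<subseteq> {x \<in> L. norm x \<le> sqrt 2}" by (auto simp: M_def norm_eq_sqrt_inner)
  then have fin: "finite M" using finite_bounded_lattice[OF frl] by (rule finite_subset)
  define T where "T a = (\<Sum>x\<in>M. (x \<bullet> a) *\<^sub>R x)" for a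
  have linT: "linear T"
    unfolding T_def by (intro linear_compose_sum ballI linearI) (auto simp: inner_right_distrib scaleR_left.add)
  have symT: "T a \<bullet> b = a \<bullet> T b" for a b
    by (simp add: T_def inner_sum_left inner_sum_right inner_commute mult_ac)
  define c where "c s = (T s \<bullet> s) / 2" for s
  have eig: "T s = c s *\<^sub>R s" if s: "s \<in> M" for s
  proof -
    \<comment> \<open>The reflection in \<open>s\<close>; the usual factor
      \<open>2 / (s \<bullet> s)\<close> is 1 for a root.\<close>
    define \<rho> where "\<rho> x = x - (x \<bullet> s) *\<^sub>R s" for x
    have ss: "s \<bullet> s = 2" "s \<in> L" using s by (auto simp: M_def)
    have \<rho>\<rho>: "\<rho> (\<rho> x) = x" for x by (simp add: \<rho>_def inner_diff_left ss algebra_simps)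
    have \<rho>M: "\<rho> x \<in> M" if "x \<in> M" for x
    proof -
      have "\<rho> x \<bullet> \<rho> x = x \<bullet> x"
        by (simp add: \<rho>_def inner_diff_left inner_diff_right ss inner_commute algebra_simps)
      moreover have "\<rho> x \<in> L" unfolding \<rho>_def using that int ss
        by (intro Ld subgroup_scale_int[OF L0 Ld]) (auto simp: M_def)
      ultimately show ?thesis using that by (simp add: M_def)
    qed
    have bij: "bij_betw \<rho> M M" by (rule bij_betwI[of _ _ _ \<rho>]) (auto simp: \<rho>\<rho> \<rho>M)
    have \<rho>s: "\<rho> x \<bullet> s = - (x \<bullet> s)" for x by (simp add: \<rho>_def inner_diff_left ss)
    have "T s = (\<Sum>x\<in>M. (\<rho> x \<bullet> s) *\<^sub>R \<rho> x)"
      unfolding T_def by (rule sum.reindex_bij_betw[OF bij, symmetric])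
    also have "\<dots> = (\<Sum>x\<in>M. (x \<bullet> s)\<^sup>2 *\<^sub>R s - (x \<bullet> s) *\<^sub>R x)"
      by (intro sum.cong refl) (simp add: \<rho>s, simp add: \<rho>_def algebra_simps power2_eq_square)
    also have "\<dots> = (T s \<bullet> s) *\<^sub>R s - T s"
      by (simp add: sum_subtractf T_def scaleR_sum_left inner_sum_left power2_eq_square)
    finally have "2 *\<^sub>R T s = (T s \<bullet> s) *\<^sub>R s" by (simp add: scaleR_2)
    then have "(1/2) *\<^sub>R (2 *\<^sub>R T s) = (1/2) *\<^sub>R ((T s \<bullet> s) *\<^sub>R s)" by simp
    then show ?thesis by (simp add: c_def)
  qed
  have nb: "T t = c r *\<^sub>R t" if t: "t \<in> insert r {y \<in> L. y \<bullet> y = 2 \<and> \<bar>r \<bullet> y\<bar> = 1}" for t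
  proof (cases "t = r")
    case True then show ?thesis using eig r by simp
  next
    case False
    then have tM: "t \<in> M" and rt: "r \<bullet> t \<noteq> 0" using t by (auto simp: M_def)
    have "c r * (r \<bullet> t) = c t * (r \<bullet> t)" using symT[of r t] by (simp add: eig r tM)
    then show ?thesis using rt eig[OF tM] by simp
  qed
  have Tc: "T a = c r *\<^sub>R a" for a
  proof -
    have "a \<in> span (insert r {y \<in> L. y \<bullet> y = 2 \<and> \<bar>r \<bullet> y\<bar> = 1})" using star[of r] r by (auto simp: M_def)
    then show ?thesis using linear_eq_on[OF linT linear_scale_self] nb by blast
  qed
  have eut: "(\<Sum>x\<in>M. (x \<bullet> a)\<^sup>2) = c r * (a \<bullet> a)" for a
  proof -
    have "(\<Sum>x\<in>M. (x \<bullet> a)\<^sup>2) = T a \<bullet> a" by (simp add: T_def inner_sum_left power2_eq_square)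
    then show ?thesis by (simp add: Tc)
  qed
  have "(r \<bullet> r)\<^sup>2 \<le> (\<Sum>x\<in>M. (x \<bullet> r)\<^sup>2)" using fin r by (intro member_le_sum) auto
  then have cpos: "c r > 0" using r unfolding eut by (auto simp: M_def)
  have "star_lattice L 2 (c r)"
  proof
    show "x - y \<in> L" if "x \<in> L" "y \<in> L" for x y using that by (rule Ld)
    show "2 \<le> x \<bullet> x" if x: "x \<in> L" "x \<noteq> 0" for x
    proof -
      obtain k :: int where k: "x \<bullet> x = 2 * of_int k" using even x by blast
      moreover have "x \<bullet> x > 0" using x by simp
      ultimately have "k > 0" by simp
      then show ?thesis using k by simp
    qed
    show "finite {x \<in> L. x \<bullet> x = 2}" using fin by (simp add: M_def)
    show "(\<Sum>x\<in>{x \<in> L. x \<bullet> x = 2}. (x \<bullet> a)\<^sup>2) = c r * (a \<bullet> a)" for a using eut by (simp add: M_def)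
    show "span (insert x {y \<in> {x \<in> L. x \<bullet> x = 2}. \<bar>x \<bullet> y\<bar> = 2 / 2}) = UNIV" if "x \<in> {x \<in> L. x \<bullet> x = 2}" for x
      using star[of x] that by (simp add: conj_assoc)
  qed (use L0 cpos in auto)
  then show "\<exists>c. star_lattice L 2 c" by blast
qed

text \<open>The conditions can be checked where the lattice naturally lives, possibly in a larger
  space. \<open>dim R = CARD('n)\<close> makes \<Lambda> span its space, and the isometry, which
  preserves inner products by polarisation, carries the conditions back. The star condition appears
  in dual form: no nonzero vector of \<open>span R\<close> is orthogonal to a star.\<close>

theorem root_lattice_periodic_extreme:
  fixes \<Lambda> :: "(real^'n) set" and R :: "'b::euclidean_space set"
  assumes iso: "lattice_isometric \<Lambda> R" and dim: "dim R = CARD('n)"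
    and R0: "0 \<in> R" and Rd: "\<And>x y. x \<in> R \<Longrightarrow> y \<in> R \<Longrightarrow> x - y \<in> R"
    and int: "\<And>x y. x \<in> R \<Longrightarrow> y \<in> R \<Longrightarrow> x \<bullet> y \<in> \<int>"
    and even: "\<And>x. x \<in> R \<Longrightarrow> \<exists>k::int. x \<bullet> x = 2 * of_int k"
    and ne: "\<exists>x\<in>R. x \<bullet> x = 2"
    and star: "\<And>x v. x \<in> R \<Longrightarrow> x \<bullet> x = 2 \<Longrightarrow> v \<in> span R \<Longrightarrow> v \<bullet> x = 0 \<Longrightarrow>
        (\<And>y. y \<in> R \<Longrightarrow> y \<bullet> y = 2 \<Longrightarrow> \<bar>x \<bullet> y\<bar> = 1 \<Longrightarrow> v \<bullet> y = 0) \<Longrightarrow> v = 0"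
  shows "periodic_extreme \<Lambda>"
proof -
  obtain f where lin: "linear f" and nf: "\<forall>x\<in>span \<Lambda>. norm (f x) = norm x" and im: "f ` \<Lambda> = R"
    using iso by (auto simp: lattice_isometric_def)
  have inj: "inj_on f (span \<Lambda>)"
  proof (rule inj_onI)
    fix x y assume "x \<in> span \<Lambda>" "y \<in> span \<Lambda>" "f x = f y"
    then have "f (x - y) = 0" "x - y \<in> span \<Lambda>" using lin by (auto simp: linear_diff span_diff)
    then show "x = y" using nf by fastforce
  qed
  have "dim \<Lambda> = dim R" using dim_image_eq[OF lin inj] im by simp
  then have sp: "span \<Lambda> = UNIV" using dim by (simp add: dim_eq_full[symmetric])
  have nf': "norm (f x) = norm x" for x using nf sp by auto
  have inn: "f x \<bullet> f y = x \<bullet> y" for x y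
  proof -
    have "(norm (f x + f y))\<^sup>2 = (norm (x + y))\<^sup>2" by (metis lin linear_add nf')
    then show ?thesis by (simp add: power2_norm_eq_inner inner_add_left inner_add_right inner_commute)
      (metis nf' power2_norm_eq_inner add_left_cancel add.commute mult_2 add_diff_cancel_left' mult_cancel_left zero_neq_numeral)
  qed
  have finj: "f x = f y \<Longrightarrow> x = y" for x y using inj sp by (auto dest: inj_onD)
  have fR: "f x \<in> R \<longleftrightarrow> x \<in> \<Lambda>" for x using im finj by (metis image_iff)
  have fspan: "f v \<in> span R" for v using sp im linear_span_image[OF lin, of \<Lambda>] by (metis UNIV_I image_eqI)
  have 1: "0 \<in> \<Lambda>" using R0 fR[of 0] lin by (simp add: linear_0)
  have 2: "x - y \<in> \<Lambda>" if "x \<in> \<Lambda>" "y \<in> \<Lambda>" for x y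
    using Rd[of "f x" "f y"] that fR lin by (simp add: linear_diff[symmetric])
  have 3: "x \<bullet> y \<in> \<int>" if "x \<in> \<Lambda>" "y \<in> \<Lambda>" for x y using int[of "f x" "f y"] that by (simp add: fR inn)
  have 4: "\<exists>k::int. x \<bullet> x = 2 * of_int k" if "x \<in> \<Lambda>" for x using even[of "f x"] that by (simp add: fR inn)
  have 5: "\<exists>x\<in>\<Lambda>. x \<bullet> x = 2" using ne im inn by (metis image_iff)
  have 6: "span (insert x {y \<in> \<Lambda>. y \<bullet> y = 2 \<and> \<bar>x \<bullet> y\<bar> = 1}) = UNIV" if x: "x \<in> \<Lambda>" "x \<bullet> x = 2" for x
    unfolding span_eq_UNIV_iff_orthogonal
  proof (intro allI impI)
    fix v assume v: "\<forall>y\<in>insert x {y \<in> \<Lambda>. y \<bullet> y = 2 \<and> \<bar>x \<bullet> y\<bar> = 1}. v \<bullet> y = 0"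
    have "f v = 0"
    proof (rule star[of "f x"])
      show "f x \<in> R" "f x \<bullet> f x = 2" using x by (auto simp: fR inn)
      show "f v \<bullet> f x = 0" using v by (simp add: inn)
      fix y assume y: "y \<in> R" "y \<bullet> y = 2" "\<bar>f x \<bullet> y\<bar> = 1"
      then obtain z where "z \<in> \<Lambda>" "y = f z" using im by blast
      then show "f v \<bullet> y = 0" using y v by (simp add: inn)
    qed (rule fspan)
    then show "v = 0" using finj[of v 0] lin by (simp add: linear_0)
  qed
  obtain c where "star_lattice \<Lambda> 2 c" using star_lattice_of_roots(2)[OF 1 2 3 4 5 6] by blast
  then show ?thesis
    by (rule star_lattice.periodic_extreme_star[OF _ star_lattice_of_roots(1)[OF 1 2 3 4 5 6]])
qed

section \<open>Integral vectors of squared length 2, and the lattices A and D\<close>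

lemma int_vec_norm_two_cases:
  fixes x :: "real^'k"
  assumes x: "x \<in> int_vecs" and n: "x \<bullet> x = 2"
  obtains i j where "i \<noteq> j" "\<bar>x $ i\<bar> = 1" "\<bar>x $ j\<bar> = 1" "\<And>k. k \<noteq> i \<Longrightarrow> k \<noteq> j \<Longrightarrow> x $ k = 0"
proof -
  have S: "(\<Sum>k\<in>UNIV. (x $ k)\<^sup>2) = 2" using n by (simp add: inner_vec_def power2_eq_square)
  have sq: "\<exists>a::int. x $ k = of_int a" for k using x by (auto simp: int_vecs_def elim: Ints_cases)
  have one: "\<bar>x $ k\<bar> = 1" if "x $ k \<noteq> 0" for k
  proof -
    obtain a :: int where a: "x $ k = of_int a" using sq by blast
    have "(x $ k)\<^sup>2 \<le> 2" unfolding S[symmetric] by (intro member_le_sum) auto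
    then have "a\<^sup>2 \<le> 2" unfolding a by (metis of_int_le_iff of_int_numeral of_int_power)
    moreover have "a \<noteq> 0" using that a by simp
    moreover have "\<bar>a\<bar> \<ge> 2 \<Longrightarrow> a\<^sup>2 \<ge> 4" using power_mono[of 2 "\<bar>a\<bar>" 2] by simp
    ultimately have "\<bar>a\<bar> = 1" by linarith
    then show ?thesis using a by (metis of_int_1 of_int_abs)
  qed
  have "x \<noteq> 0" using n by auto
  then obtain i where i: "x $ i \<noteq> 0" by (auto simp: vec_eq_iff)
  have xi: "(x $ i)\<^sup>2 = 1" using one[OF i] by (metis abs_square_eq_1)
  have S1: "(\<Sum>k\<in>UNIV - {i}. (x $ k)\<^sup>2) = 1" using S xi by (simp add: sum.remove[of UNIV i])
  then have "\<exists>j\<in>UNIV - {i}. (x $ j)\<^sup>2 \<noteq> 0" by (metis (no_types, lifting) sum.neutral zero_neq_one)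
  then obtain j where j: "j \<noteq> i" "x $ j \<noteq> 0" by auto
  have xj: "(x $ j)\<^sup>2 = 1" using one[OF j(2)] by (metis abs_square_eq_1)
  have "(\<Sum>k\<in>UNIV - {i} - {j}. (x $ k)\<^sup>2) = 0" using S1 xj j by (simp add: sum.remove[of "UNIV - {i}" j])
  then have "x $ k = 0" if "k \<noteq> i" "k \<noteq> j" for k
    using that by (simp add: sum_nonneg_eq_0_iff)
  then show thesis using that[of i j] i j one by auto
qed

lemma int_vecs_inner: "x \<in> int_vecs \<Longrightarrow> y \<in> int_vecs \<Longrightarrow> x \<bullet> y \<in> \<int>"
  by (auto simp: int_vecs_def inner_vec_def intro!: Ints_sum Ints_mult)

text \<open>\<open>a * a - a\<close> is even for every integer \<open>a\<close>. Summed over the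
  coordinates, this makes A and D even.\<close>

lemma int_vec_norm_parity:
  fixes x :: "real^'k"
  assumes "x \<in> int_vecs"
  shows "\<exists>k::int. x \<bullet> x = (\<Sum>i\<in>UNIV. x $ i) + 2 * of_int k"
proof -
  have "\<forall>i. \<exists>a::int. x $ i = of_int a" using assms by (auto simp: int_vecs_def elim: Ints_cases)
  then obtain a :: "'k \<Rightarrow> int" where a: "\<And>i. x $ i = of_int (a i)" by metis
  have "even (a i * a i - a i)" for i by simp
  then have "\<forall>i. \<exists>b. a i * a i = a i + 2 * b" by (metis add_diff_cancel_left' diff_add_cancel dvdE add.commute)
  then obtain b where b: "\<And>i. a i * a i = a i + 2 * b i" by metis
  have "x \<bullet> x = (\<Sum>i\<in>UNIV. of_int (a i * a i))" by (simp add: inner_vec_def a)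
  also have "\<dots> = (\<Sum>i\<in>UNIV. x $ i) + 2 * of_int (\<Sum>i\<in>UNIV. b i)"
    by (simp add: b a sum.distrib sum_distrib_left)
  finally show ?thesis by blast
qed

lemma axis_in_int_vecs: "r \<in> \<int> \<Longrightarrow> axis i r \<in> int_vecs"
  by (simp add: int_vecs_def axis_def)

lemma sum_axis: "(\<Sum>k\<in>UNIV. axis i (r::real) $ k) = r"
  by (simp add: axis_def)

text \<open>The star of \<open>e_i - e_j\<close> contains \<open>e_i - e_k\<close> for every other
  \<open>k\<close>. A vector orthogonal to all of these and to the root has equal coordinates, and
  in the hyperplane of coordinate sum zero it vanishes.\<close>

lemma root_A_periodic_extreme:
  fixes \<Lambda> :: "(real^'n) set"
  assumes "CARD('n) \<ge> 2" "is_root_A \<Lambda>"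
  shows "periodic_extreme \<Lambda>"
proof (rule root_lattice_periodic_extreme)
  let ?R = "root_A :: (real^('n option)) set"
  show "lattice_isometric \<Lambda> ?R" using assms(2) by (simp add: is_root_A_def)
  let ?u = "(\<chi> i. 1) :: real^('n option)"
  have sum_u: "(\<Sum>i\<in>UNIV. x $ i) = ?u \<bullet> x" for x by (simp add: inner_vec_def)
  have axA: "axis i 1 - axis j 1 \<in> ?R" for i j
    by (auto simp: root_A_def intro!: diff_in_int_vecs axis_in_int_vecs)
      (simp only: sum_subtractf sum_axis)
  have sp: "span ?R = {x. ?u \<bullet> x = 0}"
  proof (intro antisym subsetI)
    fix x assume "x \<in> span ?R"
    then have "orthogonal ?u x" by (rule orthogonal_to_span) (auto simp: orthogonal_def root_A_def sum_u)
    then show "x \<in> {x. ?u \<bullet> x = 0}" by (simp add: orthogonal_def)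
  next
    fix x assume "x \<in> {x. ?u \<bullet> x = 0}"
    then have s: "(\<Sum>i\<in>UNIV. x $ i) = 0" by (simp add: sum_u)
    have "x = (\<Sum>i\<in>UNIV. x $ i *\<^sub>R (axis i 1 - axis None 1))"
    proof -
      have "(\<Sum>i\<in>UNIV. x $ i *\<^sub>R (axis i 1 - axis None 1)) = (\<Sum>i\<in>UNIV. x $ i *\<^sub>R axis i 1) - (\<Sum>i\<in>UNIV. x $ i) *\<^sub>R axis None 1"
        by (simp add: scaleR_diff_right sum_subtractf scaleR_sum_left)
      also have "(\<Sum>i\<in>UNIV. x $ i *\<^sub>R axis i (1::real)) = x"
        by (simp add: vec_eq_iff axis_def if_distrib cong: if_cong)
      finally show ?thesis using s by simp
    qed
    then show "x \<in> span ?R"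
      using axA by (metis (no_types, lifting) span_sum span_scale span_base)
  qed
  have "?u \<noteq> 0" by (simp add: vec_eq_iff)
  then have "dim (span ?R) = DIM(real^('n option)) - 1" unfolding sp by (rule dim_hyperplane)
  then show "dim ?R = CARD('n)" by (simp add: card_UNIV_option)
  show "0 \<in> ?R" by (simp add: root_A_def zero_in_int_vecs)
  show "x - y \<in> ?R" if "x \<in> ?R" "y \<in> ?R" for x y
    using that by (simp add: root_A_def diff_in_int_vecs sum_subtractf)
  show "x \<bullet> y \<in> \<int>" if "x \<in> ?R" "y \<in> ?R" for x y using that by (auto simp: root_A_def int_vecs_inner)
  show "\<exists>k::int. x \<bullet> x = 2 * of_int k" if "x \<in> ?R" for x
    using that int_vec_norm_parity[of x] by (auto simp: root_A_def)
  have inn: "(axis i 1 - axis j 1) \<bullet> v = v $ i - v $ j" for i j and v :: "real^('n option)"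
    by (simp add: inner_diff_left inner_axis')
  \<comment> \<open>This only names an element of the type, so that \<open>None\<close> and
    \<open>Some a\<close> are two different coordinates.\<close>
  obtain a :: 'n where True by blast
  have "(axis None 1 - axis (Some a) 1 :: real^('n option)) \<bullet> (axis None 1 - axis (Some a) 1) = 2"
    unfolding inn by (simp add: axis_def)
  then show "\<exists>x\<in>?R. x \<bullet> x = 2" using axA by blast
  fix x v :: "real^('n option)"
  assume x: "x \<in> ?R" "x \<bullet> x = 2" and v: "v \<in> span ?R" and vx: "v \<bullet> x = 0"
    and vy: "\<And>y. y \<in> ?R \<Longrightarrow> y \<bullet> y = 2 \<Longrightarrow> \<bar>x \<bullet> y\<bar> = 1 \<Longrightarrow> v \<bullet> y = 0"
  obtain i' j' where ij': "i' \<noteq> j'" "\<bar>x $ i'\<bar> = 1" "\<bar>x $ j'\<bar> = 1" "\<And>k. k \<noteq> i' \<Longrightarrow> k \<noteq> j' \<Longrightarrow> x $ k = 0"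
    using int_vec_norm_two_cases[OF _ x(2)] x(1) by (auto simp: root_A_def)
  have "(\<Sum>k\<in>UNIV. x $ k) = x $ i' + x $ j'"
  proof -
    have "(\<Sum>k\<in>UNIV. x $ k) = (\<Sum>k\<in>{i', j'}. x $ k)" using ij'(4) by (intro sum.mono_neutral_right) auto
    then show ?thesis using ij'(1) by simp
  qed
  then have "x $ i' + x $ j' = 0" using x(1) by (simp add: root_A_def)
  then obtain i j where ij: "i \<noteq> j" "x $ i = 1" "x $ j = - 1" "\<And>k. k \<noteq> i \<Longrightarrow> k \<noteq> j \<Longrightarrow> x $ k = 0"
    using ij' by (metis abs_eq_iff' add_eq_0_iff zero_neq_one minus_minus abs_1)
  have xe: "x = axis i 1 - axis j 1" using ij by (auto simp: vec_eq_iff axis_def)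
  have vij: "v $ i = v $ j" using vx unfolding inner_commute[of v] xe inn by simp
  have vik: "v $ k = v $ i" for k
  proof (cases "k = i \<or> k = j")
    case True then show ?thesis using vij by auto
  next
    case False
    have "v \<bullet> (axis i 1 - axis k 1) = 0"
    proof (rule vy[OF axA])
      show "(axis i 1 - axis k 1 :: real^('n option)) \<bullet> (axis i 1 - axis k 1) = 2" unfolding inn using False by (auto simp: axis_def)
      show "\<bar>x \<bullet> (axis i 1 - axis k 1)\<bar> = 1" using ij False by (simp add: inner_commute[of x] inn)
    qed
    then show ?thesis by (simp add: inner_commute[of v] inn)
  qed
  have "0 = (\<Sum>k\<in>UNIV. v $ k)" using v sp sum_u by auto
  also have "\<dots> = (\<Sum>k\<in>(UNIV :: 'n option set). v $ i)" by (intro sum.cong refl vik)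
  finally have "v $ i = 0" by simp
  then have "v $ k = 0" for k using vik[of k] by simp
  then show "v = 0" by (simp add: vec_eq_iff)
qed

lemma lattice_isometric_refl: "lattice_isometric L L"
  unfolding lattice_isometric_def by (intro exI[of _ id]) (auto simp: linear_id)

lemma root_D_diff: "x \<in> root_D \<Longrightarrow> y \<in> root_D \<Longrightarrow> x - y \<in> root_D"
  by (auto simp: root_D_def diff_in_int_vecs sum_subtractf)
    (metis right_diff_distrib of_int_diff)

lemma zero_in_root_D: "0 \<in> root_D"
  by (auto simp: root_D_def zero_in_int_vecs intro: exI[of _ 0])

lemma root_D_even: "x \<in> root_D \<Longrightarrow> \<exists>k::int. x \<bullet> x = 2 * of_int k"
  using int_vec_norm_parity[of x] by (auto simp: root_D_def) (metis distrib_left of_int_add)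

lemma axis_sum_in_root_D:
  assumes "\<bar>r\<bar> = 1" "\<bar>s\<bar> = (1::real)"
  shows "axis i r + axis j s \<in> root_D"
proof -
  have rs: "r \<in> \<int>" "s \<in> \<int>" "r = 1 \<or> r = -1" "s = 1 \<or> s = -1" using assms by (auto simp: abs_if split: if_splits)
  have "(\<Sum>k\<in>UNIV. (axis i r + axis j s) $ k) = r + s" by (simp add: sum.distrib sum_axis)
  moreover have "\<exists>k::int. r + s = 2 * of_int k"
    using rs by (elim disjE) (auto intro: exI[of _ 0] exI[of _ 1] exI[of _ "-1"])
  ultimately show ?thesis using rs unfolding root_D_def
    by (auto intro!: add_in_int_vecs axis_in_int_vecs)
qed

lemma span_root_D: "CARD('n) \<ge> 2 \<Longrightarrow> span (root_D :: (real^'n) set) = UNIV"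
  unfolding span_eq_UNIV_iff_orthogonal
proof (intro allI impI)
  fix v :: "real^'n" assume v: "\<forall>y\<in>root_D. v \<bullet> y = 0"
  have "v \<bullet> (axis i 1 + axis i 1) = 0" for i using v axis_sum_in_root_D[of 1 1 i i] by auto
  then have "v $ i + v $ i = 0" for i by (metis inner_right_distrib inner_axis inner_real_def mult.right_neutral)
  then show "v = 0" by (simp add: vec_eq_iff)
qed

text \<open>For a root supported on \<open>i\<close> and \<open>j\<close> and a third index
  \<open>k\<close>, both \<open>e_i + e_k\<close> and \<open>e_i - e_k\<close> lie in the star, so
  an orthogonal vector vanishes at \<open>i\<close> and \<open>k\<close>. Exchanging
  \<open>i\<close> and \<open>j\<close> gives the rest. Dimension 3 provides the third
  index.\<close>

lemma root_D_periodic_extreme: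
  assumes card: "CARD('n) \<ge> 3"
  shows "periodic_extreme (root_D :: (real^'n) set)"
proof (rule root_lattice_periodic_extreme)
  let ?R = "root_D :: (real^'n) set"
  show "lattice_isometric ?R ?R" by (rule lattice_isometric_refl)
  show "dim ?R = CARD('n)" using dim_eq_full[of ?R] span_root_D[where 'n='n] card by simp
  show "0 \<in> ?R" by (rule zero_in_root_D)
  show "x - y \<in> ?R" if "x \<in> ?R" "y \<in> ?R" for x y using that by (rule root_D_diff)
  show "x \<bullet> y \<in> \<int>" if "x \<in> ?R" "y \<in> ?R" for x y using that by (auto simp: root_D_def int_vecs_inner)
  show "\<exists>k::int. x \<bullet> x = 2 * of_int k" if "x \<in> ?R" for x using that by (rule root_D_even)
  have third: "\<exists>k::'n. k \<noteq> i \<and> k \<noteq> j" for i j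
  proof (rule ccontr)
    assume "\<not> ?thesis"
    then have "(UNIV :: 'n set) \<subseteq> {i, j}" by auto
    then have "CARD('n) \<le> card {i, j}" by (intro card_mono) auto
    also have "\<dots> \<le> 2" by (simp add: card_insert_le_m1)
    finally show False using card by simp
  qed
  have inn: "(axis i r + axis j s) \<bullet> v = r * v $ i + s * v $ j" for i j :: 'n and r s v
    by (simp add: inner_left_distrib inner_axis')
  obtain a b :: 'n where ab: "a \<noteq> b" using third by metis
  have "(axis a 1 + axis b 1 :: real^'n) \<bullet> (axis a 1 + axis b 1) = 2"
    unfolding inn using ab by (simp add: axis_def)
  then show "\<exists>x\<in>?R. x \<bullet> x = 2" using axis_sum_in_root_D[of 1 1 a b] by auto
  fix x v :: "real^'n"
  assume x: "x \<in> ?R" "x \<bullet> x = 2"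
    and vy: "\<And>y. y \<in> ?R \<Longrightarrow> y \<bullet> y = 2 \<Longrightarrow> \<bar>x \<bullet> y\<bar> = 1 \<Longrightarrow> v \<bullet> y = 0"
  obtain i j where ij: "i \<noteq> j" "\<bar>x $ i\<bar> = 1" "\<bar>x $ j\<bar> = 1" "\<And>k. k \<noteq> i \<Longrightarrow> k \<noteq> j \<Longrightarrow> x $ k = 0"
    using int_vec_norm_two_cases[OF _ x(2)] x(1) by (auto simp: root_D_def)
  have zero: "v $ k = 0 \<and> v $ i = 0" if k: "k \<noteq> i" "k \<noteq> j" and ij: "i \<noteq> j" "\<bar>x $ i\<bar> = 1" "\<And>k. k \<noteq> i \<Longrightarrow> k \<noteq> j \<Longrightarrow> x $ k = 0" for i j k
  proof -
    have "v \<bullet> (axis i 1 + axis k s) = 0" if s: "\<bar>s\<bar> = 1" for s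
    proof (rule vy)
      show "axis i 1 + axis k s \<in> ?R" using s by (intro axis_sum_in_root_D) auto
      have "s * s = 1" using s by (metis abs_mult_self_eq mult.right_neutral)
      then show "(axis i 1 + axis k s :: real^'n) \<bullet> (axis i 1 + axis k s) = 2" unfolding inn using k by (simp add: axis_def)
      show "\<bar>x \<bullet> (axis i 1 + axis k s)\<bar> = 1" using ij k by (simp add: inner_commute[of x] inn)
    qed
    from this[of 1] this[of "-1"] show ?thesis by (simp add: inner_commute[of v] inn)
  qed
  obtain k where k: "k \<noteq> i" "k \<noteq> j" using third by blast
  have "v $ i = 0" "v $ j = 0" using zero[of k i j] zero[of k j i] k ij by auto
  then have "v $ k = 0" for k using zero[of k i j] ij by (cases "k = i \<or> k = j") auto
  then show "v = 0" by (simp add: vec_eq_iff)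
qed

section \<open>Poisson summation on self-dual lattices\<close>

lemma
  fixes g :: "'n::finite \<Rightarrow> real \<Rightarrow> complex"
  assumes g: "\<And>i. integrable lborel (g i)"
  shows integrable_prod_components: "integrable lborel (\<lambda>v :: real^'n. \<Prod>i\<in>UNIV. g i (v $ i))"
    and integral_prod_components: "(\<integral>v. (\<Prod>i\<in>UNIV. g i ((v :: real^'n) $ i)) \<partial>lborel) = (\<Prod>i\<in>UNIV. \<integral>x. g i x \<partial>lborel)"
proof -
  interpret product_sigma_finite "\<lambda>_ :: real^'n. lborel :: real measure" ..
  let ?B = "Basis :: (real^'n) set"
  let ?PB = "\<Pi>\<^sub>M b\<in>?B. (lborel :: real measure)"
  let ?e = "\<lambda>f. \<Sum>b\<in>?B. f b *\<^sub>R b"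
  let ?h = "\<lambda>v :: real^'n. \<Prod>i\<in>UNIV. g i (v $ i)"
  have gm[measurable]: "g i \<in> borel_measurable borel" for i
    using borel_measurable_integrable[OF g[of i]] by simp
  have bij: "bij_betw (\<lambda>i. axis i 1) (UNIV :: 'n set) ?B"
    unfolding bij_betw_def by (auto simp: inj_on_def axis_eq_axis Basis_vec_def)
  have hm: "?h \<in> borel_measurable borel"
  proof (rule borel_measurable_prod)
    fix i :: 'n
    have "(\<lambda>v :: real^'n. v $ i) \<in> borel_measurable borel"
      by (intro borel_measurable_continuous_onI continuous_intros)
    then show "(\<lambda>v. g i (v $ i)) \<in> borel_measurable borel" by (rule measurable_compose) simp
  qed
  have em: "?e \<in> measurable ?PB borel" by measurable
  have comp: "?e f $ i = f (axis i 1)" for f i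
  proof -
    have "?e f $ i = ?e f \<bullet> axis i 1" by (simp add: inner_axis)
    also have "\<dots> = f (axis i 1)"
      by (subst inner_sum_left_Basis) (auto simp: Basis_vec_def)
    finally show ?thesis .
  qed
  have prod: "?h (?e f) = (\<Prod>b\<in>?B. g (axis_index b) (f b))" for f
    unfolding comp by (subst prod.reindex_bij_betw[OF bij, symmetric]) simp
  have "integrable ?PB (\<lambda>f. \<Prod>b\<in>?B. g (axis_index b) (f b))"
    by (intro product_integrable_prod) (auto simp: g)
  then have "integrable ?PB (\<lambda>f. ?h (?e f))" unfolding prod .
  then show "integrable lborel ?h"
    by (subst lborel_eq) (simp add: integrable_distr_eq[OF em] hm)
  have "(\<integral>v. ?h v \<partial>lborel) = (\<integral>f. ?h (?e f) \<partial>?PB)"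
    by (subst lborel_eq) (rule integral_distr[OF em hm])
  also have "\<dots> = (\<Prod>b\<in>?B. \<integral>x. g (axis_index b) x \<partial>lborel)"
    unfolding prod by (intro product_integral_prod) (auto simp: g)
  also have "\<dots> = (\<Prod>i\<in>UNIV. \<integral>x. g i x \<partial>lborel)"
    by (subst prod.reindex_bij_betw[OF bij, symmetric]) simp
  finally show "(\<integral>v. ?h v \<partial>lborel) = (\<Prod>i\<in>UNIV. \<integral>x. g i x \<partial>lborel)" .
qed

text \<open>This is the characteristic function of the standard normal distribution after the
  substitution by \<open>c = sqrt (2 * pi)\<close>, which turns \<open>exp (- x\<^sup>2 / 2)\<close>
  into \<open>exp (- pi * x\<^sup>2)\<close>, the Gaussian that is its own Fourier
  transform.\<close>

lemma
  fixes \<xi> :: real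
  shows integrable_gaussian_exp: "integrable lborel (\<lambda>x. of_real (exp (- pi * x\<^sup>2)) * exp (2 * pi * \<i> * \<xi> * x))"
    and integral_gaussian_exp: "(\<integral>x. of_real (exp (- pi * x\<^sup>2)) * exp (2 * pi * \<i> * \<xi> * x) \<partial>lborel) = of_real (exp (- pi * \<xi>\<^sup>2))"
proof -
  define c where "c = sqrt (2 * pi)"
  have c: "c > 0" "c\<^sup>2 = 2 * pi" by (simp_all add: c_def)
  define t where "t = 2 * pi * \<xi> / c"
  let ?f = "\<lambda>x. std_normal_density x *\<^sub>R iexp (t * x)"
  let ?g = "\<lambda>x :: real. complex_of_real (exp (- pi * x\<^sup>2)) * exp (2 * pi * \<i> * \<xi> * x)"
  have fg: "?f (0 + c * x) = (1 / c) *\<^sub>R ?g x" for x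
  proof -
    have "std_normal_density (c * x) = 1 / c * exp (- pi * x\<^sup>2)"
      using c by (simp add: normal_density_def power_mult_distrib c_def)
    moreover have "iexp (t * (c * x)) = exp (2 * pi * \<i> * \<xi> * x)"
      using c by (simp add: t_def mult_ac)
    ultimately show ?thesis by (simp add: scaleR_conv_of_real)
  qed
  have int: "integrable lborel ?f"
  proof (rule Bochner_Integration.integrable_bound[of _ std_normal_density])
    show "integrable lborel std_normal_density" by simp
    show "AE x in lborel. norm (?f x) \<le> norm (std_normal_density x)"
      by (simp add: normal_density_nonneg)
  qed measurable
  have "integrable lborel (\<lambda>x. ?f (0 + c * x))"
    using int c by (subst lborel_integrable_real_affine_iff) auto
  then have "integrable lborel (\<lambda>x. c *\<^sub>R ((1 / c) *\<^sub>R ?g x))"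
    unfolding fg by (rule integrable_scaleR_right)
  then show "integrable lborel ?g" using c by simp
  have "(\<integral>x. ?f x \<partial>lborel) = \<bar>c\<bar> *\<^sub>R (\<integral>x. ?f (0 + c * x) \<partial>lborel)"
    using c by (intro lborel_integral_real_affine) auto
  also have "\<dots> = (\<integral>x. c *\<^sub>R ((1 / c) *\<^sub>R ?g x) \<partial>lborel)"
    unfolding fg using c by simp
  also have "\<dots> = (\<integral>x. ?g x \<partial>lborel)" using c by simp
  finally have "(\<integral>x. ?g x \<partial>lborel) = (\<integral>x. ?f x \<partial>lborel)" by simp
  also have "\<dots> = char std_normal_distribution t"
    unfolding char_def by (subst integral_density) (auto simp: normal_density_nonneg)
  also have "\<dots> = of_real (exp (- pi * \<xi>\<^sup>2))"
  proof -
    have "t\<^sup>2 / 2 = pi * \<xi>\<^sup>2" using c by (simp add: t_def power_divide power_mult_distrib power2_eq_square)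
    then show ?thesis by (simp add: char_std_normal_distribution)
  qed
  finally show "(\<integral>x. ?g x \<partial>lborel) = of_real (exp (- pi * \<xi>\<^sup>2))" .
qed

definition ex2pi :: "real \<Rightarrow> complex" where
  "ex2pi x = exp (2 * pi * \<i> * x)"

lemma ex2pi_add: "ex2pi (x + y) = ex2pi x * ex2pi y"
  by (simp add: ex2pi_def algebra_simps exp_add)

lemma norm_ex2pi [simp]: "norm (ex2pi x) = 1"
  by (simp add: ex2pi_def norm_exp_eq_Re)

lemma ex2pi_zero [simp]: "ex2pi 0 = 1"
  by (simp add: ex2pi_def)

lemma ex2pi_Ints: "x \<in> \<int> \<Longrightarrow> ex2pi x = 1"
  by (auto simp: ex2pi_def exp_eq_1 elim!: Ints_cases)

lemma ex2pi_sum: "ex2pi (sum f S) = (\<Prod>i\<in>S. ex2pi (f i))"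
  by (induction S rule: infinite_finite_induct) (auto simp: ex2pi_add)

lemma continuous_on_ex2pi [continuous_intros]: "continuous_on S f \<Longrightarrow> continuous_on S (\<lambda>x. ex2pi (f x))"
  unfolding ex2pi_def by (intro continuous_intros)

lemma
  fixes b :: "real^'n"
  shows integrable_gaussian_cart: "integrable lborel (\<lambda>v. of_real (exp (- pi * (v \<bullet> v))) * ex2pi (b \<bullet> v))"
    and integral_gaussian_cart: "(\<integral>v. of_real (exp (- pi * (v \<bullet> v))) * ex2pi (b \<bullet> v) \<partial>lborel) = of_real (exp (- pi * (b \<bullet> b)))"
proof -
  let ?g = "\<lambda>i x. of_real (exp (- pi * x\<^sup>2)) * exp (2 * pi * \<i> * (b $ i) * x)"
  have eq: "of_real (exp (- pi * (v \<bullet> v))) * ex2pi (b \<bullet> v) = (\<Prod>i\<in>UNIV. ?g i (v $ i))" for v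
  proof -
    have "exp (- pi * (v \<bullet> v)) = (\<Prod>i\<in>UNIV. exp (- pi * (v $ i)\<^sup>2))"
      by (simp add: exp_sum[symmetric] inner_vec_def sum_distrib_left power2_eq_square)
    moreover have "ex2pi (b \<bullet> v) = (\<Prod>i\<in>UNIV. exp (2 * pi * \<i> * (b $ i) * (v $ i)))"
      by (simp add: inner_vec_def ex2pi_sum) (simp add: ex2pi_def mult_ac)
    ultimately show ?thesis by (simp add: prod.distrib)
  qed
  show "integrable lborel (\<lambda>v. of_real (exp (- pi * (v \<bullet> v))) * ex2pi (b \<bullet> v))"
    unfolding eq by (rule integrable_prod_components) (rule integrable_gaussian_exp)
  show "(\<integral>v. of_real (exp (- pi * (v \<bullet> v))) * ex2pi (b \<bullet> v) \<partial>lborel) = of_real (exp (- pi * (b \<bullet> b)))"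
  proof -
    have "(\<integral>v. of_real (exp (- pi * (v \<bullet> v))) * ex2pi (b \<bullet> v) \<partial>lborel) = (\<Prod>i\<in>UNIV. of_real (exp (- pi * (b $ i)\<^sup>2)))"
      unfolding eq by (subst integral_prod_components, rule integrable_gaussian_exp) (simp only: integral_gaussian_exp)
    also have "\<dots> = of_real (\<Prod>i\<in>UNIV. exp (- pi * (b $ i)\<^sup>2))" by simp
    also have "(\<Prod>i\<in>UNIV. exp (- pi * (b $ i)\<^sup>2)) = exp (- pi * (b \<bullet> b))"
      by (simp add: exp_sum[symmetric] inner_vec_def sum_distrib_left power2_eq_square)
    finally show ?thesis .
  qed
qed

text \<open>Lebesgue measure is determined by the volumes of boxes, and the preimage of a box under
  \<open>A\<close> has its volume scaled by \<open>\<bar>det Ai\<bar>\<close>. The sort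
  \<open>wellorder\<close> of the index type is that of \<open>measure_linear_image\<close>.\<close>

lemma lborel_linear_image:
  fixes A :: "real^'n::{finite,wellorder}^'n::_"
  assumes "invertible A"
  shows "lborel = density (distr lborel borel (\<lambda>v. A *v v)) (\<lambda>_. ennreal \<bar>det A\<bar>)"
proof (rule lborel_eqI)
  obtain Ai where Ai: "A ** Ai = mat 1" "Ai ** A = mat 1" using assms by (auto simp: invertible_def)
  have meas: "(\<lambda>v. A *v v) \<in> borel_measurable borel"
    by (intro borel_measurable_continuous_onI linear_continuous_on matrix_vector_mul_bounded_linear)
  fix l u :: "real^'n::_"
  assume lu: "\<And>b. b \<in> Basis \<Longrightarrow> l \<bullet> b \<le> u \<bullet> b"
  let ?T = "(\<lambda>v. Ai *v v) ` box l u"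
  have pre: "(\<lambda>v. A *v v) -` box l u = ?T"
  proof (intro antisym subsetI)
    fix v assume "v \<in> (\<lambda>v. A *v v) -` box l u"
    then have "A *v v \<in> box l u" "v = Ai *v (A *v v)" by (auto simp: matrix_vector_mul_assoc Ai)
    then show "v \<in> ?T" by blast
  qed (auto simp: matrix_vector_mul_assoc Ai)
  have lin: "linear (\<lambda>v. Ai *v v)" by simp
  have lm: "box l u \<in> lmeasurable" by simp
  have T: "?T \<in> lmeasurable" "measure lebesgue ?T = \<bar>det Ai\<bar> * measure lebesgue (box l u)"
    using measurable_linear_image[OF lin lm] measure_linear_image[OF lin lm] by auto
  have Tb: "?T \<in> sets borel" unfolding pre[symmetric] using measurable_sets_borel[OF meas, of "box l u"] by simp
  have "emeasure (density (distr lborel borel (\<lambda>v. A *v v)) (\<lambda>_. ennreal \<bar>det A\<bar>)) (box l u) = ennreal \<bar>det A\<bar> * emeasure lborel ?T"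
    using meas by (subst emeasure_density_const) (auto simp: emeasure_distr pre)
  also have "emeasure lborel ?T = emeasure lebesgue ?T" using Tb by simp
  also have "\<dots> = ennreal (\<bar>det Ai\<bar> * measure lebesgue (box l u))" using T by (simp add: emeasure_eq_measure2)
  also have "ennreal \<bar>det A\<bar> * \<dots> = ennreal (\<bar>det A * det Ai\<bar> * measure lebesgue (box l u))"
    by (simp add: ennreal_mult'[symmetric] abs_mult mult_ac)
  also have "det A * det Ai = 1" using Ai(1) by (metis det_I det_mul)
  also have "ennreal (\<bar>1\<bar> * measure lebesgue (box l u)) = (\<Prod>b\<in>Basis. (u - l) \<bullet> b)"
    using lu by (simp add: measure_lborel_box_eq)
  finally show "emeasure (density (distr lborel borel (\<lambda>v. A *v v)) (\<lambda>_. ennreal \<bar>det A\<bar>)) (box l u) = (\<Prod>b\<in>Basis. (u - l) \<bullet> b)" .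
qed simp

lemma
  fixes A :: "real^'n::{finite,wellorder}^'n::_" and f :: "real^'n::_ \<Rightarrow> complex"
  assumes A: "invertible A" and f: "integrable lborel f"
  shows integrable_linear_image: "integrable lborel (\<lambda>v. f (A *v v))"
    and integral_linear_image: "(\<integral>v. f (A *v v) \<partial>lborel) = (\<integral>v. f v \<partial>lborel) / of_real \<bar>det A\<bar>"
proof -
  have d: "\<bar>det A\<bar> > 0" using A by (simp add: invertible_det_nz)
  have meas: "(\<lambda>v. A *v v) \<in> measurable lborel borel"
    using borel_measurable_continuous_onI[OF linear_continuous_on[OF matrix_vector_mul_bounded_linear], of A] by simp
  have fm[measurable]: "f \<in> borel_measurable borel" using borel_measurable_integrable[OF f] by simp
  have "integrable (density (distr lborel borel (\<lambda>v. A *v v)) (\<lambda>_. ennreal \<bar>det A\<bar>)) f"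
    using f unfolding lborel_linear_image[OF A, symmetric] .
  then have "integrable (distr lborel borel (\<lambda>v. A *v v)) (\<lambda>v. \<bar>det A\<bar> *\<^sub>R f v)"
    by (subst (asm) integrable_density) auto
  then have "integrable (distr lborel borel (\<lambda>v. A *v v)) f"
    using d integrable_scaleR_right[of "1 / \<bar>det A\<bar>" _ "\<lambda>v. \<bar>det A\<bar> *\<^sub>R f v"] by simp
  then show "integrable lborel (\<lambda>v. f (A *v v))" by (subst (asm) integrable_distr_eq[OF meas fm])
  have "(\<integral>v. f v \<partial>lborel) = (\<integral>v. f v \<partial>density (distr lborel borel (\<lambda>v. A *v v)) (\<lambda>_. ennreal \<bar>det A\<bar>))"
    unfolding lborel_linear_image[OF A, symmetric] ..
  also have "\<dots> = (\<integral>v. \<bar>det A\<bar> *\<^sub>R f v \<partial>distr lborel borel (\<lambda>v. A *v v))"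
    by (subst integral_density) auto
  also have "\<dots> = \<bar>det A\<bar> *\<^sub>R (\<integral>v. f (A *v v) \<partial>lborel)"
    by (subst integral_distr[OF meas]) auto
  finally show "(\<integral>v. f (A *v v) \<partial>lborel) = (\<integral>v. f v \<partial>lborel) / of_real \<bar>det A\<bar>"
    using d by (simp add: scaleR_conv_of_real field_simps)
qed

section \<open>Absolute summability over lattices\<close>

lemma summable_on_product_weight:
  fixes a :: "int \<Rightarrow> real"
  assumes F: "finite F" and a: "\<And>k. a k \<ge> 0" "a summable_on UNIV"
  shows "(\<lambda>g. \<Prod>i\<in>F. a (g i)) summable_on (PiE F (\<lambda>_. UNIV))"
  using F
proof (induction F)
  case (insert x F)
  have pi: "PiE (insert x F) (\<lambda>_. UNIV :: int set) = (\<lambda>(g, y). g(x := y)) ` (PiE F (\<lambda>_. UNIV) \<times> UNIV)"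
    unfolding PiE_insert_eq by (subst swap_product [symmetric]) (simp add: image_image case_prod_unfold)
  have inj: "inj_on (\<lambda>(g, y). g(x := y)) (PiE F (\<lambda>_. UNIV :: int set) \<times> UNIV)"
    using inj_combinator'[OF insert.hyps(2)] by blast
  have "(\<Prod>z\<in>F. a ((g(x := y)) z)) = (\<Prod>z\<in>F. a (g z))" for g y
    using insert.hyps by (intro prod.cong) auto
  then have eq: "(\<lambda>g. \<Prod>i\<in>insert x F. a (g i)) \<circ> (\<lambda>(g, y). g(x := y)) = (\<lambda>(g, y). a y * (\<Prod>i\<in>F. a (g i)))"
    using insert.hyps by (auto simp: fun_eq_iff)
  have "(\<lambda>(g, y). a y * (\<Prod>i\<in>F. a (g i))) summable_on (PiE F (\<lambda>_. UNIV :: int set) \<times> UNIV)"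
  proof (rule summable_on_SigmaI)
    show "((\<lambda>y. case (g, y) of (g, y) \<Rightarrow> a y * (\<Prod>i\<in>F. a (g i))) has_sum (infsum a UNIV * (\<Prod>i\<in>F. a (g i)))) UNIV" for g
      using has_sum_cmult_left[OF has_sum_infsum[OF a(2)]] by simp
    show "(\<lambda>g. infsum a UNIV * (\<Prod>i\<in>F. a (g i))) summable_on (PiE F (\<lambda>_. UNIV))"
      by (intro summable_on_cmult_right insert.IH)
  qed (auto intro!: mult_nonneg_nonneg prod_nonneg a)
  then show ?case unfolding pi summable_on_reindex[OF inj] eq .
qed simp

lemma summable_exp_int: "(\<lambda>k::int. exp (- \<bar>real_of_int k\<bar>)) summable_on UNIV"
proof -
  have "summable (\<lambda>n. norm (exp (- 1) ^ n :: real))" by (simp add: summable_geometric)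
  then have nat: "(\<lambda>n::nat. exp (- real n)) summable_on UNIV"
    using norm_summable_imp_summable_on[of "\<lambda>n. exp (- 1) ^ n :: real"] by (simp add: exp_of_nat_mult[symmetric])
  have 1: "(\<lambda>k::int. exp (- \<bar>real_of_int k\<bar>)) summable_on (range int)"
    using nat by (subst summable_on_reindex) (auto simp: o_def)
  have 2: "(\<lambda>k::int. exp (- \<bar>real_of_int k\<bar>)) summable_on (range (\<lambda>n. - int n))"
    using nat by (subst summable_on_reindex) (auto simp: o_def inj_on_def)
  have "(UNIV :: int set) = range int \<union> range (\<lambda>n. - int n)"
    by (auto intro: int_cases2)
  moreover have "(\<lambda>k::int. exp (- \<bar>real_of_int k\<bar>)) summable_on (range int \<union> range (\<lambda>n. - int n))"
    by (rule summable_on_union[OF 1 2])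
  ultimately show ?thesis by simp
qed

lemma summable_exp_l1: "(\<lambda>v. exp (- (\<Sum>i\<in>UNIV. \<bar>v $ i\<bar>))) summable_on (int_vecs :: (real^'n) set)"
proof -
  let ?v = "\<lambda>g :: 'n \<Rightarrow> int. \<chi> i. real_of_int (g i)"
  have img: "int_vecs = ?v ` (PiE UNIV (\<lambda>_. UNIV))"
  proof (intro antisym subsetI)
    fix v :: "real^'n" assume "v \<in> int_vecs"
    then have ev: "v = ?v (\<lambda>i. \<lfloor>v $ i\<rfloor>)" by (auto simp: int_vecs_def vec_eq_iff elim: Ints_cases)
    show "v \<in> ?v ` (PiE UNIV (\<lambda>_. UNIV))" by (rule image_eqI[where f = ?v, OF ev]) auto
  qed (auto simp: int_vecs_def)
  have inj: "inj_on ?v (PiE UNIV (\<lambda>_. UNIV))" by (auto simp: inj_on_def vec_eq_iff fun_eq_iff)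
  have "(\<lambda>g :: 'n \<Rightarrow> int. \<Prod>i\<in>UNIV. exp (- \<bar>real_of_int (g i)\<bar>)) summable_on (PiE UNIV (\<lambda>_. UNIV))"
    by (rule summable_on_product_weight) (auto intro: summable_exp_int)
  then show ?thesis
    unfolding img summable_on_reindex[OF inj] by (simp add: o_def exp_sum[symmetric] sum_negf)
qed

lemma lattice_exp_summable:
  assumes L: "full_rank_lattice L" and c: "c > 0"
  shows "(\<lambda>x :: real^'n. exp (- c * (x \<bullet> x) + b * norm x)) summable_on L"
proof -
  obtain A :: "real^'n^'n" where A: "invertible A" and LA: "L = (\<lambda>z. A *v z) ` int_vecs"
    using L by (auto simp: full_rank_lattice_def)
  obtain Ai where Ai: "Ai ** A = mat 1" using A by (auto simp: invertible_def)
  have inv: "Ai *v (A *v z) = z" for z by (simp add: matrix_vector_mul_assoc Ai)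
  have inj: "inj_on (\<lambda>z. A *v z) int_vecs" by (metis inj_onI inv)
  \<comment> \<open>The extra slope \<open>real CARD('n) * norm Ai\<close> pays for the sum of the
    absolute coordinates of \<open>z\<close> in the comparison family; \<open>K\<close> is the
    maximum of \<open>\<beta> * r - c * r\<^sup>2\<close>.\<close>
  define \<beta> where "\<beta> = b + real CARD('n) * norm Ai"
  define K where "K = \<beta>\<^sup>2 / (4 * c)"
  have bound: "exp (- c * ((A *v z) \<bullet> (A *v z)) + b * norm (A *v z)) \<le> exp K * exp (- (\<Sum>i\<in>UNIV. \<bar>z $ i\<bar>))" for z
  proof -
    define r where "r = norm (A *v z)"
    have "\<bar>z $ i\<bar> \<le> norm Ai * r" for i
      using component_le_norm_cart[of z i] norm_matrix_vector_mult_le[of Ai "A *v z"] by (simp add: inv r_def)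
    then have "(\<Sum>i\<in>UNIV. \<bar>z $ i\<bar>) \<le> (\<Sum>i\<in>(UNIV::'n set). norm Ai * r)" by (intro sum_mono)
    then have s: "(\<Sum>i\<in>UNIV. \<bar>z $ i\<bar>) \<le> real CARD('n) * norm Ai * r" by simp
    have "0 \<le> (2 * c * r - \<beta>)\<^sup>2" by simp
    then have "4 * c * (\<beta> * r - c * r\<^sup>2) \<le> \<beta>\<^sup>2" by (simp add: power2_eq_square algebra_simps)
    then have "\<beta> * r - c * r\<^sup>2 \<le> K" using c by (simp add: K_def field_simps)
    then have "- c * r\<^sup>2 + b * r \<le> K - (\<Sum>i\<in>UNIV. \<bar>z $ i\<bar>)" using s by (simp add: \<beta>_def algebra_simps)
    moreover have "(A *v z) \<bullet> (A *v z) = r\<^sup>2" by (simp add: r_def power2_norm_eq_inner)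
    ultimately show ?thesis by (simp add: r_def[symmetric] exp_add[symmetric])
  qed
  have "(\<lambda>z. exp (- c * ((A *v z) \<bullet> (A *v z)) + b * norm (A *v z))) summable_on int_vecs"
    by (rule summable_on_comparison_test[OF summable_on_cmult_right[OF summable_exp_l1, of "exp K"]]) (use bound in auto)
  then show ?thesis unfolding LA summable_on_reindex[OF inj] by (simp add: o_def)
qed

text \<open>A summable family that is nowhere zero has a countable index set. Enumerations are
  wanted because sums and integrals are exchanged for series over \<open>nat\<close>.\<close>

lemma int_vecs_enum: "\<exists>e :: nat \<Rightarrow> real^'n. bij_betw e UNIV int_vecs"
proof -
  have "countable {v \<in> (int_vecs :: (real^'n) set). exp (- (\<Sum>i\<in>UNIV. \<bar>v $ i\<bar>)) \<noteq> 0}"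
    by (rule abs_summable_countable) (use summable_exp_l1 in simp)
  then have "countable (int_vecs :: (real^'n) set)" by simp
  moreover have "infinite (int_vecs :: (real^'n) set)"
  proof
    assume "finite (int_vecs :: (real^'n) set)"
    then have "finite (range (\<lambda>k::nat. axis undefined (real k) :: real^'n))"
      by (rule finite_subset[rotated]) (auto simp: int_vecs_def axis_def)
    moreover have "inj (\<lambda>k::nat. axis undefined (real k) :: real^'n)" by (auto simp: inj_def axis_eq_axis)
    ultimately show False using finite_imageD infinite_UNIV_nat by blast
  qed
  ultimately show ?thesis using bij_betw_from_nat_into by blast
qed

lemma has_sum_enum:
  fixes f :: "'a \<Rightarrow> 'b::banach"
  assumes e: "bij_betw e (UNIV :: nat set) Z" and f: "(\<lambda>x. norm (f x)) summable_on Z"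
  shows "(\<lambda>n. f (e n)) sums infsum f Z" and "summable (\<lambda>n. norm (f (e n)))"
proof -
  have "(f has_sum infsum f Z) Z" by (rule has_sum_infsum[OF abs_summable_summable[OF f]])
  then have "((\<lambda>n. f (e n)) has_sum infsum f Z) UNIV" using has_sum_reindex_bij_betw[OF e] by blast
  then show "(\<lambda>n. f (e n)) sums infsum f Z" by (rule has_sum_imp_sums)
  have "(\<lambda>n. norm (f (e n))) summable_on UNIV"
    using f summable_on_reindex_bij_betw[OF e, of "\<lambda>x. norm (f x)"] by simp
  then show "summable (\<lambda>n. norm (f (e n)))" by (rule summable_on_imp_summable)
qed

section \<open>Sums and integrals over the unit cube\<close>

definition unit_cube :: "(real^'n) set" where
  "unit_cube = {v. \<forall>i. 0 \<le> v $ i \<and> v $ i < 1}"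

lemma unit_cube_measurable [measurable, simp]: "unit_cube \<in> sets borel"
proof -
  have "unit_cube = (\<Inter>i\<in>UNIV. {v :: real^'n. 0 \<le> v $ i} - {v. 1 \<le> v $ i})"
    by (auto simp: unit_cube_def not_le) (meson not_le)
  also have "\<dots> \<in> sets borel"
    by (intro sets.finite_INT sets.Diff borel_closed closed_Collect_le continuous_intros) auto
  finally show ?thesis .
qed

lemma unit_cube_subset: "unit_cube \<subseteq> cbox 0 (1 :: real^'n)"
  by (auto simp: unit_cube_def mem_box_cart less_imp_le)

lemma set_integrable_cube:
  fixes h :: "real^'n \<Rightarrow> complex"
  assumes "continuous_on UNIV h"
  shows "set_integrable lborel unit_cube h"
proof (rule set_integrable_subset)
  show "set_integrable lborel (cbox 0 (1::real^'n)) h"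
    unfolding set_integrable_def by (intro borel_integrable_compact continuous_on_subset[OF assms]) auto
qed (use unit_cube_subset in auto)

lemma emeasure_unit_cube_finite: "emeasure lborel (unit_cube :: (real^'n) set) < \<infinity>"
proof -
  have "emeasure lborel (unit_cube :: (real^'n) set) \<le> emeasure lborel (cbox 0 (1 :: real^'n))"
    using unit_cube_subset by (intro emeasure_mono) auto
  also have "\<dots> < \<infinity>" by (rule emeasure_lborel_cbox_finite)
  finally show ?thesis .
qed

lemma cube_integral_infsum:
  fixes g :: "real^'n \<Rightarrow> real^'n \<Rightarrow> complex"
  assumes cont: "\<And>k. k \<in> int_vecs \<Longrightarrow> continuous_on UNIV (g k)"
    and bd: "\<And>k v. k \<in> int_vecs \<Longrightarrow> v \<in> unit_cube \<Longrightarrow> norm (g k v) \<le> B k"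
    and B: "B summable_on int_vecs"
  shows "(LINT v:unit_cube|lborel. infsum (\<lambda>k. g k v) int_vecs) = infsum (\<lambda>k. LINT v:unit_cube|lborel. g k v) int_vecs"
    and "(\<lambda>k. norm (LINT v:unit_cube|lborel. g k v)) summable_on int_vecs"
proof -
  obtain e :: "nat \<Rightarrow> real^'n" where e: "bij_betw e UNIV int_vecs" using int_vecs_enum by blast
  have eZ: "e n \<in> int_vecs" for n using e by (auto simp: bij_betw_def)
  let ?I = "indicator unit_cube :: real^'n \<Rightarrow> real"
  let ?m = "measure lborel (unit_cube :: (real^'n) set)"
  define h where "h n v = ?I v *\<^sub>R g (e n) v" for n v
  have ih: "integrable lborel (h n)" for n
    using set_integrable_cube[OF cont[OF eZ]] by (simp add: h_def[abs_def] set_integrable_def)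
  have iI: "integrable lborel (\<lambda>v. B k * ?I v)" for k
    using emeasure_unit_cube_finite by (intro integrable_mult_right integrable_real_indicator) auto
  have B0: "B k \<ge> 0" if "k \<in> int_vecs" for k
    using order_trans[OF norm_ge_zero bd[OF that, of 0]] by (simp add: unit_cube_def)
  have Babs: "(\<lambda>k. norm (B k)) summable_on int_vecs" using B B0 by (simp cong: summable_on_cong)
  have sB: "summable (\<lambda>n. B (e n))"
    using has_sum_enum(1)[OF e Babs] by (rule sums_summable)
  have nh: "norm (h n v) \<le> B (e n) * ?I v" for n v using bd[OF eZ] by (auto simp: h_def indicator_def)
  have nint: "(\<integral>v. norm (g k v) * ?I v \<partial>lborel) \<le> B k * ?m" if k: "k \<in> int_vecs" for k
  proof -
    have "(\<integral>v. norm (g k v) * ?I v \<partial>lborel) \<le> (\<integral>v. B k * ?I v \<partial>lborel)"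
    proof (rule integral_mono[OF _ iI])
      have "integrable lborel (\<lambda>v. norm (?I v *\<^sub>R g k v))"
        using set_integrable_cube[OF cont[OF k]] unfolding set_integrable_def by (rule integrable_norm)
      then show "integrable lborel (\<lambda>v. norm (g k v) * ?I v)" by (simp add: mult.commute)
    qed (use bd[OF k] in \<open>auto simp: indicator_def\<close>)
    then show ?thesis using emeasure_unit_cube_finite by (simp add: measure_def)
  qed
  have nL: "norm (LINT v:unit_cube|lborel. g k v) \<le> B k * ?m" if k: "k \<in> int_vecs" for k
  proof -
    have "norm (LINT v:unit_cube|lborel. g k v) \<le> (\<integral>v. norm (?I v *\<^sub>R g k v) \<partial>lborel)"
      unfolding set_lebesgue_integral_def by (rule integral_norm_bound)
    then show ?thesis using nint[OF k] by (simp add: mult.commute)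
  qed
  show abs: "(\<lambda>k. norm (LINT v:unit_cube|lborel. g k v)) summable_on int_vecs"
    by (rule summable_on_comparison_test[OF summable_on_cmult_left[OF B, of ?m]]) (use nL in auto)
  have inner: "(\<Sum>n. h n v) = ?I v *\<^sub>R infsum (\<lambda>k. g k v) int_vecs" for v
  proof (cases "v \<in> unit_cube")
    case True
    have "(\<lambda>k. norm (g k v)) summable_on int_vecs"
      by (rule summable_on_comparison_test[OF B]) (use bd True in auto)
    then show ?thesis using True sums_unique[OF has_sum_enum(1)[OF e, of "\<lambda>k. g k v"]] by (simp add: h_def)
  qed (simp add: h_def)
  have "(LINT v:unit_cube|lborel. infsum (\<lambda>k. g k v) int_vecs) = (\<integral>v. (\<Sum>n. h n v) \<partial>lborel)"
    by (simp add: set_lebesgue_integral_def inner)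
  also have "\<dots> = (\<Sum>n. integral\<^sup>L lborel (h n))"
  proof (rule integral_suminf[OF ih])
    show "AE v in lborel. summable (\<lambda>n. norm (h n v))"
    proof (rule AE_I2)
      fix v
      show "summable (\<lambda>n. norm (h n v))"
        by (rule summable_comparison_test'[OF summable_mult2[OF sB, of "?I v"]]) (use nh in auto)
    qed
    show "summable (\<lambda>n. \<integral>v. norm (h n v) \<partial>lborel)"
    proof (rule summable_comparison_test'[OF summable_mult2[OF sB, of ?m]])
      fix n :: nat
      show "norm (\<integral>v. norm (h n v) \<partial>lborel) \<le> B (e n) * ?m"
        using nint[OF eZ, of n] by (simp add: h_def mult.commute integral_nonneg_AE)
    qed
  qed
  also have "\<dots> = infsum (\<lambda>k. LINT v:unit_cube|lborel. g k v) int_vecs"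
    using has_sum_enum(1)[OF e abs] by (simp add: h_def[abs_def] set_lebesgue_integral_def sums_unique[symmetric])
  finally show "(LINT v:unit_cube|lborel. infsum (\<lambda>k. g k v) int_vecs) = infsum (\<lambda>k. LINT v:unit_cube|lborel. g k v) int_vecs" .
qed

text \<open>The integral translates of the half-open cube tile the space: the translate containing
  \<open>x\<close> is recovered from the floors of its coordinates.\<close>

lemma cube_unfolding:
  fixes f :: "real^'n \<Rightarrow> complex"
  assumes f: "integrable lborel f"
    and abs: "(\<lambda>k. norm (LINT v:unit_cube|lborel. f (v + k))) summable_on int_vecs"
  shows "infsum (\<lambda>k. LINT v:unit_cube|lborel. f (v + k)) int_vecs = (\<integral>v. f v \<partial>lborel)"
proof -
  obtain e :: "nat \<Rightarrow> real^'n" where e: "bij_betw e UNIV int_vecs" using int_vecs_enum by blast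
  have eZ: "e n \<in> int_vecs" for n using e by (auto simp: bij_betw_def)
  define A where "A n = {x. x - e n \<in> unit_cube}" for n
  have Am: "A n \<in> sets lborel" for n
  proof -
    have "(\<lambda>x. x - e n) \<in> borel_measurable borel" by measurable
    then have "(\<lambda>x. x - e n) -` unit_cube \<in> sets borel" by (rule measurable_sets_borel) simp
    then show ?thesis by (simp add: A_def vimage_def)
  qed
  have fl: "k = (\<chi> i. of_int \<lfloor>x $ i\<rfloor>)" if xk: "x - k \<in> unit_cube" and k: "k \<in> int_vecs" for x k :: "real^'n"
  proof -
    have "k $ i = of_int \<lfloor>x $ i\<rfloor>" for i
    proof -
      obtain a :: int where a: "k $ i = of_int a" using k by (auto simp: int_vecs_def elim: Ints_cases)
      have "0 \<le> x $ i - k $ i" "x $ i - k $ i < 1" using xk by (auto simp: unit_cube_def)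
      then have "\<lfloor>x $ i\<rfloor> = a" unfolding a by (intro floor_unique) auto
      then show ?thesis using a by simp
    qed
    then show ?thesis by (simp add: vec_eq_iff)
  qed
  have disj: "A i \<inter> A j = {}" if "i \<noteq> j" for i j
  proof (rule ccontr)
    assume "A i \<inter> A j \<noteq> {}"
    then obtain x where "x - e i \<in> unit_cube" "x - e j \<in> unit_cube" by (auto simp: A_def)
    then have "e i = e j" using fl eZ by metis
    then show False using that e by (auto simp: bij_betw_def dest: injD)
  qed
  have cover: "(\<Union>n. A n) = UNIV"
  proof -
    have "\<exists>n. x \<in> A n" for x
    proof -
      let ?k = "(\<chi> i. of_int \<lfloor>x $ i\<rfloor>) :: real^'n"
      have "?k \<in> int_vecs" by (simp add: int_vecs_def)
      then obtain n where "e n = ?k" using e by (metis bij_betw_imp_surj_on imageE)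
      moreover have "x - ?k \<in> unit_cube"
        by (simp add: unit_cube_def frac_def[symmetric] frac_lt_1)
      ultimately show ?thesis by (auto simp: A_def intro!: exI[of _ n])
    qed
    then show ?thesis by auto
  qed
  have shift: "(LINT x:A n|lborel. f x) = (LINT v:unit_cube|lborel. f (v + e n))" for n
  proof -
    have fm: "f \<in> borel_measurable borel" using borel_measurable_integrable[OF f] by simp
    have "(LINT x:A n|lborel. f x) = (\<integral>x. indicator (A n) x *\<^sub>R f x \<partial>distr lborel borel ((+) (e n)))"
      by (simp add: set_lebesgue_integral_def lborel_distr_plus)
    also have "\<dots> = (\<integral>v. indicator (A n) (e n + v) *\<^sub>R f (e n + v) \<partial>lborel)"
      using fm Am[of n] by (intro integral_distr) auto
    also have "\<dots> = (LINT v:unit_cube|lborel. f (v + e n))"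
      unfolding set_lebesgue_integral_def by (intro Bochner_Integration.integral_cong) (auto simp: A_def indicator_def add.commute)
    finally show ?thesis .
  qed
  have "(\<integral>v. f v \<partial>lborel) = (LINT x:(\<Union>n. A n)|lborel. f x)" by (simp add: cover set_lebesgue_integral_def)
  also have "\<dots> = (\<Sum>n. LINT x:A n|lborel. f x)"
    by (intro lebesgue_integral_countable_add Am disj) (auto simp: cover set_integrable_def f)
  also have "\<dots> = infsum (\<lambda>k. LINT v:unit_cube|lborel. f (v + k)) int_vecs"
    unfolding shift using has_sum_enum(1)[OF e abs] by (rule sums_unique[symmetric])
  finally show ?thesis by simp
qed

lemma cube_integral_ex2pi:
  fixes l :: "real^'n"
  assumes l: "l \<in> int_vecs"
  shows "(LINT v:unit_cube|lborel. ex2pi (l \<bullet> v)) = (if l = 0 then 1 else 0)"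
proof -
  let ?J = "indicator {0..<1} :: real \<Rightarrow> real"
  let ?J' = "indicator {0..1} :: real \<Rightarrow> real"
  \<comment> \<open>The half-open interval and the closed one, to which the fundamental theorem
    applies, differ by a null set.\<close>
  have ae: "AE x in lborel. ?J x *\<^sub>R ex2pi (m * x) = ?J' x *\<^sub>R ex2pi (m * x)" for m
  proof -
    have "AE x in lborel. x \<noteq> (1::real)" by (rule AE_lborel_singleton)
    then show ?thesis by eventually_elim (auto simp: indicator_def)
  qed
  have cont: "continuous_on UNIV (\<lambda>x. ex2pi (m * x))" for m by (intro continuous_intros)
  have mea: "(\<lambda>x. ex2pi (m * x)) \<in> borel_measurable borel" for m
    by (intro borel_measurable_continuous_onI cont)
  have hb: "has_bochner_integral lborel (\<lambda>x. ?J' x *\<^sub>R ex2pi (m * x)) (if m = 0 then 1 else 0)" if m: "m \<in> \<int>" for m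
  proof (cases "m = 0")
    case True
    have "has_bochner_integral lborel (\<lambda>x. ?J' x *\<^sub>R (1::complex)) (of_real 1 - of_real 0)"
      by (rule has_bochner_integral_FTC_Icc) (auto intro!: derivative_eq_intros continuous_intros)
    then show ?thesis using True by simp
  next
    case False
    let ?F = "\<lambda>x. ex2pi (m * x) / (2 * pi * \<i> * m)"
    have "(?F has_vector_derivative ex2pi (m * x)) (at x within {0..1})" for x
    proof -
      have "((\<lambda>z. exp (2 * pi * \<i> * m * z) / (2 * pi * \<i> * m)) has_field_derivative ex2pi (m * x)) (at (of_real x))"
        using False by (auto intro!: derivative_eq_intros simp: ex2pi_def mult_ac)
      from has_vector_derivative_real_field[OF this] show ?thesis
        by (auto simp: ex2pi_def mult_ac intro: has_vector_derivative_at_within)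
    qed
    then have "has_bochner_integral lborel (\<lambda>x. ?J' x *\<^sub>R ex2pi (m * x)) (?F 1 - ?F 0)"
      by (intro has_bochner_integral_FTC_Icc continuous_on_subset[OF cont]) auto
    then show ?thesis using False m by (simp add: ex2pi_Ints)
  qed
  have hb': "has_bochner_integral lborel (\<lambda>x. ?J x *\<^sub>R ex2pi (m * x)) (if m = 0 then 1 else 0)" if m: "m \<in> \<int>" for m
    using hb[OF m] by (rule has_bochner_integral_cong_AE[THEN iffD2, rotated -1]) (use ae mea in auto)
  have l': "l $ i \<in> \<int>" for i using l by (simp add: int_vecs_def)
  have "indicator unit_cube v *\<^sub>R ex2pi (l \<bullet> v) = (\<Prod>i\<in>UNIV. ?J (v $ i) *\<^sub>R ex2pi (l $ i * v $ i))" for v :: "real^'n"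
  proof -
    have "indicator unit_cube v = (\<Prod>i\<in>UNIV. ?J (v $ i))"
      by (auto simp: unit_cube_def indicator_def prod_zero_iff)
    then show ?thesis by (simp add: inner_vec_def ex2pi_sum scaleR_conv_of_real prod.distrib)
  qed
  then have "(LINT v:unit_cube|lborel. ex2pi (l \<bullet> v)) = (\<integral>v. (\<Prod>i\<in>UNIV. ?J (v $ i) *\<^sub>R ex2pi (l $ i * v $ i)) \<partial>lborel)"
    by (simp add: set_lebesgue_integral_def)
  also have "\<dots> = (\<Prod>i\<in>UNIV. if l $ i = 0 then 1 else 0)"
    by (subst integral_prod_components) (use hb'[OF l'] in \<open>auto simp: has_bochner_integral_iff\<close>)
  also have "\<dots> = (if l = 0 then 1 else 0)" by (auto simp: vec_eq_iff prod_zero_iff)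
  finally show ?thesis .
qed

section \<open>Trigonometric polynomials and uniqueness of Fourier coefficients\<close>

inductive trig_poly :: "(real^'n \<Rightarrow> complex) \<Rightarrow> bool" where
  trig_poly_exp: "l \<in> int_vecs \<Longrightarrow> trig_poly (\<lambda>v. c * ex2pi (l \<bullet> v))"
| trig_poly_add: "trig_poly p \<Longrightarrow> trig_poly q \<Longrightarrow> trig_poly (\<lambda>v. p v + q v)"

lemma trig_poly_const: "trig_poly (\<lambda>v. c)"
  using trig_poly_exp[OF zero_in_int_vecs, of c] by simp

lemma trig_poly_sum:
  assumes "\<And>i. i \<in> I \<Longrightarrow> trig_poly (p i)"
  shows "trig_poly (\<lambda>v. \<Sum>i\<in>I. p i v)"
  using assms by (induction I rule: infinite_finite_induct) (auto intro: trig_poly_const trig_poly_add)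

lemma trig_poly_mult_exp:
  assumes l: "l \<in> int_vecs" and q: "trig_poly q"
  shows "trig_poly (\<lambda>v. c * ex2pi (l \<bullet> v) * q v)"
  using q
proof induction
  case (trig_poly_exp l' c')
  have "trig_poly (\<lambda>v. (c * c') * ex2pi ((l + l') \<bullet> v))"
    by (intro trig_poly.trig_poly_exp add_in_int_vecs l trig_poly_exp)
  then show ?case by (simp add: inner_add_left ex2pi_add mult_ac)
next
  case (trig_poly_add p q)
  have "trig_poly (\<lambda>v. c * ex2pi (l \<bullet> v) * p v + c * ex2pi (l \<bullet> v) * q v)"
    by (intro trig_poly.trig_poly_add trig_poly_add.IH)
  then show ?case by (simp add: distrib_left)
qed

lemma trig_poly_mult: "trig_poly p \<Longrightarrow> trig_poly q \<Longrightarrow> trig_poly (\<lambda>v. p v * q v)"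
proof (induction rule: trig_poly.induct)
  case (trig_poly_exp l c)
  then show ?case by (intro trig_poly_mult_exp)
next
  case (trig_poly_add p1 p2)
  have "trig_poly (\<lambda>v. p1 v * q v + p2 v * q v)"
    by (intro trig_poly.trig_poly_add trig_poly_add.IH trig_poly_add.prems)
  then show ?case by (simp add: distrib_right)
qed

lemma trig_poly_power: "trig_poly p \<Longrightarrow> trig_poly (\<lambda>v. p v ^ N)"
  by (induction N) (auto intro: trig_poly_const trig_poly_mult)

lemma trig_poly_continuous: "trig_poly p \<Longrightarrow> continuous_on UNIV p"
  by (induction rule: trig_poly.induct) (auto intro!: continuous_intros)

lemma trig_poly_orthogonal:
  assumes D: "continuous_on UNIV D" and zero: "\<And>l. l \<in> int_vecs \<Longrightarrow> (LINT v:unit_cube|lborel. D v * ex2pi (l \<bullet> v)) = 0"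
    and p: "trig_poly p"
  shows "(LINT v:unit_cube|lborel. D v * p v) = 0"
  using p
proof induction
  case (trig_poly_exp l c)
  have "(LINT v:unit_cube|lborel. D v * (c * ex2pi (l \<bullet> v))) = (LINT v:unit_cube|lborel. c * (D v * ex2pi (l \<bullet> v)))"
    by (simp add: mult_ac)
  also have "\<dots> = c * (LINT v:unit_cube|lborel. D v * ex2pi (l \<bullet> v))" by (rule set_integral_mult_right)
  finally show ?case using zero[OF trig_poly_exp] by simp
next
  case (trig_poly_add p q)
  have "(LINT v:unit_cube|lborel. D v * p v + D v * q v) = (LINT v:unit_cube|lborel. D v * p v) + (LINT v:unit_cube|lborel. D v * q v)"
    using trig_poly_add.hyps trig_poly_continuous
    by (intro set_integral_add set_integrable_cube continuous_on_mult D) auto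
  then show ?case using trig_poly_add.IH by (simp add: distrib_left)
qed

lemma trig_poly_cos:
  "trig_poly (\<lambda>v :: real^'n. complex_of_real (cos (2 * pi * (v $ i - a))))"
proof -
  have "complex_of_real (cos (2 * pi * (v $ i - a))) =
      (ex2pi (- a) / 2) * ex2pi (axis i 1 \<bullet> v) + (ex2pi a / 2) * ex2pi (- axis i 1 \<bullet> v)" for v :: "real^'n"
  proof -
    have "complex_of_real (cos (2 * pi * (v $ i - a))) = cos (complex_of_real (2 * pi * (v $ i - a)))"
      by (rule cos_of_real[symmetric])
    also have "\<dots> = (ex2pi (v $ i - a) + ex2pi (- (v $ i - a))) / 2"
      by (simp add: cos_exp_eq ex2pi_def algebra_simps)
    also have "\<dots> = (ex2pi (- a) / 2) * ex2pi (v $ i) + (ex2pi a / 2) * ex2pi (- v $ i)"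
      using ex2pi_add[of "v $ i" "- a"] ex2pi_add[of "- v $ i" a] by (simp add: field_simps)
    finally show ?thesis by (simp add: inner_axis' inner_minus_left)
  qed
  moreover have "trig_poly (\<lambda>v. (ex2pi (- a) / 2) * ex2pi (axis i 1 \<bullet> v) + (ex2pi a / 2) * ex2pi (- axis i 1 \<bullet> v))"
    by (intro trig_poly_add trig_poly_exp) (auto simp: int_vecs_def axis_def)
  ultimately show ?thesis by simp
qed

text \<open>The point \<open>x\<close> keeps distance \<open>d\<close> from the periods -1, 0 and 1,
  where the cosine peaks; beyond \<open>1/2\<close> the reflection to
  \<open>1 - \<bar>x\<bar>\<close> is used. This bounds the peaking polynomial away from its
  peak.\<close>

lemma cos_le_of_far_from_period:
  assumes d: "0 < d" "d \<le> 1/4" and x: "d \<le> \<bar>x\<bar>" "\<bar>x\<bar> \<le> 1 - d"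
  shows "cos (2 * pi * x) \<le> cos (2 * pi * d)"
proof -
  have c: "cos (2 * pi * x) = cos (2 * pi * \<bar>x\<bar>)" by (cases "x \<ge> 0") auto
  show ?thesis
  proof (cases "\<bar>x\<bar> \<le> 1/2")
    case True
    have "cos (2 * pi * \<bar>x\<bar>) \<le> cos (2 * pi * d)"
      using True d x pi_gt_zero by (intro cos_monotone_0_pi_le) (auto simp: field_simps)
    then show ?thesis using c by simp
  next
    case False
    have "cos (2 * pi * \<bar>x\<bar>) = cos (2 * pi * (1 - \<bar>x\<bar>))"
      by (simp add: right_diff_distrib cos_diff)
    also have "\<dots> \<le> cos (2 * pi * d)"
    proof (intro cos_monotone_0_pi_le)
      show "2 * pi * d \<le> 2 * pi * (1 - \<bar>x\<bar>)" using x by (intro mult_left_mono) auto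
      show "2 * pi * (1 - \<bar>x\<bar>) \<le> pi" using mult_left_mono[of "1 - \<bar>x\<bar>" "1/2" "2 * pi"] False by simp
    qed (use d in simp)
    finally show ?thesis using c by simp
  qed
qed

text \<open>
  A continuous function with vanishing Fourier coefficients vanishes inside the cube: near a point
  where it does not, powers of a trigonometric polynomial peaking there would have an unbounded
  integral against it.
\<close>

lemma fourier_coefficients_zero_interior:
  fixes D :: "real^'n \<Rightarrow> complex"
  assumes D: "continuous_on UNIV D"
    and zero: "\<And>l. l \<in> int_vecs \<Longrightarrow> (LINT v:unit_cube|lborel. D v * ex2pi (l \<bullet> v)) = 0"
    and v0: "\<And>i. 0 < v0 $ i \<and> v0 $ i < 1"
  shows "D v0 = 0"
proof (rule ccontr)
  assume nz: "D v0 \<noteq> 0"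
  define c where "c = cnj (D v0)"
  \<comment> \<open>Multiplication by the conjugate of \<open>D v0\<close> makes the value at
    \<open>v0\<close> positive, so that real parts suffice.\<close>
  define h where "h v = Re (c * D v)" for v
  have hc: "continuous_on UNIV h" unfolding h_def by (intro continuous_intros D)
  have "h v0 = (cmod (D v0))\<^sup>2" by (simp add: h_def c_def mult.commute complex_mult_cnj cmod_power2)
  then have h0: "h v0 > 0" using nz by simp
  define a where "a = h v0 / 2"
  have a: "a > 0" "h v0 > a" using h0 by (auto simp: a_def)
  have "open {v. h v > a}" by (intro open_Collect_less continuous_intros hc)
  then obtain \<delta> where \<delta>: "\<delta> > 0" "\<And>v. dist v v0 < \<delta> \<Longrightarrow> h v > a"
    using a(2) unfolding open_dist by blast
  let ?n = "real CARD('n)"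
  have n: "?n > 0" by simp
  \<comment> \<open>The box of half width \<open>d\<close> around \<open>v0\<close> lies in the cube
    and in the ball where \<open>h > a\<close>, and \<open>d \<le> 1/4\<close> keeps all cosines
    nonnegative on it.\<close>
  define d where "d = Min ({1/4, \<delta> / (2 * ?n)} \<union> range (\<lambda>i. v0 $ i) \<union> range (\<lambda>i. 1 - v0 $ i))"
  have dle: "d \<le> z" if "z \<in> {1/4, \<delta> / (2 * ?n)} \<union> range (\<lambda>i. v0 $ i) \<union> range (\<lambda>i. 1 - v0 $ i)" for z
    unfolding d_def using that by (intro Min_le) auto
  have d: "d > 0" unfolding d_def using v0 \<delta> n by (subst Min_gr_iff) auto
  have d4: "d \<le> 1/4" "d \<le> \<delta> / (2 * ?n)" "\<And>i. d \<le> v0 $ i" "\<And>i. d \<le> 1 - v0 $ i"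
    by (rule dle; simp)+
  define U where "U e = {v. \<forall>i. \<bar>v $ i - v0 $ i\<bar> < e}" for e
  have hU: "h v > a" if "v \<in> U d" for v
  proof (rule \<delta>(2))
    have "norm (v - v0) \<le> (\<Sum>i\<in>UNIV. \<bar>(v - v0) $ i\<bar>)" by (rule norm_le_l1_cart)
    also have "\<dots> \<le> (\<Sum>i\<in>(UNIV::'n set). d)" using that by (intro sum_mono) (auto simp: U_def less_imp_le)
    also have "\<dots> \<le> \<delta> / 2" using d4(2) n by (simp add: field_simps)
    finally show "dist v v0 < \<delta>" using \<delta>(1) by (simp add: dist_norm)
  qed
  define q where "q = cos (2 * pi * d)"
  have q1: "q < 1"
    unfolding q_def using d d4(1) pi_gt_zero cos_monotone_0_pi[of 0 "2 * pi * d"] by (simp add: field_simps)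
  have q0: "q \<ge> 0"
  proof -
    have "0 \<le> 2 * pi * d" "2 * pi * d \<le> pi / 2" using d mult_left_mono[OF d4(1), of "2 * pi"] by auto
    then show ?thesis unfolding q_def using pi_gt_zero by (intro cos_ge_zero) linarith+
  qed
  define \<eta> where "\<eta> = (1 - q) / (2 * ?n)"
  have \<eta>: "\<eta> > 0" "\<eta> \<le> 1/2"
  proof -
    show "\<eta> > 0" using q1 n by (simp add: \<eta>_def)
    have "?n \<ge> 1" by (simp add: Suc_leI)
    then have "(1 - q) \<le> ?n" using q0 by linarith
    then show "\<eta> \<le> 1/2" using n by (simp add: \<eta>_def field_simps)
  qed
  \<comment> \<open>The mean of the cosines, raised by \<open>\<eta>\<close>, so that the value at
    \<open>v0\<close> is \<open>1 + \<eta>\<close>. Off the box one cosine is at most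
    \<open>q\<close>, which lowers the mean by at least \<open>(1 - q) / ?n = 2 * \<eta>\<close>;
    there \<open>\<bar>T v\<bar> \<le> 1\<close>.\<close>
  define T where "T v = \<eta> + (\<Sum>i\<in>UNIV. cos (2 * pi * (v $ i - v0 $ i))) / ?n" for v
  have Tc: "continuous_on UNIV T" unfolding T_def by (intro continuous_intros) auto
  have Ttrig: "trig_poly (\<lambda>v. complex_of_real (T v))"
  proof -
    have "trig_poly (\<lambda>v. complex_of_real \<eta> + (\<Sum>i\<in>UNIV. complex_of_real (1 / ?n) * complex_of_real (cos (2 * pi * (v $ i - v0 $ i)))))"
      by (intro trig_poly_add trig_poly_sum trig_poly_mult trig_poly_const trig_poly_cos)
    then show ?thesis by (simp add: T_def sum_divide_distrib)
  qed
  have T_far: "\<bar>T v\<bar> \<le> 1" if v: "v \<in> unit_cube" "v \<notin> U d" for v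
  proof -
    obtain j where j: "d \<le> \<bar>v $ j - v0 $ j\<bar>" using v(2) by (auto simp: U_def not_less)
    have "\<bar>v $ j - v0 $ j\<bar> \<le> 1 - d" using v(1) d4(3,4)[of j] by (auto simp: unit_cube_def abs_le_iff) (smt (verit))+
    then have cj: "cos (2 * pi * (v $ j - v0 $ j)) \<le> q" unfolding q_def using j d d4(1) by (intro cos_le_of_far_from_period)
    have "(\<Sum>i\<in>UNIV. cos (2 * pi * (v $ i - v0 $ i))) = cos (2 * pi * (v $ j - v0 $ j)) + (\<Sum>i\<in>UNIV - {j}. cos (2 * pi * (v $ i - v0 $ i)))"
      by (simp add: sum.remove)
    also have "\<dots> \<le> q + (\<Sum>i\<in>UNIV - {j}. 1)" using cj by (intro add_mono sum_mono) auto
    also have "\<dots> = ?n - 2 * ?n * \<eta>" using n by (simp add: \<eta>_def card_Diff_subset of_nat_diff Suc_leI)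
    finally have "(\<Sum>i\<in>UNIV. cos (2 * pi * (v $ i - v0 $ i))) / ?n \<le> 1 - 2 * \<eta>" using n by (simp add: field_simps)
    moreover have "(\<Sum>i\<in>(UNIV::'n set). - 1) \<le> (\<Sum>i\<in>UNIV. cos (2 * pi * (v $ i - v0 $ i)))" by (intro sum_mono) auto
    then have "- 1 \<le> (\<Sum>i\<in>UNIV. cos (2 * pi * (v $ i - v0 $ i))) / ?n" using n by (simp add: field_simps)
    ultimately show ?thesis using \<eta> unfolding T_def abs_le_iff by linarith
  qed
  have T_U: "T v \<ge> 0" if v: "v \<in> U d" for v
  proof -
    have "cos (2 * pi * (v $ i - v0 $ i)) \<ge> 0" for i
    proof (rule cos_ge_zero)
      have "\<bar>v $ i - v0 $ i\<bar> < d" using v by (simp add: U_def)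
      then have b: "v $ i - v0 $ i \<le> 1/4" "- (1/4) \<le> v $ i - v0 $ i" using d4(1) by linarith+
      show "2 * pi * (v $ i - v0 $ i) \<le> pi / 2" using mult_left_mono[OF b(1), of "2 * pi"] by simp
      show "- (pi / 2) \<le> 2 * pi * (v $ i - v0 $ i)" using mult_left_mono[OF b(2), of "2 * pi"] by simp
    qed
    then show ?thesis unfolding T_def using \<eta> by (intro add_nonneg_nonneg divide_nonneg_nonneg sum_nonneg) auto
  qed
  have "open {v. T v > 1 + \<eta> / 2}" by (intro open_Collect_less continuous_intros Tc)
  moreover have "T v0 > 1 + \<eta> / 2" using \<eta> by (simp add: T_def)
  ultimately obtain \<epsilon> where \<epsilon>: "\<epsilon> > 0" "\<And>v. dist v v0 < \<epsilon> \<Longrightarrow> T v > 1 + \<eta> / 2"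
    unfolding open_dist by blast
  define r where "r = min d \<epsilon>"
  have r: "r > 0" using d \<epsilon> by (simp add: r_def)
  let ?V = "ball v0 r"
  have VU: "v \<in> U d" "v \<in> unit_cube" "T v > 1 + \<eta> / 2" if "v \<in> ?V" for v
  proof -
    have "\<bar>v $ i - v0 $ i\<bar> < d" for i
    proof -
      have "\<bar>(v - v0) $ i\<bar> \<le> norm (v - v0)" by (rule component_le_norm_cart)
      then show ?thesis using that by (simp add: r_def dist_norm norm_minus_commute)
    qed
    then show "v \<in> U d" by (simp add: U_def)
    then have "\<bar>v $ i - v0 $ i\<bar> < d" for i by (simp add: U_def)
    then show "v \<in> unit_cube" using d4(3,4) by (auto simp: unit_cube_def abs_less_iff) (smt (verit))+
    show "T v > 1 + \<eta> / 2" using that by (intro \<epsilon>(2)) (simp add: r_def dist_commute)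
  qed
  obtain B where B: "\<And>v. v \<in> unit_cube \<Longrightarrow> \<bar>h v\<bar> \<le> B"
  proof -
    have "compact (h ` cbox 0 1)" by (intro compact_continuous_image continuous_on_subset[OF hc]) auto
    then obtain B where "\<forall>x\<in>h ` cbox 0 1. norm x \<le> B" using compact_imp_bounded bounded_iff by blast
    then show thesis using unit_cube_subset by (intro that[of B]) auto
  qed
  have B0: "B \<ge> 0" using B[of v0] VU(2)[of v0] r by force
  let ?vol = "measure lborel ?V"
  let ?I = "indicator unit_cube :: real^'n \<Rightarrow> real"
  let ?vC = "measure lborel (unit_cube :: (real^'n) set)"
  have vol: "?vol > 0" using r by (simp add: content_ball_pos)
  \<comment> \<open>Near \<open>v0\<close> the integrand is at least
    \<open>a * (1 + \<eta> / 2) ^ N\<close>, on the rest of the box it is nonnegative, and elsewhere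
    on the cube it is at least \<open>- B\<close>; yet its integral is zero for every
    \<open>N\<close>.\<close>
  have upper: "a * (1 + \<eta> / 2) ^ N * ?vol \<le> B * ?vC" for N
  proof -
    have "(LINT v:unit_cube|lborel. D v * complex_of_real (T v) ^ N) = 0"
      by (intro trig_poly_orthogonal[OF D zero] trig_poly_power Ttrig)
    moreover have "(LINT v:unit_cube|lborel. c * (D v * complex_of_real (T v) ^ N)) = c * (LINT v:unit_cube|lborel. D v * complex_of_real (T v) ^ N)"
      by (rule set_integral_mult_right)
    ultimately have z: "(LINT v:unit_cube|lborel. (c * D v) * complex_of_real (T v) ^ N) = 0" by (simp add: mult_ac)
    have int: "integrable lborel (\<lambda>v. ?I v *\<^sub>R ((c * D v) * complex_of_real (T v) ^ N))"
      using set_integrable_cube[of "\<lambda>v. (c * D v) * complex_of_real (T v) ^ N"]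
      unfolding set_integrable_def by (simp add: continuous_intros D Tc)
    have re: "Re (?I v *\<^sub>R ((c * D v) * complex_of_real (T v) ^ N)) = ?I v * (h v * T v ^ N)" for v
      by (simp add: h_def flip: of_real_power)
    have int': "integrable lborel (\<lambda>v. ?I v * (h v * T v ^ N))"
      using integrable_Re[OF int] by (simp only: re)
    have "(\<integral>v. ?I v * (h v * T v ^ N) \<partial>lborel) = Re (\<integral>v. ?I v *\<^sub>R ((c * D v) * complex_of_real (T v) ^ N) \<partial>lborel)"
      using integral_Re[OF int] by (simp only: re)
    then have zero': "(\<integral>v. ?I v * (h v * T v ^ N) \<partial>lborel) = 0" using z by (simp add: set_lebesgue_integral_def)
    have iV: "integrable lborel (\<lambda>v. a * (1 + \<eta> / 2) ^ N * indicator ?V v)"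
      by (intro integrable_mult_right integrable_real_indicator) (use emeasure_bounded_finite[OF bounded_ball] in auto)
    have iC: "integrable lborel (\<lambda>v. B * ?I v)"
      using emeasure_unit_cube_finite by (intro integrable_mult_right integrable_real_indicator) auto
    have "(\<integral>v. a * (1 + \<eta> / 2) ^ N * indicator ?V v - B * ?I v \<partial>lborel) \<le> (\<integral>v. ?I v * (h v * T v ^ N) \<partial>lborel)"
    proof (rule integral_mono[OF Bochner_Integration.integrable_diff[OF iV iC] int'])
      fix v
      show "a * (1 + \<eta> / 2) ^ N * indicator ?V v - B * ?I v \<le> ?I v * (h v * T v ^ N)"
      proof (cases "v \<in> unit_cube")
        case False
        then have "v \<notin> ?V" using VU(2) by blast
        then show ?thesis using False by simp
      next
        case True
        note C = this
        show ?thesis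
        proof (cases "v \<in> U d")
          case True
          have hp: "h v * T v ^ N \<ge> 0" using hU[OF True] a T_U[OF True] by (intro mult_nonneg_nonneg) auto
          show ?thesis
          proof (cases "v \<in> ?V")
            case True
            have "a * (1 + \<eta> / 2) ^ N \<le> h v * T v ^ N"
              using hU[OF VU(1)[OF True]] VU(3)[OF True] a \<eta> by (intro mult_mono power_mono) auto
            then show ?thesis using True C B0 by simp
          qed (use C B0 hp in simp)
        next
          case False
          then have "v \<notin> ?V" using VU(1) by blast
          have "\<bar>h v * T v ^ N\<bar> \<le> B * 1"
            unfolding abs_mult power_abs using B[OF C] T_far[OF C False] B0 by (intro mult_mono power_le_one) auto
          then show ?thesis using C \<open>v \<notin> ?V\<close> by (simp add: abs_le_iff)
        qed
      qed
    qed
    also have "(\<integral>v. a * (1 + \<eta> / 2) ^ N * indicator ?V v - B * ?I v \<partial>lborel) = a * (1 + \<eta> / 2) ^ N * ?vol - B * ?vC"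
      by (subst Bochner_Integration.integral_diff[OF iV iC]) simp
    finally show ?thesis using zero' by simp
  qed
  obtain N where "B * ?vC / (a * ?vol) < (1 + \<eta> / 2) ^ N"
    using real_arch_pow[of "1 + \<eta> / 2"] \<eta> by auto
  then have "B * ?vC < (1 + \<eta> / 2) ^ N * (a * ?vol)" using a vol by (simp add: pos_divide_less_eq)
  then show False using upper[of N] by (simp add: mult_ac)
qed

text \<open>Continuity extends the vanishing from the open cube to its closure, and periodicity to
  the whole space.\<close>

lemma fourier_coefficients_zero:
  fixes D :: "real^'n \<Rightarrow> complex"
  assumes D: "continuous_on UNIV D" and per: "\<And>v k. k \<in> int_vecs \<Longrightarrow> D (v + k) = D v"
    and zero: "\<And>l. l \<in> int_vecs \<Longrightarrow> (LINT v:unit_cube|lborel. D v * ex2pi (l \<bullet> v)) = 0"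
  shows "D v = 0"
proof -
  have closed: "closed {v. D v = 0}" by (intro closed_Collect_eq continuous_intros D)
  have "box 0 1 \<subseteq> {v. D v = 0}"
    using fourier_coefficients_zero_interior[OF D zero] by (auto simp: mem_box_cart)
  then have "closure (box 0 (1 :: real^'n)) \<subseteq> {v. D v = 0}" by (rule closure_minimal[OF _ closed])
  moreover have "closure (box 0 (1 :: real^'n)) = cbox 0 1" by (intro closure_box) (auto simp: box_ne_empty Basis_vec_def inner_axis)
  ultimately have c: "cbox 0 1 \<subseteq> {v. D v = 0}" by simp
  let ?k = "(\<chi> i. - of_int \<lfloor>v $ i\<rfloor>) :: real^'n"
  have k: "?k \<in> int_vecs" by (simp add: int_vecs_def)
  have "v + ?k \<in> cbox 0 1" by (simp add: mem_box_cart frac_def[symmetric] frac_lt_1 less_imp_le)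
  then have "D (v + ?k) = 0" using c by blast
  then show ?thesis using per[OF k] by simp
qed

declare transpose_matrix_vector [simp del]

section \<open>The Poisson summation formula\<close>

lemma continuous_on_infsum:
  fixes g :: "'k \<Rightarrow> 'a::real_normed_vector \<Rightarrow> 'b::banach"
  assumes cont: "\<And>k. k \<in> Z \<Longrightarrow> continuous_on UNIV (g k)"
    and bd: "\<And>R. \<exists>B. B summable_on Z \<and> (\<forall>k\<in>Z. \<forall>v. norm v \<le> R \<longrightarrow> norm (g k v) \<le> B k)"
  shows "continuous_on UNIV (\<lambda>v. infsum (\<lambda>k. g k v) Z)"
proof -
  have "isCont (\<lambda>v. infsum (\<lambda>k. g k v) Z) v0" for v0
  proof -
    let ?S = "ball (0::'a) (norm v0 + 1)"
    obtain B where B: "B summable_on Z" "\<forall>k\<in>Z. \<forall>v. norm v \<le> norm v0 + 1 \<longrightarrow> norm (g k v) \<le> B k"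
      using bd by blast
    have "uniform_limit ?S (\<lambda>X v. \<Sum>k\<in>X. g k v) (\<lambda>v. infsum (\<lambda>k. g k v) Z) (finite_subsets_at_top Z)"
      by (rule Weierstrass_m_test_general[OF _ B(1)]) (use B(2) in auto)
    moreover have "\<forall>\<^sub>F X in finite_subsets_at_top Z. continuous_on ?S (\<lambda>v. \<Sum>k\<in>X. g k v)"
    proof (rule eventually_finite_subsets_at_top_weakI)
      fix X assume "finite X" "X \<subseteq> Z"
      then show "continuous_on ?S (\<lambda>v. \<Sum>k\<in>X. g k v)"
        by (intro continuous_on_sum continuous_on_subset[OF cont]) auto
    qed
    ultimately have "continuous_on ?S (\<lambda>v. infsum (\<lambda>k. g k v) Z)"
      by (intro uniform_limit_theorem) auto
    then show ?thesis by (simp add: continuous_on_eq_continuous_at)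
  qed
  then show ?thesis by (simp add: continuous_at_imp_continuous_on)
qed

text \<open>It lets the Gaussian at \<open>v + k\<close> decay in \<open>k\<close> uniformly for
  bounded \<open>v\<close>, at the price of half the exponent.\<close>

lemma norm_add_square_lower: "(norm (x + y :: 'a::real_inner))\<^sup>2 \<ge> (norm x)\<^sup>2 / 2 - (norm y)\<^sup>2"
proof -
  have "norm x \<le> norm (x + y) + norm y" by (metis add_diff_cancel norm_triangle_ineq4)
  then have "(norm x)\<^sup>2 \<le> (norm (x + y) + norm y)\<^sup>2" by (intro power_mono) auto
  also have "\<dots> \<le> 2 * (norm (x + y))\<^sup>2 + 2 * (norm y)\<^sup>2"
    using sum_squares_bound[of "norm (x + y)" "norm y"] by (simp add: power2_eq_square algebra_simps)
  finally show ?thesis by simp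
qed

lemma summable_gaussian_int_vecs:
  fixes A :: "real^'n^'n"
  assumes A: "invertible A" and c: "c > 0"
  shows "(\<lambda>k. exp (- c * (norm (A *v k))\<^sup>2)) summable_on int_vecs"
proof -
  obtain Ai where Ai: "Ai ** A = mat 1" using A by (auto simp: invertible_def)
  have inj: "inj_on (\<lambda>z. A *v z) int_vecs"
    by (rule inj_on_inverseI[of _ "\<lambda>z. Ai *v z"]) (simp add: matrix_vector_mul_assoc Ai)
  have "full_rank_lattice ((\<lambda>z. A *v z) ` int_vecs)" unfolding full_rank_lattice_def using A by blast
  from lattice_exp_summable[OF this c, of 0] show ?thesis
    unfolding summable_on_reindex[OF inj] by (simp add: o_def power2_norm_eq_inner)
qed

lemma inj_on_matrix_left_inverse:
  fixes A B :: "real^'n^'n"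
  assumes "B ** A = mat 1"
  shows "inj_on (\<lambda>z. A *v z) S"
proof (rule inj_on_inverseI)
  fix x show "B *v (A *v x) = x" by (simp add: matrix_vector_mul_assoc assms)
qed

lemma scaleR_matrix_mult:
  fixes A :: "real^'n^'m" and B :: "real^'k^'n"
  shows "(a *\<^sub>R A) ** (b *\<^sub>R B) = (a * b) *\<^sub>R (A ** B)"
  by (simp add: matrix_matrix_mult_def vec_eq_iff sum_distrib_left mult_ac)

text \<open>\<open>F\<close> periodises the Gaussian and \<open>G\<close> is the Fourier series with
  the expected coefficients; both are continuous and periodic. The coefficients of \<open>F\<close>
  come from unfolding the sum over the cube into an integral over the space, those of
  \<open>G\<close> from orthogonality, and a continuous periodic function is determined by its
  coefficients.\<close>

theorem gaussian_poisson_summation: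
  fixes A Ai :: "real^'n::{finite,wellorder}^'n::_"
  assumes Ai: "A ** Ai = mat 1" "Ai ** A = mat 1"
  shows "infsum (\<lambda>k. complex_of_real (exp (- pi * (norm (A *v (v + k)))\<^sup>2))) int_vecs
    = infsum (\<lambda>l. complex_of_real (exp (- pi * (norm (transpose Ai *v l))\<^sup>2)) * ex2pi (l \<bullet> v)) int_vecs / of_real \<bar>det A\<bar>"
proof -
  have A: "invertible A" and Ait: "invertible (transpose Ai)"
    using Ai by (auto simp: invertible_def) (metis matrix_transpose_mul transpose_mat)
  define f where "f x = complex_of_real (exp (- pi * (norm (A *v x))\<^sup>2))" for x
  define c where "c l = complex_of_real (exp (- pi * (norm (transpose Ai *v l))\<^sup>2) / \<bar>det A\<bar>)" for l
  define F where "F v = infsum (\<lambda>k. f (v + k)) int_vecs" for v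
  define G where "G v = infsum (\<lambda>l. c l * ex2pi (l \<bullet> v)) int_vecs" for v
  have fc: "continuous_on UNIV (\<lambda>v. f (v + k))" for k
    unfolding f_def by (intro continuous_intros linear_continuous_on matrix_vector_mul_bounded_linear
      continuous_on_compose2[OF linear_continuous_on[OF matrix_vector_mul_bounded_linear]]) auto
  have fbd: "norm (f (v + k)) \<le> exp (pi * (norm A * R)\<^sup>2) * exp (- (pi / 2) * (norm (A *v k))\<^sup>2)" if "norm v \<le> R" for v k R
  proof -
    have "norm (A *v v) \<le> norm A * R"
      using norm_matrix_vector_mult_le[of A v] mult_left_mono[OF that, of "norm A"] by simp
    then have "(norm (A *v v))\<^sup>2 \<le> (norm A * R)\<^sup>2" by (intro power_mono) auto
    moreover have "(norm (A *v (v + k)))\<^sup>2 \<ge> (norm (A *v k))\<^sup>2 / 2 - (norm (A *v v))\<^sup>2"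
      using norm_add_square_lower[of "A *v k" "A *v v"] by (simp add: matrix_vector_right_distrib add.commute)
    ultimately have "(norm (A *v k))\<^sup>2 / 2 - (norm A * R)\<^sup>2 \<le> (norm (A *v (v + k)))\<^sup>2" by linarith
    then have "pi * ((norm (A *v k))\<^sup>2 / 2 - (norm A * R)\<^sup>2) \<le> pi * (norm (A *v (v + k)))\<^sup>2" by (intro mult_left_mono) auto
    then show ?thesis by (simp add: f_def exp_add[symmetric] algebra_simps)
  qed
  have fsum: "(\<lambda>k. exp (pi * (norm A * R)\<^sup>2) * exp (- (pi / 2) * (norm (A *v k))\<^sup>2)) summable_on int_vecs" for R
    by (intro summable_on_cmult_right summable_gaussian_int_vecs A) auto
  have nc: "norm (c l) = exp (- pi * (norm (transpose Ai *v l))\<^sup>2) / \<bar>det A\<bar>" for l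
    unfolding c_def norm_of_real by simp
  have csum: "(\<lambda>l. norm (c l)) summable_on int_vecs"
    unfolding nc divide_inverse by (intro summable_on_cmult_left summable_gaussian_int_vecs Ait) auto
  have Fc: "continuous_on UNIV F" unfolding F_def
    by (rule continuous_on_infsum[OF fc]) (use fbd fsum in blast)
  have Gc: "continuous_on UNIV G" unfolding G_def
  proof (rule continuous_on_infsum)
    show "continuous_on UNIV (\<lambda>v. c l * ex2pi (l \<bullet> v))" for l by (intro continuous_intros)
    show "\<exists>B. B summable_on int_vecs \<and> (\<forall>k\<in>int_vecs. \<forall>v. norm v \<le> R \<longrightarrow> norm (c k * ex2pi (k \<bullet> v)) \<le> B k)" for R
      using csum by (intro exI[of _ "\<lambda>l. norm (c l)"]) (simp add: norm_mult)
  qed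
  have intl: "l \<bullet> k \<in> \<int>" if "l \<in> int_vecs" "k \<in> int_vecs" for l k :: "real^'n::_"
    using that by (auto simp: int_vecs_def inner_vec_def intro!: Ints_sum Ints_mult)
  have Fper: "F (v + k) = F v" if k: "k \<in> int_vecs" for v k
  proof -
    have "bij_betw (\<lambda>j. k + j) int_vecs int_vecs"
      by (rule bij_betwI[of _ _ _ "\<lambda>j. j - k"]) (auto intro: k add_in_int_vecs diff_in_int_vecs)
    from infsum_reindex_bij_betw[OF this, of "\<lambda>j. f (v + j)"] show ?thesis by (simp add: F_def add.assoc)
  qed
  have Gper: "G (v + k) = G v" if k: "k \<in> int_vecs" for v k
    unfolding G_def by (intro infsum_cong) (simp add: inner_add_right ex2pi_add ex2pi_Ints intl k)
  have cubeR: "norm v \<le> real CARD('n)" if "v \<in> unit_cube" for v :: "real^'n::_"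
  proof -
    have "norm v \<le> (\<Sum>i\<in>UNIV. \<bar>v $ i\<bar>)" by (rule norm_le_l1_cart)
    also have "\<dots> \<le> (\<Sum>i\<in>(UNIV::'n set). 1)" using that by (intro sum_mono) (auto simp: unit_cube_def less_imp_le)
    finally show ?thesis by simp
  qed
  have coeffF: "(LINT v:unit_cube|lborel. F v * ex2pi (l \<bullet> v)) = c l" if l: "l \<in> int_vecs" for l
  proof -
    define b where "b = transpose Ai *v l"
    define \<gamma> where "\<gamma> y = complex_of_real (exp (- pi * (y \<bullet> y))) * ex2pi (b \<bullet> y)" for y
    have "b \<bullet> (A *v x) = l \<bullet> x" for x
    proof -
      have "b \<bullet> (A *v x) = l \<bullet> (Ai *v (A *v x))" by (simp add: b_def inner_matrix_vector transpose_transpose)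
      then show ?thesis by (simp add: matrix_vector_mul_assoc Ai)
    qed
    then have h: "f x * ex2pi (l \<bullet> x) = \<gamma> (A *v x)" for x by (simp add: f_def \<gamma>_def power2_norm_eq_inner)
    have i\<gamma>: "integrable lborel \<gamma>" unfolding \<gamma>_def by (rule integrable_gaussian_cart)
    \<comment> \<open>\<open>l \<bullet> k\<close> is an integer, so the character may as well be
      evaluated at \<open>v + k\<close>; in this form the sum unfolds.\<close>
    have shift: "f (v + k) * ex2pi (l \<bullet> v) = \<gamma> (A *v (v + k))" if "k \<in> int_vecs" for v k
      unfolding h[symmetric] using that l by (simp add: inner_add_right ex2pi_add ex2pi_Ints intl)
    have ci: "continuous_on UNIV (\<lambda>v. f (v + k) * ex2pi (l \<bullet> v))" for k by (intro continuous_intros fc)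
    have ni: "norm (f (v + k) * ex2pi (l \<bullet> v)) \<le> exp (pi * (norm A * real CARD('n))\<^sup>2) * exp (- (pi / 2) * (norm (A *v k))\<^sup>2)"
      if "v \<in> unit_cube" for v k using fbd[OF cubeR[OF that]] by (simp add: norm_mult)
    note swap = cube_integral_infsum[OF ci ni fsum]
    have "(LINT v:unit_cube|lborel. F v * ex2pi (l \<bullet> v)) = (LINT v:unit_cube|lborel. infsum (\<lambda>k. f (v + k) * ex2pi (l \<bullet> v)) int_vecs)"
      by (simp add: F_def infsum_cmult_left')
    also have "\<dots> = infsum (\<lambda>k. LINT v:unit_cube|lborel. f (v + k) * ex2pi (l \<bullet> v)) int_vecs" by (rule swap(1))
    also have "\<dots> = infsum (\<lambda>k. LINT v:unit_cube|lborel. \<gamma> (A *v (v + k))) int_vecs"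
      by (intro infsum_cong) (simp add: shift)
    also have "\<dots> = (\<integral>v. \<gamma> (A *v v) \<partial>lborel)"
    proof (rule cube_unfolding)
      show "integrable lborel (\<lambda>v. \<gamma> (A *v v))" by (rule integrable_linear_image[OF A i\<gamma>])
      show "(\<lambda>k. norm (LINT v:unit_cube|lborel. \<gamma> (A *v (v + k)))) summable_on int_vecs"
        using swap(2) by (simp add: shift cong: summable_on_cong)
    qed
    also have "\<dots> = (\<integral>v. \<gamma> v \<partial>lborel) / of_real \<bar>det A\<bar>" by (rule integral_linear_image[OF A i\<gamma>])
    also have "(\<integral>v. \<gamma> v \<partial>lborel) = of_real (exp (- pi * (b \<bullet> b)))" unfolding \<gamma>_def by (rule integral_gaussian_cart)
    finally show ?thesis by (simp add: c_def b_def power2_norm_eq_inner)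
  qed
  have coeffG: "(LINT v:unit_cube|lborel. G v * ex2pi (l \<bullet> v)) = c l" if l: "l \<in> int_vecs" for l
  proof -
    have e: "c k * ex2pi (k \<bullet> v) * ex2pi (l \<bullet> v) = c k * ex2pi ((k + l) \<bullet> v)" for k v
      by (simp add: inner_add_left ex2pi_add mult_ac)
    have ml: "- l \<in> int_vecs" using diff_in_int_vecs[OF zero_in_int_vecs l] by simp
    have "(LINT v:unit_cube|lborel. G v * ex2pi (l \<bullet> v)) = (LINT v:unit_cube|lborel. infsum (\<lambda>k. c k * ex2pi ((k + l) \<bullet> v)) int_vecs)"
      by (simp add: G_def infsum_cmult_left'[symmetric] e)
    also have "\<dots> = infsum (\<lambda>k. LINT v:unit_cube|lborel. c k * ex2pi ((k + l) \<bullet> v)) int_vecs"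
      by (rule cube_integral_infsum(1)[OF _ _ csum]) (auto intro!: continuous_intros simp: norm_mult)
    also have "\<dots> = infsum (\<lambda>k. if k = - l then c k else 0) int_vecs"
    proof (rule infsum_cong)
      fix k :: "real^'n::_" assume k: "k \<in> int_vecs"
      have "(LINT v:unit_cube|lborel. c k * ex2pi ((k + l) \<bullet> v)) = c k * (LINT v:unit_cube|lborel. ex2pi ((k + l) \<bullet> v))"
        by (rule set_integral_mult_right)
      also have "\<dots> = c k * (if k + l = 0 then 1 else 0)" by (subst cube_integral_ex2pi[OF add_in_int_vecs[OF k l]]) simp
      also have "\<dots> = (if k = - l then c k else 0)" by (simp add: eq_neg_iff_add_eq_0)
      finally show "(LINT v:unit_cube|lborel. c k * ex2pi ((k + l) \<bullet> v)) = (if k = - l then c k else 0)" .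
    qed
    also have "\<dots> = infsum c {- l}" using ml by (intro infsum_cong_neutral) auto
    \<comment> \<open>Pairing with \<open>ex2pi (l \<bullet> v)\<close> instead of its conjugate
      picks out the coefficient at \<open>- l\<close>, which equals that at \<open>l\<close> because
      the Gaussian is even.\<close>
    also have "\<dots> = c l" using linear_neg[OF matrix_vector_mul_linear[of "transpose Ai"], of l] by (simp add: c_def)
    finally show ?thesis .
  qed
  have "F v - G v = 0"
  proof (rule fourier_coefficients_zero[of "\<lambda>v. F v - G v"])
    show "continuous_on UNIV (\<lambda>v. F v - G v)" by (intro continuous_intros Fc Gc)
    show "F (v + k) - G (v + k) = F v - G v" if "k \<in> int_vecs" for v k using that by (simp add: Fper Gper)
    fix l :: "real^'n::_" assume l: "l \<in> int_vecs"
    have "(LINT v:unit_cube|lborel. F v * ex2pi (l \<bullet> v) - G v * ex2pi (l \<bullet> v)) = (LINT v:unit_cube|lborel. F v * ex2pi (l \<bullet> v)) - (LINT v:unit_cube|lborel. G v * ex2pi (l \<bullet> v))"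
      by (intro set_integral_diff set_integrable_cube continuous_intros Fc Gc)
    then show "(LINT v:unit_cube|lborel. (F v - G v) * ex2pi (l \<bullet> v)) = 0"
      using coeffF[OF l] coeffG[OF l] by (simp add: left_diff_distrib)
  qed
  then have "F v = G v" by simp
  also have "G v = infsum (\<lambda>l. (complex_of_real (exp (- pi * (norm (transpose Ai *v l))\<^sup>2)) * ex2pi (l \<bullet> v)) / of_real \<bar>det A\<bar>) int_vecs"
    unfolding G_def by (intro infsum_cong) (simp add: c_def)
  also have "\<dots> = infsum (\<lambda>l. complex_of_real (exp (- pi * (norm (transpose Ai *v l))\<^sup>2)) * ex2pi (l \<bullet> v)) int_vecs / of_real \<bar>det A\<bar>"
    by (simp add: divide_inverse infsum_cmult_left')
  finally show ?thesis by (simp add: F_def f_def)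
qed

definition self_dual :: "(real^'n) set \<Rightarrow> bool" where
  "self_dual L \<longleftrightarrow> full_rank_lattice L \<and> (\<forall>x. x \<in> L \<longleftrightarrow> (\<forall>y\<in>L. x \<bullet> y \<in> \<int>))"

text \<open>\<open>transpose Ai\<close> is the basis dual to \<open>A\<close>, so it generates the
  dual lattice, which is \<open>L\<close> itself. Hence both Gram determinants are integers, and
  their product is 1.\<close>

lemma self_dual_basis:
  fixes A Ai :: "real^'n^'n"
  assumes sd: "self_dual L" and LA: "L = (\<lambda>z. A *v z) ` int_vecs"
    and Ai: "A ** Ai = mat 1" "Ai ** A = mat 1"
  shows "(\<lambda>z. transpose Ai *v z) ` int_vecs = L" and "\<bar>det A\<bar> = 1"
proof -
  have dual: "(transpose Ai *v l) \<bullet> (A *v k) = l \<bullet> k" for l k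
    by (simp add: inner_matrix_vector transpose_transpose matrix_vector_mul_assoc Ai)
  have int: "l \<bullet> k \<in> \<int>" if "l \<in> int_vecs" "k \<in> int_vecs" for l k :: "real^'n"
    using that by (auto simp: int_vecs_def inner_vec_def intro!: Ints_sum Ints_mult)
  have memL: "x \<in> L \<longleftrightarrow> (\<forall>y\<in>L. x \<bullet> y \<in> \<int>)" for x using sd unfolding self_dual_def by blast
  show eq: "(\<lambda>z. transpose Ai *v z) ` int_vecs = L"
  proof (intro antisym subsetI)
    fix x assume "x \<in> (\<lambda>z. transpose Ai *v z) ` int_vecs"
    then have "\<forall>y\<in>L. x \<bullet> y \<in> \<int>" by (auto simp: LA dual int)
    then show "x \<in> L" by (rule memL[THEN iffD2])
  next
    fix x assume x: "x \<in> L"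
    have "(transpose A *v x) $ i \<in> \<int>" for i
    proof -
      have "(transpose A *v x) $ i = x \<bullet> (A *v axis i 1)"
        by (simp add: inner_commute[of x] inner_matrix_vector inner_axis')
      moreover have "A *v axis i 1 \<in> L" unfolding LA by (intro imageI) (simp add: int_vecs_def axis_def)
      ultimately show ?thesis using memL[THEN iffD1, OF x] by simp
    qed
    then have "transpose A *v x \<in> int_vecs" by (simp add: int_vecs_def)
    moreover have "x = transpose Ai *v (transpose A *v x)"
      by (simp add: matrix_vector_mul_assoc matrix_transpose_mul[symmetric] Ai)
    ultimately show "x \<in> (\<lambda>z. transpose Ai *v z) ` int_vecs" by (rule rev_image_eqI)
  qed
  have ent: "P \<in> \<int>" if "P = (A *v axis i 1) \<bullet> (A *v axis j 1)" for P i j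
  proof -
    have "A *v axis k 1 \<in> L" for k unfolding LA by (intro imageI) (simp add: int_vecs_def axis_def)
    then show ?thesis using memL that by blast
  qed
  have ent': "P \<in> \<int>" if "P = (transpose Ai *v axis i 1) \<bullet> (transpose Ai *v axis j 1)" for P i j
  proof -
    have "transpose Ai *v axis k 1 \<in> L" for k unfolding eq[symmetric] by (intro imageI) (simp add: int_vecs_def axis_def)
    then show ?thesis using memL that by blast
  qed
  have gram: "(det P)\<^sup>2 \<in> \<int>" if "\<And>i j. (P *v axis i 1) \<bullet> (P *v axis j 1) \<in> \<int>" for P :: "real^'n^'n"
  proof -
    have "(transpose P ** P) $ i $ j = (P *v axis i 1) \<bullet> (P *v axis j 1)" for i j
      by (simp add: matrix_vector_mult_basis column_def matrix_matrix_mult_def transpose_def inner_vec_def)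
    then have "det (transpose P ** P) \<in> \<int>" using that by (intro Ints_det) auto
    then show ?thesis by (simp add: det_mul det_transpose power2_eq_square)
  qed
  have d1: "(det A)\<^sup>2 \<in> \<int>" by (rule gram, rule ent, rule refl)
  have "(det (transpose Ai))\<^sup>2 \<in> \<int>" by (rule gram, rule ent', rule refl)
  then have d2: "(det Ai)\<^sup>2 \<in> \<int>" by (simp add: det_transpose)
  have "det A * det Ai = 1" using Ai(1) by (metis det_I det_mul)
  then have prod: "(det A)\<^sup>2 * (det Ai)\<^sup>2 = 1" by (metis power_mult_distrib power_one)
  obtain a b :: int where ab: "(det A)\<^sup>2 = of_int a" "(det Ai)\<^sup>2 = of_int b" using d1 d2 by (auto elim!: Ints_cases)
  have "a * b = 1" using prod unfolding ab by (metis of_int_eq_1_iff of_int_mult)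
  moreover have "a \<ge> 0" using ab(1) by (metis of_int_0_le_iff zero_le_power2)
  ultimately have "a = 1" using zmult_eq_1_iff by fastforce
  then show "\<bar>det A\<bar> = 1" using ab(1) by (simp add: abs_square_eq_1)
qed

text \<open>Poisson summation for the basis \<open>sqrt t *\<^sub>R A\<close>: its dual basis
  generates \<open>L\<close> scaled by \<open>1 / sqrt t\<close>.\<close>

theorem self_dual_theta_shift:
  fixes L :: "(real^'n::{finite,wellorder}) set"
  assumes sd: "self_dual L" and t: "t > 0"
  shows "infsum (\<lambda>x. complex_of_real (exp (- pi * t * (norm (x + u))\<^sup>2))) L
    = infsum (\<lambda>y. complex_of_real (exp (- pi / t * (norm y)\<^sup>2)) * ex2pi (y \<bullet> u)) L / of_real (sqrt t ^ CARD('n))"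
proof -
  obtain A :: "real^'n::_^'n::_" where A: "invertible A" and LA: "L = (\<lambda>z. A *v z) ` int_vecs"
    using sd by (auto simp: self_dual_def full_rank_lattice_def)
  then obtain Ai where Ai: "A ** Ai = mat 1" "Ai ** A = mat 1" by (auto simp: invertible_def)
  note sdb = self_dual_basis[OF sd LA Ai]
  define s where "s = sqrt t"
  have s: "s > 0" "s\<^sup>2 = t" using t by (auto simp: s_def)
  let ?A = "s *\<^sub>R A" and ?Ai = "(1 / s) *\<^sub>R Ai"
  have Ai': "?A ** ?Ai = mat 1" "?Ai ** ?A = mat 1"
    using s by (simp_all add: scaleR_matrix_mult Ai)
  let ?v = "Ai *v u"
  have inj1: "inj_on (\<lambda>z. A *v z) int_vecs" by (rule inj_on_matrix_left_inverse[OF Ai(2)])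
  have "transpose A ** transpose Ai = mat 1" by (simp add: matrix_transpose_mul[symmetric] Ai)
  then have inj2: "inj_on (\<lambda>z. transpose Ai *v z) int_vecs" by (rule inj_on_matrix_left_inverse)
  have lhs: "(norm (?A *v (?v + k)))\<^sup>2 = t * (norm (A *v k + u))\<^sup>2" for k
  proof -
    have "?A *v (?v + k) = s *\<^sub>R (A *v k + u)"
    proof -
      have "?A *v (?v + k) = s *\<^sub>R (A *v (?v + k))" by (simp only: scaleR_matrix_vector_assoc)
      also have "A *v (?v + k) = A *v k + u" by (simp add: matrix_vector_right_distrib matrix_vector_mul_assoc Ai)
      finally show ?thesis .
    qed
    then show ?thesis using s by (simp add: power_mult_distrib)
  qed
  have rhs1: "(norm (transpose ?Ai *v l))\<^sup>2 = (norm (transpose Ai *v l))\<^sup>2 / t" for l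
  proof -
    have "transpose ?Ai = (1 / s) *\<^sub>R transpose Ai" by (simp add: transpose_def vec_eq_iff)
    then show ?thesis using s by (simp add: scaleR_matrix_vector_assoc[symmetric] power_divide)
  qed
  have rhs2: "l \<bullet> ?v = (transpose Ai *v l) \<bullet> u" for l by (simp add: inner_matrix_vector transpose_transpose)
  have det: "\<bar>det ?A\<bar> = sqrt t ^ CARD('n)" using s sdb(2) by (simp add: det_scaleR abs_mult s_def)
  have "infsum (\<lambda>x. complex_of_real (exp (- pi * t * (norm (x + u))\<^sup>2))) L
     = infsum (\<lambda>k. complex_of_real (exp (- pi * (norm (?A *v (?v + k)))\<^sup>2))) int_vecs"
    unfolding LA infsum_reindex[OF inj1] lhs by (simp add: o_def mult.assoc)
  also have "\<dots> = infsum (\<lambda>l. complex_of_real (exp (- pi * (norm (transpose ?Ai *v l))\<^sup>2)) * ex2pi (l \<bullet> ?v)) int_vecs / of_real \<bar>det ?A\<bar>"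
    by (rule gaussian_poisson_summation[OF Ai'])
  also have "infsum (\<lambda>l. complex_of_real (exp (- pi * (norm (transpose ?Ai *v l))\<^sup>2)) * ex2pi (l \<bullet> ?v)) int_vecs
     = infsum (\<lambda>y. complex_of_real (exp (- pi / t * (norm y)\<^sup>2)) * ex2pi (y \<bullet> u)) L"
    unfolding sdb(1)[symmetric] infsum_reindex[OF inj2] rhs1 rhs2 by (simp add: o_def)
  finally show ?thesis unfolding det .
qed

section \<open>Theta series with harmonic coefficients\<close>

text \<open>The sum over \<open>X\<close> is exchanged with the exponential series. If two such
  families agree as functions of \<open>s\<close>, their sums weighted by \<open>l x ^ d\<close>
  agree for every \<open>d\<close>; this is how powers are extracted from exponentials.\<close>

lemma
  fixes c l :: "'k \<Rightarrow> complex"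
  assumes sm: "\<And>\<rho>. (\<lambda>x. norm (c x) * exp (\<rho> * norm (l x))) summable_on X"
  shows exp_family_sums: "(\<lambda>d. (infsum (\<lambda>x. c x * l x ^ d) X / fact d) * s ^ d) sums infsum (\<lambda>x. c x * exp (s * l x)) X"
proof -
  define f where "f = (\<lambda>(x, d). c x * ((s * l x) ^ d / fact d))"
  have inner: "((\<lambda>d. (s * l x) ^ d / fact d) has_sum exp (s * l x)) UNIV" for x
  proof (rule norm_summable_imp_has_sum)
    show "summable (\<lambda>d. norm ((s * l x) ^ d / fact d))"
      using summable_norm_exp[of "s * l x"] by (simp add: scaleR_conv_of_real field_simps norm_divide norm_mult)
    show "(\<lambda>d. (s * l x) ^ d / fact d) sums exp (s * l x)"
      using exp_converges[of "s * l x"] by (simp add: scaleR_conv_of_real field_simps)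
  qed
  have nin: "((\<lambda>d. norm (f (x, d))) has_sum norm (c x) * exp (norm s * norm (l x))) UNIV" for x
  proof -
    have "(\<lambda>d. (norm s * norm (l x)) ^ d / fact d) sums exp (norm s * norm (l x))"
      using exp_converges[of "norm s * norm (l x)"] by (simp add: field_simps)
    then have S: "((\<lambda>d. (norm s * norm (l x)) ^ d / fact d) has_sum exp (norm s * norm (l x))) UNIV"
      by (rule sums_nonneg_imp_has_sum) simp
    show ?thesis
      using has_sum_cmult_right[OF S, of "norm (c x)"]
      by (simp add: f_def norm_mult norm_divide norm_power)
  qed
  have "(\<lambda>p. norm (f p)) summable_on (X \<times> UNIV)"
    by (rule summable_on_SigmaI[OF nin sm]) simp
  then have fs: "f summable_on (X \<times> UNIV)" by (rule abs_summable_summable)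
  then have fs': "(\<lambda>(d, x). f (x, d)) summable_on (UNIV \<times> X)"
    by (subst (asm) summable_on_swap) (simp add: case_prod_unfold)
  have row: "infsum (\<lambda>d. f (x, d)) UNIV = c x * exp (s * l x)" for x
    using has_sum_cmult_right[OF inner, of "c x" x] by (simp add: f_def infsumI)
  have col: "infsum (\<lambda>x. f (x, d)) X = (infsum (\<lambda>x. c x * l x ^ d) X / fact d) * s ^ d" for d
  proof -
    have "infsum (\<lambda>x. f (x, d)) X = infsum (\<lambda>x. (s ^ d / fact d) * (c x * l x ^ d)) X"
      by (intro infsum_cong) (simp add: f_def power_mult_distrib)
    also have "\<dots> = (s ^ d / fact d) * infsum (\<lambda>x. c x * l x ^ d) X" by (rule infsum_cmult_right')
    finally show ?thesis by simp
  qed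
  have "(\<lambda>d. infsum (\<lambda>x. f (x, d)) X) summable_on UNIV"
    using summable_on_Sigma_banach[OF fs'] by simp
  then have "((\<lambda>d. infsum (\<lambda>x. f (x, d)) X) has_sum infsum (\<lambda>d. infsum (\<lambda>x. f (x, d)) X) UNIV) UNIV"
    by (rule has_sum_infsum)
  also have "infsum (\<lambda>d. infsum (\<lambda>x. f (x, d)) X) UNIV = infsum (\<lambda>x. infsum (\<lambda>d. f (x, d)) UNIV) X"
    using infsum_swap_banach[of "\<lambda>x d. f (x, d)" X UNIV] fs by simp
  finally show ?thesis unfolding row col by (rule has_sum_imp_sums)
qed

lemma exp_family_holomorphic:
  fixes c l :: "'k \<Rightarrow> complex"
  assumes sm: "\<And>\<rho>. (\<lambda>x. norm (c x) * exp (\<rho> * norm (l x))) summable_on X"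
  shows "(\<lambda>s. infsum (\<lambda>x. c x * exp (s * l x)) X) holomorphic_on UNIV"
proof -
  have h: "(\<lambda>s. infsum (\<lambda>x. c x * exp (s * l x)) X) holomorphic_on ball 0 r" for r
    by (rule power_series_holomorphic[where a = "\<lambda>d. infsum (\<lambda>x. c x * l x ^ d) X / fact d"])
      (use exp_family_sums[OF sm] in simp)
  have "z \<in> (\<Union>r\<in>UNIV. ball (0::complex) r)" for z
    by (rule UN_I[of "norm z + 1"]) auto
  then have "(\<Union>r\<in>UNIV. ball (0::complex) r) = UNIV" by blast
  moreover have "(\<lambda>s. infsum (\<lambda>x. c x * exp (s * l x)) X) holomorphic_on (\<Union>r\<in>UNIV. ball 0 r)"
    by (rule holomorphic_on_UN_open) (use h in auto)
  ultimately show ?thesis by simp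
qed

lemma entire_power_series_unique:
  fixes a b :: "nat \<Rightarrow> complex"
  assumes "\<And>s. (\<lambda>n. a n * s ^ n) sums f s" "\<And>s. (\<lambda>n. b n * s ^ n) sums f s"
  shows "a n = b n"
proof (rule ccontr)
  assume ne: "a n \<noteq> b n"
  have z: "(\<lambda>n. (a n - b n) * s ^ n) sums 0" for s
    using sums_diff[OF assms(1)[of s] assms(2)[of s]] by (simp add: left_diff_distrib)
  have "a 0 - b 0 = 0" using z[of 0] by simp
  then have n: "n > 0" using ne by (cases n) auto
  \<comment> \<open>Zeros of a power series with a nonzero higher coefficient are isolated. The sum
    being the zero function, the conclusion is absurd on a punctured disc.\<close>
  obtain s where s: "0 < s" "\<And>z :: complex. z \<in> cball 0 s - {0} \<Longrightarrow> (0::complex) \<noteq> 0"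
  proof (rule powser_0_nonzero[of 1 0 "\<lambda>n. a n - b n" "\<lambda>_. 0" n])
    show "(\<lambda>n. (a n - b n) * (x - 0) ^ n) sums 0" for x :: complex using z by simp
  qed (use ne n in auto)
  then show False using s(2)[of "of_real s"] by auto
qed

lemma entire_zero_on_reals:
  assumes "f holomorphic_on UNIV" "\<And>x::real. f (of_real x) = 0"
  shows "f z = 0"
proof (rule analytic_continuation[of f UNIV "range complex_of_real" 0])
  have "0 islimpt (complex_of_real ` (UNIV::real set))"
  proof (rule islimptI)
    fix T :: "complex set" assume "0 \<in> T" "open T"
    then obtain e where e: "e > 0" "ball 0 e \<subseteq> T" using openE by blast
    then have "complex_of_real (e / 2) \<in> T" by (intro subsetD[OF e(2)]) simp
    moreover have "complex_of_real (e / 2) \<noteq> 0" using e by simp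
    ultimately show "\<exists>y\<in>range complex_of_real. y \<in> T \<and> y \<noteq> 0" by blast
  qed
  then show "0 islimpt (range complex_of_real)" .
qed (use assms in auto)

section \<open>Inversion of theta series with isotropic weights\<close>

definition cpair :: "real^'n \<Rightarrow> real^'n \<Rightarrow> real^'n \<Rightarrow> complex" where
  "cpair a b x = Complex (x \<bullet> a) (x \<bullet> b)"

lemma norm_cpair_le: "norm (cpair a b x) \<le> (norm a + norm b) * norm x"
proof -
  have "norm (cpair a b x) \<le> \<bar>x \<bullet> a\<bar> + \<bar>x \<bullet> b\<bar>" unfolding cpair_def using cmod_le[of "Complex (x \<bullet> a) (x \<bullet> b)"] by simp
  also have "\<dots> \<le> norm x * norm a + norm x * norm b" by (intro add_mono Cauchy_Schwarz_ineq2)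
  finally show ?thesis by (simp add: algebra_simps)
qed

lemma power_le_fact_exp: "u \<ge> 0 \<Longrightarrow> (u::real) ^ d \<le> fact d * exp u"
proof -
  assume u: "u \<ge> 0"
  have "u ^ d / fact d = (\<Sum>n\<in>{d}. u ^ n / fact n)" by simp
  also have "\<dots> \<le> (\<Sum>n. u ^ n / fact n)"
    using summable_exp[of u] u by (intro sum_le_suminf) (auto simp: field_simps)
  also have "\<dots> = exp u" by (simp add: exp_def scaleR_conv_of_real field_simps)
  finally show ?thesis by (simp add: field_simps)
qed

lemma lattice_gaussian_summable:
  fixes L :: "(real^'n) set"
  assumes L: "full_rank_lattice L" and \<tau>: "\<tau> > 0"
    and g: "\<And>x. x \<in> L \<Longrightarrow> norm (g x) \<le> C * exp (- \<tau> * (norm x)\<^sup>2 + K * norm x)"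
  shows "(\<lambda>x. norm (g x)) summable_on L"
proof (rule summable_on_comparison_test)
  show "(\<lambda>x. C * exp (- \<tau> * (x \<bullet> x) + K * norm x)) summable_on L"
    by (intro summable_on_cmult_right lattice_exp_summable L \<tau>)
qed (use g in \<open>auto simp: power2_norm_eq_inner\<close>)

text \<open>\<open>self_dual_theta_shift\<close> at \<open>u = \<alpha> a + \<beta> b\<close> is an
  identity between functions that are entire in \<alpha> and in \<beta>. It persists at
  \<open>\<beta> = \<i> \<alpha>\<close>, where the prefactor
  \<open>exp (- pi * t * (\<alpha>\<^sup>2 + \<beta>\<^sup>2) * N)\<close> becomes 1 and both sides
  are exponential generating functions of \<open>cpair a b x\<close>. The claim compares
  coefficients of degree \<open>d\<close>.\<close>

lemma theta_isotropic_transform: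
  fixes L :: "(real^'n::{finite,wellorder}) set"
  assumes sd: "self_dual L" and t: "t > 0" and ab: "a \<bullet> b = 0" "a \<bullet> a = b \<bullet> b"
  shows "infsum (\<lambda>x. complex_of_real (exp (- pi / t * (norm x)\<^sup>2)) * cpair a b x ^ d) L
     = of_real (sqrt t ^ CARD('n)) * (\<i> * t) ^ d * infsum (\<lambda>x. complex_of_real (exp (- pi * t * (norm x)\<^sup>2)) * cpair a b x ^ d) L"
proof -
  have frl: "full_rank_lattice L" using sd by (simp add: self_dual_def)
  define w where "w \<tau> x = complex_of_real (exp (- pi * \<tau> * (norm x)\<^sup>2))" for \<tau> and x :: "real^'n::_"
  define \<kappa> where "\<kappa> = (of_real (sqrt t ^ CARD('n)) :: complex)"
  have \<kappa>: "\<kappa> \<noteq> 0" using t by (simp add: \<kappa>_def)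
  have sm: "(\<lambda>x. norm (w \<tau> x * exp (\<beta> * of_real (x \<bullet> e))) * exp (\<rho> * norm (\<mu> * complex_of_real (x \<bullet> e')))) summable_on L"
    if \<tau>: "\<tau> > 0" for \<tau> \<beta> \<rho> \<mu> and e e' :: "real^'n::_"
  proof -
    have "(\<lambda>x. norm (norm (w \<tau> x * exp (\<beta> * of_real (x \<bullet> e))) * exp (\<rho> * norm (\<mu> * complex_of_real (x \<bullet> e'))))) summable_on L"
    proof (rule lattice_gaussian_summable[OF frl, of "pi * \<tau>" _ 1 "norm \<beta> * norm e + \<bar>\<rho>\<bar> * norm \<mu> * norm e'"])
      fix x assume "x \<in> L"
      have 1: "Re (\<beta> * of_real (x \<bullet> e)) \<le> norm \<beta> * norm e * norm x"
      proof -
        have "Re (\<beta> * of_real (x \<bullet> e)) \<le> norm \<beta> * \<bar>x \<bullet> e\<bar>" using complex_Re_le_cmod[of "\<beta> * of_real (x \<bullet> e)"] by (simp add: norm_mult)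
        also have "\<dots> \<le> norm \<beta> * (norm x * norm e)" by (intro mult_left_mono Cauchy_Schwarz_ineq2) auto
        finally show ?thesis by (simp add: mult_ac)
      qed
      have 2: "\<rho> * norm (\<mu> * complex_of_real (x \<bullet> e')) \<le> \<bar>\<rho>\<bar> * norm \<mu> * norm e' * norm x"
      proof -
        have "\<rho> * norm (\<mu> * complex_of_real (x \<bullet> e')) \<le> \<bar>\<rho>\<bar> * (norm \<mu> * \<bar>x \<bullet> e'\<bar>)" by (simp add: norm_mult mult_right_mono)
        also have "\<dots> \<le> \<bar>\<rho>\<bar> * (norm \<mu> * (norm x * norm e'))" by (intro mult_left_mono Cauchy_Schwarz_ineq2) auto
        finally show ?thesis by (simp add: mult_ac)
      qed
      have "norm (norm (w \<tau> x * exp (\<beta> * of_real (x \<bullet> e))) * exp (\<rho> * norm (\<mu> * complex_of_real (x \<bullet> e'))))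
         = exp (- pi * \<tau> * (norm x)\<^sup>2 + Re (\<beta> * of_real (x \<bullet> e)) + \<rho> * norm (\<mu> * complex_of_real (x \<bullet> e')))"
      proof -
        have nw: "norm (w \<tau> x) = exp (- pi * \<tau> * (norm x)\<^sup>2)" by (simp add: w_def)
        show ?thesis
          by (simp only: real_norm_def abs_mult abs_norm_cancel abs_exp_cancel norm_mult nw norm_exp_eq_Re exp_add)
      qed
      also have "\<dots> \<le> exp (- (pi * \<tau>) * (norm x)\<^sup>2 + (norm \<beta> * norm e + \<bar>\<rho>\<bar> * norm \<mu> * norm e') * norm x)"
        using 1 2 by (simp add: algebra_simps)
      finally show "norm (norm (w \<tau> x * exp (\<beta> * of_real (x \<bullet> e))) * exp (\<rho> * norm (\<mu> * complex_of_real (x \<bullet> e'))))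
         \<le> 1 * exp (- (pi * \<tau>) * (norm x)\<^sup>2 + (norm \<beta> * norm e + \<bar>\<rho>\<bar> * norm \<mu> * norm e') * norm x)" by simp
    qed (use \<tau> in simp)
    then show ?thesis by simp
  qed
  define N where "N = a \<bullet> a"
  \<comment> \<open>Both sides of the Poisson formula have this shape: the Gaussian side with
    \<open>\<mu> = - 2 * pi * t\<close>, the dual side with
    \<open>\<mu> = 2 * pi * \<i>\<close>.\<close>
  define P where "P \<tau> \<mu> \<alpha> \<beta> = infsum (\<lambda>x. w \<tau> x * exp (\<beta> * \<mu> * of_real (x \<bullet> b)) * exp (\<alpha> * (\<mu> * of_real (x \<bullet> a)))) L" for \<tau> :: real and \<mu> \<alpha> \<beta> :: complex
  have P_alt: "P \<tau> \<mu> \<alpha> \<beta> = infsum (\<lambda>x. w \<tau> x * exp (\<alpha> * \<mu> * of_real (x \<bullet> a)) * exp (\<beta> * (\<mu> * of_real (x \<bullet> b)))) L" for \<tau> \<mu> \<alpha> \<beta>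
    unfolding P_def by (intro infsum_cong) (simp add: mult_ac)
  have hol1: "(\<lambda>\<alpha>. P \<tau> \<mu> \<alpha> \<beta>) holomorphic_on UNIV" if "\<tau> > 0" for \<tau> \<mu> \<beta>
    unfolding P_def by (rule exp_family_holomorphic) (rule sm[OF that])
  have hol2: "(\<lambda>\<beta>. P \<tau> \<mu> \<alpha> \<beta>) holomorphic_on UNIV" if "\<tau> > 0" for \<tau> \<mu> \<alpha>
    unfolding P_alt by (rule exp_family_holomorphic) (rule sm[OF that])
  define D where "D \<alpha> \<beta> = exp (of_real (- pi * t) * (\<alpha>\<^sup>2 + \<beta>\<^sup>2) * of_real N) * P t (of_real (- 2 * pi * t)) \<alpha> \<beta> - P (1 / t) (2 * pi * \<i>) \<alpha> \<beta> / \<kappa>" for \<alpha> \<beta> :: complex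
  have real0: "D (of_real \<alpha>) (of_real \<beta>) = 0" for \<alpha> \<beta> :: real
  proof -
    define u where "u = \<alpha> *\<^sub>R a + \<beta> *\<^sub>R b"
    have nu: "(norm (x + u))\<^sup>2 = (norm x)\<^sup>2 + 2 * \<alpha> * (x \<bullet> a) + 2 * \<beta> * (x \<bullet> b) + (\<alpha>\<^sup>2 + \<beta>\<^sup>2) * N" for x
      unfolding power2_norm_eq_inner u_def N_def using ab
      by (simp add: inner_add_left inner_add_right inner_commute algebra_simps power2_eq_square)
    have "infsum (\<lambda>x. complex_of_real (exp (- pi * t * (norm (x + u))\<^sup>2))) L = exp (of_real (- pi * t) * ((of_real \<alpha>)\<^sup>2 + (of_real \<beta>)\<^sup>2) * of_real N) * P t (of_real (- 2 * pi * t)) (of_real \<alpha>) (of_real \<beta>)"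
      unfolding P_def infsum_cmult_right'[symmetric]
    proof (rule infsum_cong)
      fix x
      have "exp (- pi * t * (norm (x + u))\<^sup>2) = exp (- pi * t * (\<alpha>\<^sup>2 + \<beta>\<^sup>2) * N) * (exp (- pi * t * (norm x)\<^sup>2) * exp (\<beta> * (- 2 * pi * t) * (x \<bullet> b)) * exp (\<alpha> * ((- 2 * pi * t) * (x \<bullet> a))))"
        unfolding nu by (simp add: exp_add[symmetric] algebra_simps)
      then have "complex_of_real (exp (- pi * t * (norm (x + u))\<^sup>2)) = complex_of_real (exp (- pi * t * (\<alpha>\<^sup>2 + \<beta>\<^sup>2) * N) * (exp (- pi * t * (norm x)\<^sup>2) * exp (\<beta> * (- 2 * pi * t) * (x \<bullet> b)) * exp (\<alpha> * ((- 2 * pi * t) * (x \<bullet> a)))))"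
        by (rule arg_cong)
      then show "complex_of_real (exp (- pi * t * (norm (x + u))\<^sup>2)) = exp (of_real (- pi * t) * ((of_real \<alpha>)\<^sup>2 + (of_real \<beta>)\<^sup>2) * of_real N) * (w t x * exp (of_real \<beta> * of_real (- 2 * pi * t) * of_real (x \<bullet> b)) * exp (of_real \<alpha> * (of_real (- 2 * pi * t) * of_real (x \<bullet> a))))"
        unfolding w_def by (simp add: exp_of_real[symmetric])
    qed
    moreover have "infsum (\<lambda>y. complex_of_real (exp (- pi / t * (norm y)\<^sup>2)) * ex2pi (y \<bullet> u)) L = P (1 / t) (2 * pi * \<i>) (of_real \<alpha>) (of_real \<beta>)"
      unfolding P_def
    proof (rule infsum_cong)
      fix y
      have "ex2pi (y \<bullet> u) = exp (of_real \<beta> * (2 * pi * \<i>) * of_real (y \<bullet> b)) * exp (of_real \<alpha> * ((2 * pi * \<i>) * of_real (y \<bullet> a)))"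
        unfolding ex2pi_def exp_add[symmetric] by (simp add: u_def inner_add_right algebra_simps)
      then show "complex_of_real (exp (- pi / t * (norm y)\<^sup>2)) * ex2pi (y \<bullet> u) = w (1 / t) y * exp (of_real \<beta> * (2 * pi * \<i>) * of_real (y \<bullet> b)) * exp (of_real \<alpha> * ((2 * pi * \<i>) * of_real (y \<bullet> a)))"
        by (simp add: w_def)
    qed
    ultimately show ?thesis using self_dual_theta_shift[OF sd t, of u] by (simp add: D_def \<kappa>_def)
  qed
  have t': "1 / t > 0" using t by simp
  \<comment> \<open>The continuation proceeds one variable at a time: first in \<alpha> for real
    \<beta>, then in \<beta> for arbitrary \<alpha>.\<close>
  have D1: "D \<alpha> (of_real \<beta>) = 0" for \<alpha> and \<beta> :: real
  proof (rule entire_zero_on_reals[of "\<lambda>\<alpha>. D \<alpha> (of_real \<beta>)"])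
    show "(\<lambda>\<alpha>. D \<alpha> (of_real \<beta>)) holomorphic_on UNIV"
      unfolding D_def using \<kappa> by (intro holomorphic_intros hol1 t t')
  qed (rule real0)
  have D2: "D \<alpha> \<beta> = 0" for \<alpha> \<beta>
  proof (rule entire_zero_on_reals[of "\<lambda>\<beta>. D \<alpha> \<beta>"])
    show "(\<lambda>\<beta>. D \<alpha> \<beta>) holomorphic_on UNIV"
      unfolding D_def using \<kappa> by (intro holomorphic_intros hol2 t t')
  qed (rule D1)
  have iso: "exp (\<i> * s * \<mu> * of_real (x \<bullet> b)) * exp (s * (\<mu> * of_real (x \<bullet> a))) = exp (s * (\<mu> * cpair a b x))" for s \<mu> :: complex and x
    unfolding exp_add[symmetric] by (simp add: cpair_def Complex_eq algebra_simps)
  have P_iso: "P \<tau> \<mu> s (\<i> * s) = infsum (\<lambda>x. w \<tau> x * exp (s * (\<mu> * cpair a b x))) L" for \<tau> \<mu> s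
    unfolding P_def iso[symmetric] by (intro infsum_cong) (simp add: mult.assoc)
  have eq: "infsum (\<lambda>x. w t x * exp (s * (of_real (- 2 * pi * t) * cpair a b x))) L = infsum (\<lambda>x. w (1 / t) x / \<kappa> * exp (s * ((2 * pi * \<i>) * cpair a b x))) L" for s
  proof -
    have "P t (of_real (- 2 * pi * t)) s (\<i> * s) = P (1 / t) (2 * pi * \<i>) s (\<i> * s) / \<kappa>"
      using D2[of s "\<i> * s"] by (simp add: D_def power_mult_distrib)
    also have "\<dots> = infsum (\<lambda>x. w (1 / t) x / \<kappa> * exp (s * ((2 * pi * \<i>) * cpair a b x))) L"
      unfolding P_iso divide_inverse infsum_cmult_left'[symmetric] by (intro infsum_cong) (simp add: mult_ac)
    finally show ?thesis unfolding P_iso by simp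
  qed
  have smc: "(\<lambda>x. norm (w \<tau> x / k) * exp (\<rho> * norm (\<mu> * cpair a b x))) summable_on L" if \<tau>: "\<tau> > 0" for \<tau> \<mu> \<rho> k
  proof -
    have "(\<lambda>x. norm (norm (w \<tau> x / k) * exp (\<rho> * norm (\<mu> * cpair a b x)))) summable_on L"
    proof (rule lattice_gaussian_summable[OF frl, of "pi * \<tau>" _ "1 / norm k" "\<bar>\<rho>\<bar> * norm \<mu> * (norm a + norm b)"])
      fix x
      have "\<rho> * norm (\<mu> * cpair a b x) \<le> \<bar>\<rho>\<bar> * (norm \<mu> * norm (cpair a b x))" by (simp add: norm_mult mult_right_mono)
      also have "\<dots> \<le> \<bar>\<rho>\<bar> * (norm \<mu> * ((norm a + norm b) * norm x))" by (intro mult_left_mono norm_cpair_le) auto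
      finally have 2: "\<rho> * norm (\<mu> * cpair a b x) \<le> \<bar>\<rho>\<bar> * norm \<mu> * (norm a + norm b) * norm x" by (simp add: mult_ac)
      have "norm (norm (w \<tau> x / k) * exp (\<rho> * norm (\<mu> * cpair a b x))) = 1 / norm k * exp (- pi * \<tau> * (norm x)\<^sup>2 + \<rho> * norm (\<mu> * cpair a b x))"
      proof -
        have nw: "norm (w \<tau> x) = exp (- pi * \<tau> * (norm x)\<^sup>2)" by (simp add: w_def)
        show ?thesis
          by (simp only: real_norm_def abs_mult abs_norm_cancel abs_exp_cancel norm_mult norm_divide nw exp_add) simp
      qed
      also have "\<dots> \<le> 1 / norm k * exp (- (pi * \<tau>) * (norm x)\<^sup>2 + \<bar>\<rho>\<bar> * norm \<mu> * (norm a + norm b) * norm x)"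
        using 2 by (intro mult_left_mono) auto
      finally show "norm (norm (w \<tau> x / k) * exp (\<rho> * norm (\<mu> * cpair a b x))) \<le> 1 / norm k * exp (- (pi * \<tau>) * (norm x)\<^sup>2 + \<bar>\<rho>\<bar> * norm \<mu> * (norm a + norm b) * norm x)" .
    qed (use \<tau> in simp)
    then show ?thesis by simp
  qed
  have c1: "infsum (\<lambda>x. w t x * (of_real (- 2 * pi * t) * cpair a b x) ^ d) L / fact d = infsum (\<lambda>x. w (1 / t) x / \<kappa> * ((2 * pi * \<i>) * cpair a b x) ^ d) L / fact d"
  proof (rule entire_power_series_unique)
    show "(\<lambda>n. (infsum (\<lambda>x. w t x * (of_real (- 2 * pi * t) * cpair a b x) ^ n) L / fact n) * s ^ n) sums infsum (\<lambda>x. w t x * exp (s * (of_real (- 2 * pi * t) * cpair a b x))) L" for s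
      using smc[OF t, of 1] by (intro exp_family_sums) simp
    show "(\<lambda>n. (infsum (\<lambda>x. w (1 / t) x / \<kappa> * ((2 * pi * \<i>) * cpair a b x) ^ n) L / fact n) * s ^ n) sums infsum (\<lambda>x. w t x * exp (s * (of_real (- 2 * pi * t) * cpair a b x))) L" for s
      unfolding eq using smc[OF t'] by (intro exp_family_sums)
  qed
  let ?S = "\<lambda>\<tau>. infsum (\<lambda>x. w \<tau> x * cpair a b x ^ d) L"
  have pull: "infsum (\<lambda>x. w \<tau> x / k * (\<mu> * cpair a b x) ^ d) L = \<mu> ^ d / k * ?S \<tau>" for \<tau> \<mu> k
    unfolding infsum_cmult_right'[symmetric] by (intro infsum_cong) (simp add: power_mult_distrib)
  have pull1: "infsum (\<lambda>x. w \<tau> x * (\<mu> * cpair a b x) ^ d) L = \<mu> ^ d * ?S \<tau>" for \<tau> \<mu>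
    using pull[of \<tau> 1 \<mu>] by simp
  have "of_real (- 2 * pi * t) ^ d * ?S t = (2 * pi * \<i>) ^ d / \<kappa> * ?S (1 / t)"
    using c1 unfolding pull pull1 by (subst (asm) divide_cancel_right) simp
  then have "\<kappa> * (of_real (- 2 * pi * t) ^ d * ?S t) = (2 * pi * \<i>) ^ d * ?S (1 / t)" using \<kappa> by simp
  \<comment> \<open>The quotient of the scalings on the two sides is the origin of the factor
    \<open>(\<i> * t) ^ d\<close>.\<close>
  moreover have "of_real (- 2 * pi * t) = (2 * pi * \<i>) * (\<i> * t)" by (simp add: mult_ac)
  ultimately have "(2 * pi * \<i>) ^ d * (\<kappa> * (\<i> * t) ^ d * ?S t) = (2 * pi * \<i>) ^ d * ?S (1 / t)"
    by (simp only: power_mult_distrib mult_ac)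
  then have "\<kappa> * (\<i> * t) ^ d * ?S t = ?S (1 / t)" by (simp add: power_eq_0_iff)
  then show ?thesis by (simp add: \<kappa>_def w_def)
qed

text \<open>
  A power series in the nome with the modulus of a modular form of weight \<open>2 p\<close>, of order
  at least \<open>r\<close> at the cusp, vanishes for small weight: \<open>cmod (f z) * Im z ^ p\<close>
  attains its maximum over a half plane \<open>Im z \<ge> c\<close>, the inversion moves the maximum off
  the boundary, and there the maximum modulus principle for \<open>f\<close> divided by the \<open>r\<close>-th
  power of the nome is violated. The line \<open>Im z = c\<close> has to lie below the lowest point of the
  fundamental domain, whence the constant.
\<close>

lemma modular_vanishing:
  fixes a :: "nat \<Rightarrow> complex" and f :: "complex \<Rightarrow> complex"
  assumes f: "\<And>z. Im z > 0 \<Longrightarrow> (\<lambda>j. a j * exp (2 * pi * \<i> * z) ^ j) sums f z"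
    and conv: "\<And>q. norm q < 1 \<Longrightarrow> summable (\<lambda>j. a j * q ^ j)"
    and low: "\<And>j. j < r \<Longrightarrow> a j = 0" and r: "r \<ge> 1"
    and inv: "\<And>z. Im z > 0 \<Longrightarrow> norm (f (- 1 / z)) = norm z ^ (2 * p) * norm (f z)"
    and small: "real p < pi * sqrt 3 * real r"
  shows "a j = 0"
proof (rule ccontr)
  assume aj: "a j \<noteq> 0"
  define Q where "Q z = exp (2 * pi * \<i> * z)" for z
  have nQ: "norm (Q z) = exp (- 2 * pi * Im z)" for z by (simp add: Q_def norm_exp_eq_Re)
  have Q_lt: "norm (Q z) < 1" if "Im z > 0" for z using that by (simp add: nQ)
  \<comment> \<open>\<open>f\<close> divided by the \<open>r\<close>-th power of the nome, continued
    over the cusp \<open>q = 0\<close>.\<close>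
  define h where "h q = (\<Sum>j. a (j + r) * q ^ j)" for q
  have hs: "(\<lambda>j. a (j + r) * q ^ j) sums h q" if "norm q < 1" for q
  proof (cases "q = 0")
    case True
    then show ?thesis
      unfolding h_def using sums_summable[OF powser_sums_zero[of "\<lambda>j. a (j + r)"]] by (intro summable_sums) simp
  next
    case False
    have "summable (\<lambda>j. a (j + r) * q ^ (j + r))" using summable_ignore_initial_segment[OF conv[OF that], of r] .
    then have "summable (\<lambda>j. (a (j + r) * q ^ (j + r)) / q ^ r)" by (rule summable_divide)
    then show ?thesis unfolding h_def using False by (intro summable_sums) (simp add: power_add)
  qed
  have hol: "h holomorphic_on ball 0 1"
    by (rule power_series_holomorphic[where a = "\<lambda>j. a (j + r)"]) (use hs in simp)
  have fh: "f z = Q z ^ r * h (Q z)" if "Im z > 0" for z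
  proof -
    have "(\<lambda>j. Q z ^ r * (a (j + r) * Q z ^ j)) sums (Q z ^ r * h (Q z))"
      by (intro sums_mult hs Q_lt that)
    then have "(\<lambda>j. a (j + r) * Q z ^ (j + r)) sums (Q z ^ r * h (Q z))" by (simp add: power_add mult_ac)
    then have "(\<lambda>j. a j * Q z ^ j) sums (Q z ^ r * h (Q z))"
      using sums_iff_shift[of "\<lambda>j. a j * Q z ^ j" r "Q z ^ r * h (Q z)"] low by simp
    moreover have "(\<lambda>j. a j * Q z ^ j) sums f z" using f[OF that] by (simp add: Q_def)
    ultimately show ?thesis by (rule sums_unique2[symmetric])
  qed
  define g where "g z = norm (f z) * Im z ^ p" for z
  have g0: "g z \<ge> 0" if "Im z > 0" for z using that by (simp add: g_def)
  \<comment> \<open>Beyond the left bound \<open>y ^ p * exp (- 2 * pi * r * y)\<close> decreases;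
    the right bound is the height of the lowest point of the fundamental domain.
    \<open>small\<close> says that there is room between them.\<close>
  obtain c where c: "real p / (2 * pi * real r) < c" "c < sqrt 3 / 2"
  proof -
    have "real p / (2 * pi * real r) < sqrt 3 / 2" using small r by (simp add: field_simps)
    then show thesis using dense that by blast
  qed
  have c0: "c > 0" using c(1) r by (smt (verit) divide_nonneg_nonneg mult_nonneg_nonneg of_nat_0_le_iff pi_ge_zero)
  have Qper: "Q (z + of_int k) = Q z" for z k
  proof -
    have "Q (z + of_int k) = Q z * exp (of_int k * (2 * pi * \<i>))" by (simp add: Q_def exp_add[symmetric] algebra_simps)
    then show ?thesis using exp_integer_2pi[of "of_int k"] by (simp add: mult_ac)
  qed
  have gper: "g (z + of_int k) = g z" if "Im z > 0" for z k
    using fh[of z] fh[of "z + of_int k"] that by (simp add: g_def Qper)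
  have ginv: "g (- 1 / z) = g z" if "Im z > 0" for z
  proof -
    have z: "z \<noteq> 0" using that by auto
    have "Im (- 1 / z) = Im z / (norm z)\<^sup>2" by (simp add: Im_divide cmod_power2)
    then show ?thesis using z inv[OF that] by (simp add: g_def power_divide power_mult[symmetric])
  qed
  have gcont: "continuous_on {z. Im z > 0} g"
  proof -
    have "continuous_on {z. Im z > 0} (\<lambda>z. norm (Q z ^ r * h (Q z)) * Im z ^ p)"
    proof (intro continuous_intros)
      show "continuous_on {z. Im z > 0} Q" unfolding Q_def by (intro continuous_intros)
      then show "continuous_on {z. Im z > 0} (\<lambda>z. h (Q z))"
        by (intro continuous_on_compose2[OF holomorphic_on_imp_continuous_on[OF hol]]) (use Q_lt in auto)
    qed
    then show ?thesis by (rule continuous_on_cong[THEN iffD1, rotated -1]) (use fh in \<open>auto simp: g_def\<close>)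
  qed
  \<comment> \<open>If \<open>f\<close> vanished on the half plane, \<open>h\<close> would vanish on
    a punctured disc, hence on the unit disc, and with it all coefficients.\<close>
  have "\<exists>za. Im za \<ge> c \<and> g za > 0"
  proof (rule ccontr)
    assume "\<not> ?thesis"
    then have gz: "g z = 0" if "Im z \<ge> c" for z using that g0[of z] c0 by (metis less_le less_le_trans)
    have hz: "h q = 0" if q: "q \<in> ball 0 (exp (- 2 * pi * c)) - {0}" for q
    proof -
      define z where "z = Ln q / (2 * pi * \<i>)"
      have Qz: "Q z = q" using q by (simp add: Q_def z_def)
      have "exp (- 2 * pi * Im z) < exp (- 2 * pi * c)" using q nQ[of z] Qz by simp
      then have "Im z > c" by simp
      then have "f z = 0" using gz[of z] c0 by (simp add: g_def)
      then show ?thesis using fh[of z] \<open>Im z > c\<close> c0 Qz q by simp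
    qed
    have all: "h w = 0" if "w \<in> ball 0 1" for w
    proof (rule analytic_continuation_open[of "ball 0 (exp (- 2 * pi * c)) - {0}" "ball 0 1" h "\<lambda>_. 0"])
      show "ball 0 (exp (- 2 * pi * c)) - {0} \<noteq> ({} :: complex set)"
      proof -
        have "of_real (exp (- 2 * pi * c) / 2) \<in> ball 0 (exp (- 2 * pi * c)) - {0 :: complex}" by simp
        then show ?thesis by blast
      qed
      show "ball 0 (exp (- 2 * pi * c)) - {0} \<subseteq> (ball 0 1 :: complex set)"
      proof -
        have "exp (- 2 * pi * c) < 1" using c0 by simp
        then show ?thesis by (intro subset_trans[OF Diff_subset] subset_ball) simp
      qed
    qed (use hol hz that in auto)
    have jr: "j \<ge> r" using aj low by (metis not_le)
    have "a (j - r + r) = 0"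
    proof (rule ccontr)
      assume ne: "a (j - r + r) \<noteq> 0"
      have h0: "a r = 0" using all[of 0] hs[of 0] by simp
      then have jp: "j - r > 0" using ne jr by (cases "j - r") auto
      obtain s where s: "0 < s" "\<And>z :: complex. z \<in> cball 0 s - {0} \<Longrightarrow> (0::complex) \<noteq> 0"
      proof (rule powser_0_nonzero[of 1 0 "\<lambda>n. a (n + r)" "\<lambda>_. 0" "j - r"])
        show "(\<lambda>n. a (n + r) * (x - 0) ^ n) sums 0" if "norm (x - 0) < 1" for x :: complex
          using hs[of x] all[of x] that by simp
      qed (use ne jp in auto)
      then show False using s(2)[of "of_real s"] by auto
    qed
    then show False using aj jr by simp
  qed
  then obtain za where za: "Im za \<ge> c" "g za > 0" by blast
  define R where "R = exp (- 2 * pi * c)"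
  have R: "0 < R" "R < 1" using c0 by (auto simp: R_def)
  have hcR: "continuous_on (cball 0 R) h"
    by (rule continuous_on_subset[OF holomorphic_on_imp_continuous_on[OF hol]]) (use R in auto)
  obtain B where B: "\<And>q. q \<in> cball 0 R \<Longrightarrow> norm (h q) \<le> B"
  proof -
    have "compact (h ` cball 0 R)" by (intro compact_continuous_image hcR) auto
    then obtain B where "\<forall>x\<in>h ` cball 0 R. norm x \<le> B" using compact_imp_bounded bounded_iff by blast
    then show thesis by (intro that[of B]) auto
  qed
  have B0: "B \<ge> 0" using B[of 0] R norm_ge_zero order_trans by (metis centre_in_cball less_imp_le)
  have QR: "Q z \<in> cball 0 R" if "Im z \<ge> c" for z using that by (simp add: nQ R_def)
  \<comment> \<open>Decay at the cusp, from \<open>r \<ge> 1\<close>; it reduces the supremum to a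
    compact rectangle.\<close>
  have g_le: "g z \<le> B * (Im z ^ p / exp (Im z))" if "Im z \<ge> c" for z
  proof -
    have I: "Im z > 0" using that c0 by simp
    have "norm (f z) \<le> exp (- Im z) * B"
      unfolding fh[OF I] norm_mult
    proof (rule mult_mono)
      have "norm (Q z ^ r) = norm (Q z) ^ r" by (rule norm_power)
      also have "\<dots> \<le> norm (Q z) ^ 1" using Q_lt[OF I] r by (intro power_decreasing) auto
      also have "\<dots> \<le> exp (- Im z)"
      proof -
        have "1 * Im z \<le> 2 * pi * Im z" using I pi_gt3 by (intro mult_right_mono) auto
        then show ?thesis by (simp add: nQ)
      qed
      finally show "norm (Q z ^ r) \<le> exp (- Im z)" .
    qed (use B QR that in auto)
    then have "norm (f z) * Im z ^ p \<le> exp (- Im z) * B * Im z ^ p" using I by (intro mult_right_mono) auto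
    then show ?thesis by (simp add: g_def exp_minus field_simps)
  qed
  have "((\<lambda>y. B * (y ^ p / exp y)) \<longlongrightarrow> B * 0) at_top" by (intro tendsto_mult tendsto_const tendsto_power_div_exp_0)
  then have "\<forall>\<^sub>F y in at_top. B * (y ^ p / exp y) < g za" using za(2) by (intro order_tendstoD(2)) auto
  then obtain Y0 where Y0: "\<And>y. y \<ge> Y0 \<Longrightarrow> B * (y ^ p / exp y) < g za" by (auto simp: eventually_at_top_linorder)
  define Y where "Y = max Y0 (Im za)"
  define K where "K = cbox (Complex (-1) c) (Complex 1 Y)"
  have Kmem: "z \<in> K \<longleftrightarrow> -1 \<le> Re z \<and> Re z \<le> 1 \<and> c \<le> Im z \<and> Im z \<le> Y" for z
    by (auto simp: K_def in_cbox_complex_iff)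
  have reduce: "\<exists>z'. Im z' = Im z \<and> g z' = g z \<and> \<bar>Re z'\<bar> \<le> 1 / 2" if "Im z > 0" for z
  proof -
    define z' where "z' = z + of_int (- round (Re z))"
    have "\<bar>Re z'\<bar> \<le> 1 / 2" using of_int_round_abs_le[of "Re z"] by (simp add: z'_def abs_minus_commute)
    moreover have "g z' = g z" unfolding z'_def by (rule gper[OF that])
    ultimately show ?thesis by (intro exI[of _ z']) (simp add: z'_def)
  qed
  have "\<exists>z0\<in>K. \<forall>z\<in>K. g z \<le> g z0"
  proof (rule continuous_attains_sup)
    show "compact K" by (simp add: K_def)
    obtain z' where "Im z' = Im za" "\<bar>Re z'\<bar> \<le> 1 / 2" using reduce[of za] za(1) c0 by auto
    then have "z' \<in> K" using za(1) by (auto simp: Kmem Y_def)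
    then show "K \<noteq> {}" by blast
    show "continuous_on K g" by (rule continuous_on_subset[OF gcont]) (use c0 in \<open>auto simp: Kmem\<close>)
  qed
  then obtain z0 where z0: "z0 \<in> K" "\<And>z. z \<in> K \<Longrightarrow> g z \<le> g z0" by blast
  have gza: "g za \<le> g z0"
  proof -
    obtain z' where z': "Im z' = Im za" "g z' = g za" "\<bar>Re z'\<bar> \<le> 1 / 2" using reduce[of za] za(1) c0 by auto
    then have "-1 \<le> Re z'" "Re z' \<le> 1" by linarith+
    then show ?thesis using z0(2)[of z'] za(1) z' by (simp add: Kmem Y_def)
  qed
  have gmax: "g z \<le> g z0" if zc: "Im z \<ge> c" for z
  proof (cases "Im z \<le> Y")
    case True
    obtain z' where z': "Im z' = Im z" "g z' = g z" "\<bar>Re z'\<bar> \<le> 1 / 2" using reduce[OF less_le_trans[OF c0 zc]] by blast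
    then have "-1 \<le> Re z'" "Re z' \<le> 1" by linarith+
    then show ?thesis using z0(2)[of z'] zc True z' by (simp add: Kmem)
  next
    case False
    then have "B * (Im z ^ p / exp (Im z)) < g za" by (intro Y0) (simp add: Y_def)
    then show ?thesis using g_le[OF zc] gza by linarith
  qed
  \<comment> \<open>On the line \<open>Im z = c\<close> a representative with
    \<open>\<bar>Re z\<bar> \<le> 1/2\<close> has norm below 1, so the inversion raises its
    imaginary part while preserving \<open>g\<close>.\<close>
  have "\<exists>zs. Im zs > c \<and> g zs = g z0"
  proof (cases "Im z0 > c")
    case True then show ?thesis by blast
  next
    case False
    then have I0: "Im z0 = c" using z0(1) by (simp add: Kmem)
    obtain z' where z': "Im z' = c" "g z' = g z0" "\<bar>Re z'\<bar> \<le> 1 / 2" using reduce[of z0] I0 c0 by auto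
    have "(norm z')\<^sup>2 < 1"
    proof -
      have "(Re z')\<^sup>2 \<le> (1/2)\<^sup>2" using z'(3) power_mono[of "\<bar>Re z'\<bar>" "1/2" 2] by simp
      moreover have "c\<^sup>2 < (sqrt 3 / 2)\<^sup>2" using c(2) c0 by (intro power_strict_mono) auto
      ultimately show ?thesis using z'(1) by (simp add: cmod_power2 power_divide)
    qed
    moreover have "(norm z')\<^sup>2 > 0" using z'(1) c0 by auto
    ultimately have "c < c / (norm z')\<^sup>2" using c0 by (simp add: pos_less_divide_eq)
    moreover have "Im (- 1 / z') = c / (norm z')\<^sup>2" using z'(1) by (simp add: Im_divide cmod_power2)
    ultimately show ?thesis using ginv[of z'] z' c0 by (intro exI[of _ "- 1 / z'"]) auto
  qed
  then obtain zs where zs: "Im zs > c" "g zs = g z0" by blast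
  have gzs: "g zs > 0" using zs(2) gza za(2) by linarith
  obtain q1 where q1: "norm q1 = R" "norm (h (Q zs)) \<le> norm (h q1)"
  proof -
    have "continuous_on (sphere 0 R) (\<lambda>q. norm (h q))"
      by (intro continuous_intros continuous_on_subset[OF hcR]) auto
    moreover have "sphere 0 R \<noteq> ({}::complex set)" using R by simp
    ultimately obtain q1 where q1: "q1 \<in> sphere 0 R" "\<And>q. q \<in> sphere 0 R \<Longrightarrow> norm (h q) \<le> norm (h q1)"
      using continuous_attains_sup[of "sphere (0::complex) R" "\<lambda>q. norm (h q)"] by auto
    have "norm (h (Q zs)) \<le> norm (h q1)"
    proof (rule maximum_modulus_frontier[of h "cball 0 R"])
      show "h holomorphic_on interior (cball 0 R)" by (rule holomorphic_on_subset[OF hol]) (use R in auto)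
      show "continuous_on (closure (cball 0 R)) h" using hcR by simp
      show "norm (h z) \<le> norm (h q1)" if "z \<in> frontier (cball 0 R)" for z using q1(2) that R by simp
      show "Q zs \<in> cball 0 R" using zs(1) by (intro QR) simp
    qed simp
    then show thesis using that q1(1) by simp
  qed
  \<comment> \<open>A point on the line \<open>Im z = c\<close> at whose nome \<open>h\<close> is at
    least as large as at that of \<open>zs\<close>.\<close>
  define z1 where "z1 = Ln q1 / (2 * pi * \<i>)"
  have q1n: "q1 \<noteq> 0" using q1(1) R by auto
  have Qz1: "Q z1 = q1" using q1n by (simp add: Q_def z1_def)
  have Iz1: "Im z1 = c" using nQ[of z1] q1(1) unfolding Qz1 R_def by simp
  define ys where "ys = Im zs"
  have ys: "ys > c" "ys > 0" using zs(1) c0 by (auto simp: ys_def)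
  have hs0: "norm (h (Q zs)) > 0" using gzs fh[of zs] ys(2) by (auto simp: g_def ys_def)
  \<comment> \<open>Cancelling \<open>h\<close> leaves an inequality that contradicts the decrease
    of \<open>y ^ p * exp (- 2 * pi * r * y)\<close> from \<open>c\<close> to
    \<open>ys\<close>.\<close>
  have "g z1 \<le> g zs" using gmax[of z1] Iz1 zs(2) by simp
  then have "R ^ r * norm (h q1) * c ^ p \<le> exp (- 2 * pi * ys) ^ r * norm (h (Q zs)) * ys ^ p"
    using fh[of z1] fh[of zs] ys c0 by (simp add: g_def Iz1 Qz1 norm_mult norm_power q1(1) nQ ys_def)
  also have "\<dots> \<le> exp (- 2 * pi * ys) ^ r * norm (h q1) * ys ^ p"
    using q1(2) ys by (intro mult_right_mono mult_left_mono) auto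
  finally have "norm (h q1) * (R ^ r * c ^ p) \<le> norm (h q1) * (exp (- 2 * pi * ys) ^ r * ys ^ p)" by (simp add: mult_ac)
  moreover have "norm (h q1) > 0" using hs0 q1(2) by linarith
  ultimately have le: "R ^ r * c ^ p \<le> exp (- 2 * pi * ys) ^ r * ys ^ p" by simp
  have "ln (R ^ r * c ^ p) \<le> ln (exp (- 2 * pi * ys) ^ r * ys ^ p)"
    using le R c0 ys by (intro ln_mono) auto
  then have "real r * (- 2 * pi * c) + real p * ln c \<le> real r * (- 2 * pi * ys) + real p * ln ys"
    using R c0 ys by (simp add: ln_mult ln_realpow R_def)
  then have 1: "2 * pi * real r * (ys - c) \<le> real p * (ln ys - ln c)" by (simp add: algebra_simps)
  have "ln ys - ln c \<le> (ys - c) / c"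
    using ln_le_minus_one[of "ys / c"] c0 ys by (simp add: ln_div field_simps)
  then have "real p * (ln ys - ln c) \<le> real p * ((ys - c) / c)" by (intro mult_left_mono) auto
  with 1 have "2 * pi * real r * (ys - c) \<le> real p / c * (ys - c)" by simp
  then have "2 * pi * real r \<le> real p / c" by (rule mult_right_le_imp_le) (use ys in simp)
  then have "c \<le> real p / (2 * pi * real r)" using c0 r by (simp add: field_simps)
  then show False using c(1) by simp
qed

section \<open>Isotropic sums over shells of even self-dual lattices\<close>

lemma finite_shell:
  fixes L :: "(real^'n) set"
  assumes "full_rank_lattice L"
  shows "finite {x \<in> L. x \<bullet> x = s}"
  by (rule finite_subset[OF _ finite_bounded_lattice[OF assms, of "sqrt s"]]) (auto simp: norm_eq_sqrt_inner)

text \<open>The theta series weighted by \<open>cpair a b x ^ (2 * \<delta>)\<close> has weight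
  \<open>CARD('n) / 2 + 2 * \<delta> = 2 * (e + \<delta>)\<close>. The gap makes it vanish to order
  \<open>r\<close> at the cusp, the zero vector dropping out because the exponent is positive. The
  claim concerns its coefficient of index \<open>r\<close>.\<close>

lemma isotropic_shell_sum:
  fixes L :: "(real^'n::{finite,wellorder}) set"
  assumes sd: "self_dual L" and even: "\<And>x. x \<in> L \<Longrightarrow> \<exists>k::int. x \<bullet> x = 2 * of_int k"
    and gap: "\<And>x. x \<in> L \<Longrightarrow> x \<noteq> 0 \<Longrightarrow> 2 * real r \<le> x \<bullet> x" and r: "r \<ge> 1"
    and n: "CARD('n) = 4 * e" and \<delta>: "\<delta> \<ge> 1" and small: "real (e + \<delta>) < pi * sqrt 3 * real r"
    and ab: "a \<bullet> b = 0" "a \<bullet> a = b \<bullet> b"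
  shows "(\<Sum>x\<in>{x \<in> L. x \<bullet> x = 2 * real r}. cpair a b x ^ (2 * \<delta>)) = 0"
proof -
  have frl: "full_rank_lattice L" using sd by (simp add: self_dual_def)
  define d where "d = 2 * \<delta>"
  define S where "S j = {x \<in> L. x \<bullet> x = 2 * real j}" for j :: nat
  define c where "c j = (\<Sum>x\<in>S j. cpair a b x ^ d)" for j
  define g where "g z x = cpair a b x ^ d * exp (pi * \<i> * z * of_real (x \<bullet> x))" for z x
  define f where "f z = infsum (g z) L" for z
  have gsum: "(\<lambda>x. norm (g z x)) summable_on L" if z: "Im z > 0" for z
  proof (rule lattice_gaussian_summable[OF frl, of "pi * Im z" _ "fact d" "norm a + norm b"])
    fix x
    have "norm (cpair a b x ^ d) \<le> fact d * exp (norm (cpair a b x))"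
      unfolding norm_power by (rule power_le_fact_exp) simp
    also have "\<dots> \<le> fact d * exp ((norm a + norm b) * norm x)" by (simp add: norm_cpair_le)
    finally have 1: "norm (cpair a b x ^ d) \<le> fact d * exp ((norm a + norm b) * norm x)" .
    have 2: "norm (exp (pi * \<i> * z * of_real (x \<bullet> x))) = exp (- (pi * Im z) * (norm x)\<^sup>2)"
      by (simp add: norm_exp_eq_Re power2_norm_eq_inner)
    have "norm (g z x) \<le> fact d * exp ((norm a + norm b) * norm x) * exp (- (pi * Im z) * (norm x)\<^sup>2)"
      unfolding g_def norm_mult[of "cpair a b x ^ d"] 2 by (intro mult_right_mono 1) simp
    also have "\<dots> = fact d * exp (- (pi * Im z) * (norm x)\<^sup>2 + (norm a + norm b) * norm x)"
      by (simp only: exp_add mult.assoc mult.commute mult.left_commute)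
    finally show "norm (g z x) \<le> fact d * exp (- (pi * Im z) * (norm x)\<^sup>2 + (norm a + norm b) * norm x)" .
  qed (use z in simp)
  \<comment> \<open>Evenness sorts \<open>L\<close> into the shells
    \<open>x \<bullet> x = 2 * j\<close>, which makes \<open>f\<close> a power series in the
    nome.\<close>
  have bij: "bij_betw snd (Sigma UNIV S) L"
    unfolding bij_betw_def
  proof (intro conjI)
    show "inj_on snd (Sigma UNIV S)" by (auto simp: inj_on_def S_def)
    have "\<exists>j. x \<in> S j" if x: "x \<in> L" for x
    proof -
      obtain k :: int where k: "x \<bullet> x = 2 * of_int k" using even x by blast
      then have "k \<ge> 0" using inner_ge_zero[of x] by simp
      then show ?thesis using k x by (intro exI[of _ "nat k"]) (simp add: S_def)
    qed
    then show "snd ` Sigma UNIV S = L" by (force simp: S_def image_iff)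
  qed
  have fs: "(\<lambda>j. c j * exp (2 * pi * \<i> * z) ^ j) sums f z" if z: "Im z > 0" for z
  proof -
    have "(g z has_sum f z) L" unfolding f_def by (intro has_sum_infsum abs_summable_summable[OF gsum[OF z]])
    then have 1: "((\<lambda>p. g z (snd p)) has_sum f z) (Sigma UNIV S)" using has_sum_reindex_bij_betw[OF bij] by blast
    have 2: "((\<lambda>x. g z (snd (j, x))) has_sum (c j * exp (2 * pi * \<i> * z) ^ j)) (S j)" for j
    proof -
      have "g z x = cpair a b x ^ d * exp (2 * pi * \<i> * z) ^ j" if "x \<in> S j" for x
        using that by (simp add: g_def S_def exp_of_nat_mult[symmetric] mult_ac)
      then have "(\<Sum>x\<in>S j. g z x) = c j * exp (2 * pi * \<i> * z) ^ j" by (simp add: c_def sum_distrib_right)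
      moreover have "finite (S j)" unfolding S_def by (rule finite_shell[OF frl])
      ultimately show ?thesis using has_sum_finite[of "S j" "g z"] by simp
    qed
    have "((\<lambda>j. c j * exp (2 * pi * \<i> * z) ^ j) has_sum f z) UNIV"
      by (rule has_sum_SigmaD[OF 1 2])
    then show ?thesis by (rule has_sum_imp_sums)
  qed
  have Qz: "\<exists>z. Im z > 0 \<and> exp (2 * pi * \<i> * z) = q" if "norm q < 1" "q \<noteq> 0" for q
  proof -
    define z where "z = Ln q / (2 * pi * \<i>)"
    have e: "exp (2 * pi * \<i> * z) = q" using that by (simp add: z_def)
    have "norm (exp (2 * pi * \<i> * z)) = exp (- 2 * pi * Im z)" by (simp add: norm_exp_eq_Re)
    then have "exp (- 2 * pi * Im z) < 1" using that(1) e by metis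
    then have "- 2 * pi * Im z < 0" by (simp only: exp_less_one_iff)
    then have "pi * Im z > 0" by simp
    then have "Im z > 0" using pi_gt_zero zero_less_mult_pos by blast
    then show ?thesis using e by blast
  qed
  have conv: "summable (\<lambda>j. c j * q ^ j)" if "norm q < 1" for q
  proof (cases "q = 0")
    case True then show ?thesis using sums_summable[OF powser_sums_zero[of c]] by simp
  next
    case False then show ?thesis using Qz[OF that] fs sums_summable by blast
  qed
  have low: "c j = 0" if "j < r" for j
    unfolding c_def
  proof (rule sum.neutral, rule ballI)
    fix x assume "x \<in> S j"
    then have "x = 0" using gap[of x] that by (auto simp: S_def)
    then show "cpair a b x ^ d = 0" using \<delta> by (simp add: cpair_def d_def Complex_eq_0 zero_power)
  qed
  define F where "F q = (\<Sum>j. c j * q ^ j)" for q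
  have Fhol: "F holomorphic_on ball 0 1"
    by (rule power_series_holomorphic[where a = c]) (use conv in \<open>auto simp: F_def intro: summable_sums\<close>)
  have fF: "f z = F (exp (2 * pi * \<i> * z))" if "Im z > 0" for z
    unfolding F_def using fs[OF that] by (rule sums_unique)
  let ?H = "{z. Im z > 0}"
  have fhol: "f holomorphic_on ?H"
  proof -
    have "(F \<circ> (\<lambda>z. exp (2 * pi * \<i> * z))) holomorphic_on ?H"
      by (rule holomorphic_on_compose_gen[OF _ Fhol]) (auto intro!: holomorphic_intros simp: norm_exp_eq_Re)
    then show ?thesis by (rule holomorphic_transform) (simp add: fF)
  qed
  have Hinv: "Im (- 1 / z) > 0" if "Im z > 0" for z :: complex
  proof -
    have "z \<noteq> 0" using that by auto
    then show ?thesis using that by (simp add: Im_divide add_pos_nonneg sum_power2_gt_zero_iff complex_eq_iff)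
  qed
  define k where "k = 2 * e + d"
  \<comment> \<open>On the imaginary axis this defect vanishes by
    \<open>theta_isotropic_transform\<close>; being holomorphic, it vanishes on the half plane. The
    constant \<open>\<i> ^ d / \<i> ^ k\<close> has absolute value 1.\<close>
  define D where "D z = f (- 1 / z) - (\<i> ^ d / \<i> ^ k) * z ^ k * f z" for z
  have Dhol: "D holomorphic_on ?H"
  proof -
    have "(f \<circ> (\<lambda>z. - 1 / z)) holomorphic_on ?H"
      by (rule holomorphic_on_compose_gen[OF _ fhol]) (use Hinv in \<open>auto intro!: holomorphic_intros\<close>)
    then show ?thesis unfolding D_def o_def by (intro holomorphic_intros fhol)
  qed
  have Dim: "D (\<i> * of_real t) = 0" if t: "t > 0" for t :: real
  proof -
    have m: "- 1 / (\<i> * of_real t) = \<i> * of_real (1 / t)" using t by (simp add: field_simps)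
    have fi: "f (\<i> * of_real \<tau>) = infsum (\<lambda>x. complex_of_real (exp (- pi * \<tau> * (norm x)\<^sup>2)) * cpair a b x ^ d) L" for \<tau>
      unfolding f_def
    proof (rule infsum_cong)
      fix x :: "real^'n::_"
      have "exp (pi * \<i> * (\<i> * of_real \<tau>) * of_real (x \<bullet> x)) = complex_of_real (exp (- pi * \<tau> * (norm x)\<^sup>2))"
        by (simp add: exp_of_real[symmetric] power2_norm_eq_inner mult_ac)
      then show "g (\<i> * of_real \<tau>) x = complex_of_real (exp (- pi * \<tau> * (norm x)\<^sup>2)) * cpair a b x ^ d"
        by (simp add: g_def)
    qed
    have st: "sqrt t ^ CARD('n) = t ^ (2 * e)"
    proof -
      have "sqrt t ^ CARD('n) = ((sqrt t)\<^sup>2) ^ (2 * e)" unfolding n by (simp add: power_mult[symmetric])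
      then show ?thesis using t by simp
    qed
    have "f (\<i> * of_real (1 / t)) = infsum (\<lambda>x. complex_of_real (exp (- pi / t * (norm x)\<^sup>2)) * cpair a b x ^ d) L"
      unfolding fi by simp
    also have "\<dots> = of_real (t ^ (2 * e)) * (\<i> * t) ^ d * f (\<i> * of_real t)"
      unfolding theta_isotropic_transform[OF sd t ab, of d] st fi ..
    finally have "f (\<i> * of_real (1 / t)) = of_real (t ^ (2 * e)) * (\<i> * t) ^ d * f (\<i> * of_real t)" .
    moreover have "(\<i> ^ d / \<i> ^ k) * (\<i> * complex_of_real t) ^ k = of_real (t ^ (2 * e)) * (\<i> * of_real t) ^ d"
      by (simp add: k_def power_mult_distrib power_add)
    ultimately show ?thesis unfolding D_def m by simp
  qed
  have Dzero: "D z = 0" if "Im z > 0" for z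
  proof (rule analytic_continuation[OF Dhol, of "(\<lambda>t. \<i> * complex_of_real t) ` {0<..}" \<i>])
    show "open ?H" by (rule open_halfspace_Im_gt)
    show "connected ?H" by (intro convex_connected convex_halfspace_Im_gt)
    show "\<i> islimpt (\<lambda>t. \<i> * complex_of_real t) ` {0<..}"
    proof (rule islimptI)
      fix T :: "complex set" assume "\<i> \<in> T" "open T"
      then obtain \<epsilon> where \<epsilon>: "\<epsilon> > 0" "ball \<i> \<epsilon> \<subseteq> T" using openE by blast
      have "\<i> * complex_of_real (1 + \<epsilon> / 2) \<in> ball \<i> \<epsilon>"
      proof -
        have "\<i> - \<i> * complex_of_real (1 + \<epsilon> / 2) = - (\<i> * complex_of_real (\<epsilon> / 2))" by (simp add: algebra_simps)
        then have "dist \<i> (\<i> * complex_of_real (1 + \<epsilon> / 2)) = \<epsilon> / 2"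
          unfolding dist_norm using \<epsilon> by (simp only: norm_minus_cancel norm_mult norm_of_real) simp
        then show ?thesis using \<epsilon> by simp
      qed
      moreover have "\<i> * complex_of_real (1 + \<epsilon> / 2) \<noteq> \<i>" using \<epsilon> by (simp add: complex_eq_iff)
      moreover have "\<i> * complex_of_real (1 + \<epsilon> / 2) \<in> (\<lambda>t. \<i> * complex_of_real t) ` {0<..}"
        using \<epsilon> by (intro imageI) simp
      ultimately show "\<exists>y\<in>(\<lambda>t. \<i> * complex_of_real t) ` {0<..}. y \<in> T \<and> y \<noteq> \<i>" using \<epsilon>(2) by blast
    qed
  qed (use Dim that in auto)
  have "c r = 0"
  proof (rule modular_vanishing[OF fs conv low r _ small])
    fix z assume z: "Im z > 0"
    have "f (- 1 / z) = (\<i> ^ d / \<i> ^ k) * z ^ k * f z" using Dzero[OF z] by (simp add: D_def)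
    then show "norm (f (- 1 / z)) = norm z ^ (2 * (e + \<delta>)) * norm (f z)"
      by (simp add: norm_mult norm_power norm_divide k_def d_def algebra_simps)
  qed
  then show ?thesis by (simp add: c_def S_def d_def)
qed

section \<open>Moments of degree at most six\<close>

lemma Re_Complex_powers:
  "Re (Complex x y ^ 2) = x\<^sup>2 - y\<^sup>2"
  "Re (Complex x y ^ 4) = x ^ 4 - 6 * x\<^sup>2 * y\<^sup>2 + y ^ 4"
  "Re (Complex x y ^ 6) = x ^ 6 - 15 * x ^ 4 * y\<^sup>2 + 15 * x\<^sup>2 * y ^ 4 - y ^ 6"
  by (simp_all add: eval_nat_numeral algebra_simps)

lemma orthonormal_parseval:
  fixes S :: "'a::euclidean_space set"
  assumes "pairwise orthogonal S" "\<And>b. b \<in> S \<Longrightarrow> norm b = 1" "independent S" "span S = UNIV"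
  shows "(\<Sum>b\<in>S. (x \<bullet> b)\<^sup>2) = x \<bullet> x"
proof -
  have "(\<Sum>b\<in>S. (x \<bullet> b) *\<^sub>R b) = x"
    using assms by (intro orthonormal_basis_expand) (auto intro: independent_imp_finite)
  then have "x \<bullet> x = x \<bullet> (\<Sum>b\<in>S. (x \<bullet> b) *\<^sub>R b)" by simp
  then show ?thesis by (simp add: inner_sum_right power2_eq_square)
qed

locale isotropic_design =
  fixes M :: "(real^'n) set" and R :: real
  assumes fin: "finite M" and norm_M: "\<And>x. x \<in> M \<Longrightarrow> x \<bullet> x = R"
    and iso: "\<And>a b d. a \<bullet> b = 0 \<Longrightarrow> a \<bullet> a = b \<bullet> b \<Longrightarrow> d \<in> {2, 4, 6} \<Longrightarrow> (\<Sum>x\<in>M. cpair a b x ^ d) = 0"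
begin

definition n where "n = real CARD('n)"

text \<open>\<open>C2\<close>, \<open>C4\<close>, \<open>C6\<close> are \<open>card M\<close> times
  the moments of degree 2, 4, 6 of a coordinate on the sphere of squared radius \<open>R\<close>. In
  degree 6 that moment is \<open>15 * R ^ 3 / (n * (n + 2) * (n + 4))\<close>.\<close>

definition C2 where "C2 = R * real (card M) / n"
definition C4 where "C4 = 3 * R * C2 / (n + 2)"
definition C6 where "C6 = 5 * R * C4 / (n + 4)"

lemma n_pos: "n > 0"
  by (simp add: n_def)

lemma iso2: "a \<bullet> b = 0 \<Longrightarrow> a \<bullet> a = b \<bullet> b \<Longrightarrow> (\<Sum>x\<in>M. (x \<bullet> a)\<^sup>2 - (x \<bullet> b)\<^sup>2) = 0"
  using arg_cong[OF iso[of a b 2], of Re] by (simp add: cpair_def Re_Complex_powers)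

lemma iso4: "a \<bullet> b = 0 \<Longrightarrow> a \<bullet> a = b \<bullet> b \<Longrightarrow>
    (\<Sum>x\<in>M. (x \<bullet> a) ^ 4 - 6 * (x \<bullet> a)\<^sup>2 * (x \<bullet> b)\<^sup>2 + (x \<bullet> b) ^ 4) = 0"
  using arg_cong[OF iso[of a b 4], of Re] by (simp add: cpair_def Re_Complex_powers)

lemma iso6: "a \<bullet> b = 0 \<Longrightarrow> a \<bullet> a = b \<bullet> b \<Longrightarrow>
    (\<Sum>x\<in>M. (x \<bullet> a) ^ 6 - 15 * (x \<bullet> a) ^ 4 * (x \<bullet> b)\<^sup>2 + 15 * (x \<bullet> a)\<^sup>2 * (x \<bullet> b) ^ 4 - (x \<bullet> b) ^ 6) = 0"
  using arg_cong[OF iso[of a b 6], of Re] by (simp add: cpair_def Re_Complex_powers)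

text \<open>Extend \<open>u\<close> to an orthonormal basis \<open>S\<close>; the squared
  coordinates \<open>t b x\<close> sum to \<open>R\<close>. The vectors \<open>a + \<i> b\<close>
  with \<open>a\<close>, \<open>b\<close> in \<open>S\<close> give linear relations between power
  sums, enough for degrees 2 and 4. In degree 6 a mixed sum \<open>Y\<close> remains, and the
  vectors \<open>sqrt 2 a + \<i> (b + c)\<close> and \<open>sqrt 2 a + \<i> (b - c)\<close> supply a
  second relation that eliminates it.\<close>

lemma unit_moments:
  assumes u: "norm u = 1"
  shows "(\<Sum>x\<in>M. (x \<bullet> u)\<^sup>2) = C2" and "(\<Sum>x\<in>M. (x \<bullet> u) ^ 4) = C4" and "(\<Sum>x\<in>M. (x \<bullet> u) ^ 6) = C6"
proof -
  obtain S where S: "u \<in> S" "pairwise orthogonal S" "\<And>b. b \<in> S \<Longrightarrow> norm b = 1"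
    "independent S" "card S = DIM(real^'n)" "span S = UNIV"
    using vector_in_orthonormal_basis[OF u] by metis
  have finS: "finite S" using S(4) by (rule independent_imp_finite)
  have cS: "real (card S) = n" using S(5) by (simp add: n_def)
  define t where "t b x = (x \<bullet> b)\<^sup>2" for b x :: "real^'n"
  have tot: "(\<Sum>b\<in>S. t b x) = R" if "x \<in> M" for x
    unfolding t_def using orthonormal_parseval[OF S(2,3,4,6)] norm_M[OF that] by simp
  have orth: "a \<bullet> b = 0" "a \<bullet> a = b \<bullet> b" if "a \<in> S" "b \<in> S" "a \<noteq> b" for a b
    using S(2) S(3)[OF that(1)] S(3)[OF that(2)] that by (auto simp: pairwise_def orthogonal_def norm_eq_1)
  have oo: "a \<bullet> a = 1" if "a \<in> S" for a using S(3)[OF that] by (simp add: norm_eq_1)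
  have p4: "(x \<bullet> b) ^ 4 = (t b x)\<^sup>2" and p6: "(x \<bullet> b) ^ 6 = (t b x) ^ 3" for b x
    by (simp_all add: t_def power_mult[symmetric])
  have m2: "(\<Sum>x\<in>M. t a x) = C2" if a: "a \<in> S" for a
  proof -
    have "(\<Sum>x\<in>M. t b x) = (\<Sum>x\<in>M. t a x)" if b: "b \<in> S" for b
    proof (cases "a = b")
      case False
      then show ?thesis using iso2[OF orth[OF a b]] by (simp add: t_def sum_subtractf)
    qed simp
    then have "(\<Sum>b\<in>S. \<Sum>x\<in>M. t b x) = n * (\<Sum>x\<in>M. t a x)" by (simp add: cS)
    moreover have "(\<Sum>b\<in>S. \<Sum>x\<in>M. t b x) = (\<Sum>x\<in>M. R)" by (subst sum.swap) (simp add: tot)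
    ultimately show ?thesis using n_pos by (simp add: C2_def field_simps)
  qed
  then show "(\<Sum>x\<in>M. (x \<bullet> u)\<^sup>2) = C2" using S(1) by (simp add: t_def)
  have m4: "(\<Sum>x\<in>M. (t a x)\<^sup>2) = C4" if a: "a \<in> S" for a
  proof -
    define P where "P b = (\<Sum>x\<in>M. (t b x)\<^sup>2)" for b
    define T where "T = (\<Sum>b\<in>S. P b)"
    \<comment> \<open>The relation is summed over all \<open>c\<close> other than \<open>b\<close>;
      the missing diagonal term would be \<open>- 4 * P b\<close>, which turns \<open>n\<close> into
      \<open>n + 4\<close>.\<close>
    have lin: "(n + 4) * P b + T = 6 * R * C2" if b: "b \<in> S" for b
    proof -
      have "(\<Sum>c\<in>S - {b}. \<Sum>x\<in>M. (t b x)\<^sup>2 - 6 * t b x * t c x + (t c x)\<^sup>2) = 0"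
      proof (rule sum.neutral, rule ballI)
        fix c assume c: "c \<in> S - {b}"
        then have "c \<in> S" "b \<noteq> c" by auto
        then show "(\<Sum>x\<in>M. (t b x)\<^sup>2 - 6 * t b x * t c x + (t c x)\<^sup>2) = 0"
          using iso4[OF orth[OF b]] by (simp add: p4) (simp add: t_def)
      qed
      also have "(\<Sum>c\<in>S - {b}. \<Sum>x\<in>M. (t b x)\<^sup>2 - 6 * t b x * t c x + (t c x)\<^sup>2)
         = (\<Sum>c\<in>S. \<Sum>x\<in>M. (t b x)\<^sup>2 - 6 * t b x * t c x + (t c x)\<^sup>2) - (\<Sum>x\<in>M. (t b x)\<^sup>2 - 6 * t b x * t b x + (t b x)\<^sup>2)"
        using finS b by (simp add: sum_diff1)
      also have "(\<Sum>x\<in>M. (t b x)\<^sup>2 - 6 * t b x * t b x + (t b x)\<^sup>2) = - 4 * P b"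
        by (simp add: P_def sum_distrib_left power2_eq_square)
      also have "(\<Sum>c\<in>S. \<Sum>x\<in>M. (t b x)\<^sup>2 - 6 * t b x * t c x + (t c x)\<^sup>2)
         = n * P b - 6 * (\<Sum>c\<in>S. \<Sum>x\<in>M. t b x * t c x) + T"
        by (simp add: sum.distrib sum_subtractf P_def T_def cS sum_distrib_left mult.assoc)
      also have "(\<Sum>c\<in>S. \<Sum>x\<in>M. t b x * t c x) = (\<Sum>x\<in>M. t b x * R)"
        by (subst sum.swap) (simp add: sum_distrib_left[symmetric] tot)
      also have "\<dots> = R * C2" using m2[OF b] by (simp add: sum_distrib_right[symmetric])
      finally show ?thesis by (simp add: algebra_simps)
    qed
    have eqP: "P b = P a" if "b \<in> S" for b 
    proof -
      have "(n + 4) * P b = (n + 4) * P a" using lin[OF that] lin[OF a] by linarith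
      then show ?thesis using n_pos by simp
    qed
    have "T = n * P a" using eqP by (simp add: T_def cS)
    then have "(n + 2) * P a = 3 * R * C2" using lin[OF a] by algebra
    then show ?thesis using n_pos by (simp add: P_def C4_def field_simps)
  qed
  then show "(\<Sum>x\<in>M. (x \<bullet> u) ^ 4) = C4" using S(1) by (simp add: p4)
  define N where "N = n - 1"
  define X where "X b = (\<Sum>x\<in>M. (t b x) ^ 3)" for b
  define W where "W = (\<Sum>b\<in>S. X b)"
  \<comment> \<open>As \<open>W\<close> is common to all \<open>a\<close>, a relation of this shape
    forces the sixth moments of all basis vectors to agree.\<close>
  have rel: "(2 * N + 15) * X a + (W - X a) = 45 * R\<^sup>2 * C2 / (N + 3)" if a: "a \<in> S" for a
  proof -
    let ?B = "S - {a}"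
    have finB: "finite ?B" using finS by simp
    have cB: "real (card ?B) = N" using finS a cS by (simp add: N_def card_gt_0_iff of_nat_diff Suc_leI) (metis One_nat_def Suc_leI card_gt_0_iff empty_iff of_nat_1 of_nat_diff)
    define s2 where "s2 x = (\<Sum>b\<in>?B. (t b x)\<^sup>2)" for x
    define s3 where "s3 x = (\<Sum>b\<in>?B. (t b x) ^ 3)" for x
    have s1: "(\<Sum>b\<in>?B. t b x) = R - t a x" if "x \<in> M" for x
      using tot[OF that] finS a by (simp add: sum_diff1)
    define Y where "Y = (\<Sum>x\<in>M. t a x * s2 x)"
    define Z where "Z = (\<Sum>x\<in>M. s3 x)"
    have ZW: "Z = W - X a"
      unfolding Z_def s3_def W_def X_def using finS a by (subst sum.swap) (simp add: sum_diff1)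
    have S2: "(\<Sum>x\<in>M. s2 x) = N * C4"
    proof -
      have "(\<Sum>x\<in>M. s2 x) = (\<Sum>b\<in>?B. \<Sum>x\<in>M. (t b x)\<^sup>2)" unfolding s2_def by (rule sum.swap)
      also have "\<dots> = (\<Sum>b\<in>?B. C4)" by (intro sum.cong refl m4) auto
      finally show ?thesis using cB by simp
    qed
    \<comment> \<open>\<open>iso6\<close> for the pair \<open>a\<close>, \<open>b\<close>, summed
      over the \<open>N\<close> basis vectors \<open>b\<close> other than \<open>a\<close>.\<close>
    have one: "(\<Sum>x\<in>M. N * (t a x) ^ 3 - 15 * (t a x)\<^sup>2 * (R - t a x) + 15 * t a x * s2 x - s3 x) = 0"
    proof -
      have "(\<Sum>b\<in>?B. \<Sum>x\<in>M. (t a x) ^ 3 - 15 * (t a x)\<^sup>2 * t b x + 15 * t a x * (t b x)\<^sup>2 - (t b x) ^ 3) = 0"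
      proof (rule sum.neutral, rule ballI)
        fix b assume b: "b \<in> ?B"
        then have "b \<in> S" "a \<noteq> b" by auto
        then show "(\<Sum>x\<in>M. (t a x) ^ 3 - 15 * (t a x)\<^sup>2 * t b x + 15 * t a x * (t b x)\<^sup>2 - (t b x) ^ 3) = 0"
          using iso6[OF orth[OF a]] by (simp add: p4 p6) (simp add: t_def)
      qed
      then have "(\<Sum>x\<in>M. \<Sum>b\<in>?B. (t a x) ^ 3 - 15 * (t a x)\<^sup>2 * t b x + 15 * t a x * (t b x)\<^sup>2 - (t b x) ^ 3) = 0"
        by (subst sum.swap)
      then show ?thesis
        by (simp add: sum.distrib sum_subtractf cB s1 s2_def s3_def sum_distrib_left[symmetric] cong: sum.cong)
    qed
    \<comment> \<open>Half the sum of the expressions of \<open>iso6\<close> for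
      \<open>sqrt 2 a\<close> with \<open>b + c\<close> and with \<open>b - c\<close>. The odd
      powers of \<open>x \<bullet> b\<close> cancel, which leaves a polynomial in squared
      coordinates.\<close>
    define F where "F b c x = 8 * (t a x) ^ 3 - 60 * (t a x)\<^sup>2 * (t b x + t c x) + 30 * t a x * ((t b x)\<^sup>2 + 6 * t b x * t c x + (t c x)\<^sup>2)
       - ((t b x) ^ 3 + 15 * (t b x)\<^sup>2 * t c x + 15 * t b x * (t c x)\<^sup>2 + (t c x) ^ 3)" for b c x
    have F0: "(\<Sum>x\<in>M. F b c x) = 0" if b: "b \<in> ?B" and c: "c \<in> ?B" and bc: "b \<noteq> c" for b c
    proof -
      let ?a = "sqrt 2 *\<^sub>R a"
      have inn: "?a \<bullet> (b + c) = 0" "?a \<bullet> (b - c) = 0" "?a \<bullet> ?a = (b + c) \<bullet> (b + c)" "?a \<bullet> ?a = (b - c) \<bullet> (b - c)"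
        using orth[of a b] orth[of a c] orth[of b c] orth[of c b] oo[of a] oo[of b] oo[of c] a b c bc
        by (auto simp: inner_add_left inner_add_right inner_diff_left inner_diff_right)
      have sq: "sqrt 2 ^ 4 = (4::real)" "sqrt 2 ^ 6 = (8::real)"
        using real_sqrt_pow2[of 2] power_mult[of "sqrt 2" 2 2] power_mult[of "sqrt 2" 2 3] by simp_all
      define G where "G s x = 8 * (x \<bullet> a) ^ 6 - 60 * (x \<bullet> a) ^ 4 * s\<^sup>2 + 30 * (x \<bullet> a)\<^sup>2 * s ^ 4 - s ^ 6" for s x
      have G1: "(\<Sum>x\<in>M. G (x \<bullet> b + x \<bullet> c) x) = 0"
        using iso6[OF inn(1,3)] by (simp add: G_def power_mult_distrib sq inner_add_right mult_ac)
      have G2: "(\<Sum>x\<in>M. G (x \<bullet> b - x \<bullet> c) x) = 0"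
        using iso6[OF inn(2,4)] by (simp add: G_def power_mult_distrib sq inner_diff_right mult_ac)
      have "G (x \<bullet> b + x \<bullet> c) x + G (x \<bullet> b - x \<bullet> c) x = 2 * F b c x" for x
        unfolding G_def F_def t_def by algebra
      then have "2 * (\<Sum>x\<in>M. F b c x) = (\<Sum>x\<in>M. G (x \<bullet> b + x \<bullet> c) x) + (\<Sum>x\<in>M. G (x \<bullet> b - x \<bullet> c) x)"
        by (simp add: sum_distrib_left sum.distrib[symmetric])
      then show ?thesis using G1 G2 by simp
    qed
    have FF: "(\<Sum>b\<in>?B. \<Sum>c\<in>?B. F b c x) = 8 * N\<^sup>2 * (t a x) ^ 3 - 120 * N * (t a x)\<^sup>2 * (R - t a x)
        + 30 * t a x * (2 * N * s2 x + 6 * (R - t a x)\<^sup>2) - (2 * N * s3 x + 30 * (R - t a x) * s2 x)" if x: "x \<in> M" for x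
    proof -
      have row: "(\<Sum>c\<in>?B. F b c x) = 8 * N * (t a x) ^ 3 - 60 * (t a x)\<^sup>2 * (N * t b x + (R - t a x))
         + 30 * t a x * (N * (t b x)\<^sup>2 + 6 * t b x * (R - t a x) + s2 x)
         - (N * (t b x) ^ 3 + 15 * (t b x)\<^sup>2 * (R - t a x) + 15 * t b x * s2 x + s3 x)" for b
        unfolding F_def
        by (simp add: sum.distrib sum_subtractf cB s1[OF x] s2_def s3_def sum_distrib_left[symmetric] mult.assoc)
      show ?thesis
        unfolding row
        by (simp add: sum.distrib sum_subtractf cB s1[OF x] s2_def[symmetric] s3_def[symmetric] sum_distrib_left[symmetric] sum_distrib_right[symmetric] mult.assoc)
          (simp add: power2_eq_square algebra_simps)
    qed
    have diag: "(\<Sum>b\<in>?B. F b b x) = 8 * N * (t a x) ^ 3 - 120 * (t a x)\<^sup>2 * (R - t a x) + 240 * t a x * s2 x - 32 * s3 x" if x: "x \<in> M" for x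
    proof -
      have "F b b x = 8 * (t a x) ^ 3 - 120 * (t a x)\<^sup>2 * t b x + 240 * t a x * (t b x)\<^sup>2 - 32 * (t b x) ^ 3" for b
        unfolding F_def by algebra
      then show ?thesis
        by (simp add: sum.distrib sum_subtractf cB s1[OF x] s2_def s3_def sum_distrib_left[symmetric] mult.assoc)
    qed
    \<comment> \<open>The relation \<open>F0\<close> holds for \<open>b \<noteq> c\<close>, hence
      the diagonal is subtracted from the full double sum.\<close>
    have "(\<Sum>x\<in>M. (\<Sum>b\<in>?B. \<Sum>c\<in>?B. F b c x) - (\<Sum>b\<in>?B. F b b x)) = 0"
    proof -
      have "(\<Sum>x\<in>M. (\<Sum>b\<in>?B. \<Sum>c\<in>?B. F b c x) - (\<Sum>b\<in>?B. F b b x)) = (\<Sum>x\<in>M. \<Sum>b\<in>?B. \<Sum>c\<in>?B - {b}. F b c x)"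
      proof (rule sum.cong[OF refl])
        fix x
        have "(\<Sum>b\<in>?B. \<Sum>c\<in>?B - {b}. F b c x) = (\<Sum>b\<in>?B. (\<Sum>c\<in>?B. F b c x) - F b b x)"
          by (intro sum.cong refl) (simp only: sum.remove[OF finB] add_diff_cancel_left')
        then show "(\<Sum>b\<in>?B. \<Sum>c\<in>?B. F b c x) - (\<Sum>b\<in>?B. F b b x) = (\<Sum>b\<in>?B. \<Sum>c\<in>?B - {b}. F b c x)"
          by (simp only: sum_subtractf)
      qed
      also have "\<dots> = (\<Sum>b\<in>?B. \<Sum>x\<in>M. \<Sum>c\<in>?B - {b}. F b c x)" by (rule sum.swap)
      also have "\<dots> = (\<Sum>b\<in>?B. \<Sum>c\<in>?B - {b}. \<Sum>x\<in>M. F b c x)"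
        by (rule sum.cong[OF refl], rule sum.swap)
      also have "\<dots> = 0" 
      proof (rule sum.neutral, rule ballI, rule sum.neutral, rule ballI)
        fix b c assume "b \<in> ?B" and "c \<in> ?B - {b}"
        then show "(\<Sum>x\<in>M. F b c x) = 0" by (intro F0) auto
      qed
      finally show ?thesis .
    qed
    then have two: "(\<Sum>x\<in>M. 8 * N * (N - 1) * (t a x) ^ 3 - 120 * (N - 1) * (t a x)\<^sup>2 * (R - t a x)
        + 60 * (N - 4) * (t a x * s2 x) + 180 * t a x * (R - t a x)\<^sup>2 - (2 * N - 32) * s3 x - 30 * (R - t a x) * s2 x) = 0"
      by (simp add: FF diag power2_eq_square algebra_simps cong: sum.cong)
    have A2: "(\<Sum>x\<in>M. t a x) = C2" by (rule m2[OF a])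
    have A4: "(\<Sum>x\<in>M. (t a x)\<^sup>2) = C4" by (rule m4[OF a])
    have XX: "(\<Sum>x\<in>M. (t a x) ^ 3) = X a" by (simp add: X_def)
    have lin: "(\<Sum>x\<in>M. c1 * (t a x) ^ 3 + c2 * (t a x)\<^sup>2 + c3 * t a x + c4 * (t a x * s2 x) + c5 * s2 x + c6 * s3 x)
       = c1 * X a + c2 * C4 + c3 * C2 + c4 * Y + c5 * (N * C4) + c6 * Z" for c1 c2 c3 c4 c5 c6
      by (simp add: sum.distrib sum_distrib_left[symmetric] A2 A4 XX S2 Y_def Z_def)
    have e1: "(N + 15) * X a - 15 * R * C4 + 15 * Y - Z = 0"
    proof -
      have "(\<Sum>x\<in>M. N * (t a x) ^ 3 - 15 * (t a x)\<^sup>2 * (R - t a x) + 15 * t a x * s2 x - s3 x)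
        = (\<Sum>x\<in>M. (N + 15) * (t a x) ^ 3 + (- 15 * R) * (t a x)\<^sup>2 + 0 * t a x + 15 * (t a x * s2 x) + 0 * s2 x + (- 1) * s3 x)"
        by (intro sum.cong refl) algebra
      then show ?thesis using one unfolding lin by simp
    qed
    have e2: "(8 * N * (N - 1) + 120 * (N - 1) + 180) * X a - (120 * (N - 1) * R + 360 * R) * C4 + 180 * R\<^sup>2 * C2
        + (60 * (N - 4) + 30) * Y - 30 * R * (N * C4) - (2 * N - 32) * Z = 0"
    proof -
      have "(\<Sum>x\<in>M. 8 * N * (N - 1) * (t a x) ^ 3 - 120 * (N - 1) * (t a x)\<^sup>2 * (R - t a x)
        + 60 * (N - 4) * (t a x * s2 x) + 180 * t a x * (R - t a x)\<^sup>2 - (2 * N - 32) * s3 x - 30 * (R - t a x) * s2 x)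
        = (\<Sum>x\<in>M. (8 * N * (N - 1) + 120 * (N - 1) + 180) * (t a x) ^ 3 + (- (120 * (N - 1) * R + 360 * R)) * (t a x)\<^sup>2
           + (180 * R\<^sup>2) * t a x + (60 * (N - 4) + 30) * (t a x * s2 x) + (- 30 * R) * s2 x + (- (2 * N - 32)) * s3 x)"
        by (intro sum.cong refl) algebra
      from trans[OF this lin] two show ?thesis by algebra
    qed
    \<comment> \<open>The combination of \<open>e1\<close> and \<open>e2\<close> that eliminates
      \<open>Y\<close>; the common factor \<open>N + 9\<close> is cancelled below.\<close>
    have "2 * ((N + 9) * ((2 * N + 15) * X a + Z)) = R * C4 * (90 * N + 450) - 180 * R\<^sup>2 * C2"
      using e1 e2 by algebra
    moreover have C4N: "C4 * (N + 3) = 3 * R * C2" using n_pos by (simp add: C4_def N_def field_simps)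
    ultimately have "(N + 9) * (((2 * N + 15) * X a + Z) * (N + 3)) = (N + 9) * (45 * R\<^sup>2 * C2)"
      by algebra
    moreover have "N + 9 > 0" "N + 3 > 0" using n_pos by (auto simp: N_def)
    ultimately have "((2 * N + 15) * X a + Z) * (N + 3) = 45 * R\<^sup>2 * C2"
      by (metis mult_left_cancel less_irrefl)
    then show ?thesis using \<open>N + 3 > 0\<close> unfolding ZW by (simp add: eq_divide_eq)
  qed
  have N: "2 * N + 14 > 0" "N + 3 > 0" "N + 5 > 0" using n_pos by (auto simp: N_def)
  have eqX: "X b = X u" if "b \<in> S" for b
  proof -
    have "(2 * N + 14) * X b = (2 * N + 14) * X u" using rel[OF that] rel[OF S(1)] by (simp add: algebra_simps)
    then show ?thesis using N by simp
  qed
  have "W = (N + 1) * X u" using eqX cS by (simp add: W_def N_def)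
  then have "3 * (N + 5) * X u * (N + 3) = 45 * R\<^sup>2 * C2" using rel[OF S(1)] N by (simp add: field_simps)
  moreover have "C6 * (n + 4) = 5 * R * C4" using n_pos by (simp add: C6_def)
  moreover have "C4 * (n + 2) = 3 * R * C2" using n_pos by (simp add: C4_def)
  moreover have "n = N + 1" by (simp add: N_def)
  ultimately have "((N + 3) * (N + 5)) * X u = ((N + 3) * (N + 5)) * C6" by algebra
  then have "X u = C6" using N by simp
  then show "(\<Sum>x\<in>M. (x \<bullet> u) ^ 6) = C6" by (simp add: p6 X_def)
qed

section \<open>Moments along one and several orthogonal directions\<close>

lemma
  shows moment2: "(\<Sum>x\<in>M. (x \<bullet> a)\<^sup>2) = C2 * (a \<bullet> a)"
    and moment4: "(\<Sum>x\<in>M. (x \<bullet> a) ^ 4) = C4 * (a \<bullet> a)\<^sup>2"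
    and moment6: "(\<Sum>x\<in>M. (x \<bullet> a) ^ 6) = C6 * (a \<bullet> a) ^ 3"
proof -
  have "\<exists>u. norm u = 1 \<and> a = norm a *\<^sub>R u"
  proof (cases "a = 0")
    case True
    obtain u :: "real^'n" where "norm u = 1" using vector_choose_size[of 1] by auto
    then show ?thesis using True by (intro exI[of _ u]) simp
  next
    case False
    then have "norm ((1 / norm a) *\<^sub>R a) = 1" "a = norm a *\<^sub>R ((1 / norm a) *\<^sub>R a)" by simp_all
    then show ?thesis by (intro exI[of _ "(1 / norm a) *\<^sub>R a"] conjI)
  qed
  then obtain u where u: "norm u = 1" "a = norm a *\<^sub>R u" by (elim exE conjE)
  have xa: "x \<bullet> a = norm a * (x \<bullet> u)" for x using arg_cong[OF u(2), of "\<lambda>y. x \<bullet> y"] by simp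
  have aa: "a \<bullet> a = (norm a)\<^sup>2" by (simp add: power2_norm_eq_inner)
  show "(\<Sum>x\<in>M. (x \<bullet> a)\<^sup>2) = C2 * (a \<bullet> a)"
    unfolding aa by (simp add: xa power_mult_distrib sum_distrib_left[symmetric] unit_moments[OF u(1)] aa)
  show "(\<Sum>x\<in>M. (x \<bullet> a) ^ 4) = C4 * (a \<bullet> a)\<^sup>2"
    unfolding aa by (simp add: xa power_mult_distrib sum_distrib_left[symmetric] unit_moments[OF u(1)] aa power_mult[symmetric])
  show "(\<Sum>x\<in>M. (x \<bullet> a) ^ 6) = C6 * (a \<bullet> a) ^ 3"
    unfolding aa by (simp add: xa power_mult_distrib sum_distrib_left[symmetric] unit_moments[OF u(1)] aa power_mult[symmetric])
qed

text \<open>Adding the fourth moments at \<open>w + v\<close> and \<open>w - v\<close>, two vectors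
  of equal length, isolates the mixed term.\<close>

lemma mixed22:
  assumes "v \<bullet> w = 0"
  shows "(\<Sum>x\<in>M. (x \<bullet> v)\<^sup>2 * (x \<bullet> w)\<^sup>2) = C4 / 3 * (v \<bullet> v) * (w \<bullet> w)"
proof -
  have e: "(x \<bullet> (w + v)) ^ 4 + (x \<bullet> (w - v)) ^ 4 = 2 * (x \<bullet> w) ^ 4 + 12 * ((x \<bullet> v)\<^sup>2 * (x \<bullet> w)\<^sup>2) + 2 * (x \<bullet> v) ^ 4" for x
    unfolding inner_add_right inner_diff_right by algebra
  have s: "(w + v) \<bullet> (w + v) = w \<bullet> w + v \<bullet> v" "(w - v) \<bullet> (w - v) = w \<bullet> w + v \<bullet> v"
    using assms by (simp_all add: inner_add_left inner_add_right inner_diff_left inner_diff_right inner_commute)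
  have "(\<Sum>x\<in>M. (x \<bullet> (w + v)) ^ 4 + (x \<bullet> (w - v)) ^ 4) = 2 * (C4 * (w \<bullet> w + v \<bullet> v)\<^sup>2)"
    by (simp add: sum.distrib moment4 s)
  then have "2 * (C4 * (w \<bullet> w)\<^sup>2) + 12 * (\<Sum>x\<in>M. (x \<bullet> v)\<^sup>2 * (x \<bullet> w)\<^sup>2) + 2 * (C4 * (v \<bullet> v)\<^sup>2) = 2 * (C4 * (w \<bullet> w + v \<bullet> v)\<^sup>2)"
    unfolding e by (simp add: sum.distrib sum_distrib_left[symmetric] moment4)
  then show ?thesis by (simp add: power2_eq_square algebra_simps)
qed

text \<open>The sixth moments at \<open>w + r v\<close> and \<open>w - r v\<close> involve two
  unknown mixed sums with the weights \<open>r\<^sup>2\<close> and \<open>r ^ 4\<close>; the values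
  1 and 2 of \<open>r\<close> separate them.\<close>

lemma mixed24:
  assumes "v \<bullet> w = 0"
  shows "(\<Sum>x\<in>M. (x \<bullet> v)\<^sup>2 * (x \<bullet> w) ^ 4) = C6 / 5 * (v \<bullet> v) * (w \<bullet> w)\<^sup>2"
proof -
  define A where "A = (\<Sum>x\<in>M. (x \<bullet> v)\<^sup>2 * (x \<bullet> w) ^ 4)"
  define A' where "A' = (\<Sum>x\<in>M. (x \<bullet> v) ^ 4 * (x \<bullet> w)\<^sup>2)"
  define V where "V = v \<bullet> v"
  define U where "U = w \<bullet> w"
  have key: "30 * (r\<^sup>2 * A + r ^ 4 * A') = 6 * C6 * (r\<^sup>2 * U\<^sup>2 * V + r ^ 4 * U * V\<^sup>2)" for r :: real
  proof -
    have e: "(x \<bullet> (w + r *\<^sub>R v)) ^ 6 + (x \<bullet> (w - r *\<^sub>R v)) ^ 6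
       = 2 * (x \<bullet> w) ^ 6 + 30 * r\<^sup>2 * ((x \<bullet> v)\<^sup>2 * (x \<bullet> w) ^ 4) + 30 * r ^ 4 * ((x \<bullet> v) ^ 4 * (x \<bullet> w)\<^sup>2) + 2 * r ^ 6 * (x \<bullet> v) ^ 6" for x
      unfolding inner_add_right inner_diff_right inner_scaleR_right by algebra
    have s: "(w + r *\<^sub>R v) \<bullet> (w + r *\<^sub>R v) = U + r\<^sup>2 * V" "(w - r *\<^sub>R v) \<bullet> (w - r *\<^sub>R v) = U + r\<^sup>2 * V"
      using assms by (simp_all add: inner_add_left inner_add_right inner_diff_left inner_diff_right inner_commute U_def V_def power2_eq_square)
    have "(\<Sum>x\<in>M. (x \<bullet> (w + r *\<^sub>R v)) ^ 6 + (x \<bullet> (w - r *\<^sub>R v)) ^ 6) = 2 * (C6 * (U + r\<^sup>2 * V) ^ 3)"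
      by (simp add: sum.distrib moment6 s)
    then have "2 * (C6 * U ^ 3) + 30 * r\<^sup>2 * A + 30 * r ^ 4 * A' + 2 * r ^ 6 * (C6 * V ^ 3) = 2 * (C6 * (U + r\<^sup>2 * V) ^ 3)"
      unfolding e by (simp add: sum.distrib sum_distrib_left[symmetric] moment6 A_def A'_def U_def V_def)
    moreover have "2 * (C6 * (U + r\<^sup>2 * V) ^ 3) = 2 * (C6 * U ^ 3) + 6 * C6 * (r\<^sup>2 * U\<^sup>2 * V + r ^ 4 * U * V\<^sup>2) + 2 * r ^ 6 * (C6 * V ^ 3)"
      by algebra
    ultimately show ?thesis unfolding distrib_left mult.assoc by linarith
  qed
  show ?thesis using key[of 1] key[of 2] unfolding A_def[symmetric] U_def[symmetric] V_def[symmetric] by (simp add: algebra_simps)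
qed

text \<open>This is \<open>mixed24\<close> polarised in its second argument, at \<open>a + b\<close>
  and \<open>a - b\<close>.\<close>

lemma mixed222:
  assumes "v \<bullet> a = 0" "v \<bullet> b = 0" "a \<bullet> b = 0"
  shows "(\<Sum>x\<in>M. (x \<bullet> v)\<^sup>2 * ((x \<bullet> a)\<^sup>2 * (x \<bullet> b)\<^sup>2)) = C6 / 15 * (v \<bullet> v) * (a \<bullet> a) * (b \<bullet> b)"
proof -
  have e: "(x \<bullet> v)\<^sup>2 * (x \<bullet> (a + b)) ^ 4 + (x \<bullet> v)\<^sup>2 * (x \<bullet> (a - b)) ^ 4
     = 2 * ((x \<bullet> v)\<^sup>2 * (x \<bullet> a) ^ 4) + 12 * ((x \<bullet> v)\<^sup>2 * ((x \<bullet> a)\<^sup>2 * (x \<bullet> b)\<^sup>2)) + 2 * ((x \<bullet> v)\<^sup>2 * (x \<bullet> b) ^ 4)" for x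
    unfolding inner_add_right inner_diff_right by algebra
  have o: "v \<bullet> (a + b) = 0" "v \<bullet> (a - b) = 0" using assms by (auto simp: inner_add_right inner_diff_right)
  have s: "(a + b) \<bullet> (a + b) = a \<bullet> a + b \<bullet> b" "(a - b) \<bullet> (a - b) = a \<bullet> a + b \<bullet> b"
    using assms by (simp_all add: inner_add_left inner_add_right inner_diff_left inner_diff_right inner_commute)
  have "(\<Sum>x\<in>M. (x \<bullet> v)\<^sup>2 * (x \<bullet> (a + b)) ^ 4 + (x \<bullet> v)\<^sup>2 * (x \<bullet> (a - b)) ^ 4) = 2 * (C6 / 5 * (v \<bullet> v) * (a \<bullet> a + b \<bullet> b)\<^sup>2)"
    by (simp add: sum.distrib mixed24[OF o(1)] mixed24[OF o(2)] s)
  then have "2 * (C6 / 5 * (v \<bullet> v) * (a \<bullet> a)\<^sup>2) + 12 * (\<Sum>x\<in>M. (x \<bullet> v)\<^sup>2 * ((x \<bullet> a)\<^sup>2 * (x \<bullet> b)\<^sup>2)) + 2 * (C6 / 5 * (v \<bullet> v) * (b \<bullet> b)\<^sup>2)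
      = 2 * (C6 / 5 * (v \<bullet> v) * (a \<bullet> a + b \<bullet> b)\<^sup>2)"
    unfolding e by (simp add: sum.distrib sum_distrib_left[symmetric] mixed24 assms)
  then show ?thesis by (simp add: power2_eq_square algebra_simps)
qed

end

text \<open>The bound on the weight for \<open>r = 1\<close> and \<open>e + 3 = 5\<close>, the case
  of E8. Doubled, it covers \<open>r = 2\<close> and \<open>e + 3 = 9\<close>, the case of the Leech
  lattice.\<close>

lemma pi_sqrt3_bound: "5 < pi * sqrt 3"
proof -
  have "1.7 < sqrt (3::real)" by (rule real_less_rsqrt) (simp add: power2_eq_square)
  then have "3 * 1.7 < pi * sqrt 3" using pi_gt3 by (intro mult_strict_mono) auto
  then show ?thesis by simp
qed

lemma even_norm_gap:
  assumes "x \<bullet> x = 2 * of_int k" "(x :: 'a::real_inner) \<noteq> 0"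
  shows "2 \<le> x \<bullet> x"
proof -
  have "k > 0" using assms inner_gt_zero_iff[of x] by simp
  then have "real_of_int k \<ge> 1" by simp
  then show ?thesis using assms by simp
qed

lemma isotropic_design_shell:
  fixes L :: "(real^'n::{finite,wellorder}) set"
  assumes "self_dual L" "\<And>x. x \<in> L \<Longrightarrow> \<exists>k::int. x \<bullet> x = 2 * of_int k"
    and "\<And>x. x \<in> L \<Longrightarrow> x \<noteq> 0 \<Longrightarrow> 2 * real r \<le> x \<bullet> x" "r \<ge> 1"
    and "CARD('n) = 4 * e" "real (e + 3) < pi * sqrt 3 * real r"
  shows "isotropic_design {x \<in> L. x \<bullet> x = 2 * real r} (2 * real r)"
proof
  have "full_rank_lattice L" using assms(1) unfolding self_dual_def ..
  then show "finite {x \<in> L. x \<bullet> x = 2 * real r}" by (rule finite_shell)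
  fix a b :: "real^'n::_" and d :: nat
  assume ab: "a \<bullet> b = 0" "a \<bullet> a = b \<bullet> b" and d: "d \<in> {2, 4, 6}"
  obtain \<delta> where \<delta>: "d = 2 * \<delta>" "\<delta> \<ge> 1" "\<delta> \<le> 3"
    using d by (auto intro: that[of 1] that[of 2] that[of 3])
  have "real (e + \<delta>) \<le> real (e + 3)" using \<delta>(3) by simp
  then have "real (e + \<delta>) < pi * sqrt 3 * real r" using assms(6) by (rule le_less_trans)
  then show "(\<Sum>x\<in>{x \<in> L. x \<bullet> x = 2 * real r}. cpair a b x ^ d) = 0"
    unfolding \<delta>(1) by (intro isotropic_shell_sum[OF assms(1-5) \<delta>(2) _ ab])
qed simp

section \<open>The lattices $E_8$, $E_7$ and $E_6$\<close>

lemma half_vec_inner: "(x :: real^'n) \<bullet> (\<chi> i. 1/2) = (\<Sum>i\<in>UNIV. x $ i) / 2"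
  by (simp add: inner_vec_def sum_divide_distrib)

lemma mem_root_E8: "x \<in> root_E8 \<longleftrightarrow> x \<in> root_D \<or> x - (\<chi> i. 1/2) \<in> root_D"
proof -
  have "x \<in> (\<lambda>x. x + (\<chi> i. 1/2)) ` root_D" if "x - (\<chi> i. 1/2) \<in> root_D"
    using that by (intro image_eqI[of _ _ "x - (\<chi> i. 1/2)"]) auto
  then show ?thesis by (auto simp: root_E8_def)
qed

lemma root_D_inner_half: "x \<in> root_D \<Longrightarrow> x \<bullet> (\<chi> i. 1/2) \<in> \<int>"
  by (auto simp: half_vec_inner root_D_def)

lemma zero_in_root_E8: "0 \<in> root_E8"
  by (simp add: root_E8_def zero_in_root_D)

lemma root_E8_diff:
  assumes "x \<in> root_E8" "y \<in> root_E8"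
  shows "x - y \<in> root_E8"
proof -
  let ?h = "(\<chi> i. 1/2) :: real^8"
  have h: "?h + ?h \<in> root_D" by (auto simp: root_D_def int_vecs_def intro!: exI[of _ 4])
  then have "x - y - ?h \<in> root_D" if "x \<in> root_D" "y - ?h \<in> root_D"

  proof -
    have "x - (y - ?h) - (?h + ?h) = x - y - ?h" by (simp add: vec_eq_iff)
    then show ?thesis using root_D_diff[OF root_D_diff[OF that] h] by simp
  qed
  moreover have "x - y \<in> root_D" if "x - ?h \<in> root_D" "y - ?h \<in> root_D"
    using root_D_diff[OF that] by simp
  moreover have "x - y - ?h \<in> root_D" if "x - ?h \<in> root_D" "y \<in> root_D"
    using root_D_diff[OF that] by (simp add: algebra_simps)
  ultimately show ?thesis using assms root_D_diff[of x y] unfolding mem_root_E8 by blast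
qed

lemma root_D_inner: "x \<in> root_D \<Longrightarrow> y \<in> root_D \<Longrightarrow> x \<bullet> y \<in> \<int>"
  by (auto simp: root_D_def int_vecs_inner)

lemma root_E8_inner:
  assumes "x \<in> root_E8" "y \<in> root_E8"
  shows "x \<bullet> y \<in> \<int>"
proof -
  let ?h = "(\<chi> i. 1/2) :: real^8"
  have hh: "?h \<bullet> ?h = 2" by (simp add: inner_vec_def)
  have half: "w \<bullet> z \<in> \<int>" if "w \<in> root_D" "z \<in> root_E8" for w z
  proof (cases "z \<in> root_D")
    case False
    then have "w \<bullet> (z - ?h) + w \<bullet> ?h \<in> \<int>" 
      using that by (intro Ints_add root_D_inner root_D_inner_half) (auto simp: mem_root_E8)
    then show ?thesis by (simp add: inner_diff_right)
  qed (use that root_D_inner in auto)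
  show ?thesis
  proof (cases "x \<in> root_D")
    case True
    then show ?thesis using half assms by blast
  next
    case False
    then have x: "x - ?h \<in> root_D" using assms by (simp add: mem_root_E8)
    have "?h \<bullet> y \<in> \<int>"
    proof (cases "y \<in> root_D")
      case True
      then show ?thesis using root_D_inner_half[of y] by (simp add: inner_commute)
    next
      case False
      then have "(y - ?h) \<bullet> ?h + 2 \<in> \<int>" using assms by (intro Ints_add root_D_inner_half) (auto simp: mem_root_E8)
      then show ?thesis by (simp add: inner_diff_left hh inner_commute[of ?h y])
    qed
    then have "(x - ?h) \<bullet> y + ?h \<bullet> y \<in> \<int>" using half[OF x assms(2)] by simp
    then show ?thesis by (simp add: inner_diff_left)
  qed
qed

lemma root_E8_even:
  assumes "x \<in> root_E8"
  shows "\<exists>k::int. x \<bullet> x = 2 * of_int k"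
proof (cases "x \<in> root_D")
  case False
  let ?h = "(\<chi> i. 1/2) :: real^8"
  have z: "x - ?h \<in> root_D" using False assms by (simp add: mem_root_E8)
  obtain k where k: "(x - ?h) \<bullet> (x - ?h) = 2 * of_int k" using root_D_even[OF z] by blast
  obtain l where l: "(x - ?h) \<bullet> ?h = of_int l" using root_D_inner_half[OF z] by (auto elim: Ints_cases)
  have "?h \<bullet> ?h = 2" by (simp add: inner_vec_def)
  moreover have "x \<bullet> x = (x - ?h) \<bullet> (x - ?h) + 2 * ((x - ?h) \<bullet> ?h) + ?h \<bullet> ?h"
    by (simp add: inner_diff_left inner_diff_right inner_commute)
  ultimately have "x \<bullet> x = 2 * of_int (k + l + 1)" using k l by simp
  then show ?thesis by blast
qed (rule root_D_even)

text \<open>A dual vector pairs integrally with every \<open>e_i + e_j\<close>, also for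
  \<open>i = j\<close>, so its coordinates are all integers or all half-odd. Pairing with the half
  vector makes their sum even.\<close>

lemma self_dual_root_E8: "self_dual root_E8"
  unfolding self_dual_def
proof (intro conjI allI iffI)
  have "span (root_E8 :: (real^8) set) = UNIV"
    using span_mono[of "root_D :: (real^8) set" root_E8] span_root_D[where 'n=8] by (auto simp: root_E8_def)
  then show "full_rank_lattice root_E8"
    by (intro integral_subgroup_full_rank zero_in_root_E8 root_E8_diff root_E8_inner)
next
  fix x assume "x \<in> root_E8"
  then show "\<forall>y\<in>root_E8. x \<bullet> y \<in> \<int>" using root_E8_inner by blast
next
  let ?h = "(\<chi> i. 1/2) :: real^8"
  fix x :: "real^8" assume x: "\<forall>y\<in>root_E8. x \<bullet> y \<in> \<int>"
  have pair: "x $ i + x $ j \<in> \<int>" for i j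
  proof -
    have "axis i 1 + axis j 1 \<in> root_E8" using axis_sum_in_root_D[of 1 1 i j] by (simp add: root_E8_def)
    then have "x \<bullet> (axis i 1 + axis j 1) \<in> \<int>" using x by blast
    then show ?thesis by (simp add: inner_right_distrib inner_axis)
  qed
  have "?h \<in> root_E8" by (simp add: mem_root_E8 zero_in_root_D)
  then have "(\<Sum>i\<in>UNIV. x $ i) / 2 \<in> \<int>" using x half_vec_inner[of x] by metis
  then obtain k :: int where k: "(\<Sum>i\<in>UNIV. x $ i) = 2 * of_int k" by (auto elim!: Ints_cases)
  show "x \<in> root_E8"
  proof (cases "\<exists>i. x $ i \<in> \<int>")
    case True
    then obtain i where "x $ i \<in> \<int>" by blast
    then have "x $ j \<in> \<int>" for j using Ints_diff[OF pair[of i j], of "x $ i"] by simp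
    then show ?thesis using k by (auto simp: mem_root_E8 root_D_def int_vecs_def)
  next
    case False
    have "x $ i - 1/2 \<in> \<int>" for i
    proof -
      obtain m :: int where m: "x $ i + x $ i = of_int m" using pair[of i i] by (auto elim: Ints_cases)
      have "odd m"
      proof
        assume "even m"
        then obtain l where "m = 2 * l" by auto
        then have "x $ i = of_int l" using m by simp
        then have "x $ i \<in> \<int>" by simp
        then show False using False by auto
      qed
      then obtain l where "m = 2 * l + 1" by (auto elim: oddE)
      then have "x $ i - 1/2 = of_int l" using m by simp
      then show ?thesis by simp
    qed
    moreover have "(\<Sum>i\<in>UNIV. x $ i - 1/2) = 2 * of_int (k - 2)" using k by (simp add: sum_subtractf)
    ultimately have "x - ?h \<in> root_D" unfolding root_D_def int_vecs_def by (auto simp: k intro!: exI[of _ "k - 2"])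
    then show ?thesis by (simp add: mem_root_E8)
  qed
qed

section \<open>Roots of E8 and their orthogonal sublattices\<close>

abbreviation E8_roots :: "(real^8) set" where
  "E8_roots \<equiv> {x \<in> root_E8. x \<bullet> x = 2}"

interpretation E8: isotropic_design E8_roots 2
proof -
  have "isotropic_design {x \<in> root_E8. x \<bullet> x = 2 * real 1} (2 * real 1)"
  proof (rule isotropic_design_shell[where e = 2])
    show "2 * real 1 \<le> x \<bullet> x" if "x \<in> root_E8" "x \<noteq> 0" for x
      using root_E8_even[OF that(1)] even_norm_gap[of x] that(2) by auto
  qed (use self_dual_root_E8 root_E8_even pi_sqrt3_bound in auto)
  then show "isotropic_design E8_roots 2" by simp
qed

lemma E8_constants: "E8.C2 > 0" "E8.C4 = 3 / 5 * E8.C2" "E8.C6 = E8.C2 / 2"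
proof -
  have "(\<chi> i. 1/2) \<in> E8_roots" by (simp add: mem_root_E8 zero_in_root_D inner_vec_def)
  then have "card E8_roots > 0" using E8.fin by (auto simp: card_gt_0_iff)
  then show "E8.C2 > 0" by (simp add: E8.C2_def E8.n_def)
  show "E8.C4 = 3 / 5 * E8.C2" "E8.C6 = E8.C2 / 2" by (simp_all add: E8.C4_def E8.C6_def E8.n_def)
qed

text \<open>Both \<open>x - y\<close> and \<open>x + y\<close> have nonnegative squared length,
  which confines the integer \<open>x \<bullet> y\<close>; at the extremes one of them
  vanishes.\<close>

lemma root_inner_cases:
  fixes x y :: "'a::real_inner"
  assumes "x \<bullet> x = 2" "y \<bullet> y = 2" "x \<bullet> y \<in> \<int>"
  shows "x \<bullet> y \<in> {-2, -1, 0, 1, 2}" and "x \<bullet> y = 2 \<Longrightarrow> y = x" and "x \<bullet> y = -2 \<Longrightarrow> y = - x"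
proof -
  have d: "(x - y) \<bullet> (x - y) = 4 - 2 * (x \<bullet> y)" and s: "(x + y) \<bullet> (x + y) = 4 + 2 * (x \<bullet> y)"
    using assms by (simp_all add: inner_diff_left inner_diff_right inner_left_distrib inner_right_distrib inner_commute)
  have le: "x \<bullet> y \<le> 2" "- 2 \<le> x \<bullet> y" using d s inner_ge_zero[of "x - y"] inner_ge_zero[of "x + y"] by linarith+
  obtain k :: int where k: "x \<bullet> y = of_int k" using assms(3) by (auto elim: Ints_cases)
  have "k \<le> 2" "-2 \<le> k" using le unfolding k by linarith+
  then have "k = -2 \<or> k = -1 \<or> k = 0 \<or> k = 1 \<or> k = 2" by arith
  then show "x \<bullet> y \<in> {-2, -1, 0, 1, 2}" unfolding k by (elim disjE) simp_all
  show "y = x" if "x \<bullet> y = 2"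
  proof -
    have "(x - y) \<bullet> (x - y) = 0" unfolding d that by simp
    then show ?thesis unfolding inner_eq_zero_iff by simp
  qed
  show "y = - x" if "x \<bullet> y = - 2"
  proof -
    have "(x + y) \<bullet> (x + y) = 0" unfolding s that by simp
    then show ?thesis unfolding inner_eq_zero_iff by (simp add: eq_neg_iff_add_eq_0 add.commute)
  qed
qed

text \<open>
  The weight \<open>g\<close> annihilates the roots outside the orthogonal complement of \<open>S\<close>, except those
  in the span of \<open>S\<close>, which do not see \<open>v\<close>.
\<close>

lemma orth_in_E8_periodic_extreme:
  fixes \<Lambda> :: "(real^'n) set" and S :: "(real^8) set"
  assumes iso: "lattice_isometric \<Lambda> (orth_in_E8 S)" and dimS: "dim S + CARD('n) = 8"
    and g: "\<And>y v. y \<in> E8_roots \<Longrightarrow> y \<notin> orth_in_E8 S \<Longrightarrow> (\<And>s. s \<in> S \<Longrightarrow> v \<bullet> s = 0) \<Longrightarrow> g y = 0 \<or> y \<bullet> v = 0"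
    and k1: "k1 > 0" "\<And>v. (\<And>s. s \<in> S \<Longrightarrow> v \<bullet> s = 0) \<Longrightarrow> (\<Sum>y\<in>E8_roots. (y \<bullet> v)\<^sup>2 * g y) = k1 * (v \<bullet> v)"
    and k2: "k2 > 0" "\<And>v x. (\<And>s. s \<in> S \<Longrightarrow> v \<bullet> s = 0) \<Longrightarrow> (\<And>s. s \<in> S \<Longrightarrow> x \<bullet> s = 0) \<Longrightarrow> v \<bullet> x = 0 \<Longrightarrow>
      (\<Sum>y\<in>E8_roots. (y \<bullet> v)\<^sup>2 * (y \<bullet> x)\<^sup>2 * g y) = k2 * (v \<bullet> v) * (x \<bullet> x)"
  shows "periodic_extreme \<Lambda>"
proof (rule root_lattice_periodic_extreme[OF iso])
  let ?R = "orth_in_E8 S"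
  define V where "V = {y. \<forall>s\<in>span S. orthogonal s y}"
  have V: "y \<in> V \<longleftrightarrow> (\<forall>s\<in>S. y \<bullet> s = 0)" for y
    unfolding V_def using orthogonal_to_span[of _ S y] by (auto simp: orthogonal_def inner_commute span_base)
  have subV: "subspace V" unfolding subspace_def V_def by (auto simp: orthogonal_clauses)
  have RV: "?R \<subseteq> V" by (auto simp: V orth_in_E8_def orthogonal_def)
  \<comment> \<open>The weighted sum vanishes term by term: on the roots in the complement by
    assumption, on all others by the property of \<open>g\<close>. Its value
    \<open>k1 * (v \<bullet> v)\<close> then forces \<open>v = 0\<close>.\<close>
  have spanning: "v = 0" if v: "v \<in> V" "\<And>y. y \<in> ?R \<Longrightarrow> y \<bullet> y = 2 \<Longrightarrow> v \<bullet> y = 0" for v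
  proof -
    have "(\<Sum>y\<in>E8_roots. (y \<bullet> v)\<^sup>2 * g y) = 0"
    proof (rule sum.neutral, rule ballI)
      fix y assume y: "y \<in> E8_roots"
      show "(y \<bullet> v)\<^sup>2 * g y = 0"
      proof (cases "y \<in> ?R")
        case True
        then show ?thesis using v(2)[of y] y by (simp add: inner_commute)
      next
        case False
        then show ?thesis using g[OF y False, of v] v(1) by (auto simp: V)
      qed
    qed
    then show ?thesis using k1 v(1) by (auto simp: V)
  qed
  have sp: "span ?R = V"
  proof (intro antisym subsetI)
    fix v assume "v \<in> span ?R"
    then show "v \<in> V" using span_minimal[OF RV subV] by blast
  next
    fix v assume v: "v \<in> V"
    obtain p q where p: "p \<in> span ?R" and q: "\<And>w. w \<in> span ?R \<Longrightarrow> orthogonal q w" and vpq: "v = p + q"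
      using orthogonal_subspace_decomp_exists[of ?R v] by metis
    have "p \<in> V" using p span_minimal[OF RV subV] by blast
    then have "v - p \<in> V" by (rule subspace_diff[OF subV v])
    then have "q \<in> V" using vpq by simp
    then have "q = 0" using q by (intro spanning) (auto simp: orthogonal_def span_base)
    then show "v \<in> span ?R" using p vpq by simp
  qed
  have "dim V + dim (span S) = dim (UNIV :: (real^8) set)"
    using dim_subspace_orthogonal_to_vectors[OF subspace_span[of S] subspace_UNIV] by (simp add: V_def)
  then show "dim ?R = CARD('n)" using dimS by (simp add: dim_span[of ?R, symmetric] sp)
  show "0 \<in> ?R" by (simp add: orth_in_E8_def zero_in_root_E8 orthogonal_def)
  show "x - y \<in> ?R" if "x \<in> ?R" "y \<in> ?R" for x y
    using that by (auto simp: orth_in_E8_def root_E8_diff orthogonal_def inner_diff_left)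
  show "x \<bullet> y \<in> \<int>" if "x \<in> ?R" "y \<in> ?R" for x y using that by (auto simp: orth_in_E8_def root_E8_inner)
  show "\<exists>k::int. x \<bullet> x = 2 * of_int k" if "x \<in> ?R" for x using that by (auto simp: orth_in_E8_def root_E8_even)
  show "\<exists>x\<in>?R. x \<bullet> x = 2"
  proof (rule ccontr)
    assume n: "\<not> ?thesis"
    have "V \<subseteq> {0}" using spanning n by blast
    then have "dim ?R = 0" using RV dim_eq_0[of ?R] by blast
    with \<open>dim ?R = CARD('n)\<close> show False by simp
  qed
  fix x v assume x: "x \<in> ?R" "x \<bullet> x = 2" and v: "v \<in> span ?R" "v \<bullet> x = 0"
    and vy: "\<And>y. y \<in> ?R \<Longrightarrow> y \<bullet> y = 2 \<Longrightarrow> \<bar>x \<bullet> y\<bar> = 1 \<Longrightarrow> v \<bullet> y = 0"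
  have vV: "v \<in> V" using v sp by simp
  \<comment> \<open>The factor \<open>(y \<bullet> x)\<^sup>2\<close> removes the roots orthogonal
    to \<open>x\<close>; the terms of \<open>x\<close> and \<open>- x\<close> vanish because
    \<open>v \<bullet> x = 0\<close>, those of the neighbours of \<open>x\<close> by
    hypothesis.\<close>
  have "(\<Sum>y\<in>E8_roots. (y \<bullet> v)\<^sup>2 * (y \<bullet> x)\<^sup>2 * g y) = 0"
  proof (rule sum.neutral, rule ballI)
    fix y assume y: "y \<in> E8_roots"
    show "(y \<bullet> v)\<^sup>2 * (y \<bullet> x)\<^sup>2 * g y = 0"
    proof (cases "y \<in> ?R")
      case True
      have xy: "x \<bullet> y \<in> \<int>" using x y by (auto simp: orth_in_E8_def root_E8_inner)
      have "y \<bullet> v = 0 \<or> x \<bullet> y = 0"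

      proof -
        have yy: "y \<bullet> y = 2" using y by simp
        note c = root_inner_cases[OF x(2) yy xy]
        have vv: "v \<bullet> y = 0" if "\<bar>x \<bullet> y\<bar> = 1" using vy[OF True yy that] .
        consider "x \<bullet> y = 2" | "x \<bullet> y = -2" | "\<bar>x \<bullet> y\<bar> = 1" | "x \<bullet> y = 0" using c(1) by auto
        then show ?thesis
        proof cases
          case 1 then show ?thesis using c(2) v(2) by (simp add: inner_commute)
        next
          case 2 then show ?thesis using c(3) v(2) by (simp add: inner_commute)
        next
          case 3 then show ?thesis using vv by (simp add: inner_commute)
        qed simp
      qed
      then show ?thesis by (auto simp: inner_commute)
    next
      case False
      then show ?thesis using g[OF y False, of v] vV by (auto simp: V)
    qed
  qed
  moreover have "(\<Sum>y\<in>E8_roots. (y \<bullet> v)\<^sup>2 * (y \<bullet> x)\<^sup>2 * g y) = k2 * (v \<bullet> v) * (x \<bullet> x)"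
    using vV x RV v(2) by (intro k2) (auto simp: V)
  ultimately show "v = 0" using k2(1) x(2) by simp
qed

lemma root_E8_periodic_extreme: "periodic_extreme root_E8"
proof (rule orth_in_E8_periodic_extreme[where S = "{}" and g = "\<lambda>_. 1" and ?k1.0 = E8.C2 and ?k2.0 = "E8.C4 / 3"])
  show "lattice_isometric root_E8 (orth_in_E8 {})" by (simp add: orth_in_E8_def lattice_isometric_refl)
  show "dim ({} :: (real^8) set) + CARD(8) = 8" by simp
  show "E8.C2 > 0" "E8.C4 / 3 > 0" using E8_constants by simp_all
  show "(\<Sum>y\<in>E8_roots. (y \<bullet> v)\<^sup>2 * 1) = E8.C2 * (v \<bullet> v)" for v using E8.moment2[of v] by simp
  show "(\<Sum>y\<in>E8_roots. (y \<bullet> v)\<^sup>2 * (y \<bullet> x)\<^sup>2 * 1) = E8.C4 / 3 * (v \<bullet> v) * (x \<bullet> x)" if "v \<bullet> x = 0" for v x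
    using E8.mixed22[OF that] by simp
qed (simp add: orth_in_E8_def)

text \<open>The weight is 1 on the roots orthogonal to \<open>r\<close>, 0 on those with inner
  product 1 or -1, and -3 on \<open>r\<close> and \<open>- r\<close>, which are orthogonal to
  \<open>v\<close>. The constants are \<open>1 - 2/5\<close> and \<open>1/5 - 1/15\<close> times
  \<open>E8.C2\<close>.\<close>

lemma orth_root_E8_weight:
  fixes r :: "real^8"
  assumes r: "r \<in> E8_roots" and v: "v \<bullet> r = 0"
  shows "(\<Sum>y\<in>E8_roots. (y \<bullet> v)\<^sup>2 * (1 - (y \<bullet> r)\<^sup>2)) = 3 / 5 * E8.C2 * (v \<bullet> v)"
    and "v \<bullet> x = 0 \<Longrightarrow> x \<bullet> r = 0 \<Longrightarrow>
      (\<Sum>y\<in>E8_roots. (y \<bullet> v)\<^sup>2 * (y \<bullet> x)\<^sup>2 * (1 - (y \<bullet> r)\<^sup>2)) = 2 / 15 * E8.C2 * (v \<bullet> v) * (x \<bullet> x)"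
proof -
  have rr: "r \<bullet> r = 2" using r by simp
  show "(\<Sum>y\<in>E8_roots. (y \<bullet> v)\<^sup>2 * (1 - (y \<bullet> r)\<^sup>2)) = 3 / 5 * E8.C2 * (v \<bullet> v)"
    using E8.mixed22[OF v]
    by (simp add: right_diff_distrib sum_subtractf E8.moment2 rr E8_constants algebra_simps)
  show "(\<Sum>y\<in>E8_roots. (y \<bullet> v)\<^sup>2 * (y \<bullet> x)\<^sup>2 * (1 - (y \<bullet> r)\<^sup>2)) = 2 / 15 * E8.C2 * (v \<bullet> v) * (x \<bullet> x)"
    if "v \<bullet> x = 0" "x \<bullet> r = 0"
    using E8.mixed22[OF that(1)] E8.mixed222[OF that(1) v that(2)]
    by (simp add: right_diff_distrib sum_subtractf rr E8_constants mult.assoc) (simp add: algebra_simps)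
qed

text \<open>As a copy of A1, \<open>S\<close> lies on the line of one root \<open>r\<close>. A root
  of E8 not orthogonal to \<open>r\<close> is \<open>r\<close> or \<open>- r\<close>, which do not
  see \<open>v\<close>, or has weight 0.\<close>

lemma is_root_E7_periodic_extreme:
  fixes \<Lambda> :: "(real^7) set"
  assumes "is_root_E7 \<Lambda>"
  shows "periodic_extreme \<Lambda>"
proof -
  obtain S where S: "S \<subseteq> root_E8" and iso: "lattice_isometric \<Lambda> (orth_in_E8 S)"
    and "lattice_isometric S (root_A :: (real^2) set)"
    using assms unfolding is_root_E7_def by blast
  then obtain f where f: "linear f" "f ` S = (root_A :: (real^2) set)" and "\<forall>x\<in>span S. norm (f x) = norm x"
    unfolding lattice_isometric_def by blast
  then have fn: "norm (f x) = norm x" if "x \<in> span S" for x using that by blast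
  define \<alpha> where "\<alpha> = (axis 1 1 - axis 2 1 :: real^2)"
  have "\<alpha> \<in> root_A" by (auto simp: \<alpha>_def root_A_def sum_2 intro!: diff_in_int_vecs axis_in_int_vecs) (simp add: axis_def)
  then obtain r where r: "r \<in> S" "f r = \<alpha>" using f(2) by (metis imageE)
  have \<alpha>: "\<alpha> \<bullet> \<alpha> = 2" by (simp add: \<alpha>_def inner_vec_def sum_2 axis_def)
  have rr: "r \<bullet> r = 2" using fn[OF span_base[OF r(1)]] r(2) \<alpha> by (metis norm_eq)
  have rE: "r \<in> E8_roots" using r S rr by auto
  have Sr: "\<exists>k. s = k *\<^sub>R r" if s: "s \<in> S" for s
  proof -
    have "f s $ 1 + f s $ 2 = 0" using s f(2) by (auto simp: root_A_def sum_2)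
    then have "f s = (f s $ 1) *\<^sub>R \<alpha>" by (simp add: vec_eq_iff forall_2 \<alpha>_def axis_def)
    then have "f (s - (f s $ 1) *\<^sub>R r) = 0" using f(1) r(2) by (simp add: linear_diff linear_cmul)
    moreover have "s - (f s $ 1) *\<^sub>R r \<in> span S" using s r(1) by (intro span_diff span_mul span_base)
    ultimately have "s - (f s $ 1) *\<^sub>R r = 0" using fn by fastforce
    then show ?thesis by (metis eq_iff_diff_eq_0)
  qed
  have "S \<subseteq> span {r}" using Sr by (auto simp: span_singleton)
  then have "span S = span {r}" using r(1) by (metis span_eq span_base insert_subset empty_subsetI subset_trans span_superset)
  then have "dim S = dim {r}" by (metis dim_span)
  also have "\<dots> = 1" using rr by (subst dim_insert) auto
  finally have dimS: "dim S = 1" .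
  show ?thesis
  proof (rule orth_in_E8_periodic_extreme[OF iso, where g = "\<lambda>y. 1 - (y \<bullet> r)\<^sup>2" and ?k1.0 = "3 / 5 * E8.C2" and ?k2.0 = "2 / 15 * E8.C2"])
    show "dim S + CARD(7) = 8" using dimS by simp
    fix y v assume y: "y \<in> E8_roots" "y \<notin> orth_in_E8 S" and v: "\<And>s. s \<in> S \<Longrightarrow> v \<bullet> s = 0"
    have "r \<bullet> y \<noteq> 0"
    proof
      assume ry: "r \<bullet> y = 0"
      have "y \<bullet> s = 0" if s: "s \<in> S" for s
      proof -
        obtain k where "s = k *\<^sub>R r" using Sr[OF s] by (elim exE)
        then show ?thesis using ry by (simp add: inner_commute[of y])
      qed
      then show False using y by (simp add: orth_in_E8_def orthogonal_def)
    qed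
    then show "1 - (y \<bullet> r)\<^sup>2 = 0 \<or> y \<bullet> v = 0"

    proof -
      have yy: "y \<bullet> y = 2" using y by simp
      have "r \<bullet> y \<in> \<int>" using y rE by (auto simp: root_E8_inner)
      note c = root_inner_cases[OF rr yy this]
      consider "r \<bullet> y = 2" | "r \<bullet> y = -2" | "\<bar>r \<bullet> y\<bar> = 1" using c(1) \<open>r \<bullet> y \<noteq> 0\<close> by auto
      then show ?thesis
      proof cases
        case 1 then show ?thesis using c(2) v[OF r(1)] by (simp add: inner_commute)
      next
        case 2 then show ?thesis using c(3) v[OF r(1)] by (simp add: inner_commute)
      next
        case 3
        then have "(y \<bullet> r)\<^sup>2 = 1" by (simp add: inner_commute abs_square_eq_1)
        then show ?thesis by simp
      qed
    qed
  qed (use E8_constants(1) orth_root_E8_weight[OF rE] r(1) in auto)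
qed

text \<open>The form \<open>a\<^sup>2 + a * b + b\<^sup>2\<close> takes the values 1 and 3 but not
  2. With \<open>a\<close>, \<open>b\<close> the inner products of a root with a base of A2 it is
  3/2 times the squared length of the projection to the plane of A2; that length is at most 2,
  whence the bound 3.\<close>

lemma A2_form_cases:
  fixes a b :: real
  assumes "a \<in> {-2, -1, 0, 1, 2}" "b \<in> {-2, -1, 0, 1, 2}" "a\<^sup>2 + a * b + b\<^sup>2 \<le> 3" "a \<noteq> 0 \<or> b \<noteq> 0"
  shows "a\<^sup>2 + a * b + b\<^sup>2 = 1 \<or> a\<^sup>2 + a * b + b\<^sup>2 = 3"
  using assms by auto

lemma inner_diff_combination:
  fixes y r p :: "'a::real_inner"
  shows "(y - \<alpha> *\<^sub>R r - \<beta> *\<^sub>R p) \<bullet> (y - \<alpha> *\<^sub>R r - \<beta> *\<^sub>R p)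
    = y \<bullet> y - 2 * \<alpha> * (y \<bullet> r) - 2 * \<beta> * (y \<bullet> p) + \<alpha>\<^sup>2 * (r \<bullet> r) + \<beta>\<^sup>2 * (p \<bullet> p) + 2 * \<alpha> * \<beta> * (r \<bullet> p)"
  by (simp add: inner_diff_left inner_diff_right inner_commute[of r y] inner_commute[of p y] inner_commute[of p r]
      power2_eq_square algebra_simps)

lemma is_root_E6_periodic_extreme:
  fixes \<Lambda> :: "(real^6) set"
  assumes "is_root_E6 \<Lambda>"
  shows "periodic_extreme \<Lambda>"
proof -
  obtain S where S: "S \<subseteq> root_E8" and iso: "lattice_isometric \<Lambda> (orth_in_E8 S)"
    and "lattice_isometric S (root_A :: (real^3) set)"
    using assms unfolding is_root_E6_def by blast
  then obtain f where f: "linear f" "f ` S = (root_A :: (real^3) set)" and "\<forall>x\<in>span S. norm (f x) = norm x"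
    unfolding lattice_isometric_def by blast
  then have fn: "norm (f x) = norm x" if "x \<in> span S" for x using that by blast
  define \<alpha> where "\<alpha> = (axis 1 1 - axis 2 1 :: real^3)"
  define \<beta> where "\<beta> = (axis 2 1 - axis 3 1 :: real^3)"
  have ab: "\<alpha> \<in> root_A" "\<beta> \<in> root_A"
    by (auto simp: \<alpha>_def \<beta>_def root_A_def sum_3 intro!: diff_in_int_vecs axis_in_int_vecs) (simp_all add: axis_def)
  obtain r where r: "r \<in> S" "f r = \<alpha>" using ab(1) f(2) by (metis imageE)
  obtain q where q: "q \<in> S" "f q = \<beta>" using ab(2) f(2) by (metis imageE)
  have \<alpha>: "\<alpha> \<bullet> \<alpha> = 2" "\<beta> \<bullet> \<beta> = 2" "(\<alpha> + \<beta>) \<bullet> (\<alpha> + \<beta>) = 2"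
    by (simp_all add: \<alpha>_def \<beta>_def inner_vec_def sum_3 axis_def)
  have rr: "r \<bullet> r = 2" using fn[OF span_base[OF r(1)]] r(2) \<alpha> by (metis norm_eq)
  have qq: "q \<bullet> q = 2" using fn[OF span_base[OF q(1)]] q(2) \<alpha> by (metis norm_eq)
  have "norm (\<alpha> + \<beta>) = norm (r + q)"
    using fn[OF span_add[OF span_base[OF r(1)] span_base[OF q(1)]]] f(1) r(2) q(2) by (simp add: linear_add)
  then have "(r + q) \<bullet> (r + q) = 2" using \<alpha>(3) by (metis norm_eq)
  then have rq: "r \<bullet> q = - 1" using rr qq by (simp add: inner_left_distrib inner_right_distrib inner_commute)
  have rE: "r \<in> E8_roots" "q \<in> E8_roots" using r q S rr qq by auto
  have Sr: "\<exists>k l. s = k *\<^sub>R r + l *\<^sub>R q" if s: "s \<in> S" for s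
  proof -
    have "f s $ 1 + f s $ 2 + f s $ 3 = 0" using s f(2) by (auto simp: root_A_def sum_3)
    then have "f s = (f s $ 1) *\<^sub>R \<alpha> + (f s $ 1 + f s $ 2) *\<^sub>R \<beta>" by (simp add: vec_eq_iff forall_3 \<alpha>_def \<beta>_def axis_def)
    then have "f (s - ((f s $ 1) *\<^sub>R r + (f s $ 1 + f s $ 2) *\<^sub>R q)) = 0"
      using f(1) r(2) q(2) by (simp add: linear_diff linear_add linear_cmul)
    moreover have "s - ((f s $ 1) *\<^sub>R r + (f s $ 1 + f s $ 2) *\<^sub>R q) \<in> span S"
      using s r(1) q(1) by (intro span_diff span_add span_mul span_base)
    ultimately have "s - ((f s $ 1) *\<^sub>R r + (f s $ 1 + f s $ 2) *\<^sub>R q) = 0" using fn by fastforce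
    then show ?thesis by (metis eq_iff_diff_eq_0)
  qed
  have "s \<in> span {r, q}" if "s \<in> S" for s
    using Sr[OF that] by (auto intro!: span_add span_mul intro: span_base)
  then have "span S \<subseteq> span {r, q}" by (intro span_minimal) auto
  moreover have "span {r, q} \<subseteq> span S" using r(1) q(1) by (intro span_mono) auto
  ultimately have "dim S = dim {r, q}" by (metis dim_span antisym)
  also have "\<dots> = 2"
  proof -
    have "r \<notin> span {q}"
    proof
      assume "r \<in> span {q}"
      then obtain k where k: "r = k *\<^sub>R q" by (auto simp: span_singleton)
      have "2 * k = -1" using rq qq unfolding k by simp
      moreover have "k * (2 * k) = 2" using rr qq unfolding k by simp
      ultimately show False by algebra
    qed
    moreover have "q \<noteq> 0" using qq by auto
    ultimately show ?thesis by (subst dim_insert, subst dim_insert) auto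
  qed
  finally have dimS: "dim S = 2" .
  \<comment> \<open>Together with \<open>r\<close> an orthogonal basis of the plane of
    \<open>S\<close>, as \<open>mixed22\<close> and \<open>mixed222\<close> ask for orthogonal
    directions.\<close>
  define p where "p = r + 2 *\<^sub>R q"
  have p: "p \<bullet> p = 6" "r \<bullet> p = 0"
    using rr qq rq by (simp_all add: p_def inner_left_distrib inner_right_distrib inner_commute)
  \<comment> \<open>\<open>g y = 1 - 3/2 N\<close>, with \<open>N\<close> the squared length of the projection of \<open>y\<close> to the span of \<open>S\<close>\<close>
  define g where "g y = 1 - 3 / 4 * (y \<bullet> r)\<^sup>2 - 1 / 4 * (y \<bullet> p)\<^sup>2" for y
  have vp: "v \<bullet> r = 0" "v \<bullet> p = 0" if "\<And>s. s \<in> S \<Longrightarrow> v \<bullet> s = 0" for v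
    using that[OF r(1)] that[OF q(1)] by (simp_all add: p_def inner_right_distrib)
  show ?thesis
  proof (rule orth_in_E8_periodic_extreme[OF iso, where g = g and ?k1.0 = "2 / 5 * E8.C2" and ?k2.0 = "1 / 10 * E8.C2"])
    show "dim S + CARD(6) = 8" using dimS by simp
    show "2 / 5 * E8.C2 > 0" "1 / 10 * E8.C2 > 0" using E8_constants(1) by auto
    fix v assume v: "\<And>s. s \<in> S \<Longrightarrow> v \<bullet> s = 0"
    note v' = vp[OF v]
    have "(\<Sum>y\<in>E8_roots. (y \<bullet> v)\<^sup>2 * g y) = (\<Sum>y\<in>E8_roots. (y \<bullet> v)\<^sup>2 - 3 / 4 * ((y \<bullet> v)\<^sup>2 * (y \<bullet> r)\<^sup>2) - 1 / 4 * ((y \<bullet> v)\<^sup>2 * (y \<bullet> p)\<^sup>2))"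
      by (intro sum.cong refl) (simp add: g_def algebra_simps)
    also have "\<dots> = E8.C2 * (v \<bullet> v) - 3 / 4 * (E8.C4 / 3 * (v \<bullet> v) * (r \<bullet> r)) - 1 / 4 * (E8.C4 / 3 * (v \<bullet> v) * (p \<bullet> p))"
      by (simp only: sum_subtractf sum_distrib_left[symmetric] E8.moment2 E8.mixed22[OF v'(1)] E8.mixed22[OF v'(2)])
    finally show "(\<Sum>y\<in>E8_roots. (y \<bullet> v)\<^sup>2 * g y) = 2 / 5 * E8.C2 * (v \<bullet> v)"
      using rr p E8_constants by simp
    {
      fix x assume x: "\<And>s. s \<in> S \<Longrightarrow> x \<bullet> s = 0" and vx: "v \<bullet> x = 0"
      note x' = vp[OF x]
      have "(\<Sum>y\<in>E8_roots. (y \<bullet> v)\<^sup>2 * (y \<bullet> x)\<^sup>2 * g y) = (\<Sum>y\<in>E8_roots. (y \<bullet> v)\<^sup>2 * (y \<bullet> x)\<^sup>2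
          - 3 / 4 * ((y \<bullet> v)\<^sup>2 * ((y \<bullet> x)\<^sup>2 * (y \<bullet> r)\<^sup>2)) - 1 / 4 * ((y \<bullet> v)\<^sup>2 * ((y \<bullet> x)\<^sup>2 * (y \<bullet> p)\<^sup>2)))"
        by (intro sum.cong refl) (simp add: g_def algebra_simps)
      also have "\<dots> = E8.C4 / 3 * (v \<bullet> v) * (x \<bullet> x) - 3 / 4 * (E8.C6 / 15 * (v \<bullet> v) * (x \<bullet> x) * (r \<bullet> r))
          - 1 / 4 * (E8.C6 / 15 * (v \<bullet> v) * (x \<bullet> x) * (p \<bullet> p))"
        by (simp only: sum_subtractf sum_distrib_left[symmetric] E8.mixed22[OF vx] E8.mixed222[OF vx v'(1) x'(1)] E8.mixed222[OF vx v'(2) x'(2)])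
      finally show "(\<Sum>y\<in>E8_roots. (y \<bullet> v)\<^sup>2 * (y \<bullet> x)\<^sup>2 * g y) = 1 / 10 * E8.C2 * (v \<bullet> v) * (x \<bullet> x)"
        using rr p E8_constants by simp
    next
      fix y assume y: "y \<in> E8_roots" "y \<notin> orth_in_E8 S"
      define a where "a = y \<bullet> r"
      define b where "b = y \<bullet> q"
      have ab: "a \<in> {-2, -1, 0, 1, 2}" "b \<in> {-2, -1, 0, 1, 2}"
        unfolding a_def b_def using root_inner_cases(1)[of y r] root_inner_cases(1)[of y q] y(1) rE root_E8_inner by simp_all
      have "a \<noteq> 0 \<or> b \<noteq> 0"
      proof (rule ccontr)
        assume "\<not> ?thesis"
        then have "y \<bullet> s = 0" if "s \<in> S" for s using Sr[OF that] by (auto simp: a_def b_def inner_right_distrib)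
        then show False using y by (auto simp: orth_in_E8_def orthogonal_def)
      qed
      note nz = this
      \<comment> \<open>The component of \<open>y\<close> orthogonal to \<open>S\<close>. Its
        squared length bounds the form in \<open>a\<close> and \<open>b\<close>; if it is zero,
        \<open>y\<close> lies in the plane of \<open>S\<close> and is orthogonal to
        \<open>v\<close>.\<close>
      define z where "z = y - (a / 2) *\<^sub>R r - ((a + 2 * b) / 6) *\<^sub>R p"
      have yp: "y \<bullet> p = a + 2 * b" by (simp add: p_def inner_right_distrib a_def b_def)
      have "z \<bullet> z = y \<bullet> y - 2 * (a / 2) * (y \<bullet> r) - 2 * ((a + 2 * b) / 6) * (y \<bullet> p) + (a / 2)\<^sup>2 * (r \<bullet> r)
          + ((a + 2 * b) / 6)\<^sup>2 * (p \<bullet> p) + 2 * (a / 2) * ((a + 2 * b) / 6) * (r \<bullet> p)"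
        unfolding z_def by (rule inner_diff_combination)
      also have "\<dots> = 2 - 2 / 3 * (a\<^sup>2 + a * b + b\<^sup>2)"
        using y(1) unfolding p rr yp a_def[symmetric] by (simp add: power2_eq_square field_simps)
      finally have z: "z \<bullet> z = 2 - 2 / 3 * (a\<^sup>2 + a * b + b\<^sup>2)" .
      then have "2 / 3 * (a\<^sup>2 + a * b + b\<^sup>2) \<le> 2" using inner_ge_zero[of z] by (simp only: le_diff_eq)
      then have "a\<^sup>2 + a * b + b\<^sup>2 \<le> 3" by simp
      then have "a\<^sup>2 + a * b + b\<^sup>2 = 1 \<or> a\<^sup>2 + a * b + b\<^sup>2 = 3" using A2_form_cases[OF ab _ nz] by blast
      then show "g y = 0 \<or> y \<bullet> v = 0"
      proof
        assume 1: "a\<^sup>2 + a * b + b\<^sup>2 = 1"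
        have "g y = 1 - (a\<^sup>2 + a * b + b\<^sup>2)"
          unfolding g_def yp a_def[symmetric] by (simp add: power2_eq_square) (simp add: algebra_simps)
        then show ?thesis using 1 by simp
      next
        assume "a\<^sup>2 + a * b + b\<^sup>2 = 3"
        then have "z = 0" using z by simp
        then have "y = (a / 2) *\<^sub>R r + ((a + 2 * b) / 6) *\<^sub>R p" unfolding z_def by (simp add: algebra_simps)
        from arg_cong[OF this, of "\<lambda>u. u \<bullet> v"] have "y \<bullet> v = (a / 2) * (r \<bullet> v) + ((a + 2 * b) / 6) * (p \<bullet> v)"
          by (simp only: inner_add_left inner_scaleR_left)
        then show ?thesis using v' by (simp only: inner_commute[of r v] inner_commute[of p v]) simp
      qed
    }
  qed
qed

section \<open>The Leech lattice\<close>

text \<open>If \<open>x = A *v z\<close> pairs integrally with \<open>L\<close>, then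
  \<open>G *v z\<close> is integral for the integral Gram matrix \<open>G\<close> of determinant 1,
  and Cramer's rule makes \<open>z\<close> integral.\<close>

lemma unimodular_self_dual:
  fixes L :: "(real^'n) set"
  assumes "unimodular_lattice L"
  shows "self_dual L"
proof -
  obtain A :: "real^'n^'n" where A: "\<bar>det A\<bar> = 1" and LA: "L = (\<lambda>z. A *v z) ` int_vecs"
    and int: "\<And>x y. x \<in> L \<Longrightarrow> y \<in> L \<Longrightarrow> x \<bullet> y \<in> \<int>"
    using assms unfolding unimodular_lattice_def by blast
  have inv: "invertible A" using A by (auto simp: invertible_det_nz)
  then obtain Ai where Ai: "A ** Ai = mat 1" by (auto simp: invertible_def)
  have col: "A *v axis j 1 \<in> L" for j
    unfolding LA by (intro imageI) (simp add: axis_in_int_vecs)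
  define G where "G = transpose A ** A"
  have G: "(G *v z) $ i = (A *v axis i 1) \<bullet> (A *v z)" for i z
  proof -
    have "(A *v axis i 1) \<bullet> (A *v z) = axis i 1 \<bullet> (transpose A *v (A *v z))"
      by (rule inner_matrix_vector)
    then show ?thesis by (simp add: G_def matrix_vector_mul_assoc inner_axis')
  qed
  have entry: "G $ i $ j \<in> \<int>" for i j
  proof -
    have "G $ i $ j = (G *v axis j 1) $ i" by (simp add: matrix_vector_mult_basis column_def)
    then show ?thesis using G[of "axis j 1" i] int[OF col col] by simp
  qed
  have "det G = (det A)\<^sup>2" by (simp add: G_def det_mul det_transpose power2_eq_square)
  also have "\<dots> = 1" using A by (simp add: abs_square_eq_1)
  finally have detG: "det G = 1" .
  have "x \<in> L" if x: "\<forall>y\<in>L. x \<bullet> y \<in> \<int>" for x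
  proof -
    define z where "z = Ai *v x"
    have xz: "x = A *v z" by (simp add: z_def matrix_vector_mul_assoc Ai)
    define w where "w = G *v z"
    have w: "w $ i \<in> \<int>" for i
      using x[rule_format, OF col[of i]] by (simp add: w_def G xz inner_commute)
    have "z = (\<chi> k. det (\<chi> i j. if j = k then w $ i else G $ i $ j) / det G)"
      using cramer[of G z w] detG by (simp add: w_def)
    then have "z $ k = det (\<chi> i j. if j = k then w $ i else G $ i $ j)" for k using detG by (simp add: vec_eq_iff)
    moreover have "det (\<chi> i j. if j = k then w $ i else G $ i $ j) \<in> \<int>" for k
      by (intro Ints_det) (simp add: w entry)
    ultimately show ?thesis unfolding xz LA int_vecs_def by auto
  qed
  then show ?thesis
    unfolding self_dual_def using int inv LA by (auto simp: full_rank_lattice_def)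
qed

section \<open>Existence of short vectors in dimension 24\<close>

lemma self_dual_theta_real:
  fixes L :: "(real^'n::{finite,wellorder}) set"
  assumes sd: "self_dual L" and t: "t > 0"
  shows "(\<lambda>x. exp (- pi * t * (x \<bullet> x))) summable_on L"
    and "infsum (\<lambda>x. exp (- pi / t * (x \<bullet> x))) L = sqrt t ^ CARD('n) * infsum (\<lambda>x. exp (- pi * t * (x \<bullet> x))) L"
proof -
  have frl: "full_rank_lattice L" using sd unfolding self_dual_def ..
  have s: "(\<lambda>x. exp (- pi * \<tau> * (x \<bullet> x))) summable_on L" if "\<tau> > 0" for \<tau>
  proof -
    have "(\<lambda>x. norm (exp (- pi * \<tau> * (x \<bullet> x)))) summable_on L"
      by (rule lattice_gaussian_summable[OF frl, of "pi * \<tau>" _ 1 0]) (use that in \<open>auto simp: power2_norm_eq_inner\<close>)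
    then show ?thesis by simp
  qed
  have c: "infsum (\<lambda>x. complex_of_real (exp (- pi * \<tau> * (x \<bullet> x)))) L = of_real (infsum (\<lambda>x. exp (- pi * \<tau> * (x \<bullet> x))) L)"
    if "\<tau> > 0" for \<tau>
    by (rule infsumI[OF has_sum_bounded_linear[OF bounded_linear_of_real has_sum_infsum[OF s[OF that]]]])
  show "(\<lambda>x. exp (- pi * t * (x \<bullet> x))) summable_on L" by (rule s[OF t])
  \<comment> \<open>The unweighted inversion formula is the case \<open>d = 0\<close>,
    \<open>a = b = 0\<close> of \<open>theta_isotropic_transform\<close>.\<close>
  have "complex_of_real (infsum (\<lambda>x. exp (- pi * (1 / t) * (x \<bullet> x))) L)
      = of_real (sqrt t ^ CARD('n) * infsum (\<lambda>x. exp (- pi * t * (x \<bullet> x))) L)"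
    unfolding of_real_mult c[OF t, symmetric] using t c[of "1 / t"] theta_isotropic_transform[OF sd t, of 0 0 0]
    by (simp add: power2_norm_eq_inner)
  then have "infsum (\<lambda>x. exp (- pi * (1 / t) * (x \<bullet> x))) L = sqrt t ^ CARD('n) * infsum (\<lambda>x. exp (- pi * t * (x \<bullet> x))) L"
    unfolding of_real_eq_iff .
  then show "infsum (\<lambda>x. exp (- pi / t * (x \<bullet> x))) L = sqrt t ^ CARD('n) * infsum (\<lambda>x. exp (- pi * t * (x \<bullet> x))) L"
    by simp
qed

text \<open>
  The inversion formula in dimension 24 reads \<open>\<Theta> (1 / t) = t ^ 12 * \<Theta> t\<close>; the defect below is
  the summand of its symmetric form. Its combination for \<open>t = 5/4\<close> and \<open>t\<^sup>2\<close> is positive at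
  \<open>0\<close> because \<open>4.08\<close> exceeds \<open>t ^ 6 + 1 / t ^ 6 = 4.07...\<close>, and nonnegative from \<open>6 \<pi>\<close> on, which
  excludes that all nonzero vectors have squared length at least 6.
\<close>

definition theta_defect :: "real \<Rightarrow> real \<Rightarrow> real" where
  "theta_defect t \<rho> = t ^ 6 * exp (- t * \<rho>) - exp (- \<rho> / t) / t ^ 6"

lemma theta_defect_sum:
  fixes L :: "(real^24) set"
  assumes sd: "self_dual L" and t: "t > 0"
  shows "((\<lambda>x. theta_defect t (pi * (x \<bullet> x))) has_sum 0) L"
proof -
  define T where "T = infsum (\<lambda>x. exp (- pi * t * (x \<bullet> x))) L"
  have 1: "((\<lambda>x. exp (- pi * t * (x \<bullet> x))) has_sum T) L"
    unfolding T_def by (rule has_sum_infsum[OF self_dual_theta_real(1)[OF sd t]])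
  have "sqrt t ^ 24 = (sqrt t ^ 2) ^ 12" by (simp only: power_mult[symmetric]) simp
  also have "\<dots> = t ^ 12" using t by simp
  finally have "infsum (\<lambda>x. exp (- pi / t * (x \<bullet> x))) L = t ^ 12 * T"
    using self_dual_theta_real(2)[OF sd t] by (simp add: T_def)
  then have 2: "((\<lambda>x. exp (- pi / t * (x \<bullet> x))) has_sum t ^ 12 * T) L"
    using has_sum_infsum[OF self_dual_theta_real(1)[OF sd, of "1 / t"]] t by simp
  have "((\<lambda>x. t ^ 6 * exp (- pi * t * (x \<bullet> x)) + (- 1 / t ^ 6) * exp (- pi / t * (x \<bullet> x)))
      has_sum (t ^ 6 * T + (- 1 / t ^ 6) * (t ^ 12 * T))) L"
    by (intro has_sum_add has_sum_cmult_right 1 2)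
  moreover have "t ^ 6 * T + (- 1 / t ^ 6) * (t ^ 12 * T) = 0" using t by (simp add: field_simps flip: power_add)
  moreover have "t ^ 6 * exp (- pi * t * (x \<bullet> x)) + (- 1 / t ^ 6) * exp (- pi / t * (x \<bullet> x)) = theta_defect t (pi * (x \<bullet> x))" for x :: "real^24"
    by (simp add: theta_defect_def mult_ac)
  ultimately show ?thesis by simp
qed

text \<open>The slowest decay is that of \<open>exp (- (16/25) * \<rho>)\<close>, which enters with
  positive sign. After division by \<open>E / a\<^sup>2\<close> it is at least 16.9 from 18 on,
  against \<open>4.08 * a\<close>, about 15.6, and a remainder below 0.03. The threshold 18 is below
  \<open>6 * pi\<close>.\<close>

lemma theta_defect_combination_nonneg:
  assumes "\<rho> \<ge> 18"
  shows "4.08 * theta_defect (5/4) \<rho> - theta_defect (25/16) \<rho> \<ge> 0"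
proof -
  define a :: real where "a = (5/4) ^ 6"
  have aa: "(25/16 :: real) ^ 6 = a\<^sup>2" by (simp add: a_def power_divide)
  define E where "E = exp (- (4/5) * \<rho>)"
  have e1: "exp (- (16/25) * \<rho>) = E * exp (4/25 * \<rho>)" and e2: "exp (- (25/16) * \<rho>) = E * exp (- (61/80) * \<rho>)"
    unfolding E_def by (simp_all add: exp_add[symmetric] algebra_simps)
  \<comment> \<open>\<open>72/25\<close> is \<open>4/25\<close> times 18, cut into eight equal parts
    so that the quadratic Taylor bound is sharp enough.\<close>
  have "16.9 \<le> (1 + 9/25 + (9/25)\<^sup>2 / 2 :: real) ^ 8" by (simp add: power_divide)
  also have "\<dots> \<le> exp (9/25) ^ 8" by (intro power_mono exp_lower_Taylor_quadratic) auto
  also have "\<dots> = exp (72/25)" by (simp add: exp_of_nat_mult[symmetric])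
  also have "\<dots> \<le> exp (4/25 * \<rho>)" using assms by simp
  finally have big: "16.9 \<le> exp (4/25 * \<rho>)" .
  have "exp (- (61/80) * \<rho>) \<le> exp (- 13)" using assms by simp
  also have "\<dots> = 1 / exp 1 ^ 13" by (simp add: exp_minus exp_of_nat_mult[symmetric] inverse_eq_divide)
  also have "\<dots> \<le> 1 / 2 ^ 13" by (intro divide_left_mono power_mono) (auto intro: exp_ge_add_one_self[of 1, simplified])
  finally have small: "a ^ 4 * exp (- (61/80) * \<rho>) \<le> a ^ 4 * (1 / 2 ^ 13)" by (intro mult_left_mono) (auto simp: a_def)
  have "4.08 * a + a ^ 4 * (1 / 2 ^ 13) \<le> (16.9 :: real)" by (simp add: a_def power_divide)
  then have pos: "0 \<le> exp (4/25 * \<rho>) - 4.08 * a - a ^ 4 * exp (- (61/80) * \<rho>)" using big small by linarith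
  have a0: "a > 0" by (simp add: a_def)
  have "4.08 * theta_defect (5/4) \<rho> - theta_defect (25/16) \<rho>
     = 4.08 * a * exp (- (5/4) * \<rho>) + E / a\<^sup>2 * (exp (4/25 * \<rho>) - 4.08 * a - a ^ 4 * exp (- (61/80) * \<rho>))"
  proof -
    have "theta_defect (5/4) \<rho> = a * exp (- (5/4) * \<rho>) - E / a" unfolding theta_defect_def E_def a_def by simp
    moreover have "theta_defect (25/16) \<rho> = a\<^sup>2 * (E * exp (- (61/80) * \<rho>)) - E * exp (4/25 * \<rho>) / a\<^sup>2"
      unfolding theta_defect_def aa e1[symmetric] e2[symmetric] by simp
    moreover have "E / a\<^sup>2 * (exp (4/25 * \<rho>) - 4.08 * a - a ^ 4 * exp (- (61/80) * \<rho>))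
       = E * exp (4/25 * \<rho>) / a\<^sup>2 - 4.08 * (E / a) - a\<^sup>2 * (E * exp (- (61/80) * \<rho>))"
      using a0 by (simp add: power2_eq_square power4_eq_xxxx field_simps)
    moreover have "k * (A - B) - (C - D) = k * A + (D - k * B - C)" for k A B C D :: real by algebra
    ultimately show ?thesis by (simp only: mult.assoc)
  qed
  moreover have "E / a\<^sup>2 * (exp (4/25 * \<rho>) - 4.08 * a - a ^ 4 * exp (- (61/80) * \<rho>)) \<ge> 0"
    using pos by (intro mult_nonneg_nonneg) (auto simp: E_def)
  moreover have "4.08 * a * exp (- (5/4) * \<rho>) \<ge> 0" using a0 by simp
  ultimately show ?thesis by linarith
qed

text \<open>This is what shows that the shell of squared length 4 of the Leech lattice is not empty:
  lengths are even and 2 is excluded, so a nonzero vector below 6 has squared length 4. With an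
  empty shell the constants \<open>C2\<close>, \<open>C4\<close>, \<open>C6\<close> would be
  zero.\<close>

lemma self_dual_24_short_vector:
  fixes L :: "(real^24) set"
  assumes sd: "self_dual L"
  shows "\<exists>x\<in>L. x \<noteq> 0 \<and> x \<bullet> x < 6"
proof (rule ccontr)
  assume n: "\<not> ?thesis"
  define g where "g x = 4.08 * theta_defect (5/4) (pi * (x \<bullet> x)) - theta_defect (25/16) (pi * (x \<bullet> x))" for x :: "real^24"
  have "((\<lambda>x. 4.08 * theta_defect (5/4) (pi * (x \<bullet> x)) + (- 1) * theta_defect (25/16) (pi * (x \<bullet> x)))
      has_sum (4.08 * 0 + (- 1) * 0)) L"
    by (intro has_sum_add has_sum_cmult_right theta_defect_sum sd) auto
  then have g: "(g has_sum 0) L" by (simp add: g_def[abs_def])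
  have "0 \<in> L \<longleftrightarrow> (\<forall>y\<in>L. 0 \<bullet> y \<in> \<int>)" using sd unfolding self_dual_def by blast
  then have 0: "0 \<in> L" by (rule iffD2) simp
  have "sum g {0} \<le> infsum g L"
  proof (rule finite_sum_le_infsum)
    show "g summable_on L" using g by (rule has_sum_imp_summable)
    fix x assume x: "x \<in> L - {0}"
    then have "x \<bullet> x \<ge> 6" using n by force
    then have "3 * 6 \<le> pi * (x \<bullet> x)" using pi_gt3 by (intro mult_mono) auto
    then show "g x \<ge> 0" unfolding g_def by (intro theta_defect_combination_nonneg) simp
  qed (use 0 in auto)
  moreover have "infsum g L = 0" using g by (rule infsumI)
  moreover have "g 0 > 0" by (simp add: g_def theta_defect_def power_divide)
  ultimately show False by simp
qed

lemma pi_sqrt3_bound': "9 < pi * sqrt 3 * 2"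
  using pi_sqrt3_bound by linarith

lemma is_Leech_periodic_extreme:
  fixes \<Lambda> :: "(real^24) set"
  assumes "is_Leech \<Lambda>"
  shows "periodic_extreme \<Lambda>"
proof -
  have sd: "self_dual \<Lambda>" and even: "\<And>x. x \<in> \<Lambda> \<Longrightarrow> \<exists>k::int. x \<bullet> x = 2 * of_int k"
    and no2: "\<And>x. x \<in> \<Lambda> \<Longrightarrow> x \<bullet> x \<noteq> 2"
    using assms unimodular_self_dual by (auto simp: is_Leech_def)
  have frl: "full_rank_lattice \<Lambda>" using sd unfolding self_dual_def ..
  have int: "x \<bullet> y \<in> \<int>" if "x \<in> \<Lambda>" "y \<in> \<Lambda>" for x y using sd that unfolding self_dual_def by blast
  have mem: "x \<in> \<Lambda>" if "\<And>y. y \<in> \<Lambda> \<Longrightarrow> x \<bullet> y \<in> \<int>" for x using sd that unfolding self_dual_def by blast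
  have zero: "0 \<in> \<Lambda>" by (rule mem) simp
  have diff: "x - y \<in> \<Lambda>" if "x \<in> \<Lambda>" "y \<in> \<Lambda>" for x y
    by (rule mem) (simp add: inner_diff_left int that)
  have add: "x + y \<in> \<Lambda>" if "x \<in> \<Lambda>" "y \<in> \<Lambda>" for x y
    by (rule mem) (simp add: inner_add_left int that)
  have gap: "4 \<le> x \<bullet> x" if x: "x \<in> \<Lambda>" "x \<noteq> 0" for x
  proof -
    obtain k :: int where k: "x \<bullet> x = 2 * of_int k" using even[OF x(1)] by (elim exE)
    have "k > 0" using k x(2) inner_gt_zero_iff[of x] by simp
    moreover have "k \<noteq> 1" using k no2[OF x(1)] by auto
    ultimately have "2 \<le> k" by linarith
    then show ?thesis using k by simp
  qed
  define M where "M = {x \<in> \<Lambda>. x \<bullet> x = 4}"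
  have "isotropic_design {x \<in> \<Lambda>. x \<bullet> x = 2 * real 2} (2 * real 2)"
    using gap pi_sqrt3_bound' by (intro isotropic_design_shell[where e = 6] sd even) auto
  then interpret isotropic_design M 4 by (simp add: M_def)
  obtain x where x: "x \<in> \<Lambda>" "x \<noteq> 0" "x \<bullet> x < 6" using self_dual_24_short_vector[OF sd] by blast
  obtain k :: int where k: "x \<bullet> x = 2 * of_int k" using even[OF x(1)] by (elim exE)
  have "k = 2" using k gap[OF x(1,2)] x(3) by linarith
  then have "x \<in> M" using x(1) k by (simp add: M_def)
  then have "card M > 0" using fin by (auto simp: card_gt_0_iff)
  then have C2: "C2 > 0" by (simp add: C2_def n_def)
  have C4: "C4 > 0" and C6: "C6 = 5 / 7 * C4" using C2 by (simp_all add: C4_def C6_def n_def)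
  have inner_M: "y = w \<or> y = - w \<or> \<bar>w \<bullet> y\<bar> = 2 \<or> \<bar>w \<bullet> y\<bar> = 1 \<or> w \<bullet> y = 0" if w: "w \<in> M" and y: "y \<in> M" for w y
  proof -
    have wy: "w \<in> \<Lambda>" "y \<in> \<Lambda>" "w \<bullet> w = 4" "y \<bullet> y = 4" using w y by (auto simp: M_def)
    have d: "(y - w) \<bullet> (y - w) = 8 - 2 * (w \<bullet> y)" and s: "(y + w) \<bullet> (y + w) = 8 + 2 * (w \<bullet> y)"
      using wy by (simp_all add: inner_diff_left inner_diff_right inner_left_distrib inner_right_distrib inner_commute)
    obtain k :: int where k: "w \<bullet> y = of_int k" using int[OF wy(1,2)] by (auto elim: Ints_cases)
    show ?thesis
    proof (cases "y = w \<or> y = - w")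
      case False
      then have "y - w \<noteq> 0" "y + w \<noteq> 0" by (auto simp: eq_neg_iff_add_eq_0)
      then have "w \<bullet> y \<le> 2" "- 2 \<le> w \<bullet> y" using gap[OF diff[OF wy(2,1)]] gap[OF add[OF wy(2,1)]] d s by linarith+
      then have "k \<le> 2" "-2 \<le> k" unfolding k by linarith+
      then have "k = -2 \<or> k = -1 \<or> k = 0 \<or> k = 1 \<or> k = 2" by arith
      then show ?thesis unfolding k by (elim disjE) simp_all
    qed blast
  qed
  have "star_lattice \<Lambda> 4 C2"
  proof
    show "span (insert w {y \<in> {x \<in> \<Lambda>. x \<bullet> x = 4}. \<bar>w \<bullet> y\<bar> = 4 / 2}) = UNIV" if w: "w \<in> {x \<in> \<Lambda>. x \<bullet> x = 4}" for w
      unfolding span_eq_UNIV_iff_orthogonal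
    proof (intro allI impI)
      fix v assume v: "\<forall>y\<in>insert w {y \<in> {x \<in> \<Lambda>. x \<bullet> x = 4}. \<bar>w \<bullet> y\<bar> = 4 / 2}. v \<bullet> y = 0"
      have wM: "w \<in> M" using w by (simp add: M_def)
      have vw: "v \<bullet> w = 0" using v by blast
      have vy: "v \<bullet> y = 0" if "y \<in> M" "\<bar>w \<bullet> y\<bar> = 2" for y
        using v that unfolding M_def by simp
      \<comment> \<open>The polynomial \<open>u ^ 4 - u\<^sup>2\<close> vanishes at the inner
        products 0, 1 and -1; the values 2 and -2 belong to the star, and the remaining vectors
        \<open>w\<close> and \<open>- w\<close> are orthogonal to \<open>v\<close>. By the moments
        the sum is \<open>16/7 - 4/3\<close> times \<open>C4 * (v \<bullet> v)\<close>.\<close>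
      have "(\<Sum>y\<in>M. (y \<bullet> v)\<^sup>2 * (y \<bullet> w) ^ 4 - (y \<bullet> v)\<^sup>2 * (y \<bullet> w)\<^sup>2) = 0"
      proof (rule sum.neutral, rule ballI)
        fix y assume y: "y \<in> M"
        consider "y = w" | "y = - w" | "\<bar>w \<bullet> y\<bar> = 2" | "\<bar>w \<bullet> y\<bar> = 1" | "w \<bullet> y = 0" using inner_M[OF wM y] by blast
        then show "(y \<bullet> v)\<^sup>2 * (y \<bullet> w) ^ 4 - (y \<bullet> v)\<^sup>2 * (y \<bullet> w)\<^sup>2 = 0"
        proof cases
          case 1 then show ?thesis using vw by (simp add: inner_commute)
        next
          case 2 then show ?thesis using vw by (simp add: inner_commute)
        next
          case 3 then show ?thesis using vy[OF y] by (simp add: inner_commute)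
        next
          case 4
          then have "(y \<bullet> w)\<^sup>2 = 1" by (simp add: inner_commute abs_square_eq_1)
          moreover have "(y \<bullet> w) ^ 4 = ((y \<bullet> w)\<^sup>2)\<^sup>2" by simp
          ultimately show ?thesis by (simp only: power_one mult_1_right diff_self)
        next
          case 5 then show ?thesis by (simp add: inner_commute)
        qed
      qed
      moreover have "w \<bullet> w = 4" using w by simp
      ultimately have "C4 * (v \<bullet> v) = 0"
        by (auto simp: sum_subtractf mixed22[OF vw] mixed24[OF vw] C6)
      then show "v = 0" using C4 by simp
    qed
  next
    show "finite {x \<in> \<Lambda>. x \<bullet> x = 4}" using fin by (simp add: M_def)
    show "(\<Sum>x\<in>{x \<in> \<Lambda>. x \<bullet> x = 4}. (x \<bullet> a)\<^sup>2) = C2 * (a \<bullet> a)" for a using moment2 by (simp add: M_def)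
  qed (use zero diff gap C2 in auto)
  then show ?thesis using frl by (rule star_lattice.periodic_extreme_star)
qed

theorem corollary11:
  shows "(CARD('n::finite) \<ge> 2 \<longrightarrow> (\<forall>\<Lambda> :: (real^'n) set. is_root_A \<Lambda> \<longrightarrow> periodic_extreme \<Lambda>))
    \<and> (CARD('n) \<ge> 3 \<longrightarrow> periodic_extreme (root_D :: (real^'n) set))
    \<and> (\<forall>\<Lambda>. is_root_E6 \<Lambda> \<longrightarrow> periodic_extreme \<Lambda>)
    \<and> (\<forall>\<Lambda>. is_root_E7 \<Lambda> \<longrightarrow> periodic_extreme \<Lambda>)
    \<and> periodic_extreme root_E8
    \<and> (\<forall>\<Lambda>. is_Leech \<Lambda> \<longrightarrow> periodic_extreme \<Lambda>)"
  by (intro conjI impI allI root_A_periodic_extreme root_D_periodic_extreme is_root_E6_periodic_extreme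
      is_root_E7_periodic_extreme root_E8_periodic_extreme is_Leech_periodic_extreme)

end
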